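(* Let $\{a_n\}_{n=1}^\infty$ be real numbers with $a_n\geq 0$ for all $n$. Assume that $A(s)=\sum_{n}a_n n^{-s}$ converges absolutely for $\Re s>1$ and extends meromorphically to $\mathbb{C}$, with a simple pole at $s=1$ and no other poles with $\Re s=1$, $|\Im s|\leq T$, for some $T>0$. Assume that $A(s)T^s$ is bounded on some ladder $$S=((-\infty,1]\pm iT)\cup\bigcup_{n\geq 0}(\sigma_n+i[-T,T]),$$ where $\{\sigma_n\}_{n=0}^\infty$ satisfies $\sigma_0=1$ and $\sigma_n\to-\infty$, and that $A(s)T^s$ is also bounded on some admissible contour $\mathcal{C}$ going from $1$ to $\Re s=-\infty$ within $R_{1/4}=(-\infty,1]+i[0,\tfrac{T}{4}]$ in such a way that all real poles of $A(s)$ lie below $\mathcal{C}$ and all poles $\rho$ of $A(s)$ with $\Im\rho>0$ lie above it. Then, for any $\sigma\in\mathbb{R}$ and any $x>T$, $$\begin{aligned} \frac{\sum_{n\leq x} a_n n^{-\sigma}}{x^{1-\sigma}} &= \frac{\pi}{T}\sum_{\rho\in \mathcal{Z}_{A,\mathbb{R}}\cup\{\sigma\}}\operatorname{Res}_{s=\rho}\Big(\coth\frac{\pi(s-\sigma)}{T}\,A(s)x^{s-1}\Big)+\frac{2\pi}{T}\,\Im\!\!\sum_{\rho\in\mathcal{Z}_A^+(T)}\omega^+_{T,\sigma}(\rho)\,x^{\rho-1}\operatorname{Res}_{s=\rho}A(s)\\ &\quad+O^*\Big(\frac{\pi}{T}\sum_{\rho\in\mathcal{Z}_{A,\mathbb{R}}}\operatorname{Res}_{s=\rho}\big(A(s)x^{s-1}\big)+\frac{2I_{+,\mathcal{C}}(T)}{T^2}+\frac{2\pi}{T}\,\Re\!\!\sum_{\rho\in\mathcal{Z}_A^+(T)}\theta_{T,1}(\rho)\,x^{\rho-1}\operatorname{Res}_{s=\rho}A(s)\Big),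 \end{aligned}$$ where $$I_{+,\mathcal{C}}(T)=\int_0^\infty t\,|F(1-t+iT)|\,x^{-t}\,dt+\Big|\int_{\mathcal{C}}\Phi(s)F(s)x^{s-1}\,ds\Big|,\qquad F(s)=A(s)-\frac{\operatorname{Res}_{s=1}A(s)}{s-1},$$ and $\Phi(s)$ is a function holomorphic on a neighborhood of $R_{1/4}$ with $\Phi(1)=0$ and $|\Phi'(s)|\leq 1$ for $s\in R_{1/4}$, whose restriction to $(-\infty,1)$ is real-valued and of constant sign.
   Context: Notation: $O^*(R)$ denotes a quantity of absolute value at most $R$. $\mathcal{Z}_A^+(T)$ is the set of poles $\rho$ of $A(s)$ with $0<\Im\rho<T$; $\mathcal{Z}_{A,\mathbb{R}}$ is the set of real poles of $A(s)$. "Bounded on $S$" implies in particular that $A$ has no poles on $S$. An admissible contour is a continuous path $s(t)$ such that its intersection with any strip of width $1$ consists of finitely many smooth arcs of bounded total length. Sums over poles $\sum_{\rho\in\mathcal{Z}}$ are to be read as $\lim_{n\to\infty}\sum_{\rho\in\mathcal{Z}:\Re\rho>\sigma_n}$. The weights are $$\theta_{T,\sigma}(s)=1-\frac{s-\sigma}{iT},\qquad c_{T,\sigma}=\theta_{T,\sigma}(1+iT)\cot\big(\pi\theta_{T,\sigma}(1+iT)\big),\qquad \omega^+_{T,\sigma}(s)=-\theta_{T,\sigma}(s)\cot\big(\pi\theta_{T,\sigma}(s)\big)+c_{T,\sigma},$$ and $\theta_{T,1}(s)=1-\frac{s-1}{iT}$.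
   Formalization: In the sums over Z_A^+(T), residues are of the whole products ω⁺(s)x^{s-1}A(s) and θ(s)x^{s-1}A(s); the displayed terms follow when these poles are simple (false for multiple poles). Boundedness on S and C is read away from the pole s=1, and only real poles other than 1 must lie below C. *)

theory Defs
  imports "HOL-Complex_Analysis.Complex_Analysis"
begin

definition coth :: "complex \<Rightarrow> complex" where
  "coth z = cosh z / sinh z"

text \<open>The function \<open>z cot (\<pi> z)\<close> with its removable singularity at \<open>0\<close> filled in. The value
  at \<open>0\<close> matters: for \<open>\<sigma> = 1\<close> the constant \<open>c\<close> below is that value.\<close>

definition zcot :: "complex \<Rightarrow> complex" where
  "zcot z = (if z = 0 then 1 / of_real pi else z * cot (of_real pi * z))"

definition theta :: "real \<Rightarrow> real \<Rightarrow> complex \<Rightarrow> complex" where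
  "theta T \<sigma> s = 1 - (s - of_real \<sigma>) / (\<i> * of_real T)"

definition c_const :: "real \<Rightarrow> real \<Rightarrow> complex" where
  "c_const T \<sigma> = zcot (theta T \<sigma> (1 + \<i> * of_real T))"

definition omega_plus :: "real \<Rightarrow> real \<Rightarrow> complex \<Rightarrow> complex" where
  "omega_plus T \<sigma> s = - zcot (theta T \<sigma> s) + c_const T \<sigma>"

definition upper_poles :: "(complex \<Rightarrow> complex) \<Rightarrow> real \<Rightarrow> complex set" where
  "upper_poles A T = {\<rho>. is_pole A \<rho> \<and> 0 < Im \<rho> \<and> Im \<rho> < T}"

definition real_poles :: "(complex \<Rightarrow> complex) \<Rightarrow> complex set" where
  "real_poles A = {\<rho>. is_pole A \<rho> \<and> Im \<rho> = 0}"

text \<open>\<open>has_pole_sum \<sigma>n f Z L\<close>: the sum of \<open>f\<close> over \<open>Z\<close>, taken as the limit over \<open>n\<close> of the sums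
  over the points of \<open>Z\<close> to the right of \<open>\<sigma>n n\<close>, converges to \<open>L\<close>.\<close>

definition has_pole_sum ::
  "(nat \<Rightarrow> real) \<Rightarrow> (complex \<Rightarrow> complex) \<Rightarrow> complex set \<Rightarrow> complex \<Rightarrow> bool" where
  "has_pole_sum \<sigma>n f Z L \<longleftrightarrow>
     (\<lambda>n. \<Sum>\<rho> | \<rho> \<in> Z \<and> Re \<rho> > \<sigma>n n. f \<rho>) \<longlonglongrightarrow> L"

definition ladder :: "real \<Rightarrow> (nat \<Rightarrow> real) \<Rightarrow> complex set" where
  "ladder T \<sigma>n =
     {s. Re s \<le> 1 \<and> \<bar>Im s\<bar> = T} \<union> (\<Union>n. {s. Re s = \<sigma>n n \<and> \<bar>Im s\<bar> \<le> T})"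

text \<open>Both the ladder and the contour contain the pole \<open>s = 1\<close> of \<open>A\<close>, so boundedness of
  \<open>A(s) T\<^sup>s\<close> on them can only mean boundedness away from that point. Absence of other poles is
  required explicitly because a HOL function takes some finite value at each of its poles.\<close>

definition bounded_away_from_1 :: "(complex \<Rightarrow> complex) \<Rightarrow> real \<Rightarrow> complex set \<Rightarrow> bool" where
  "bounded_away_from_1 A T S \<longleftrightarrow>
     (\<forall>s \<in> S - {1}. \<not> is_pole A s) \<and>
     (\<forall>\<epsilon>>0. bounded ((\<lambda>s. A s * of_real T powr s) ` (S - ball 1 \<epsilon>)))"

definition R_quarter :: "real \<Rightarrow> complex set" where
  "R_quarter T = {s. Re s \<le> 1 \<and> 0 \<le> Im s \<and> Im s \<le> T / 4}"

text \<open>One-sided derivatives at the endpoints, so that arcs may meet at corners (the library's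
  \<open>C1_differentiable_on\<close> asks for two-sided derivatives).\<close>

definition smooth_arc :: "(real \<Rightarrow> complex) \<Rightarrow> real \<Rightarrow> real \<Rightarrow> bool" where
  "smooth_arc \<gamma> u v \<longleftrightarrow>
     (\<forall>t\<in>{u..v}. \<gamma> differentiable (at t within {u..v})) \<and>
     continuous_on {u..v} (\<lambda>t. vector_derivative \<gamma> (at t within {u..v}))"

definition arc_length :: "(real \<Rightarrow> complex) \<Rightarrow> real \<Rightarrow> real \<Rightarrow> real" where
  "arc_length \<gamma> u v = integral {u..v} (\<lambda>t. cmod (vector_derivative \<gamma> (at t within {u..v})))"

text \<open>A contour is parametrised by \<open>[0,\<infinity>)\<close>. The bound \<open>L\<close> on the length is uniform over all
  vertical strips of width \<open>1\<close>.\<close>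

definition admissible_contour :: "(real \<Rightarrow> complex) \<Rightarrow> bool" where
  "admissible_contour \<gamma> \<longleftrightarrow> continuous_on {0..} \<gamma> \<and>
     (\<exists>L. \<forall>b. \<exists>J. finite J \<and>
        {t. 0 \<le> t \<and> b \<le> Re (\<gamma> t) \<and> Re (\<gamma> t) \<le> b + 1} = (\<Union>(u, v)\<in>J. {u..v}) \<and>
        (\<forall>(u, v)\<in>J. u \<le> v \<and> smooth_arc \<gamma> u v) \<and>
        (\<Sum>(u, v)\<in>J. arc_length \<gamma> u v) \<le> L)"

text \<open>For a contour \<open>C\<close> from \<open>1\<close> to \<open>Re s = -\<infinity>\<close> that need not be a graph over the real axis: the
  ray \<open>[1,\<infinity>)\<close> completes \<open>C\<close> to a curve separating the plane, and \<open>z\<close> is above (below) \<open>C\<close> if it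
  can be connected, off that curve, to all points of sufficiently large (small) imaginary part.\<close>

definition completed :: "complex set \<Rightarrow> complex set" where
  "completed C = C \<union> {s. Im s = 0 \<and> 1 \<le> Re s}"

definition lies_above :: "complex set \<Rightarrow> complex \<Rightarrow> bool" where
  "lies_above C z \<longleftrightarrow> (\<exists>h. \<forall>w. Im w > h \<longrightarrow> connected_component (- completed C) z w)"

definition lies_below :: "complex set \<Rightarrow> complex \<Rightarrow> bool" where
  "lies_below C z \<longleftrightarrow> (\<exists>h. \<forall>w. Im w < h \<longrightarrow> connected_component (- completed C) z w)"

definition F_reg :: "(complex \<Rightarrow> complex) \<Rightarrow> complex \<Rightarrow> complex" where
  "F_reg A s = A s - residue A 1 / (s - 1)"

text \<open>Integral along a contour parametrised by \<open>[0,\<infinity>)\<close>; the library's \<open>contour_integral\<close> is for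
  paths on \<open>[0,1]\<close>.\<close>

definition ray_contour_integral :: "(real \<Rightarrow> complex) \<Rightarrow> (complex \<Rightarrow> complex) \<Rightarrow> complex" where
  "ray_contour_integral \<gamma> f = integral {0..} (\<lambda>t. f (\<gamma> t) * vector_derivative \<gamma> (at t))"

text \<open>Extended-valued: for \<open>T < x \<le> 1\<close> the first integral diverges (then the error bound is
  \<open>\<infinity>\<close>), while for \<open>x > 1\<close> both integrals converge.\<close>

definition I_plus ::
  "(complex \<Rightarrow> complex) \<Rightarrow> real \<Rightarrow> (real \<Rightarrow> complex) \<Rightarrow> (complex \<Rightarrow> complex) \<Rightarrow> real \<Rightarrow> ennreal" where
  "I_plus A T \<gamma> \<Phi> x =
     (\<integral>\<^sup>+t\<in>{0..}. ennreal (t * cmod (F_reg A (1 - of_real t + \<i> * of_real T)) * x powr (- t)) \<partial>lborel)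
     + ennreal (cmod (ray_contour_integral \<gamma> (\<lambda>s. \<Phi> s * F_reg A s * of_real x powr (s - 1))))"

definition contour_weight :: "real \<Rightarrow> (complex \<Rightarrow> complex) \<Rightarrow> bool" where
  "contour_weight T \<Phi> \<longleftrightarrow>
     (\<exists>U. open U \<and> R_quarter T \<subseteq> U \<and> \<Phi> holomorphic_on U) \<and>
     \<Phi> 1 = 0 \<and>
     (\<forall>s \<in> R_quarter T. cmod (deriv \<Phi> s) \<le> 1) \<and>
     (\<forall>r<1. \<Phi> (of_real r) \<in> \<real>) \<and>
     ((\<forall>r<1. Re (\<Phi> (of_real r)) > 0) \<or> (\<forall>r<1. Re (\<Phi> (of_real r)) < 0))"

end

theory Submission
  imports Defs "HOL-Real_Asymp.Real_Asymp"
begin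

text \<open>
  Put \<open>h(z) = z coth (\<pi>z)\<close> and \<open>\<Phi>(s) = T/2 (h((s - \<sigma>)/T) - h((1 - \<sigma>)/T)) + \<delta> (s - 1)/2\<close> with
  \<open>\<delta> = \<plusminus>1\<close>. Then \<open>\<Phi>(1) = 0\<close>, \<open>\<Phi>\<close> has constant sign on either side of \<open>1\<close> on the real line, and
  \<open>\<Phi>(s) - \<Phi>(s - iT) = iT (coth (\<pi>(s - \<sigma>)/T) + \<delta>)/2\<close>. Let \<open>K(y)\<close> be the real part of the integral of
  \<open>\<Phi>(s - iT) y\<^sup>s\<^sup>-\<^sup>1\<close> along \<open>\<kappa>, \<kappa> + iT, 1 + iT\<close> plus that of \<open>\<Phi>(s) y\<^sup>s\<^sup>-\<^sup>1\<close> along \<open>[1,\<kappa>]\<close>. Moving the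
  vertical segment to infinity, to the left for \<open>y > 1\<close> and to the right for \<open>y < 1\<close>, leaves an integral of
  \<open>\<Phi>(u) y\<^sup>u\<^sup>-\<^sup>1 (1 - cos (T ln y))\<close> over a real half-line, so \<open>K(y)\<close> is a one-sided bound for
  \<open>T\<^sup>2/2 y\<^sup>\<sigma>\<^sup>-\<^sup>1\<close> on \<open>y \<ge> 1\<close> and for \<open>0\<close> on \<open>y < 1\<close>. As \<open>a\<^sub>n \<ge> 0\<close>, summing over \<open>y = x/n\<close> bounds the
  partial sum by the same integral with \<open>A(s) x\<^sup>s\<^sup>-\<^sup>1\<close> in place of \<open>y\<^sup>s\<^sup>-\<^sup>1\<close>. Moving that integral to the left
  produces the residues and leaves integrals over the contour and the line \<open>Im s = T\<close>. There \<open>A\<close> may be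
  replaced by \<open>F\<close>, because the contribution of the polar part at \<open>1\<close> has a favourable sign.
\<close>

section \<open>The function \<open>z coth (\<pi>z)\<close>\<close>

text \<open>The shift of \<Phi> is computable because coth(\<pi>z) has period \<i>: replacing z by z
  - \<i> changes only the factor z of h. The bound on \<Phi>' rests on |h'(z)| <= 1 for |Im z| <=
  1/4. The value \<delta> = 1 gives an upper and \<delta> = -1 a lower bound for the partial sum;
  adding the two cases yields the main terms, subtracting them the error terms, and the sign of the
  deviation selects the \<Phi> of the theorem. Three obstacles shape the proof. The pole of A at 1
  lies on the path, where the series does not converge: the zero \<Phi>(1) = 0 cancels it, and the
  line Re s = 1 is reached through a shift by \<epsilon>. The contour need not be a graph, and its
  sides are defined by connectedness: it is clamped at each rung, closed to a loop, and winding
  numbers replace any picture of inside and outside. Finally, the identity obtained by conjugation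
  sees only one real component of the sum over upper poles, so that this sum needs its own
  convergence proof, in which A is modified to remove the singularities at 1 and \<sigma>.\<close>

definition hcoth :: "complex \<Rightarrow> complex" where
  "hcoth z = (if z = 0 then 1 / of_real pi else z * coth (of_real pi * z))"

lemma sinh_cosh_add_I_pi:
  "sinh (z + \<i> * of_real pi) = - sinh (z::complex)" "cosh (z + \<i> * of_real pi) = - cosh (z::complex)"
proof -
  have "exp (z + \<i> * of_real pi) = - exp z" "exp (- (z + \<i> * of_real pi)) = - exp (- z)"
    by (simp_all add: exp_add exp_minus exp_diff mult.commute)
  then show "sinh (z + \<i> * of_real pi) = - sinh z" "cosh (z + \<i> * of_real pi) = - cosh z"
    unfolding sinh_def cosh_def by (simp_all add: scaleR_conv_of_real field_simps)
qed

text \<open>The zeros of \<open>sinh\<close> are the integer multiples of \<i>\<pi>, and only 0 lies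
  in the open strip.\<close>

lemma sinh_nonzero_strip:
  fixes w :: complex
  assumes "w \<noteq> 0" "\<bar>Im w\<bar> < pi"
  shows "sinh w \<noteq> 0"
proof
  assume "sinh w = 0"
  then have "sin (\<i> * w) = 0" using sinh_conv_sin[of w] by simp
  then obtain n :: int where "\<i> * w = of_real (n * pi)"
    unfolding sin_eq_0 by auto
  then have e: "w = - \<i> * of_real (n * pi)" by (simp add: complex_eq_iff)
  then have "\<bar>Im w\<bar> = \<bar>real_of_int n\<bar> * pi" by (simp add: abs_mult)
  with assms(2) have "\<bar>real_of_int n\<bar> < 1" by simp
  then have "n = 0" by linarith
  with e assms(1) show False by simp
qed

lemma hcoth_minus [simp]: "hcoth (- z) = hcoth z"
  by (simp add: hcoth_def coth_def)

lemma hcoth_cnj: "hcoth (cnj z) = cnj (hcoth z)"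
proof -
  have "coth (of_real pi * cnj z) = cnj (coth (of_real pi * z))"
    by (simp add: coth_def sinh_def cosh_def exp_cnj)
  then show ?thesis by (simp add: hcoth_def)
qed

lemma hcoth_holomorphic: "hcoth holomorphic_on {z. \<bar>Im z\<bar> < 1}"
proof (rule no_isolated_singularity[where K = "{0}"])
  have op: "open {z. \<bar>Im z\<bar> < 1}"
    by (intro open_Collect_less continuous_intros)
  show "open {z. \<bar>Im z\<bar> < 1}" by fact
  show "finite {0::complex}" by simp
  have nz: "sinh (of_real pi * z) \<noteq> 0" if "\<bar>Im z\<bar> < 1" "z \<noteq> 0" for z
    using that by (intro sinh_nonzero_strip) (auto simp: abs_mult)
  have "(\<lambda>z. z * (cosh (of_real pi * z) / sinh (of_real pi * z))) holomorphic_on {z. \<bar>Im z\<bar> < 1} - {0}"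
    unfolding sinh_def cosh_def using nz
    by (intro holomorphic_intros) (auto simp: sinh_def)
  then show h: "hcoth holomorphic_on {z. \<bar>Im z\<bar> < 1} - {0}"
    by (rule holomorphic_transform) (auto simp: hcoth_def coth_def)
  show "continuous_on {z. \<bar>Im z\<bar> < 1} hcoth"
  proof (rule continuous_at_imp_continuous_on, rule ballI)
    fix z assume z: "z \<in> {z. \<bar>Im z\<bar> < 1}"
    show "isCont hcoth z"
    proof (cases "z = 0")
      case False
      then show ?thesis
        using holomorphic_on_imp_continuous_on[OF h] z
        by (simp add: continuous_on_eq_continuous_at open_delete[OF op])
    next
      case True
      \<comment> \<open>At the removable point z cosh / sinh is read as cosh / (sinh / z); the
        denominator tends to the derivative \<pi> of sinh(\<pi>z) at 0.\<close>
      have "((\<lambda>z::complex. sinh (of_real pi * z)) has_field_derivative of_real pi) (at 0)"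
        by (auto intro!: derivative_eq_intros)
      then have "((\<lambda>z::complex. sinh (of_real pi * z) / z) \<longlongrightarrow> of_real pi) (at 0)"
        by (simp add: has_field_derivative_iff)
      moreover have "((\<lambda>z. cosh (of_real pi * z)) \<longlongrightarrow> cosh (of_real pi * 0)) (at (0::complex))"
        by (intro tendsto_intros)
      ultimately have "((\<lambda>z. cosh (of_real pi * z) / (sinh (of_real pi * z) / z))
          \<longlongrightarrow> cosh (of_real pi * 0) / of_real pi) (at (0::complex))"
        by (intro tendsto_divide) auto
      then have "((\<lambda>z. cosh (of_real pi * z) / (sinh (of_real pi * z) / z)) \<longlongrightarrow> hcoth 0) (at 0)"
        by (simp add: hcoth_def)
      then have "(hcoth \<longlongrightarrow> hcoth 0) (at 0)"
        by (rule Lim_transform_eventually)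
          (auto simp: eventually_at_filter hcoth_def coth_def)
      then show ?thesis using True by (simp add: isCont_def)
    qed
  qed
qed

text \<open>coth(\<pi>z) has period \<i>, so only the factor z changes. The hypotheses keep both z
  and z - \<i> away from 0, where \<open>hcoth\<close> takes its filled-in value.\<close>

lemma hcoth_shift:
  assumes "0 < \<bar>Im z\<bar> \<or> z \<noteq> 0" "\<bar>Im z\<bar> < 1"
  shows "hcoth (z - \<i>) = hcoth z - \<i> * coth (of_real pi * z)"
proof -
  have "z \<noteq> \<i>" "z \<noteq> 0" using assms by auto
  moreover have "coth (of_real pi * (z - \<i>)) = coth (of_real pi * z)"
    using sinh_cosh_add_I_pi[of "of_real pi * (z - \<i>)"]
    by (simp add: coth_def algebra_simps)
  ultimately show ?thesis by (simp add: hcoth_def algebra_simps)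
qed

text \<open>cot and coth differ by a quarter turn of the argument, and the two values filled in at 0
  agree. This is the link between \<open>omega_plus\<close> and h.\<close>

lemma zcot_eq_hcoth: "zcot w = hcoth (- \<i> * w)"
proof (cases "w = 0")
  case False
  have s: "sinh (- (\<i> * (of_real pi * w))) = - (\<i> * sin (of_real pi * w))"
    and c: "cosh (- (\<i> * (of_real pi * w))) = cos (of_real pi * w)"
    by (simp_all add: sinh_conv_sin cosh_conv_cos sinh_minus cosh_minus flip: mult.assoc)
  show ?thesis using False s c
    by (simp add: zcot_def hcoth_def coth_def cot_def mult.left_commute)
qed (simp add: zcot_def hcoth_def)

section \<open>Elementary inequalities behind the bound on h'\<close>

text \<open>Both sides are even and agree at 0; for positive arguments their difference has
  derivative u (cosh u - 1).\<close>

lemma mult_sinh_minus_cosh_ge: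
  fixes a :: real shows "a\<^sup>2 / 2 - 1 \<le> a * sinh a - cosh a"
proof -
  have *: "a\<^sup>2 / 2 - 1 \<le> a * sinh a - cosh a" if "a \<ge> 0" for a :: real
  proof -
    let ?f = "\<lambda>a::real. a * sinh a - cosh a - a\<^sup>2 / 2"
    have "?f 0 \<le> ?f a"
    proof (rule DERIV_nonneg_imp_nondecreasing[OF that])
      fix u :: real assume "0 \<le> u"
      have "(?f has_real_derivative u * cosh u - u) (at u)"
        by (auto intro!: derivative_eq_intros simp: algebra_simps)
      moreover have "0 \<le> u * cosh u - u"
        using mult_left_mono[OF cosh_real_ge_1[of u] \<open>0 \<le> u\<close>] by simp
      ultimately show "\<exists>y. (?f has_real_derivative y) (at u) \<and> 0 \<le> y" by blast
    qed
    then show ?thesis by simp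
  qed
  show ?thesis
    using *[of "\<bar>a\<bar>"] by (cases "a \<ge> 0") (auto simp: abs_if sinh_minus cosh_minus)
qed

text \<open>Equality holds at 0, and the difference has derivative u cos u, nonnegative up to
  \<pi>/2.\<close>

lemma one_minus_cos_le_mult_sin:
  fixes b :: real assumes "0 \<le> b" "b \<le> pi / 2" shows "1 - cos b \<le> b * sin b"
proof -
  let ?f = "\<lambda>b::real. b * sin b - 1 + cos b"
  have "?f 0 \<le> ?f b"
  proof (rule DERIV_nonneg_imp_nondecreasing[OF assms(1)])
    fix u :: real assume u: "0 \<le> u" "u \<le> b"
    have "(?f has_real_derivative u * cos u) (at u)"
      by (auto intro!: derivative_eq_intros simp: algebra_simps)
    moreover have "0 \<le> u * cos u" using u assms by (simp add: cos_ge_zero)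
    ultimately show "\<exists>y. (?f has_real_derivative y) (at u) \<and> 0 \<le> y" by blast
  qed
  then show ?thesis by simp
qed

lemma half_le_sin:
  fixes b :: real assumes "0 \<le> b" "b \<le> pi / 2" shows "b / 2 \<le> sin b"
proof (cases "b \<le> pi / 3")
  case True
  let ?f = "\<lambda>b::real. sin b - b / 2"
  have "?f 0 \<le> ?f b"
  proof (rule DERIV_nonneg_imp_nondecreasing[OF assms(1)])
    fix u :: real assume u: "0 \<le> u" "u \<le> b"
    have "(?f has_real_derivative cos u - 1 / 2) (at u)"
      by (auto intro!: derivative_eq_intros)
    moreover have "cos (pi / 3) \<le> cos u" using u True by (intro cos_monotone_0_pi_le) auto
    ultimately show "\<exists>y. (?f has_real_derivative y) (at u) \<and> 0 \<le> y"
      by (auto simp: cos_60)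
  qed
  then show ?thesis by simp
next
  case False
  \<comment> \<open>Beyond \<pi>/3 the sine is at least sqrt 3 / 2 >= 0.85, whereas b/2 <= \<pi>/4 <
    0.8.\<close>
  have "sin (pi / 3) \<le> sin b" using False assms by (intro sin_monotone_2pi_le) auto
  moreover have "sqrt 3 \<ge> 1.7" by (rule real_le_rsqrt) (simp add: power2_eq_square)
  moreover have "pi < 3.2" using pi_approx by simp
  ultimately show ?thesis using assms(2) by (simp add: sin_60)
qed

text \<open>The derivative factors as (1 - cos u)(4 sin u - 2u), so \<open>half_le_sin\<close> makes
  the expression increasing, and it is 0 at 0.\<close>

lemma quadratic_cos_sin_nonneg:
  fixes b :: real assumes "0 \<le> b" "b \<le> pi / 2"
  shows "0 \<le> 2 * (cos b * cos b) - 2 * cos b + 2 * b * sin b - b * b"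
proof -
  let ?f = "\<lambda>b::real. 2 * (cos b * cos b) - 2 * cos b + 2 * b * sin b - b * b"
  have "?f 0 \<le> ?f b"
  proof (rule DERIV_nonneg_imp_nondecreasing[OF assms(1)])
    fix u :: real assume u: "0 \<le> u" "u \<le> b"
    have "(?f has_real_derivative
        2 * (- sin u * cos u + - sin u * cos u) - 2 * (- sin u) + (2 * sin u + cos u * (2 * u)) - (u + u)) (at u)"
      by (rule derivative_eq_intros refl | simp only: mult_1_left mult_1_right mult_1 mult_zero_left add_0_left add_0_right diff_0)+
    also have "2 * (- sin u * cos u + - sin u * cos u) - 2 * (- sin u) + (2 * sin u + cos u * (2 * u)) - (u + u) =
        (1 - cos u) * (4 * sin u - 2 * u)"
      by algebra
    finally have "(?f has_real_derivative (1 - cos u) * (4 * sin u - 2 * u)) (at u)" .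
    moreover have "0 \<le> (1 - cos u) * (4 * sin u - 2 * u)"
    proof (rule mult_nonneg_nonneg)
      show "0 \<le> 4 * sin u - 2 * u" using half_le_sin[of u] u assms(2) by linarith
    qed simp
    ultimately show "\<exists>y. (?f has_real_derivative y) (at u) \<and> 0 \<le> y" by blast
  qed
  moreover have "?f 0 = 0" by simp
  ultimately show ?thesis by linarith
qed

lemma Re_sinh: "Re (sinh v) = sinh (Re v) * cos (Im v)"
  and Im_sinh: "Im (sinh v) = cosh (Re v) * sin (Im v)"
  by (simp_all add: sinh_def cosh_def Re_exp Im_exp algebra_simps)

text \<open>As cosh(2w) - 1 is twice the square of sinh w, this yields the exact modulus of the
  denominator of h'.\<close>

lemma norm_sinh_squared:
  "(cmod (sinh w))\<^sup>2 = (cosh (2 * Re w) - cos (2 * Im w)) / 2"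
proof -
  have "(cmod (sinh w))\<^sup>2 = (sinh (Re w))\<^sup>2 * (cos (Im w))\<^sup>2 + (cosh (Re w))\<^sup>2 * (sin (Im w))\<^sup>2"
    by (simp add: cmod_power2 Re_sinh Im_sinh power_mult_distrib)
  also have "\<dots> = (sinh (Re w))\<^sup>2 + (sin (Im w))\<^sup>2"
    by (simp add: cosh_square_eq cos_squared_eq algebra_simps)
  also have "\<dots> = (cosh (2 * Re w) - cos (2 * Im w)) / 2"
    by (simp add: cosh_double cos_double cosh_square_eq cos_squared_eq)
  finally show ?thesis .
qed

lemma half_square_le_cosh: "1 + a\<^sup>2 / 2 \<le> cosh (a::real)"
proof -
  have *: "1 + a\<^sup>2 / 2 \<le> cosh a" if "a \<ge> 0" for a :: real
  proof -
    have s: "u \<le> sinh u" if "u \<ge> 0" for u :: real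
    proof -
      have "sinh 0 - 0 \<le> sinh u - u"
      proof (rule DERIV_nonneg_imp_nondecreasing[OF that])
        fix t :: real
        have "((\<lambda>u. sinh u - u) has_real_derivative cosh t - 1) (at t)"
          by (auto intro!: derivative_eq_intros)
        then show "\<exists>y. ((\<lambda>u. sinh u - u) has_real_derivative y) (at t) \<and> 0 \<le> y"
          using cosh_real_ge_1[of t] by fastforce
      qed
      then show ?thesis by simp
    qed
    have "cosh 0 - 0\<^sup>2 / 2 \<le> cosh a - a\<^sup>2 / 2"
    proof (rule DERIV_nonneg_imp_nondecreasing[OF that])
      fix t :: real assume "0 \<le> t"
      have "((\<lambda>u. cosh u - u\<^sup>2 / 2) has_real_derivative sinh t - t) (at t)"
        by (auto intro!: derivative_eq_intros)
      then show "\<exists>y. ((\<lambda>u. cosh u - u\<^sup>2 / 2) has_real_derivative y) (at t) \<and> 0 \<le> y"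
        using s[OF \<open>0 \<le> t\<close>] by fastforce
    qed
    then show ?thesis by simp
  qed
  show ?thesis
    using *[of "\<bar>a\<bar>"] by (cases "a \<ge> 0") (auto simp: abs_if cosh_minus)
qed

text \<open>The right-hand side is |cosh v - 1|, so this is |h'| <= 1 in disguise. Squaring reduces
  it to real inequalities in a = |Re v| and b = |Im v|; the range b <= \<pi>/2 keeps cos b
  nonnegative.\<close>

lemma norm_sinh_minus_self_le:
  assumes "\<bar>Im v\<bar> \<le> pi / 2"
  shows "cmod (sinh v - v) \<le> cosh (Re v) - cos (Im v)"
proof -
  define a b where "a = \<bar>Re v\<bar>" and "b = \<bar>Im v\<bar>"
  have b: "0 \<le> b" "b \<le> pi / 2" using assms by (auto simp: b_def)
  have cb: "cos b \<ge> 0" "cos b \<le> 1" using b by (auto intro!: cos_ge_zero)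
  have sb: "sin b \<ge> 0" using b by (auto intro!: sin_ge_zero)
  have "(cmod (sinh v - v))\<^sup>2 = (sinh a * cos b - a)\<^sup>2 + (cosh a * sin b - b)\<^sup>2"
  proof -
    have *: "(- u - - w)\<^sup>2 = (u - w)\<^sup>2" for u w :: real
      using power2_minus[of "u - w"] by simp
    have "(sinh (Re v) * cos (Im v) - Re v)\<^sup>2 = (sinh a * cos b - a)\<^sup>2"
      using *[of "sinh (Re v) * cos (Im v)" "Re v"] by (cases "Re v \<ge> 0") (simp_all add: a_def b_def)
    moreover have "(cosh (Re v) * sin (Im v) - Im v)\<^sup>2 = (cosh a * sin b - b)\<^sup>2"
      using *[of "cosh (Re v) * sin (Im v)" "Im v"] by (cases "Im v \<ge> 0") (simp_all add: a_def b_def)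
    ultimately show ?thesis
      unfolding cmod_power2 minus_complex.sel Re_sinh Im_sinh by simp
  qed
  also have "\<dots> = sinh a * sinh a * (cos b * cos b) + cosh a * cosh a * (sin b * sin b)
      - 2 * cos b * (a * sinh a) - 2 * (b * sin b) * cosh a + a * a + b * b"
    by (simp add: power2_eq_square algebra_simps)
  also have "\<dots> \<le> (cosh a - cos b) * (cosh a - cos b)"
  proof -
    have c2: "cosh a * cosh a = sinh a * sinh a + 1"
      using cosh_square_eq[of a] by (simp add: power2_eq_square)
    have s2: "sin b * sin b = 1 - cos b * cos b"
      using sin_squared_eq[of b] by (simp add: power2_eq_square)
    have e1: "2 * cos b * (a * a / 2 - 1) \<le> 2 * cos b * (a * sinh a - cosh a)"
      using mult_sinh_minus_cosh_ge[of a] cb by (intro mult_left_mono) (auto simp: power2_eq_square)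
    have "1 + a * a / 2 \<le> cosh a"
      using half_square_le_cosh[of a] by (simp add: power2_eq_square)
    then have e2: "2 * (b * sin b) * (1 + a * a / 2) \<le> 2 * (b * sin b) * cosh a"
      using b sb by (intro mult_left_mono) auto
    have e3: "0 \<le> a * a * (cos b - 1 + b * sin b)"
      using one_minus_cos_le_mult_sin[OF b] by (intro mult_nonneg_nonneg) (auto simp: a_def)
    have e4: "0 \<le> 2 * (cos b * cos b) - 2 * cos b + 2 * b * sin b - b * b"
      by (rule quadratic_cos_sin_nonneg[OF b])
    \<comment> \<open>The products of two hyperbolic functions cancel. What remains is linear in a
      sinh a - cosh a and in cosh a, with nonnegative coefficients 2 cos b and 2 b sin b. Replacing
      both by the lower bounds of \<open>e1\<close> and \<open>e2\<close> leaves a quadratic in a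
      without linear term, whose coefficients are nonnegative by \<open>e3\<close> and
      \<open>e4\<close>.\<close>
    have "(cosh a - cos b) * (cosh a - cos b) - (sinh a * sinh a * (cos b * cos b) + cosh a * cosh a * (sin b * sin b)
      - 2 * cos b * (a * sinh a) - 2 * (b * sin b) * cosh a + a * a + b * b)
      = 2 * (cos b * cos b) + 2 * cos b * (a * sinh a - cosh a) + 2 * (b * sin b) * cosh a - a * a - b * b"
    proof -
      have "cos b * cos b * (cosh a * cosh a) = cos b * cos b * (sinh a * sinh a + 1)"
        by (simp only: c2)
      then show ?thesis unfolding s2 by (simp add: algebra_simps)
    qed
    also have "\<dots> \<ge> a * a * (cos b - 1 + b * sin b) +
        (2 * (cos b * cos b) - 2 * cos b + 2 * b * sin b - b * b)"
      using e1 e2 by (simp add: algebra_simps)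
    finally show ?thesis using e3 e4 by linarith
  qed
  also have "\<dots> = (cosh a - cos b)\<^sup>2" by (simp add: power2_eq_square)
  finally have sq: "(cmod (sinh v - v))\<^sup>2 \<le> (cosh a - cos b)\<^sup>2" .
  have "0 \<le> cosh a - cos b" using cosh_real_ge_1[of a] cb(2) by linarith
  from power2_le_imp_le[OF sq this] have "cmod (sinh v - v) \<le> cosh a - cos b" .
  moreover have "cosh a = cosh (Re v)" "cos b = cos (Im v)"
    by (simp_all add: a_def b_def abs_if cosh_minus)
  ultimately show ?thesis by simp
qed

text \<open>With w = \<pi>z the derivative is (sinh w cosh w - w) divided by the square of sinh w.
  Passing to v = 2w by the doubling formulas makes the denominator cosh v - 1.\<close>

lemma deriv_hcoth:
  assumes "z \<noteq> 0" "\<bar>Im z\<bar> < 1"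
  defines "v \<equiv> 2 * of_real pi * z"
  shows "deriv hcoth z = (sinh v - v) / (cosh v - 1)" and "cosh v \<noteq> 1"
    and "cmod (cosh v - 1) = cosh (Re v) - cos (Im v)"
proof -
  define w where "w = of_real pi * z"
  have v: "v = 2 * w" by (simp add: v_def w_def)
  have nz: "sinh w \<noteq> 0"
    using assms by (intro sinh_nonzero_strip) (auto simp: w_def abs_mult)
  have c: "cosh v - 1 = 2 * (sinh w)\<^sup>2"
    unfolding v by (simp add: cosh_double cosh_square_eq)
  show "cosh v \<noteq> 1" using c nz by auto
  have "cmod (cosh v - 1) = 2 * (cmod (sinh w))\<^sup>2"
    by (simp add: c norm_mult norm_power)
  also have "\<dots> = cosh (Re v) - cos (Im v)" by (simp add: norm_sinh_squared v)
  finally show "cmod (cosh v - 1) = cosh (Re v) - cos (Im v)" .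
  have "((\<lambda>z. z * (cosh (of_real pi * z) / sinh (of_real pi * z))) has_field_derivative
      cosh w / sinh w + z * ((sinh w * of_real pi * sinh w - cosh w * (cosh w * of_real pi)) / (sinh w * sinh w))) (at z)"
  proof -
    have d1: "((\<lambda>z. cosh (of_real pi * z)) has_field_derivative sinh w * of_real pi) (at z)"
      and d2: "((\<lambda>z. sinh (of_real pi * z)) has_field_derivative cosh w * of_real pi) (at z)"
      unfolding w_def by (auto intro!: derivative_eq_intros)
    have "sinh (of_real pi * z) \<noteq> 0" using nz by (simp add: w_def)
    from DERIV_mult[OF DERIV_ident DERIV_divide[OF d1 d2 this]] show ?thesis
      unfolding w_def by (simp only: mult_1_left mult.commute[of _ z])
  qed
  also have "cosh w / sinh w + z * ((sinh w * of_real pi * sinh w - cosh w * (cosh w * of_real pi)) / (sinh w * sinh w))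
     = (sinh v - v) / (cosh v - 1)"
  proof -
    have "cosh w * cosh w = sinh w * sinh w + 1"
      using cosh_square_eq[of w] by (simp add: power2_eq_square)
    then have "cosh w * cosh w * of_real pi = (sinh w * sinh w + 1) * of_real pi"
      by (rule arg_cong)
    then have X: "sinh w * of_real pi * sinh w - cosh w * (cosh w * of_real pi) = - of_real pi"
      by (simp add: algebra_simps)
    have "cosh w / sinh w + z * ((sinh w * of_real pi * sinh w - cosh w * (cosh w * of_real pi)) / (sinh w * sinh w))
      = cosh w / sinh w - w / (sinh w * sinh w)"
      unfolding X by (simp add: w_def)
    also have "\<dots> = (sinh w * cosh w - w) / (sinh w * sinh w)"
      using nz by (simp add: diff_divide_distrib)
    also have "\<dots> = (2 * sinh w * cosh w - 2 * w) / (2 * (sinh w)\<^sup>2)"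
    proof -
      have "2 * sinh w * cosh w - 2 * w = 2 * (sinh w * cosh w - w)" by (simp add: algebra_simps)
      have "2 * sinh w * cosh w - 2 * w = 2 * (sinh w * cosh w - w)" by (simp add: algebra_simps)
      moreover have "2 * (sinh w * cosh w - w) / (2 * (sinh w * sinh w)) =
          (sinh w * cosh w - w) / (sinh w * sinh w)"
        by (rule mult_divide_mult_cancel_left) simp
      ultimately show ?thesis by (simp only: power2_eq_square)
    qed
    also have "\<dots> = (sinh v - v) / (cosh v - 1)"
      unfolding c by (simp add: v sinh_double)
    finally show ?thesis .
  qed
  finally have "((\<lambda>z. z * (cosh (of_real pi * z) / sinh (of_real pi * z))) has_field_derivative
      (sinh v - v) / (cosh v - 1)) (at z)" .
  moreover have "\<forall>\<^sub>F y in nhds z. y * (cosh (of_real pi * y) / sinh (of_real pi * y)) = hcoth y"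
    using t1_space_nhds[OF assms(1)] by eventually_elim (auto simp: hcoth_def coth_def)
  ultimately have "(hcoth has_field_derivative (sinh v - v) / (cosh v - 1)) (at z)"
    by (rule DERIV_cong_ev[THEN iffD1, OF refl _ refl, rotated])
  then show "deriv hcoth z = (sinh v - v) / (cosh v - 1)" by (rule DERIV_imp_deriv)
qed

lemma deriv_hcoth_0: "deriv hcoth 0 = 0"
proof -
  have d: "(hcoth has_field_derivative deriv hcoth 0) (at 0)"
    by (rule holomorphic_derivI[OF hcoth_holomorphic])
      (auto intro!: open_Collect_less continuous_intros)
  have "((\<lambda>z. hcoth (- z)) has_field_derivative deriv hcoth 0 * - 1) (at 0)"
    by (rule DERIV_chain2[where g = uminus]) (use d in \<open>auto intro!: derivative_eq_intros\<close>)
  then have "(hcoth has_field_derivative - deriv hcoth 0) (at 0)" by simp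
  from DERIV_unique[OF d this] show ?thesis by simp
qed

text \<open>The factor 2\<pi> in v carries |Im z| <= 1/4 to |Im v| <= \<pi>/2; this is where the
  quarter in \<open>R_quarter\<close> comes from.\<close>

lemma norm_deriv_hcoth_le:
  assumes "\<bar>Im z\<bar> \<le> 1 / 4"
  shows "cmod (deriv hcoth z) \<le> 1"
proof (cases "z = 0")
  case False
  define v where "v = 2 * of_real pi * z"
  have i: "\<bar>Im z\<bar> < 1" using assms by simp
  note d = deriv_hcoth[OF False i, folded v_def]
  have "\<bar>Im v\<bar> \<le> pi / 2" using assms by (simp add: v_def abs_mult)
  from norm_sinh_minus_self_le[OF this] show ?thesis
    using d(2) by (simp add: d(1) norm_divide divide_le_eq_1 flip: d(3))
qed (simp add: deriv_hcoth_0)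

text \<open>|sinh v - v| < cosh v - 1 amounts to 1 + u < exp u for u = v and u = -v. The strictness
  makes the weight strictly monotone on the real line.\<close>

lemma deriv_hcoth_real:
  "deriv hcoth (of_real r) \<in> \<real>" "\<bar>Re (deriv hcoth (of_real r))\<bar> < 1"
proof -
  have "deriv hcoth (of_real r) \<in> \<real> \<and> \<bar>Re (deriv hcoth (of_real r))\<bar> < 1"
  proof (cases "r = 0")
    case False
    define v where "v = 2 * pi * r"
    have v: "v \<noteq> 0" using False by (simp add: v_def)
    have "deriv hcoth (of_real r) = (sinh (of_real v) - of_real v) / (cosh (of_real v) - 1)"
      using deriv_hcoth(1)[of "of_real r"] False by (simp add: v_def)
    also have "\<dots> = of_real ((sinh v - v) / (cosh v - 1))"
      by (simp add: sinh_def cosh_def scaleR_conv_of_real exp_of_real flip: of_real_minus)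
    finally have e: "deriv hcoth (of_real r) = of_real ((sinh v - v) / (cosh v - 1))" .
    have "1 + u < exp u" if "u \<noteq> 0" for u :: real
    proof (cases "1 + u / 2 \<ge> 0")
      case True
      \<comment> \<open>Squaring 1 + u/2 <= exp(u/2) gains the term u^2/4, which makes the
        inequality strict.\<close>
      have "1 + u < (1 + u / 2) * (1 + u / 2)" using that by (simp add: algebra_simps) (simp flip: power2_eq_square)
      also have "\<dots> \<le> exp (u / 2) * exp (u / 2)"
        using True by (intro mult_mono exp_ge_add_one_self) auto
      finally show ?thesis by (simp flip: exp_add)
    next
      case False
      then have "1 + u < 0" by simp
      then show ?thesis by (meson exp_gt_zero less_trans)
    qed
    from this[of v] this[of "-v"] v
    have "1 + v < exp v" "1 - v < exp (- v)" by auto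
    moreover have "cosh v - sinh v = exp (- v)" "cosh v + sinh v = exp v"
      by (simp_all add: cosh_minus_sinh cosh_plus_sinh)
    ultimately have "sinh v - v < cosh v - 1" "- (cosh v - 1) < sinh v - v"
      by linarith+
    then have "\<bar>sinh v - v\<bar> < cosh v - 1" by linarith
    then show ?thesis unfolding e by (auto simp: divide_simps)
  qed (simp add: deriv_hcoth_0)
  then show "deriv hcoth (of_real r) \<in> \<real>" "\<bar>Re (deriv hcoth (of_real r))\<bar> < 1" by auto
qed

text \<open>For |Re z| >= 1 the larger of exp(\<pi>z) and exp(-\<pi>z) exceeds the other by a factor
  of at least 3 in modulus, hence |coth(\<pi>z)| <= 2. The weight therefore grows at most
  linearly.\<close>

lemma norm_hcoth_le:
  assumes "1 \<le> \<bar>Re z\<bar>"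
  shows "cmod (hcoth z) \<le> 2 * cmod z"
proof -
  define w where "w = of_real pi * z"
  define a where "a = \<bar>Re w\<bar>"
  have "pi * 1 \<le> pi * \<bar>Re z\<bar>" using assms by (intro mult_left_mono) auto
  moreover have "a = pi * \<bar>Re z\<bar>" unfolding a_def w_def by (simp add: abs_mult)
  ultimately have a: "a \<ge> 1" using pi_ge_two by linarith
  have "cmod (exp w + exp (- w)) \<le> exp a + exp (- a)"
    using norm_triangle_ineq[of "exp w" "exp (- w)"] by (auto simp: a_def abs_if)
  moreover have "exp a - exp (- a) \<le> cmod (exp w - exp (- w))"
    using norm_triangle_ineq2[of "exp w" "exp (- w)"] norm_triangle_ineq2[of "exp (- w)" "exp w"]
    by (auto simp: a_def abs_if norm_minus_commute)
  moreover have "3 * exp (- a) \<le> exp a"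
  proof -
    have "3 \<le> 1 + 2 * a" using a by simp
    also have "\<dots> \<le> exp (2 * a)" by (rule exp_ge_add_one_self)
    finally have "3 * exp (- a) \<le> exp (2 * a) * exp (- a)" by simp
    then show ?thesis by (simp flip: exp_add)
  qed
  ultimately have "cmod (exp w + exp (- w)) \<le> 2 * cmod (exp w - exp (- w))" by simp
  then have "cmod (cosh w) \<le> 2 * cmod (sinh w)" by (simp add: cosh_def sinh_def)
  then have "cmod (coth w) \<le> 2"
    by (cases "sinh w = 0") (auto simp: coth_def norm_divide divide_le_eq)
  then have "cmod z * cmod (coth w) \<le> cmod z * 2" by (intro mult_left_mono) auto
  moreover have "z \<noteq> 0" using assms by auto
  ultimately show ?thesis by (simp add: hcoth_def norm_mult w_def mult.commute)
qed

section \<open>Integrals over segments and residues\<close>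

abbreviation seg :: "(complex \<Rightarrow> complex) \<Rightarrow> complex \<Rightarrow> complex \<Rightarrow> complex" where
  "seg f p q \<equiv> contour_integral (linepath p q) f"

text \<open>Local finiteness: every residue sum over a rectangle is finite and, unlike for a set
  whose points are merely isolated, the set is closed.\<close>

definition discrete_set :: "complex set \<Rightarrow> bool" where
  "discrete_set P \<longleftrightarrow> (\<forall>K. compact K \<longrightarrow> finite (P \<inter> K))"

lemma discrete_set_subset: "discrete_set P \<Longrightarrow> Q \<subseteq> P \<Longrightarrow> discrete_set Q"
  unfolding discrete_set_def by (meson finite_subset Int_mono order_refl)

lemma discrete_set_insert [simp]: "discrete_set (insert a P) = discrete_set P"
  unfolding discrete_set_def by (metis (no_types, opaque_lifting) Int_insert_left finite_insert)

lemma discrete_set_empty [simp]: "discrete_set {}"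
  by (simp add: discrete_set_def)

lemma discrete_set_closed:
  assumes "discrete_set P" shows "closed P"
proof -
  have "\<not> z islimpt P" for z
  proof
    assume "z islimpt P"
    then have "infinite (P \<inter> ball z 1)" by (auto simp: islimpt_eq_infinite_ball)
    moreover have "P \<inter> ball z 1 \<subseteq> P \<inter> cball z 1" by auto
    ultimately have "infinite (P \<inter> cball z 1)" using finite_subset by blast
    then show False using assms by (simp add: discrete_set_def)
  qed
  then show ?thesis by (simp add: closed_limpt)
qed

lemma seg_reverse: "seg f q p = - seg f p q"
  by (metis contour_integral_reversepath reversepath_linepath valid_path_linepath)

lemma seg_cnj:
  assumes "\<And>s. s \<in> closed_segment p q \<Longrightarrow> f (cnj s) = cnj (f s)"
  shows "seg f (cnj p) (cnj q) = cnj (seg f p q)"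
proof -
  have "cnj \<circ> linepath p q = linepath (cnj p) (cnj q)"
    by (simp add: fun_eq_iff linepath_def scaleR_conv_of_real)
  then have "seg f (cnj p) (cnj q) = cnj (contour_integral (linepath p q) (cnj \<circ> f \<circ> cnj))"
    using contour_integral_cnj[of "linepath p q" f] by simp
  also have "contour_integral (linepath p q) (cnj \<circ> f \<circ> cnj) = seg f p q"
    by (rule contour_integral_eq) (use assms in auto)
  finally show ?thesis .
qed

lemma seg_split_Re:
  assumes "continuous_on (closed_segment (Complex a v) (Complex c v)) f"
    and "b \<in> closed_segment a c"
  shows "seg f (Complex a v) (Complex c v) = seg f (Complex a v) (Complex b v) + seg f (Complex b v) (Complex c v)"
  by (rule contour_integral_split_linepath[OF assms(1)])
    (use assms(2) in \<open>auto simp: closed_segment_same_Im\<close>)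

lemma seg_split_Im:
  assumes "continuous_on (closed_segment (Complex u a) (Complex u c)) f"
    and "b \<in> closed_segment a c"
  shows "seg f (Complex u a) (Complex u c) = seg f (Complex u a) (Complex u b) + seg f (Complex u b) (Complex u c)"
  by (rule contour_integral_split_linepath[OF assms(1)])
    (use assms(2) in \<open>auto simp: closed_segment_same_Re\<close>)

lemma rect_residues:
  assumes U: "open U" "convex U" and f: "f holomorphic_on U - P" and P: "discrete_set P"
    and ab: "a1 < b1" "a2 < b2" and sub: "cbox (Complex a1 a2) (Complex b1 b2) \<subseteq> U"
    and bd: "\<And>p. p \<in> P \<Longrightarrow> p \<in> cbox (Complex a1 a2) (Complex b1 b2) \<Longrightarrow> p \<in> box (Complex a1 a2) (Complex b1 b2)"
  shows "seg f (Complex a1 a2) (Complex b1 a2) + seg f (Complex b1 a2) (Complex b1 b2)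
     + seg f (Complex b1 b2) (Complex a1 b2) + seg f (Complex a1 b2) (Complex a1 a2)
     = 2 * of_real pi * \<i> * (\<Sum>p\<in>P \<inter> box (Complex a1 a2) (Complex b1 b2). residue f p)"
proof -
  let ?a = "Complex a1 a2" and ?b = "Complex b1 b2"
  let ?g = "rectpath ?a ?b"
  \<comment> \<open>Cutting \<open>U\<close> down to a slightly larger box leaves finitely many
    points of \<open>P\<close>, as the residue theorem demands; points outside the closed rectangle
    have winding number 0.\<close>
  define S where "S = U \<inter> box (Complex (a1 - 1) (a2 - 1)) (Complex (b1 + 1) (b2 + 1))"
  have S: "open S" "convex S" using U by (auto simp: S_def intro: open_Int convex_Int)
  have fin: "finite (P \<inter> S)"
  proof (rule finite_subset)
    show "P \<inter> S \<subseteq> P \<inter> cbox (Complex (a1 - 1) (a2 - 1)) (Complex (b1 + 1) (b2 + 1))"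
      by (auto simp: S_def box_subset_cbox[THEN subsetD])
    show "finite (P \<inter> cbox (Complex (a1 - 1) (a2 - 1)) (Complex (b1 + 1) (b2 + 1)))"
      using P by (simp add: discrete_set_def)
  qed
  have cS: "cbox ?a ?b \<subseteq> S"
    using sub by (auto simp: S_def in_cbox_complex_iff in_box_complex_iff)
  have im: "path_image ?g = cbox ?a ?b - box ?a ?b"
    using ab by (intro path_image_rectpath_cbox_minus_box) auto
  have imP: "path_image ?g \<inter> P = {}" using bd im by auto
  have wn0: "winding_number ?g z = 0" if "z \<notin> cbox ?a ?b" for z
    by (rule winding_number_zero_outside[OF _ _ _ that]) (use im in auto)
  have "contour_integral ?g f = 2 * pi * \<i> * (\<Sum>p\<in>P \<inter> S. winding_number ?g p * residue f p)"
  proof (rule Residue_theorem)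
    show "f holomorphic_on S - P \<inter> S" by (rule holomorphic_on_subset[OF f]) (auto simp: S_def)
    show "path_image ?g \<subseteq> S - P \<inter> S" using im imP cS by auto
    show "\<forall>z. z \<notin> S \<longrightarrow> winding_number ?g z = 0" using wn0 cS by blast
  qed (use S fin convex_connected in auto)
  also have "(\<Sum>p\<in>P \<inter> S. winding_number ?g p * residue f p) = (\<Sum>p\<in>P \<inter> box ?a ?b. residue f p)"
  proof (rule sum.mono_neutral_cong_right[OF fin])
    show "P \<inter> box ?a ?b \<subseteq> P \<inter> S" using cS box_subset_cbox by blast
    show "\<forall>p\<in>P \<inter> S - P \<inter> box ?a ?b. winding_number ?g p * residue f p = 0"
      using bd wn0 by fastforce
    show "winding_number ?g p * residue f p = residue f p" if "p \<in> P \<inter> box ?a ?b" for p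
      using that winding_number_rectpath[of p ?a ?b] by simp
  qed
  also have "contour_integral ?g f = seg f ?a (Complex b1 a2) + seg f (Complex b1 a2) ?b
     + seg f ?b (Complex a1 b2) + seg f (Complex a1 b2) ?a"
  proof -
    have cont: "continuous_on (path_image ?g) f"
      by (rule continuous_on_subset[OF holomorphic_on_imp_continuous_on[OF f]])
        (use imP im sub in auto)
    have "path_image ?g = closed_segment ?a (Complex b1 a2) \<union> closed_segment (Complex b1 a2) ?b
        \<union> (closed_segment ?b (Complex a1 b2) \<union> closed_segment (Complex a1 b2) ?a)"
      by (auto simp: rectpath_def Let_def path_image_join)
    then have "f contour_integrable_on linepath ?a (Complex b1 a2)" "f contour_integrable_on linepath (Complex b1 a2) ?b"
      "f contour_integrable_on linepath ?b (Complex a1 b2)" "f contour_integrable_on linepath (Complex a1 b2) ?a"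
      by (auto intro!: contour_integrable_continuous_linepath intro: continuous_on_subset[OF cont])
    then show ?thesis by (simp add: rectpath_def Let_def contour_integrable_joinI add.assoc)
  qed
  finally show ?thesis by simp
qed

section \<open>Moving the shifted weight through the strip\<close>

text \<open>The properties of the weight on which the shift of contours rests. Its poles \<sigma> -
  \<i>T and \<sigma> + \<i>T move to \<sigma> and \<sigma> + 2\<i>T, so \<sigma> is the only
  singularity of the shifted function in the open strip -T < Im s < 2T.\<close>

locale shift_weight =
  fixes T \<sigma> :: real and \<Phi> :: "complex \<Rightarrow> complex"
  assumes T_pos: "0 < T"
    and Phi_hol: "\<Phi> holomorphic_on {s. \<bar>Im s\<bar> < T}"
    and Phi_1: "\<Phi> 1 = 0"
    and Phi_cnj: "\<Phi> (cnj s) = cnj (\<Phi> s)"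
    and shift_hol: "(\<lambda>s. \<Phi> (s - \<i> * of_real T)) holomorphic_on
          {s. - T < Im s \<and> Im s < 2 * T} - {of_real \<sigma>}"
    and jump_cnj_aux: "\<bar>Im s\<bar> < T \<Longrightarrow> s \<noteq> of_real \<sigma> \<Longrightarrow>
          (\<Phi> (cnj s) - \<Phi> (cnj s - \<i> * of_real T)) / (\<i> * of_real T)
          = cnj ((\<Phi> s - \<Phi> (s - \<i> * of_real T)) / (\<i> * of_real T))"
begin

definition shifted :: "complex \<Rightarrow> complex" where
  "shifted s = \<Phi> (s - \<i> * of_real T)"

text \<open>For the weight this is \<alpha>/2 coth(\<pi>(s - \<sigma>)/T) + \<delta>/2, the function
  whose residues enter the sum over the real poles.\<close>

definition jump :: "complex \<Rightarrow> complex" where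
  "jump s = (\<Phi> s - shifted s) / (\<i> * of_real T)"

lemma jump_cnj: "\<bar>Im s\<bar> < T \<Longrightarrow> s \<noteq> of_real \<sigma> \<Longrightarrow> jump (cnj s) = cnj (jump s)"
  unfolding jump_def shifted_def by (rule jump_cnj_aux)

lemma shifted_hol: "shifted holomorphic_on {s. - T < Im s \<and> Im s < 2 * T} - {of_real \<sigma>}"
  using shift_hol unfolding shifted_def .

lemma jump_hol: "jump holomorphic_on {s. \<bar>Im s\<bar> < T} - {of_real \<sigma>}"
  unfolding jump_def
proof (intro holomorphic_intros)
  show "\<Phi> holomorphic_on {s. \<bar>Im s\<bar> < T} - {of_real \<sigma>}"
    by (rule holomorphic_on_subset[OF Phi_hol]) auto
  show "shifted holomorphic_on {s. \<bar>Im s\<bar> < T} - {of_real \<sigma>}"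
    by (rule holomorphic_on_subset[OF shifted_hol]) auto
qed (use T_pos in auto)

lemma shifted_eq: "shifted s = \<Phi> s - \<i> * of_real T * jump s"
  using T_pos by (simp add: jump_def)

lemma open_strips:
  "open {s. \<bar>Im s\<bar> < T}" "open {s. - T < Im s \<and> Im s < 2 * T}"
  "convex {s. \<bar>Im s\<bar> < T}" "convex {s. - T < Im s \<and> Im s < 2 * T}"
proof -
  have "{s. \<bar>Im s\<bar> < T} = {s. Im s < T} \<inter> {s. Im s > - T}" by auto
  then show "open {s. \<bar>Im s\<bar> < T}" "convex {s. \<bar>Im s\<bar> < T}"
    by (simp_all add: open_Int convex_Int open_halfspace_Im_lt open_halfspace_Im_gt
        convex_halfspace_Im_lt convex_halfspace_Im_gt)
  have "{s. - T < Im s \<and> Im s < 2 * T} = {s. Im s < 2 * T} \<inter> {s. Im s > - T}" by auto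
  then show "open {s. - T < Im s \<and> Im s < 2 * T}" "convex {s. - T < Im s \<and> Im s < 2 * T}"
    by (simp_all add: open_Int convex_Int open_halfspace_Im_lt open_halfspace_Im_gt
        convex_halfspace_Im_lt convex_halfspace_Im_gt)
qed

text \<open>The weight differs by \<open>\<i> T jump\<close> from \<open>\<Phi>\<close>; the first part is moved through the upper
  half of the strip, and the \<open>jump\<close> part, being symmetric under conjugation, turns the path along
  the real axis into half of a closed contour around the real singularities.\<close>

lemma shift_identity:
  fixes B :: "complex \<Rightarrow> complex" and P :: "complex set" and b \<kappa> \<eta> :: real
  defines "g \<equiv> \<lambda>s. shifted s * B s"
    and "f \<equiv> \<lambda>s. \<Phi> s * B s"
    and "S1 \<equiv> \<Sum>p | p \<in> P \<and> b < Re p \<and> 0 < Im p \<and> Im p < T. residue (\<lambda>s. shifted s * B s) p"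
    and "S2 \<equiv> \<Sum>p | p \<in> insert (of_real \<sigma>) P \<and> b < Re p \<and> Im p = 0. residue (\<lambda>s. jump s * B s) p"
  assumes B: "B holomorphic_on - P" and P: "discrete_set P"
    and Bcnj: "\<And>s. B (cnj s) = cnj (B s)"
    and k: "1 < \<kappa>" "\<sigma> < \<kappa>" "b < 1" "b < \<sigma>"
    and P1: "\<And>p. p \<in> P \<Longrightarrow> \<bar>Im p\<bar> \<le> T \<Longrightarrow> Re p < \<kappa>"
    and Pb: "\<And>p. p \<in> P \<Longrightarrow> \<bar>Im p\<bar> \<le> T \<Longrightarrow> Re p \<noteq> b"
    and PT: "\<And>p. p \<in> P \<Longrightarrow> Im p \<noteq> T"
    and eta: "0 < \<eta>" "\<eta> < T" "\<And>p. p \<in> P \<Longrightarrow> b \<le> Re p \<Longrightarrow> \<bar>Im p\<bar> \<le> \<eta> \<Longrightarrow> Im p = 0"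
  shows "S2 \<in> \<real>"
    and "Re (seg g (Complex \<kappa> 0) (Complex \<kappa> T) + seg g (Complex \<kappa> T) (Complex 1 T)) =
      Re (2 * of_real pi * \<i> * S1) + pi * T * Re S2
      + Re (seg f (Complex \<kappa> 0) (Complex \<kappa> \<eta>) + seg f (Complex \<kappa> \<eta>) (Complex b \<eta>)
          + seg f (Complex b \<eta>) (Complex b 0))
      + Re (seg g (Complex b 0) (Complex b T) + seg g (Complex b T) (Complex 1 T))"
proof -
  define h where "h = (\<lambda>s. jump s * B s)"
  have T: "T > 0" by (rule T_pos)
  let ?U = "{s. - T < Im s \<and> Im s < 2 * T}" and ?V = "{s. \<bar>Im s\<bar> < T}"
  let ?P = "insert (of_real \<sigma>) P"
  have P': "discrete_set ?P" using P by simp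
  have g: "g holomorphic_on ?U - ?P"
    unfolding g_def
    by (intro holomorphic_on_mult holomorphic_on_subset[OF shifted_hol] holomorphic_on_subset[OF B]) auto
  have h: "h holomorphic_on ?V - ?P"
    unfolding h_def
    by (intro holomorphic_on_mult holomorphic_on_subset[OF jump_hol] holomorphic_on_subset[OF B]) auto
  have f: "f holomorphic_on ?V - P"
    unfolding f_def
    by (intro holomorphic_on_mult holomorphic_on_subset[OF Phi_hol] holomorphic_on_subset[OF B]) auto
  have cg: "continuous_on X g" if "X \<subseteq> ?U - ?P" for X
    using holomorphic_on_imp_continuous_on[OF g] continuous_on_subset that by blast
  have ch: "continuous_on X h" if "X \<subseteq> ?V - ?P" for X
    using holomorphic_on_imp_continuous_on[OF h] continuous_on_subset that by blast
  have cf: "continuous_on X f" if "X \<subseteq> ?V - P" for X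
    using holomorphic_on_imp_continuous_on[OF f] continuous_on_subset that by blast
  have s0: "{p \<in> P \<inter> box (Complex b \<eta>) (Complex \<kappa> T). True} = {p. p \<in> P \<and> b < Re p \<and> 0 < Im p \<and> Im p < T}"
    using P1 eta by (fastforce simp: in_box_complex_iff)
  \<comment> \<open>The side at height \<open>\<eta>\<close> separates the real poles from the
    others: this rectangle collects the upper poles, and the next one, symmetric about the real
    axis, the real ones together with \<sigma>.\<close>
  have R1: "seg g (Complex b \<eta>) (Complex \<kappa> \<eta>) + seg g (Complex \<kappa> \<eta>) (Complex \<kappa> T)
      + seg g (Complex \<kappa> T) (Complex b T) + seg g (Complex b T) (Complex b \<eta>)
      = 2 * of_real pi * \<i> * S1"
  proof -
    have "seg g (Complex b \<eta>) (Complex \<kappa> \<eta>) + seg g (Complex \<kappa> \<eta>) (Complex \<kappa> T)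
      + seg g (Complex \<kappa> T) (Complex b T) + seg g (Complex b T) (Complex b \<eta>)
      = 2 * of_real pi * \<i> * (\<Sum>p\<in>?P \<inter> box (Complex b \<eta>) (Complex \<kappa> T). residue g p)"
    proof (rule rect_residues[OF open_strips(2,4) g P'])
      fix p assume p: "p \<in> ?P" "p \<in> cbox (Complex b \<eta>) (Complex \<kappa> T)"
      then have "p \<in> P" using eta by (auto simp: in_cbox_complex_iff)
      then show "p \<in> box (Complex b \<eta>) (Complex \<kappa> T)"
        using p(2) P1[of p] Pb[of p] PT[of p] eta(1,2) eta(3)[of p]
        by (force simp: in_cbox_complex_iff in_box_complex_iff)
    qed (use k eta in \<open>auto simp: in_cbox_complex_iff\<close>)
    also have "?P \<inter> box (Complex b \<eta>) (Complex \<kappa> T) = {p. p \<in> P \<and> b < Re p \<and> 0 < Im p \<and> Im p < T}"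
      using s0 eta by (auto simp: in_box_complex_iff)
    finally show ?thesis by (simp add: S1_def g_def)
  qed
  have R2: "seg h (Complex b (-\<eta>)) (Complex \<kappa> (-\<eta>)) + seg h (Complex \<kappa> (-\<eta>)) (Complex \<kappa> \<eta>)
      + seg h (Complex \<kappa> \<eta>) (Complex b \<eta>) + seg h (Complex b \<eta>) (Complex b (-\<eta>))
      = 2 * of_real pi * \<i> * S2"
  proof -
    have "seg h (Complex b (-\<eta>)) (Complex \<kappa> (-\<eta>)) + seg h (Complex \<kappa> (-\<eta>)) (Complex \<kappa> \<eta>)
      + seg h (Complex \<kappa> \<eta>) (Complex b \<eta>) + seg h (Complex b \<eta>) (Complex b (-\<eta>))
      = 2 * of_real pi * \<i> * (\<Sum>p\<in>?P \<inter> box (Complex b (-\<eta>)) (Complex \<kappa> \<eta>). residue h p)"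
    proof (rule rect_residues[OF open_strips(1,3) h P'])
      fix p assume p: "p \<in> ?P" "p \<in> cbox (Complex b (-\<eta>)) (Complex \<kappa> \<eta>)"
      show "p \<in> box (Complex b (-\<eta>)) (Complex \<kappa> \<eta>)"
      proof (cases "p = of_real \<sigma>")
        case False
        then have "p \<in> P" using p by auto
        then show ?thesis
          using p(2) P1[of p] Pb[of p] eta(1,2) eta(3)[of p]
          by (force simp: in_cbox_complex_iff in_box_complex_iff)
      qed (use k eta in \<open>auto simp: in_box_complex_iff\<close>)
    qed (use k eta in \<open>auto simp: in_cbox_complex_iff\<close>)
    also have "?P \<inter> box (Complex b (-\<eta>)) (Complex \<kappa> \<eta>) = {p. p \<in> ?P \<and> b < Re p \<and> Im p = 0}"
    proof -
      have "p \<in> box (Complex b (-\<eta>)) (Complex \<kappa> \<eta>) \<longleftrightarrow> b < Re p \<and> Im p = 0" if "p \<in> ?P" for p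
      proof (cases "p = of_real \<sigma>")
        case False
        then have "p \<in> P" using that by auto
        then show ?thesis
          using P1[of p] eta(1,2) eta(3)[of p] by (auto simp: in_box_complex_iff)
      qed (use k eta in \<open>auto simp: in_box_complex_iff\<close>)
      then show ?thesis by auto
    qed
    finally show ?thesis by (simp add: S2_def h_def)
  qed
  \<comment> \<open>\<open>Q\<close> is the upper half of the symmetric rectangle. Conjugation
    carries it to the lower half with reversed orientation, so the whole boundary integral of
    \<open>h\<close> is \<open>Q - cnj Q\<close>.\<close>
  define Q where "Q = seg h (Complex \<kappa> 0) (Complex \<kappa> \<eta>) + seg h (Complex \<kappa> \<eta>) (Complex b \<eta>)
      + seg h (Complex b \<eta>) (Complex b 0)"
  have sv: "closed_segment (Complex u v) (Complex u w) \<subseteq> ?V - ?P"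
    if "u = b \<or> u = \<kappa>" "\<bar>v\<bar> \<le> \<eta>" "\<bar>w\<bar> \<le> \<eta>" for u v w
    using that k P1 Pb eta by (fastforce simp: closed_segment_same_Re closed_segment_eq_real_ivl split: if_splits)
  have sh: "closed_segment (Complex u v) (Complex w v) \<subseteq> ?V - ?P"
    if "\<bar>v\<bar> = \<eta>" "b \<le> u" "u \<le> \<kappa>" "b \<le> w" "w \<le> \<kappa>" for u v w
    using that eta by (fastforce simp: closed_segment_same_Im closed_segment_eq_real_ivl split: if_splits)
  have svg: "closed_segment (Complex u v) (Complex u w) \<subseteq> ?U - ?P"
    if "u = b \<or> u = \<kappa>" "0 \<le> v" "v \<le> T" "0 \<le> w" "w \<le> T" for u v w
    using that k P1 Pb T by (fastforce simp: closed_segment_same_Re closed_segment_eq_real_ivl split: if_splits)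
  have shg: "closed_segment (Complex u T) (Complex w T) \<subseteq> ?U - ?P" for u w
    using PT T by (fastforce simp: closed_segment_same_Im closed_segment_eq_real_ivl split: if_splits)
  have hc: "h (cnj s) = cnj (h s)" if "s \<in> ?V - ?P" for s
    using that by (simp add: h_def jump_cnj Bcnj)
  have cn: "seg h (Complex u (-v)) (Complex w (-z)) = cnj (seg h (Complex u v) (Complex w z))"
    if "closed_segment (Complex u v) (Complex w z) \<subseteq> ?V - ?P" for u v w z
    using seg_cnj[of "Complex u v" "Complex w z" h] hc that by (auto simp: complex_cnj)
  have e1: "seg h (Complex b (-\<eta>)) (Complex \<kappa> (-\<eta>)) = - cnj (seg h (Complex \<kappa> \<eta>) (Complex b \<eta>))"
    using cn[of \<kappa> \<eta> b \<eta>] sh[of \<eta> \<kappa> b] k eta seg_reverse[of "Complex b (-\<eta>)" _ h] by auto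
  have e2: "seg h (Complex \<kappa> (-\<eta>)) (Complex \<kappa> \<eta>) = seg h (Complex \<kappa> (-\<eta>)) (Complex \<kappa> 0)
      + seg h (Complex \<kappa> 0) (Complex \<kappa> \<eta>)"
    by (intro seg_split_Im ch sv) (use eta in \<open>auto simp: closed_segment_eq_real_ivl\<close>)
  have e3: "seg h (Complex \<kappa> (-\<eta>)) (Complex \<kappa> 0) = - cnj (seg h (Complex \<kappa> 0) (Complex \<kappa> \<eta>))"
    using cn[of \<kappa> 0 \<kappa> \<eta>] sv[of \<kappa> 0 \<eta>] eta seg_reverse[of "Complex \<kappa> (-\<eta>)" _ h] by auto
  have e4: "seg h (Complex b \<eta>) (Complex b (-\<eta>)) = seg h (Complex b \<eta>) (Complex b 0)
      + seg h (Complex b 0) (Complex b (-\<eta>))"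
    by (intro seg_split_Im ch sv) (use eta in \<open>auto simp: closed_segment_eq_real_ivl\<close>)
  have e5: "seg h (Complex b 0) (Complex b (-\<eta>)) = - cnj (seg h (Complex b \<eta>) (Complex b 0))"
    using cn[of b \<eta> b 0] sv[of b \<eta> 0] eta seg_reverse[of "Complex b 0" "Complex b (-\<eta>)" h] by auto
  have "Q - cnj Q = 2 * of_real pi * \<i> * S2"
    unfolding R2[symmetric] Q_def e1 e2 e3 e4 e5 by (simp add: algebra_simps)
  moreover have "Q - cnj Q = 2 * of_real pi * \<i> * of_real (Im Q / pi)"
    by (simp add: complex_eq_iff)
  ultimately have "2 * of_real pi * \<i> * S2 = 2 * of_real pi * \<i> * of_real (Im Q / pi)" by simp
  \<comment> \<open>\<open>Q - cnj Q\<close> is 2\<i> times the imaginary part of \<open>Q\<close>,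
    so \<open>S2\<close> is real. In the final identity the real part of -\<i>T\<open>Q\<close> thus
    becomes \<pi>T\<open>S2\<close>.\<close>
  then have S2: "S2 = of_real (Im Q / pi)" by (simp del: of_real_divide)
  then show "S2 \<in> \<real>" by simp
  have gf: "seg g p q = seg f p q - \<i> * of_real T * seg h p q" if "closed_segment p q \<subseteq> ?V - ?P" for p q
  proof -
    have "seg g p q = contour_integral (linepath p q) (\<lambda>s. f s - \<i> * of_real T * h s)"
      by (rule contour_integral_eq) (simp add: g_def f_def h_def shifted_eq algebra_simps)
    also have "\<dots> = seg f p q - contour_integral (linepath p q) (\<lambda>s. \<i> * of_real T * h s)"
      using that by (intro contour_integral_diff contour_integrable_continuous_linepath cf
          continuous_intros ch) auto
    also have "contour_integral (linepath p q) (\<lambda>s. \<i> * of_real T * h s) = \<i> * of_real T * seg h p q"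
      using that by (intro contour_integral_lmul contour_integrable_continuous_linepath ch) auto
    finally show ?thesis .
  qed
  have "seg g (Complex \<kappa> 0) (Complex \<kappa> T) = seg g (Complex \<kappa> 0) (Complex \<kappa> \<eta>) + seg g (Complex \<kappa> \<eta>) (Complex \<kappa> T)"
    by (intro seg_split_Im cg svg) (use eta in \<open>auto simp: closed_segment_eq_real_ivl\<close>)
  moreover have "seg g (Complex \<kappa> T) (Complex b T) = seg g (Complex \<kappa> T) (Complex 1 T) + seg g (Complex 1 T) (Complex b T)"
    by (intro seg_split_Re cg shg) (use k in \<open>auto simp: closed_segment_eq_real_ivl\<close>)
  moreover have "seg g (Complex b T) (Complex 1 T) = - seg g (Complex 1 T) (Complex b T)"
    by (rule seg_reverse)
  moreover have "seg g (Complex b 0) (Complex b T) = seg g (Complex b 0) (Complex b \<eta>) + seg g (Complex b \<eta>) (Complex b T)"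
    by (intro seg_split_Im cg svg) (use eta in \<open>auto simp: closed_segment_eq_real_ivl\<close>)
  moreover have "seg g (Complex b T) (Complex b \<eta>) = - seg g (Complex b \<eta>) (Complex b T)"
    by (rule seg_reverse)
  moreover have "seg g (Complex b \<eta>) (Complex b 0) = - seg g (Complex b 0) (Complex b \<eta>)"
    by (rule seg_reverse)
  moreover have "seg g (Complex b \<eta>) (Complex \<kappa> \<eta>) = - seg g (Complex \<kappa> \<eta>) (Complex b \<eta>)"
    by (rule seg_reverse)
  ultimately have "seg g (Complex \<kappa> 0) (Complex \<kappa> T) + seg g (Complex \<kappa> T) (Complex 1 T) =
     2 * of_real pi * \<i> * S1 + (seg g (Complex \<kappa> 0) (Complex \<kappa> \<eta>) + seg g (Complex \<kappa> \<eta>) (Complex b \<eta>)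
       + seg g (Complex b \<eta>) (Complex b 0)) + (seg g (Complex b 0) (Complex b T) + seg g (Complex b T) (Complex 1 T))"
    using R1 by (simp add: algebra_simps)
  also have "seg g (Complex \<kappa> 0) (Complex \<kappa> \<eta>) + seg g (Complex \<kappa> \<eta>) (Complex b \<eta>) + seg g (Complex b \<eta>) (Complex b 0)
     = seg f (Complex \<kappa> 0) (Complex \<kappa> \<eta>) + seg f (Complex \<kappa> \<eta>) (Complex b \<eta>)
          + seg f (Complex b \<eta>) (Complex b 0) - \<i> * of_real T * Q"
  proof -
    have "closed_segment (Complex \<kappa> 0) (Complex \<kappa> \<eta>) \<subseteq> ?V - ?P"
      "closed_segment (Complex b \<eta>) (Complex b 0) \<subseteq> ?V - ?P"
      "closed_segment (Complex \<kappa> \<eta>) (Complex b \<eta>) \<subseteq> ?V - ?P"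
      using sv[of \<kappa> 0 \<eta>] sv[of b \<eta> 0] sh[of \<eta> \<kappa> b] eta(1) k by auto
    from this[THEN gf] show ?thesis by (simp only: Q_def) (simp add: algebra_simps)
  qed
  finally have "Re (seg g (Complex \<kappa> 0) (Complex \<kappa> T) + seg g (Complex \<kappa> T) (Complex 1 T)) =
      Re (2 * of_real pi * \<i> * S1 + (seg f (Complex \<kappa> 0) (Complex \<kappa> \<eta>) + seg f (Complex \<kappa> \<eta>) (Complex b \<eta>)
          + seg f (Complex b \<eta>) (Complex b 0) - \<i> * of_real T * Q)
      + (seg g (Complex b 0) (Complex b T) + seg g (Complex b T) (Complex 1 T)))"
    by (rule arg_cong)
  moreover have "Re (\<i> * of_real T * Q) = - (pi * T * Re S2)"
    by (simp add: S2)
  ultimately show "Re (seg g (Complex \<kappa> 0) (Complex \<kappa> T) + seg g (Complex \<kappa> T) (Complex 1 T)) =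
      Re (2 * of_real pi * \<i> * S1) + pi * T * Re S2
      + Re (seg f (Complex \<kappa> 0) (Complex \<kappa> \<eta>) + seg f (Complex \<kappa> \<eta>) (Complex b \<eta>)
          + seg f (Complex b \<eta>) (Complex b 0))
      + Re (seg g (Complex b 0) (Complex b T) + seg g (Complex b T) (Complex 1 T))"
    by (simp only: plus_complex.sel minus_complex.sel)
qed

end

section \<open>Contours descending to infinity\<close>

text \<open>A pointwise form of continuous differentiability: it can be checked at each parameter
  off an exceptional set and then yields \<open>C1_differentiable_on\<close> for all the remaining
  parameters at once.\<close>

definition C1_at :: "(real \<Rightarrow> complex) \<Rightarrow> real \<Rightarrow> bool" where
  "C1_at f t \<longleftrightarrow> (\<exists>e>0. f C1_differentiable_on ball t e)"

lemma C1_at_imp_differentiable: "C1_at f t \<Longrightarrow> f differentiable at t"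
  by (auto simp: C1_at_def C1_differentiable_on_eq)

lemma C1_at_imp_isCont: assumes "C1_at f t" shows "isCont (\<lambda>s. vector_derivative f (at s)) t"
proof -
  obtain e where "e > 0" "continuous_on (ball t e) (\<lambda>s. vector_derivative f (at s))"
    using assms by (auto simp: C1_at_def C1_differentiable_on_eq)
  then show ?thesis by (auto simp: continuous_on_eq_continuous_at)
qed

lemma C1_at_imp_C1_differentiable_on:
  "(\<And>t. t \<in> S \<Longrightarrow> C1_at f t) \<Longrightarrow> f C1_differentiable_on S"
  by (simp add: C1_differentiable_on_eq C1_at_imp_differentiable C1_at_imp_isCont
      continuous_at_imp_continuous_on)

lemma C1_at_I:
  assumes "\<forall>\<^sub>F s in nhds t. (f has_vector_derivative D s) (at s)" "\<forall>\<^sub>F s in nhds t. isCont D s"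
  shows "C1_at f t"
proof -
  from eventually_conj[OF assms] obtain e where "e > 0"
    and e: "\<And>s. dist s t < e \<Longrightarrow> (f has_vector_derivative D s) (at s) \<and> isCont D s"
    by (auto simp: eventually_nhds_metric)
  then have "f C1_differentiable_on ball t e"
    unfolding C1_differentiable_on_def
    by (intro exI[of _ D]) (auto simp: dist_commute intro!: continuous_at_imp_continuous_on)
  then show ?thesis using \<open>e > 0\<close> by (auto simp: C1_at_def)
qed

lemma C1_at_eventually:
  assumes "C1_at f t"
  shows "\<forall>\<^sub>F s in nhds t. (f has_vector_derivative vector_derivative f (at s)) (at s)"
    and "\<forall>\<^sub>F s in nhds t. isCont (\<lambda>s. vector_derivative f (at s)) s"
proof -
  obtain e where e: "e > 0" "f C1_differentiable_on ball t e"
    using assms by (auto simp: C1_at_def)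
  have "\<forall>\<^sub>F s in nhds t. s \<in> ball t e" using e by (intro eventually_nhds_in_open) auto
  then show "\<forall>\<^sub>F s in nhds t. (f has_vector_derivative vector_derivative f (at s)) (at s)"
    by eventually_elim (use e(2) in \<open>auto simp: C1_differentiable_on_eq vector_derivative_works\<close>)
  have "\<forall>\<^sub>F s in nhds t. s \<in> ball t e" using e by (intro eventually_nhds_in_open) auto
  then show "\<forall>\<^sub>F s in nhds t. isCont (\<lambda>s. vector_derivative f (at s)) s"
    by eventually_elim (use e(2) in \<open>auto simp: C1_differentiable_on_eq continuous_on_eq_continuous_at\<close>)
qed

lemma eventually_nhds_shrink:
  assumes "\<forall>\<^sub>F s in nhds (t::real). P s" shows "\<forall>\<^sub>F s in nhds t. \<forall>\<^sub>F r in nhds s. P r"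
  using assms by (simp add: eventually_eventually)

lemma has_vector_derivative_eventually_eq:
  fixes f g :: "real \<Rightarrow> 'a :: real_normed_vector"
  assumes "(f has_vector_derivative D) (at s)" "\<forall>\<^sub>F r in nhds s. f r = g r"
  shows "(g has_vector_derivative D) (at s)"
proof -
  have "(f has_vector_derivative D) (at s) = (g has_vector_derivative D) (at s)"
    by (rule has_vector_derivative_cong_ev)
      (use assms(2) eventually_nhds_x_imp_x[OF assms(2)] in \<open>auto elim: eventually_mono\<close>)
  with assms(1) show ?thesis by simp
qed

lemma C1_at_cong:
  assumes "C1_at f t" "\<forall>\<^sub>F s in nhds t. f s = g s"
  shows "C1_at g t"
proof (rule C1_at_I)
  show "\<forall>\<^sub>F s in nhds t. isCont (\<lambda>s. vector_derivative f (at s)) s"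
    by (rule C1_at_eventually[OF assms(1)])
  show "\<forall>\<^sub>F s in nhds t. (g has_vector_derivative vector_derivative f (at s)) (at s)"
    using C1_at_eventually(1)[OF assms(1)] eventually_nhds_shrink[OF assms(2)]
  proof eventually_elim
    case (elim s)
    then show ?case by (rule has_vector_derivative_eventually_eq)
  qed
qed

text \<open>The factor \<open>max 0 (min 1 (1 - b + Re s))\<close> falls from 1 to 0 as Re s goes
  from b to b - 1, which keeps the map continuous and sends everything farther left to the real
  point b. A mere projection onto Re s >= b would end at an uncontrolled height and would turn every
  excursion to the left into length on the line Re s = b.\<close>

definition clamp_left :: "real \<Rightarrow> complex \<Rightarrow> complex" where
  "clamp_left b s = Complex (max b (Re s)) (Im s * max 0 (min 1 (1 - b + Re s)))"

lemma clamp_left_right: "b \<le> Re s \<Longrightarrow> clamp_left b s = s"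
  by (simp add: clamp_left_def)

lemma clamp_left_left: "Re s \<le> b - 1 \<Longrightarrow> clamp_left b s = of_real b"
  by (simp add: clamp_left_def complex_eq_iff)

lemma clamp_left_strip:
  "b - 1 \<le> Re s \<Longrightarrow> Re s \<le> b \<Longrightarrow> clamp_left b s = of_real b + \<i> * of_real (Im s * (1 - b + Re s))"
  by (simp add: clamp_left_def complex_eq_iff)

lemma continuous_on_clamp_left [continuous_intros]:
  "continuous_on S f \<Longrightarrow> continuous_on S (\<lambda>t. clamp_left b (f t))"
  unfolding clamp_left_def by (intro continuous_intros)

lemma Re_clamp_left [simp]: "Re (clamp_left b s) = max b (Re s)"
  by (simp add: clamp_left_def)

lemma Im_clamp_left_bounds:
  assumes "0 \<le> Im s" shows "0 \<le> Im (clamp_left b s)" "Im (clamp_left b s) \<le> Im s"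
  using assms by (auto simp: clamp_left_def intro!: mult_left_le)

locale descending_contour =
  fixes \<gamma> :: "real \<Rightarrow> complex" and T :: real
  assumes T_pos: "0 < T"
    and adm: "admissible_contour \<gamma>"
    and start: "\<gamma> 0 = 1"
    and Re_lim: "filterlim (\<lambda>t. Re (\<gamma> t)) at_bot at_top"
    and region: "\<gamma> ` {0..} \<subseteq> R_quarter T"
begin

lemma gamma_cont: "continuous_on {0..} \<gamma>"
  using adm by (simp add: admissible_contour_def)

lemma gamma_region: "0 \<le> t \<Longrightarrow> Re (\<gamma> t) \<le> 1" "0 \<le> t \<Longrightarrow> 0 \<le> Im (\<gamma> t)" "0 \<le> t \<Longrightarrow> Im (\<gamma> t) \<le> T / 4"
  using region by (auto simp: R_quarter_def image_subset_iff)

definition strip :: "real \<Rightarrow> real set" where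
  "strip b = {t. 0 \<le> t \<and> b \<le> Re (\<gamma> t) \<and> Re (\<gamma> t) \<le> b + 1}"

definition arcs_of :: "real \<Rightarrow> real \<Rightarrow> (real \<times> real) set \<Rightarrow> bool" where
  "arcs_of L b J \<longleftrightarrow> finite J \<and> strip b = (\<Union>(u, v)\<in>J. {u..v}) \<and>
     (\<forall>(u, v)\<in>J. u \<le> v \<and> smooth_arc \<gamma> u v) \<and> (\<Sum>(u, v)\<in>J. arc_length \<gamma> u v) \<le> L"

text \<open>The uniform length bound and, below, one decomposition of each strip are fixed by
  choice, so that all later estimates refer to the same arcs.\<close>

definition strip_length :: real where
  "strip_length = (SOME L. \<forall>b. \<exists>J. arcs_of L b J)"

definition arcs :: "real \<Rightarrow> (real \<times> real) set" where
  "arcs b = (SOME J. arcs_of strip_length b J)"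

lemma arcs_of_arcs: "arcs_of strip_length b (arcs b)"
proof -
  have "\<exists>L. \<forall>b. \<exists>J. arcs_of L b J"
    using adm unfolding admissible_contour_def arcs_of_def strip_def by blast
  then have "\<forall>b. \<exists>J. arcs_of strip_length b J"
    unfolding strip_length_def by (rule someI_ex)
  then show ?thesis unfolding arcs_def by (blast intro: someI_ex)
qed

lemma finite_arcs: "finite (arcs b)"
  and strip_eq: "strip b = (\<Union>(u, v)\<in>arcs b. {u..v})"
  and arcs_le: "(u, v) \<in> arcs b \<Longrightarrow> u \<le> v"
  and arcs_smooth: "(u, v) \<in> arcs b \<Longrightarrow> smooth_arc \<gamma> u v"
  and arcs_length: "(\<Sum>(u, v)\<in>arcs b. arc_length \<gamma> u v) \<le> strip_length"
  using arcs_of_arcs[of b] unfolding arcs_of_def by auto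

lemma arc_in_strip: "(u, v) \<in> arcs b \<Longrightarrow> {u..v} \<subseteq> strip b"
  using strip_eq by auto

definition ends :: "real \<Rightarrow> real set" where
  "ends b = fst ` arcs b \<union> snd ` arcs b"

lemma finite_ends: "finite (ends b)"
  by (simp add: ends_def finite_arcs)

lemma strip_interior:
  assumes "t \<in> strip b" "t \<notin> ends b"
  obtains u v where "(u, v) \<in> arcs b" "u < t" "t < v"
proof -
  obtain u v where uv: "(u, v) \<in> arcs b" "u \<le> t" "t \<le> v"
    using assms(1) strip_eq by auto
  moreover have "u \<noteq> t" "v \<noteq> t" using uv(1) assms(2) by (force simp: ends_def)+
  ultimately show ?thesis using that by (metis less_le)
qed

text \<open>Inside an arc the one-sided derivative is the ordinary one. This holds at all nearby
  parameters as well, so its continuity along the arc carries over.\<close>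

lemma smooth_arc_C1_at:
  assumes "smooth_arc \<gamma> u v" "u < t" "t < v"
  shows "C1_at \<gamma> t"
    and "vector_derivative \<gamma> (at t within {u..v}) = vector_derivative \<gamma> (at t)"
proof -
  have w: "at s within {u..v} = at s" if "u < s" "s < v" for s
    using that by (simp add: at_within_Icc_at)
  show "vector_derivative \<gamma> (at t within {u..v}) = vector_derivative \<gamma> (at t)"
    using w assms by simp
  let ?D = "\<lambda>s. vector_derivative \<gamma> (at s within {u..v})"
  have ev: "\<forall>\<^sub>F s in nhds t. s \<in> {u<..<v}"
    using assms by (intro eventually_nhds_in_open) auto
  have "continuous_on {u<..<v} ?D"
    using assms(1) by (auto simp: smooth_arc_def intro: continuous_on_subset)
  then have "isCont ?D s" if "s \<in> {u<..<v}" for s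
    using that by (simp add: continuous_on_eq_continuous_at)
  moreover have "(\<gamma> has_vector_derivative ?D s) (at s)" if "s \<in> {u<..<v}" for s
    using assms(1) that w[of s] unfolding smooth_arc_def
    by (metis greaterThanLessThan_iff atLeastAtMost_iff less_imp_le vector_derivative_works)
  ultimately show "C1_at \<gamma> t"
    by (intro C1_at_I[of _ ?D] eventually_mono[OF ev]) auto
qed

text \<open>The closed strips between consecutive integers cover the contour, so differentiability
  can fail only at the endpoints of their arcs.\<close>

definition bad :: "real set" where
  "bad = (\<Union>k::int. ends (of_int k))"

lemma countable_bad: "countable bad"
  unfolding bad_def by (intro countable_UN countableI_type) (simp add: countable_finite finite_ends)

lemma strip_cover: "0 \<le> t \<Longrightarrow> t \<in> strip (of_int \<lfloor>Re (\<gamma> t)\<rfloor>)"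
  by (simp add: strip_def)

lemma C1_at_gamma:
  assumes "0 \<le> t" "t \<notin> bad" shows "C1_at \<gamma> t"
proof -
  have "t \<notin> ends (of_int \<lfloor>Re (\<gamma> t)\<rfloor>)" using assms(2) by (auto simp: bad_def)
  from strip_interior[OF strip_cover[OF assms(1)] this] obtain u v where
    "(u, v) \<in> arcs (of_int \<lfloor>Re (\<gamma> t)\<rfloor>)" "u < t" "t < v" by metis
  then show ?thesis using smooth_arc_C1_at arcs_smooth by blast
qed

text \<open>All parameters in a strip are nonnegative, so 0 cannot be interior to an arc and must be
  an endpoint.\<close>

lemma bad_0: "0 \<in> bad"
proof (rule ccontr)
  assume "0 \<notin> bad"
  then have "0 \<notin> ends (of_int \<lfloor>Re (\<gamma> 0)\<rfloor>)" by (auto simp: bad_def)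
  from strip_interior[OF strip_cover this] obtain u v where
    "(u, v) \<in> arcs (of_int \<lfloor>Re (\<gamma> 0)\<rfloor>)" "u < 0" "0 < v" by auto
  moreover then have "u \<in> strip (of_int \<lfloor>Re (\<gamma> 0)\<rfloor>)" using arc_in_strip by fastforce
  ultimately show False by (simp add: strip_def)
qed

text \<open>On a bounded parameter interval the contour is bounded, so it meets finitely many
  integer strips, each with finitely many arcs.\<close>

lemma finite_bad_Icc: "finite (bad \<inter> {0..t})"
proof -
  have "bounded (\<gamma> ` {0..t})"
    by (intro compact_imp_bounded compact_continuous_image continuous_on_subset[OF gamma_cont]) auto
  then obtain M where M: "\<And>s. s \<in> {0..t} \<Longrightarrow> cmod (\<gamma> s) \<le> M" unfolding bounded_iff by blast
  have "bad \<inter> {0..t} \<subseteq> (\<Union>k\<in>{\<lfloor>- M\<rfloor> - 2..\<lceil>M\<rceil> + 2}. ends (of_int k))"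
  proof
    fix s assume s: "s \<in> bad \<inter> {0..t}"
    then obtain k :: int where k: "s \<in> ends (of_int k)" by (auto simp: bad_def)
    then have "s \<in> strip (of_int k)"
      using arc_in_strip arcs_le by (fastforce simp: ends_def)
    moreover have "\<bar>Re (\<gamma> s)\<bar> \<le> M" using M[of s] s abs_Re_le_cmod[of "\<gamma> s"] by auto
    ultimately have "real_of_int k \<le> M" "- M \<le> real_of_int k + 1" by (auto simp: strip_def)
    then have "k \<in> {\<lfloor>- M\<rfloor> - 2..\<lceil>M\<rceil> + 2}" by simp linarith
    then show "s \<in> (\<Union>k\<in>{\<lfloor>- M\<rfloor> - 2..\<lceil>M\<rceil> + 2}. ends (of_int k))" using k by auto
  qed
  then show ?thesis by (rule finite_subset) (auto simp: finite_ends)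
qed

text \<open>\<open>clamped b\<close> stops the contour at the line \<open>Re s = b\<close>, where it ends at the real point \<open>b\<close>.
  Excursions beyond \<open>Re s = b - 1\<close> are collapsed, so only the arcs in one strip of width \<open>1\<close>
  contribute to the part of \<open>clamped b\<close> on that line.\<close>

definition clamped :: "real \<Rightarrow> real \<Rightarrow> complex" where
  "clamped b t = clamp_left b (\<gamma> t)"

text \<open>\<open>b\<close> need not be an integer, so the strip between \<open>b - 1\<close> and
  \<open>b\<close>, where clamping bends the contour, brings its own arc endpoints.\<close>

definition bad_at :: "real \<Rightarrow> real set" where
  "bad_at b = bad \<union> ends (b - 1)"

lemma finite_bad_at_Icc: "finite (bad_at b \<inter> {0..t})"
  using finite_bad_Icc[of t] finite_ends[of "b - 1"] by (simp add: bad_at_def Int_Un_distrib2)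

text \<open>The strip is tested first because it contains the boundary case Re (\<gamma> t) = b. In
  the interior of one of its arcs such a \<open>t\<close> maximises Re \<gamma> locally, so Re v = 0
  and the strip formula gives v as well.\<close>

definition clamped_deriv :: "real \<Rightarrow> real \<Rightarrow> complex" where
  "clamped_deriv b t =
     (let v = vector_derivative \<gamma> (at t) in
      if t \<in> strip (b - 1) then \<i> * of_real (Im v * (1 - b + Re (\<gamma> t)) + Im (\<gamma> t) * Re v)
      else if b \<le> Re (\<gamma> t) then v else 0)"

lemma clamped_C1:
  assumes "0 \<le> t" "t \<notin> bad_at b"
  shows "(clamped b has_vector_derivative clamped_deriv b t) (at t)" "C1_at (clamped b) t"
proof -
  have C1: "C1_at \<gamma> t" using assms C1_at_gamma by (auto simp: bad_at_def)
  note ev = C1_at_eventually[OF C1]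
  have t: "t > 0" using assms bad_0 by (cases "t = 0") (auto simp: bad_at_def)
  have cont: "isCont \<gamma> t"
    using C1_at_imp_differentiable[OF C1] differentiable_imp_continuous_within by blast
  have tend: "(\<gamma> \<longlongrightarrow> \<gamma> t) (nhds t)"
    using cont by (simp add: isCont_def tendsto_at_iff_tendsto_nhds)
  have "(clamped b has_vector_derivative clamped_deriv b t) (at t) \<and> C1_at (clamped b) t"
  proof (cases "t \<in> strip (b - 1)")
    case True
    moreover have "t \<notin> ends (b - 1)" using assms by (auto simp: bad_at_def)
    ultimately obtain u v where uv: "(u, v) \<in> arcs (b - 1)" "u < t" "t < v"
      by (rule strip_interior)
    \<comment> \<open>The whole arc around \<open>t\<close> stays in the closed strip, so near
      \<open>t\<close> the clamped path is this smooth function, even if Re (\<gamma> t) equals b or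
      b - 1.\<close>
    define f where "f = (\<lambda>s. of_real b + \<i> * of_real (Im (\<gamma> s) * (1 - b + Re (\<gamma> s))))"
    define D where "D = (\<lambda>s. let w = vector_derivative \<gamma> (at s) in
        \<i> * of_real (Im w * (1 - b + Re (\<gamma> s)) + Im (\<gamma> s) * Re w))"
    have eq: "\<forall>\<^sub>F s in nhds t. f s = clamped b s"
    proof (rule eventually_mono)
      show "\<forall>\<^sub>F s in nhds t. s \<in> {u<..<v}" using uv by (intro eventually_nhds_in_open) auto
      show "f s = clamped b s" if "s \<in> {u<..<v}" for s
      proof -
        have "s \<in> strip (b - 1)" using that arc_in_strip[OF uv(1)] by auto
        then show ?thesis
          using clamp_left_strip[of b "\<gamma> s"] by (simp add: f_def clamped_def strip_def)
      qed
    qed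
    have fD: "(f has_vector_derivative D s) (at s)"
      if "(\<gamma> has_vector_derivative vector_derivative \<gamma> (at s)) (at s)" for s
    proof -
      have 1: "((\<lambda>s. Re (\<gamma> s)) has_real_derivative Re (vector_derivative \<gamma> (at s))) (at s)"
        and 2: "((\<lambda>s. Im (\<gamma> s)) has_real_derivative Im (vector_derivative \<gamma> (at s))) (at s)"
        using bounded_linear.has_vector_derivative[OF bounded_linear_Re that]
          bounded_linear.has_vector_derivative[OF bounded_linear_Im that]
        by (simp_all add: has_real_derivative_iff_has_vector_derivative)
      have "((\<lambda>s. Im (\<gamma> s) * (1 - b + Re (\<gamma> s))) has_real_derivative
          (Im (vector_derivative \<gamma> (at s)) * (1 - b + Re (\<gamma> s)) + Im (\<gamma> s) * Re (vector_derivative \<gamma> (at s)))) (at s)"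
        using DERIV_mult[OF 2 DERIV_add[OF DERIV_const[of "1 - b"] 1]] by (simp add: algebra_simps)
      then have 3: "((\<lambda>s. of_real (Im (\<gamma> s) * (1 - b + Re (\<gamma> s))) :: complex) has_vector_derivative
          of_real (Im (vector_derivative \<gamma> (at s)) * (1 - b + Re (\<gamma> s)) + Im (\<gamma> s) * Re (vector_derivative \<gamma> (at s)))) (at s)"
        by (rule has_vector_derivative_of_real)
      have "(f has_vector_derivative 0 + D s) (at s)" unfolding f_def D_def Let_def
        by (intro has_vector_derivative_add has_vector_derivative_const has_vector_derivative_mult_right 3)
      then show ?thesis by simp
    qed
    have "\<forall>\<^sub>F s in nhds t. (f has_vector_derivative D s) (at s)"
      by (rule eventually_mono[OF ev(1) fD])
    moreover have "\<forall>\<^sub>F s in nhds t. isCont D s"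
      using ev
    proof eventually_elim
      case (elim s)
      have "isCont \<gamma> s" using elim(1) has_vector_derivative_continuous by blast
      then show ?case unfolding D_def Let_def using elim(2) by (intro continuous_intros) auto
    qed
    ultimately have Cf: "C1_at f t" by (rule C1_at_I)
    have "(f has_vector_derivative D t) (at t)"
      using fD eventually_nhds_x_imp_x[OF ev(1)] by blast
    from has_vector_derivative_eventually_eq[OF this eq]
    have "(clamped b has_vector_derivative D t) (at t)" .
    moreover have "D t = clamped_deriv b t" using True by (simp add: D_def clamped_deriv_def)
    ultimately show ?thesis using C1_at_cong[OF Cf eq] by simp
  next
    case False
    \<comment> \<open>Off the closed strip, clamping is locally the identity on the right and
      constant on the left.\<close>
    then consider "Re (\<gamma> t) > b" | "Re (\<gamma> t) < b - 1" using assms by (auto simp: strip_def)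
    then show ?thesis
    proof cases
      case 1
      have "\<forall>\<^sub>F s in nhds t. Re (\<gamma> s) > b"
        using order_tendstoD(1)[OF tendsto_Re[OF tend] 1] .
      then have eq: "\<forall>\<^sub>F s in nhds t. \<gamma> s = clamped b s"
        by eventually_elim (simp add: clamped_def clamp_left_right)
      have "(\<gamma> has_vector_derivative vector_derivative \<gamma> (at t)) (at t)"
        using eventually_nhds_x_imp_x[OF ev(1)] .
      from has_vector_derivative_eventually_eq[OF this eq]
      have "(clamped b has_vector_derivative vector_derivative \<gamma> (at t)) (at t)" .
      then show ?thesis using 1 False C1_at_cong[OF C1 eq] by (simp add: clamped_deriv_def Let_def)
    next
      case 2
      have "\<forall>\<^sub>F s in nhds t. Re (\<gamma> s) < b - 1"
        using order_tendstoD(2)[OF tendsto_Re[OF tend] 2] .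
      then have eq: "\<forall>\<^sub>F s in nhds t. of_real b = clamped b s"
        by eventually_elim (simp add: clamped_def clamp_left_left)
      have "((\<lambda>s. of_real b :: complex) has_vector_derivative 0) (at t)" by simp
      from has_vector_derivative_eventually_eq[OF this eq]
      have "(clamped b has_vector_derivative 0) (at t)" .
      moreover have "C1_at (\<lambda>s. of_real b) t"
        by (rule C1_at_I[of _ "\<lambda>s. 0"]) auto
      ultimately show ?thesis using 2 False C1_at_cong[OF _ eq] by (simp add: clamped_deriv_def Let_def)
    qed
  qed
  then show "(clamped b has_vector_derivative clamped_deriv b t) (at t)" "C1_at (clamped b) t" by auto
qed

text \<open>In the strip the clamped path is vertical with height Im \<gamma> (1 - b + Re \<gamma>).
  In the product rule the second factor is at most 1 and Im \<gamma> is at most T/4.\<close>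

lemma norm_clamped_deriv_le:
  assumes "t \<in> strip (b - 1)"
  shows "cmod (clamped_deriv b t) \<le> (1 + T / 4) * cmod (vector_derivative \<gamma> (at t))"
proof -
  define v where "v = vector_derivative \<gamma> (at t)"
  have t: "0 \<le> t" "0 \<le> 1 - b + Re (\<gamma> t)" "1 - b + Re (\<gamma> t) \<le> 1" using assms by (auto simp: strip_def)
  have "cmod (clamped_deriv b t) = \<bar>Im v * (1 - b + Re (\<gamma> t)) + Im (\<gamma> t) * Re v\<bar>"
    using assms by (simp only: clamped_deriv_def v_def Let_def norm_mult if_True norm_ii mult_1_left norm_of_real)
  also have "\<dots> \<le> \<bar>Im v\<bar> * \<bar>1 - b + Re (\<gamma> t)\<bar> + \<bar>Im (\<gamma> t)\<bar> * \<bar>Re v\<bar>"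
    by (metis abs_mult abs_triangle_ineq)
  also have "\<dots> \<le> cmod v * 1 + (T / 4) * cmod v"
    using t gamma_region[of t] abs_Im_le_cmod[of v] abs_Re_le_cmod[of v]
    by (intro add_mono mult_mono) auto
  finally show ?thesis by (simp add: v_def algebra_simps)
qed

text \<open>\<open>te\<close> is meant to be a parameter from which on the contour stays left of
  \<open>b - 1\<close>. The clamped contour then rests at b, so restricting to [0, te] and rescaling
  to [0, 1] loses nothing.\<close>

definition cpath :: "real \<Rightarrow> real \<Rightarrow> real \<Rightarrow> complex" where
  "cpath b te u = clamped b (te * u)"

lemma clamped_cont: "continuous_on {0..} (clamped b)"
  unfolding clamped_def by (intro continuous_intros gamma_cont)

lemma path_cpath: "0 \<le> te \<Longrightarrow> path (cpath b te)"
  unfolding path_def cpath_def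
  by (rule continuous_on_compose2[OF clamped_cont]) (auto intro!: continuous_intros)

lemma valid_path_cpath:
  assumes "0 < te" shows "valid_path (cpath b te)"
  unfolding valid_path_def piecewise_C1_differentiable_on_def
proof (intro conjI exI)
  show "continuous_on {0..1} (cpath b te)" using path_cpath[of te b] assms by (simp add: path_def)
  show "finite ((\<lambda>t. t / te) ` (bad_at b \<inter> {0..te}))" by (simp add: finite_bad_at_Icc)
  show "cpath b te C1_differentiable_on {0..1} - (\<lambda>t. t / te) ` (bad_at b \<inter> {0..te})"
  proof (rule C1_at_imp_C1_differentiable_on)
    fix u assume u: "u \<in> {0..1} - (\<lambda>t. t / te) ` (bad_at b \<inter> {0..te})"
    have "te * u \<notin> bad_at b"
    proof
      assume "te * u \<in> bad_at b"
      then have "te * u \<in> bad_at b \<inter> {0..te}" using u assms by (auto simp: mult_le_cancel_left1)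
      then have "(te * u) / te \<in> (\<lambda>t. t / te) ` (bad_at b \<inter> {0..te})" by (rule imageI)
      then show False using u assms by simp
    qed
    then have "C1_at (clamped b) (te * u)" using u assms by (intro clamped_C1) auto
    note ev = C1_at_eventually[OF this]
    have fl: "filterlim (\<lambda>u. te * u) (nhds (te * u)) (nhds u)"
      by (intro tendsto_intros filterlim_ident)
    show "C1_at (cpath b te) u"
    proof (rule C1_at_I)
      show "\<forall>\<^sub>F s in nhds u. (cpath b te has_vector_derivative te *\<^sub>R vector_derivative (clamped b) (at (te * s))) (at s)"
        using eventually_compose_filterlim[OF ev(1) fl]
      proof eventually_elim
        case (elim s)
        have "((\<lambda>s. te * s) has_vector_derivative te) (at s)"
          by (auto intro!: derivative_eq_intros)
        from vector_diff_chain_at[OF this elim] show ?case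
          by (simp add: cpath_def[abs_def] o_def)
      qed
      show "\<forall>\<^sub>F s in nhds u. isCont (\<lambda>s. te *\<^sub>R vector_derivative (clamped b) (at (te * s))) s"
        using eventually_compose_filterlim[OF ev(2) fl]
        by eventually_elim (intro continuous_intros isCont_o2[where f = "\<lambda>s. te * s"], auto intro!: continuous_intros)
    qed
  qed
qed

end

section \<open>Integrability along the contour and the error of clamping\<close>

context descending_contour
begin

definition speed :: "real \<Rightarrow> real" where
  "speed t = cmod (vector_derivative \<gamma> (at t))"

lemma speed_nonneg [simp]: "0 \<le> speed t"
  by (simp add: speed_def)

lemma arc_cont:
  assumes "(u, v) \<in> arcs c"
  shows "continuous_on {u..v} (\<lambda>t. cmod (vector_derivative \<gamma> (at t within {u..v})))"
  using arcs_smooth[OF assms] by (intro continuous_on_norm) (simp add: smooth_arc_def)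

lemma arc_length_nonneg: "(u, v) \<in> arcs c \<Longrightarrow> 0 \<le> arc_length \<gamma> u v"
  unfolding arc_length_def
  by (intro Henstock_Kurzweil_Integration.integral_nonneg integrable_continuous_real arc_cont) auto

lemma strip_length_nonneg: "0 \<le> strip_length"
proof -
  have "0 \<le> (\<Sum>(u, v)\<in>arcs 0. arc_length \<gamma> u v)"
    by (intro sum_nonneg) (auto intro: arc_length_nonneg)
  also have "\<dots> \<le> strip_length" by (rule arcs_length)
  finally show ?thesis .
qed

text \<open>Arcs of one strip may overlap, so the speed is only bounded by this sum; its integral is
  the total arc length, at most \<open>strip_length\<close>.\<close>

definition majorant :: "real \<Rightarrow> real \<Rightarrow> ennreal" where
  "majorant c t = (\<Sum>(u, v)\<in>arcs c. ennreal (cmod (vector_derivative \<gamma> (at t within {u..v}))) * indicator {u..v} t)"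

lemma majorant_measurable: "majorant c \<in> borel_measurable lborel"
  unfolding majorant_def
proof (intro borel_measurable_sum, clarify)
  fix u v assume p: "(u, v) \<in> arcs c"
  let ?h = "\<lambda>t. cmod (vector_derivative \<gamma> (at t within {u..v}))"
  have "(\<lambda>t. indicator {u..v} t *\<^sub>R ?h t) \<in> borel_measurable borel"
    by (intro borel_measurable_continuous_on_indicator arc_cont[OF p]) auto
  then have "(\<lambda>t. ennreal (indicator {u..v} t *\<^sub>R ?h t)) \<in> borel_measurable lborel" by simp
  also have "(\<lambda>t. ennreal (indicator {u..v} t *\<^sub>R ?h t)) = (\<lambda>t. ennreal (?h t) * indicator {u..v} t)"
    by (auto simp: fun_eq_iff indicator_def)
  finally show "(\<lambda>t. ennreal (?h t) * indicator {u..v} t) \<in> borel_measurable lborel" .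
qed

lemma majorant_integral: "(\<integral>\<^sup>+t. majorant c t \<partial>lborel) \<le> ennreal strip_length"
proof -
  let ?h = "\<lambda>u v t. cmod (vector_derivative \<gamma> (at t within {u..v}))"
  have m: "(\<lambda>t. ennreal (?h u v t) * indicator {u..v} t) \<in> borel_measurable lborel"
    if p: "(u, v) \<in> arcs c" for u v
  proof -
    have "(\<lambda>t. indicator {u..v} t *\<^sub>R ?h u v t) \<in> borel_measurable borel"
      by (intro borel_measurable_continuous_on_indicator arc_cont[OF p]) auto
    then have "(\<lambda>t. ennreal (indicator {u..v} t *\<^sub>R ?h u v t)) \<in> borel_measurable lborel" by simp
    also have "(\<lambda>t. ennreal (indicator {u..v} t *\<^sub>R ?h u v t)) = (\<lambda>t. ennreal (?h u v t) * indicator {u..v} t)"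
      by (auto simp: fun_eq_iff indicator_def)
    finally show ?thesis .
  qed
  have "(\<integral>\<^sup>+t. majorant c t \<partial>lborel)
      = (\<Sum>p\<in>arcs c. \<integral>\<^sup>+t. (case p of (u, v) \<Rightarrow> ennreal (?h u v t) * indicator {u..v} t) \<partial>lborel)"
    unfolding majorant_def by (intro nn_integral_sum) (use m in auto)
  also have "\<dots> = (\<Sum>(u, v)\<in>arcs c. ennreal (arc_length \<gamma> u v))"
  proof (rule sum.cong[OF refl], clarify)
    fix u v assume p: "(u, v) \<in> arcs c"
    have "(?h u v has_integral arc_length \<gamma> u v) {u..v}"
      unfolding arc_length_def by (intro integrable_integral integrable_continuous_real arc_cont[OF p])
    then show "(\<integral>\<^sup>+t. ennreal (?h u v t) * indicator {u..v} t \<partial>lborel) = ennreal (arc_length \<gamma> u v)"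
      by (intro nn_integral_has_integral_lebesgue') auto
  qed
  also have "\<dots> = ennreal (\<Sum>(u, v)\<in>arcs c. arc_length \<gamma> u v)"
    unfolding case_prod_unfold by (intro sum_ennreal) (auto intro: arc_length_nonneg)
  also have "\<dots> \<le> ennreal strip_length" by (intro ennreal_leI arcs_length)
  finally show ?thesis .
qed

lemma speed_le_majorant:
  assumes "t \<in> strip c" "t \<notin> ends c"
  shows "ennreal (speed t) \<le> majorant c t"
proof -
  obtain u v where uv: "(u, v) \<in> arcs c" "u < t" "t < v"
    using strip_interior[OF assms] by blast
  have "ennreal (speed t) = (case (u, v) of (u, v) \<Rightarrow>
      ennreal (cmod (vector_derivative \<gamma> (at t within {u..v}))) * indicator {u..v} t)"
    using smooth_arc_C1_at(2)[OF arcs_smooth[OF uv(1)] uv(2,3)] uv by (simp add: speed_def)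
  also have "\<dots> \<le> majorant c t"
    unfolding majorant_def by (rule member_le_sum[OF uv(1) _ finite_arcs]) simp
  finally show ?thesis .
qed

lemma le_majorant:
  assumes "t \<in> strip c" "t \<notin> ends c" "w \<le> M * speed t" "0 \<le> M"
  shows "ennreal w \<le> ennreal M * majorant c t"
proof -
  have "ennreal w \<le> ennreal M * ennreal (speed t)"
    using assms by (auto simp flip: ennreal_mult intro!: ennreal_leI)
  also have "\<dots> \<le> ennreal M * majorant c t"
    using assms by (intro mult_left_mono speed_le_majorant) auto
  finally show ?thesis .
qed

lemma Re_le_closed: "closed {t. 0 \<le> t \<and> Re (\<gamma> t) \<le> b}"
  and Re_ge_closed: "closed {t. 0 \<le> t \<and> b \<le> Re (\<gamma> t)}"
proof -
  have "closed ({0..} \<inter> (\<lambda>t. Re (\<gamma> t)) -` {..b})" "closed ({0..} \<inter> (\<lambda>t. Re (\<gamma> t)) -` {b..})"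
    by (intro continuous_closed_preimage continuous_intros gamma_cont; simp)+
  moreover have "{0..} \<inter> (\<lambda>t. Re (\<gamma> t)) -` {..b} = {t. 0 \<le> t \<and> Re (\<gamma> t) \<le> b}"
     "{0..} \<inter> (\<lambda>t. Re (\<gamma> t)) -` {b..} = {t. 0 \<le> t \<and> b \<le> Re (\<gamma> t)}" by auto
  ultimately show "closed {t. 0 \<le> t \<and> Re (\<gamma> t) \<le> b}" "closed {t. 0 \<le> t \<and> b \<le> Re (\<gamma> t)}" by simp_all
qed

lemma countable_bad_at: "countable (bad_at b)"
  unfolding bad_at_def using countable_bad finite_ends by (simp add: countable_finite)

lemma good_borel: "{0..} - bad \<in> sets borel" "{0..} - bad_at b \<in> sets borel"
proof -
  have "bad \<in> sets borel" "bad_at b \<in> sets borel"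
    using sets.countable[OF _ countable_bad] sets.countable[OF _ countable_bad_at] by auto
  then show "{0..} - bad \<in> sets borel" "{0..} - bad_at b \<in> sets borel" by auto
qed

lemma ends_subset_bad: "ends (of_int k) \<subseteq> bad"
  by (auto simp: bad_def)

lemma speed_cont: "continuous_on ({0..} - bad) (\<lambda>t. vector_derivative \<gamma> (at t))"
  using C1_at_imp_isCont[OF C1_at_gamma] by (intro continuous_at_imp_continuous_on) auto

lemma integrand_measurable:
  assumes "continuous_on (\<gamma> ` {0..}) f"
  shows "(\<lambda>t. indicator ({0..} - bad) t *\<^sub>R (f (\<gamma> t) * vector_derivative \<gamma> (at t))) \<in> borel_measurable lborel"
proof -
  have "continuous_on {0..} (\<lambda>t. f (\<gamma> t))"
    by (rule continuous_on_compose2[OF assms gamma_cont]) auto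
  then have "continuous_on ({0..} - bad) (\<lambda>t. f (\<gamma> t) * vector_derivative \<gamma> (at t))"
    by (intro continuous_intros speed_cont) (auto intro: continuous_on_subset)
  then show ?thesis
    using borel_measurable_continuous_on_indicator[OF good_borel(1)] by simp
qed

text \<open>The part left of b is covered by the unit strips from \<lfloor>b\<rfloor> - j to
  \<lfloor>b\<rfloor> - j + 1. Each has length at most \<open>strip_length\<close> and carries a
  weight at most B exp(c (b + 1 - j)), which gives a geometric series in exp(-c).\<close>

lemma weighted_tail:
  assumes c: "0 < c" "0 \<le> B"
    and bound: "\<And>t. 0 \<le> t \<Longrightarrow> Re (\<gamma> t) \<le> \<beta> \<Longrightarrow> cmod (f (\<gamma> t)) \<le> B * exp (c * Re (\<gamma> t))"
    and b: "b \<le> \<beta>"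
  shows "(\<integral>\<^sup>+t. ennreal (cmod (f (\<gamma> t)) * speed t) * indicator {t \<in> {0..} - bad. Re (\<gamma> t) \<le> b} t \<partial>lborel)
         \<le> ennreal (B * strip_length * exp (c * (b + 1)) / (1 - exp (- c)))"
proof -
  define C where "C = (\<lambda>j::nat. B * exp (c * (b + 1 - real j)))"
  define m where "m = (\<lambda>j::nat. majorant (of_int (\<lfloor>b\<rfloor> - int j)))"
  have C0: "0 \<le> C j" for j using c by (simp add: C_def)
  have mm: "m j \<in> borel_measurable lborel" for j
    unfolding m_def by (rule majorant_measurable)
  have "(\<integral>\<^sup>+t. ennreal (cmod (f (\<gamma> t)) * speed t) * indicator {t \<in> {0..} - bad. Re (\<gamma> t) \<le> b} t \<partial>lborel)
     \<le> (\<integral>\<^sup>+t. (\<Sum>j. ennreal (C j) * m j t) \<partial>lborel)"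
  proof (rule nn_integral_mono)
    fix t
    show "ennreal (cmod (f (\<gamma> t)) * speed t) * indicator {t \<in> {0..} - bad. Re (\<gamma> t) \<le> b} t
        \<le> (\<Sum>j. ennreal (C j) * m j t)"
    proof (cases "t \<in> {t \<in> {0..} - bad. Re (\<gamma> t) \<le> b}")
      case True
      define j where "j = nat (\<lfloor>b\<rfloor> - \<lfloor>Re (\<gamma> t)\<rfloor>)"
      have fl: "\<lfloor>Re (\<gamma> t)\<rfloor> \<le> \<lfloor>b\<rfloor>" using True by (intro floor_mono) auto
      then have j: "of_int (\<lfloor>b\<rfloor> - int j) = (of_int \<lfloor>Re (\<gamma> t)\<rfloor> :: real)" by (simp add: j_def)
      have "Re (\<gamma> t) \<le> b + 1 - real j" using fl by (simp add: j_def) linarith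
      then have "exp (c * Re (\<gamma> t)) \<le> exp (c * (b + 1 - real j))" using c by simp
      then have "cmod (f (\<gamma> t)) \<le> C j"
        unfolding C_def using bound[of t] True b mult_left_mono[OF _ c(2)]
        by (intro order_trans[OF bound]) auto
      then have "ennreal (cmod (f (\<gamma> t)) * speed t) \<le> ennreal (C j) * m j t"
        unfolding m_def j using True strip_cover[of t] ends_subset_bad C0
        by (intro le_majorant mult_right_mono) auto
      also have "\<dots> = (\<Sum>i\<in>{j}. ennreal (C i) * m i t)" by simp
      also have "\<dots> \<le> (\<Sum>j. ennreal (C j) * m j t)"
        by (intro sum_le_suminf) auto
      finally show ?thesis using True by simp
    qed simp
  qed
  also have "\<dots> = (\<Sum>j. ennreal (C j) * (\<integral>\<^sup>+t. m j t \<partial>lborel))"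
    using mm by (simp add: nn_integral_suminf nn_integral_cmult)
  also have "\<dots> \<le> (\<Sum>j. ennreal (C j * strip_length))"
  proof (intro suminf_le)
    fix j
    have "ennreal (C j) * (\<integral>\<^sup>+t. m j t \<partial>lborel) \<le> ennreal (C j) * ennreal strip_length"
      unfolding m_def by (intro mult_left_mono majorant_integral) auto
    then show "ennreal (C j) * (\<integral>\<^sup>+t. m j t \<partial>lborel) \<le> ennreal (C j * strip_length)"
      using C0 strip_length_nonneg by (simp add: ennreal_mult)
  qed auto
  also have "(\<lambda>j. C j * strip_length) = (\<lambda>j. B * exp (c * (b + 1)) * strip_length * exp (- c) ^ j)"
  proof
    fix j
    have "exp (c * (b + 1 - real j)) = exp (c * (b + 1)) * exp (- c) ^ j"
      by (simp add: exp_of_nat_mult[symmetric] exp_add[symmetric] algebra_simps)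
    then show "C j * strip_length = B * exp (c * (b + 1)) * strip_length * exp (- c) ^ j"
      by (simp add: C_def)
  qed
  also have "(\<Sum>j. ennreal (B * exp (c * (b + 1)) * strip_length * exp (- c) ^ j))
      = ennreal (\<Sum>j. B * exp (c * (b + 1)) * strip_length * exp (- c) ^ j)"
    using c strip_length_nonneg by (intro suminf_ennreal2 summable_mult summable_geometric) auto
  also have "(\<Sum>j. B * exp (c * (b + 1)) * strip_length * exp (- c) ^ j)
      = B * strip_length * exp (c * (b + 1)) / (1 - exp (- c))"
    using c by (simp add: suminf_mult suminf_geometric summable_geometric)
  finally show ?thesis .
qed

lemma Re_ge_bounded: obtains t0 where "t0 > 0" "\<And>t. t0 \<le> t \<Longrightarrow> Re (\<gamma> t) < \<beta>"
proof -
  have "\<forall>\<^sub>F t in at_top. Re (\<gamma> t) < \<beta>"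
    using Re_lim by (auto simp: filterlim_at_bot_dense)
  then obtain N where "\<And>t. N \<le> t \<Longrightarrow> Re (\<gamma> t) < \<beta>" by (auto simp: eventually_at_top_linorder)
  then show ?thesis by (intro that[of "max N 1"]) auto
qed

lemma compact_Re_ge: "compact {t. 0 \<le> t \<and> \<beta> \<le> Re (\<gamma> t)}"
proof -
  obtain t0 where t0: "\<And>t. t0 \<le> t \<Longrightarrow> Re (\<gamma> t) < \<beta>" using Re_ge_bounded[of \<beta>] by blast
  have "t \<le> t0" if "\<beta> \<le> Re (\<gamma> t)" for t
  proof (rule ccontr)
    assume "\<not> t \<le> t0"
    then show False using t0[of t] that by simp
  qed
  then have "{t. 0 \<le> t \<and> \<beta> \<le> Re (\<gamma> t)} \<subseteq> {0..t0}" by auto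
  then show ?thesis
    using Re_ge_closed bounded_subset[OF bounded_closed_interval] compact_eq_bounded_closed by blast
qed

text \<open>As Re \<gamma> <= 1, the finitely many unit strips starting at the integers from
  \<lfloor>\<beta>\<rfloor> to 1 suffice, and each has bounded length.\<close>

lemma nn_integral_Re_ge:
  assumes w: "\<And>t. t \<in> {0..} - bad \<Longrightarrow> \<beta> \<le> Re (\<gamma> t) \<Longrightarrow> w t \<le> M * speed t" "0 \<le> M"
  shows "(\<integral>\<^sup>+t. ennreal (w t) * indicator {t \<in> {0..} - bad. \<beta> \<le> Re (\<gamma> t)} t \<partial>lborel) < \<infinity>"
proof -
  define I where "I = {\<lfloor>\<beta>\<rfloor>..1}"
  have "(\<integral>\<^sup>+t. ennreal (w t) * indicator {t \<in> {0..} - bad. \<beta> \<le> Re (\<gamma> t)} t \<partial>lborel)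
    \<le> (\<integral>\<^sup>+t. (\<Sum>k\<in>I. ennreal M * majorant (of_int k) t) \<partial>lborel)"
  proof (rule nn_integral_mono)
    fix t
    show "ennreal (w t) * indicator {t \<in> {0..} - bad. \<beta> \<le> Re (\<gamma> t)} t
        \<le> (\<Sum>k\<in>I. ennreal M * majorant (of_int k) t)"
    proof (cases "t \<in> {t \<in> {0..} - bad. \<beta> \<le> Re (\<gamma> t)}")
      case True
      define k where "k = \<lfloor>Re (\<gamma> t)\<rfloor>"
      have k: "k \<in> I" using True gamma_region(1)[of t] by (auto simp: I_def k_def intro!: floor_mono)
      have "t \<in> strip (of_int k)" "t \<notin> ends (of_int k)"
        using True strip_cover[of t] ends_subset_bad by (auto simp: k_def)
      then have "ennreal (w t) \<le> ennreal M * majorant (of_int k) t"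
        using w True by (intro le_majorant) auto
      also have "\<dots> \<le> (\<Sum>k\<in>I. ennreal M * majorant (of_int k) t)"
        by (rule member_le_sum[OF k]) (auto simp: I_def)
      finally show ?thesis using True by simp
    qed simp
  qed
  also have "\<dots> = (\<Sum>k\<in>I. ennreal M * (\<integral>\<^sup>+t. majorant (of_int k) t \<partial>lborel))"
  proof -
    have "majorant c \<in> borel_measurable borel" for c using majorant_measurable[of c] by simp
    then show ?thesis
      by (subst nn_integral_sum) (auto intro!: borel_measurable_times sum.cong nn_integral_cmult)
  qed
  also have "\<dots> \<le> (\<Sum>k\<in>I. ennreal M * ennreal strip_length)"
    by (intro sum_mono mult_left_mono majorant_integral) auto
  also have "\<dots> < \<infinity>"
    by (simp add: ennreal_mult_less_top I_def ennreal_of_nat_eq_real_of_nat)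
  finally show ?thesis .
qed

text \<open>The far part is controlled by \<open>weighted_tail\<close>; the parameters with Re
  (\<gamma> t) >= \<beta> form a compact set, on which f is bounded.\<close>

lemma contour_integrable:
  assumes f: "continuous_on (\<gamma> ` {0..}) f" and c: "0 < c" "0 \<le> B"
    and bound: "\<And>t. 0 \<le> t \<Longrightarrow> Re (\<gamma> t) \<le> \<beta> \<Longrightarrow> cmod (f (\<gamma> t)) \<le> B * exp (c * Re (\<gamma> t))"
  shows "integrable lborel (\<lambda>t. indicator ({0..} - bad) t *\<^sub>R (f (\<gamma> t) * vector_derivative \<gamma> (at t)))"
proof (rule integrableI_bounded[OF integrand_measurable[OF f]])
  have "compact ((\<lambda>t. f (\<gamma> t)) ` {t. 0 \<le> t \<and> \<beta> \<le> Re (\<gamma> t)})"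
    by (intro compact_continuous_image compact_Re_ge continuous_on_compose2[OF f]
        continuous_on_subset[OF gamma_cont]) auto
  from compact_imp_bounded[OF this] obtain M where "M > 0"
    "\<forall>z\<in>(\<lambda>t. f (\<gamma> t)) ` {t. 0 \<le> t \<and> \<beta> \<le> Re (\<gamma> t)}. cmod z \<le> M"
    unfolding bounded_pos by blast
  then have "M > 0" "\<And>t. 0 \<le> t \<Longrightarrow> \<beta> \<le> Re (\<gamma> t) \<Longrightarrow> cmod (f (\<gamma> t)) \<le> M" by auto
  then have fin1: "(\<integral>\<^sup>+t. ennreal (cmod (f (\<gamma> t)) * speed t) * indicator {t \<in> {0..} - bad. \<beta> \<le> Re (\<gamma> t)} t \<partial>lborel) < \<infinity>"
    by (intro nn_integral_Re_ge[of _ _ M] mult_right_mono) auto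
  have fin2: "(\<integral>\<^sup>+t. ennreal (cmod (f (\<gamma> t)) * speed t) * indicator {t \<in> {0..} - bad. Re (\<gamma> t) \<le> \<beta>} t \<partial>lborel) < \<infinity>"
    using weighted_tail[OF c bound order_refl] by (rule le_less_trans) auto
  define N where "N = (\<lambda>t. ennreal (norm (indicator ({0..} - bad) t *\<^sub>R (f (\<gamma> t) * vector_derivative \<gamma> (at t)))))"
  have Nm: "N \<in> borel_measurable lborel"
    unfolding N_def using integrand_measurable[OF f] by measurable
  have S: "{t. 0 \<le> t \<and> b \<le> Re (\<gamma> t)} \<in> sets lborel" "{t. 0 \<le> t \<and> Re (\<gamma> t) \<le> b} \<in> sets lborel" for b
    using Re_ge_closed Re_le_closed by (auto intro: borel_closed)
  have "(\<integral>\<^sup>+t. N t \<partial>lborel) \<le> (\<integral>\<^sup>+t. N t * indicator {t. 0 \<le> t \<and> \<beta> \<le> Re (\<gamma> t)} t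
       + N t * indicator {t. 0 \<le> t \<and> Re (\<gamma> t) \<le> \<beta>} t \<partial>lborel)"
    by (intro nn_integral_mono) (auto simp: N_def indicator_def)
  also have "\<dots> = (\<integral>\<^sup>+t. N t * indicator {t. 0 \<le> t \<and> \<beta> \<le> Re (\<gamma> t)} t \<partial>lborel)
       + (\<integral>\<^sup>+t. N t * indicator {t. 0 \<le> t \<and> Re (\<gamma> t) \<le> \<beta>} t \<partial>lborel)"
    using Nm S by (intro nn_integral_add borel_measurable_times borel_measurable_indicator) auto
  also have "(\<lambda>t. N t * indicator {t. 0 \<le> t \<and> \<beta> \<le> Re (\<gamma> t)} t)
      = (\<lambda>t. ennreal (cmod (f (\<gamma> t)) * speed t) * indicator {t \<in> {0..} - bad. \<beta> \<le> Re (\<gamma> t)} t)"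
    by (auto simp: fun_eq_iff N_def indicator_def norm_mult speed_def)
  also have "(\<lambda>t. N t * indicator {t. 0 \<le> t \<and> Re (\<gamma> t) \<le> \<beta>} t)
      = (\<lambda>t. ennreal (cmod (f (\<gamma> t)) * speed t) * indicator {t \<in> {0..} - bad. Re (\<gamma> t) \<le> \<beta>} t)"
    by (auto simp: fun_eq_iff N_def indicator_def norm_mult speed_def)
  also have "(\<integral>\<^sup>+t. ennreal (cmod (f (\<gamma> t)) * speed t) * indicator {t \<in> {0..} - bad. \<beta> \<le> Re (\<gamma> t)} t \<partial>lborel)
      + (\<integral>\<^sup>+t. ennreal (cmod (f (\<gamma> t)) * speed t) * indicator {t \<in> {0..} - bad. Re (\<gamma> t) \<le> \<beta>} t \<partial>lborel) < \<infinity>"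
    using fin1 fin2 by simp
  finally show "(\<integral>\<^sup>+t. ennreal (norm (indicator ({0..} - bad) t *\<^sub>R (f (\<gamma> t) * vector_derivative \<gamma> (at t)))) \<partial>lborel) < \<infinity>"
    by (simp add: N_def)
qed

lemma negligible_countable_real: "countable (X :: real set) \<Longrightarrow> negligible X"
  by (meson countable_imp_null_set_lborel negligible_iff_null_sets null_sets_completionI)

text \<open>Countable sets are negligible, so the Lebesgue integral over the good parameters is also
  the gauge integral used in \<open>ray_contour_integral\<close>.\<close>

lemma has_integral_good:
  fixes g :: "real \<Rightarrow> complex"
  assumes "integrable lborel (\<lambda>t. indicator ({0..} - X) t *\<^sub>R g t)" "countable X"
  shows "(g has_integral (LINT t|lborel. indicator ({0..} - X) t *\<^sub>R g t)) {0..}"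
proof -
  have "((\<lambda>t. indicator ({0..} - X) t *\<^sub>R g t) has_integral (LINT t|lborel. indicator ({0..} - X) t *\<^sub>R g t)) UNIV"
    by (rule has_integral_integral_lborel[OF assms(1)])
  then have "((\<lambda>t. if t \<in> {0..} then g t else 0) has_integral (LINT t|lborel. indicator ({0..} - X) t *\<^sub>R g t)) UNIV"
    by (rule has_integral_spike[OF negligible_countable_real[OF assms(2)], rotated]) (auto simp: indicator_def)
  then show ?thesis by (simp only: has_integral_restrict_UNIV)
qed

lemma ray_contour_integral_eq:
  assumes "integrable lborel (\<lambda>t. indicator ({0..} - bad) t *\<^sub>R (f (\<gamma> t) * vector_derivative \<gamma> (at t)))"
  shows "ray_contour_integral \<gamma> f = (LINT t|lborel. indicator ({0..} - bad) t *\<^sub>R (f (\<gamma> t) * vector_derivative \<gamma> (at t)))"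
  unfolding ray_contour_integral_def
  using has_integral_good[OF assms countable_bad] by (rule integral_unique)

lemma clamped_eventually_const:
  assumes "0 < te" "\<And>t. te \<le> t \<Longrightarrow> Re (\<gamma> t) < b - 1" "te \<le> t"
  shows "clamped b t = of_real b" "clamped_deriv b t = 0"
  using assms(1) assms(2)[OF assms(3)] assms(3)
  by (auto simp: clamped_def clamp_left_left clamped_deriv_def strip_def)

lemma clamped_integrand_measurable:
  assumes "continuous_on (clamped b ` {0..}) f"
  shows "(\<lambda>t. indicator ({0..} - bad_at b) t *\<^sub>R (f (clamped b t) * clamped_deriv b t)) \<in> borel_measurable lborel"
proof -
  have "continuous_on {0..} (\<lambda>t. f (clamped b t))"
    by (rule continuous_on_compose2[OF assms clamped_cont]) auto
  moreover have "continuous_on ({0..} - bad_at b) (\<lambda>t. vector_derivative (clamped b) (at t))"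
    using C1_at_imp_isCont[OF clamped_C1(2)] by (intro continuous_at_imp_continuous_on) auto
  then have "continuous_on ({0..} - bad_at b) (clamped_deriv b)"
    by (rule continuous_on_eq) (auto intro!: vector_derivative_at clamped_C1(1))
  ultimately have "continuous_on ({0..} - bad_at b) (\<lambda>t. f (clamped b t) * clamped_deriv b t)"
    by (intro continuous_intros) (auto intro: continuous_on_subset)
  then show ?thesis
    using borel_measurable_continuous_on_indicator[OF good_borel(2)] by simp
qed

lemma norm_clamped_deriv_cases:
  assumes "t \<in> {0..} - bad_at b"
  shows "Re (\<gamma> t) < b - 1 \<and> clamped_deriv b t = 0 \<or>
    b - 1 \<le> Re (\<gamma> t) \<and> Re (\<gamma> t) \<le> b \<and> t \<in> strip (b - 1) \<and> cmod (clamped_deriv b t) \<le> (1 + T / 4) * speed t \<or>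
    b < Re (\<gamma> t) \<and> clamped_deriv b t = vector_derivative \<gamma> (at t) \<and> clamped b t = \<gamma> t"
proof -
  consider "Re (\<gamma> t) < b - 1" | "t \<in> strip (b - 1)" | "b < Re (\<gamma> t)"
    using assms by (fastforce simp: strip_def)
  then show ?thesis
  proof cases
    case 1 then show ?thesis by (auto simp: clamped_deriv_def strip_def)
  next
    case 2 then show ?thesis using norm_clamped_deriv_le[OF 2] by (auto simp: strip_def speed_def)
  next
    case 3 then show ?thesis by (auto simp: clamped_deriv_def strip_def clamped_def clamp_left_right)
  qed
qed

lemma clamped_integrable:
  assumes f: "continuous_on (clamped b ` {0..}) f"
    and te: "0 < te" "\<And>t. te \<le> t \<Longrightarrow> Re (\<gamma> t) < b - 1"
  shows "integrable lborel (\<lambda>t. indicator ({0..} - bad_at b) t *\<^sub>R (f (clamped b t) * clamped_deriv b t))"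
proof (rule integrableI_bounded[OF clamped_integrand_measurable[OF f]])
  have "compact ((\<lambda>t. f (clamped b t)) ` {0..te})"
    by (intro compact_continuous_image continuous_on_compose2[OF f]
        continuous_on_subset[OF clamped_cont]) auto
  from compact_imp_bounded[OF this] obtain M where M: "M > 0"
    "\<forall>z\<in>(\<lambda>t. f (clamped b t)) ` {0..te}. cmod z \<le> M"
    unfolding bounded_pos by blast
  have Mt: "cmod (f (clamped b t)) \<le> M" if "0 \<le> t" for t
  proof (cases "t \<le> te")
    case False
    then have "clamped b t = clamped b te"
      using clamped_eventually_const(1)[OF te] by simp
    then show ?thesis using M te by auto
  qed (use M that in auto)
  define w where "w = (\<lambda>t. if t \<in> bad_at b then 0 else cmod (f (clamped b t) * clamped_deriv b t))"
  have "(\<integral>\<^sup>+t. ennreal (norm (indicator ({0..} - bad_at b) t *\<^sub>R (f (clamped b t) * clamped_deriv b t))) \<partial>lborel)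
     \<le> (\<integral>\<^sup>+t. ennreal (w t) * indicator {t \<in> {0..} - bad. b - 1 \<le> Re (\<gamma> t)} t \<partial>lborel)"
  proof (rule nn_integral_mono)
    fix t
    show "ennreal (norm (indicator ({0..} - bad_at b) t *\<^sub>R (f (clamped b t) * clamped_deriv b t)))
        \<le> ennreal (w t) * indicator {t \<in> {0..} - bad. b - 1 \<le> Re (\<gamma> t)} t"
      using norm_clamped_deriv_cases[of t b]
      by (cases "t \<in> {0..} - bad_at b") (auto simp: w_def bad_at_def)
  qed
  also have "\<dots> < \<infinity>"
  proof (rule nn_integral_Re_ge[of _ _ "M * (1 + T / 4)"])
    fix t assume t: "t \<in> {0..} - bad" "b - 1 \<le> Re (\<gamma> t)"
    have T4: "0 \<le> 1 + T / 4" using T_pos by simp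
    show "w t \<le> M * (1 + T / 4) * speed t"
    proof (cases "t \<in> bad_at b")
      case False
      then have "cmod (clamped_deriv b t) \<le> (1 + T / 4) * speed t"
        using norm_clamped_deriv_cases[of t b] t T_pos speed_nonneg[of t] by (auto simp: speed_def algebra_simps)
      then have "cmod (f (clamped b t)) * cmod (clamped_deriv b t) \<le> M * ((1 + T / 4) * speed t)"
        using Mt[of t] t M by (intro mult_mono) auto
      then show ?thesis using False by (simp add: w_def norm_mult mult.assoc)
    qed (use M T4 in \<open>simp add: w_def\<close>)
  qed (use M T_pos in auto)
  finally show "(\<integral>\<^sup>+t. ennreal (norm (indicator ({0..} - bad_at b) t *\<^sub>R (f (clamped b t) * clamped_deriv b t))) \<partial>lborel) < \<infinity>" .
qed

text \<open>The value does not involve \<open>te\<close>: after the contour has left the strip for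
  good, the clamped path is constant.\<close>

lemma cpath_has_contour_integral:
  assumes f: "continuous_on (clamped b ` {0..}) f"
    and te: "0 < te" "\<And>t. te \<le> t \<Longrightarrow> Re (\<gamma> t) < b - 1"
  shows "(f has_contour_integral
     (LINT t|lborel. indicator ({0..} - bad_at b) t *\<^sub>R (f (clamped b t) * clamped_deriv b t))) (cpath b te)"
proof -
  define g where "g = (\<lambda>t. f (clamped b t) * clamped_deriv b t)"
  define I where "I = (LINT t|lborel. indicator ({0..} - bad_at b) t *\<^sub>R g t)"
  have "(g has_integral I) {0..}"
    unfolding I_def g_def by (rule has_integral_good[OF clamped_integrable[OF assms] countable_bad_at])
  then have "((\<lambda>t. if t \<in> {0..te} then g t else 0) has_integral I) {0..}"
    by (rule has_integral_eq[rotated]) (auto simp: g_def clamped_eventually_const(2)[OF te])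
  then have "(g has_integral I) {0..te}"
    by (subst (asm) has_integral_restrict) auto
  from has_integral_stretch_real[OF this, of te]
  have "((\<lambda>u. g (te * u)) has_integral (1 / te) *\<^sub>R I) ((\<lambda>x. x / te) ` {0..te})"
    using te by simp
  also have "(\<lambda>x. x / te) ` {0..te} = {0..1}"
    using te(1) by (auto simp: image_iff divide_simps intro!: bexI[of _ "_ * te"])
  finally have "((\<lambda>u. te *\<^sub>R g (te * u)) has_integral te *\<^sub>R ((1 / te) *\<^sub>R I)) {0..1}"
    by (rule has_integral_cmul)
  then have "((\<lambda>u. te *\<^sub>R g (te * u)) has_integral I) {0..1}" using te by simp
  moreover have "negligible ((\<lambda>u. te * u) -` bad_at b)"
  proof (rule negligible_countable_real)
    have "(\<lambda>u. te * u) -` bad_at b \<subseteq> (\<lambda>t. t / te) ` bad_at b"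
      using te(1) by (auto simp: image_iff intro!: bexI[of _ "te * _"])
    then show "countable ((\<lambda>u. te * u) -` bad_at b)"
      by (rule countable_subset) (simp add: countable_bad_at)
  qed
  ultimately have "((\<lambda>u. f (cpath b te u) * vector_derivative (cpath b te) (at u)) has_integral I) {0..1}"
  proof (rule has_integral_spike[rotated 2])
    fix u assume u: "u \<in> {0..1} - (\<lambda>u. te * u) -` bad_at b"
    have "((\<lambda>u. te * u) has_vector_derivative te) (at u)"
      by (auto intro!: derivative_eq_intros)
    moreover have "(clamped b has_vector_derivative clamped_deriv b (te * u)) (at (te * u))"
      using u te by (intro clamped_C1(1)) auto
    ultimately have "(cpath b te has_vector_derivative te *\<^sub>R clamped_deriv b (te * u)) (at u)"
      using vector_diff_chain_at by (fastforce simp: cpath_def[abs_def] o_def)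
    then show "f (cpath b te u) * vector_derivative (cpath b te) (at u) = te *\<^sub>R g (te * u)"
      by (simp add: vector_derivative_at g_def cpath_def)
  qed
  then show ?thesis by (simp add: has_contour_integral I_def g_def)
qed

text \<open>Right of b the two integrands coincide. The difference consists of the tail of the
  contour, bounded by \<open>weighted_tail\<close>, and of the clamped part on the line Re s = b,
  whose length is at most (1 + T/4) times \<open>strip_length\<close> and on which |f| <= V.\<close>

lemma cpath_close_to_ray:
  assumes f: "continuous_on (\<gamma> ` {0..}) f" "continuous_on (clamped b ` {0..}) f"
    and te: "0 < te" "\<And>t. te \<le> t \<Longrightarrow> Re (\<gamma> t) < b - 1"
    and c: "0 < c" "0 \<le> B"
    and bound: "\<And>t. 0 \<le> t \<Longrightarrow> Re (\<gamma> t) \<le> \<beta> \<Longrightarrow> cmod (f (\<gamma> t)) \<le> B * exp (c * Re (\<gamma> t))"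
    and b: "b \<le> \<beta>"
    and V: "\<And>y. 0 \<le> y \<Longrightarrow> y \<le> T / 4 \<Longrightarrow> cmod (f (Complex b y)) \<le> V"
  shows "cmod (contour_integral (cpath b te) f - ray_contour_integral \<gamma> f)
    \<le> B * strip_length * exp (c * (b + 1)) / (1 - exp (- c)) + V * (1 + T / 4) * strip_length"
proof -
  define g where "g = (\<lambda>t. f (\<gamma> t) * vector_derivative \<gamma> (at t))"
  define h where "h = (\<lambda>t. f (clamped b t) * clamped_deriv b t)"
  let ?G = "{0..} - bad_at b"
  have V0: "0 \<le> V" using order_trans[OF norm_ge_zero V[of 0]] T_pos by simp
  have ig: "integrable lborel (\<lambda>t. indicator ({0..} - bad) t *\<^sub>R g t)"
    unfolding g_def by (rule contour_integrable[OF f(1) c bound])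
  have "integrable lborel (\<lambda>t. indicator ?G t *\<^sub>R (indicator ({0..} - bad) t *\<^sub>R g t))"
    using good_borel by (intro integrable_mult_indicator ig) auto
  also have "(\<lambda>t. indicator ?G t *\<^sub>R (indicator ({0..} - bad) t *\<^sub>R g t)) = (\<lambda>t. indicator ?G t *\<^sub>R g t)"
    by (auto simp: fun_eq_iff indicator_def bad_at_def)
  finally have ig': "integrable lborel (\<lambda>t. indicator ?G t *\<^sub>R g t)" .
  have ih: "integrable lborel (\<lambda>t. indicator ?G t *\<^sub>R h t)"
    unfolding h_def by (rule clamped_integrable[OF f(2) te])
  have iD: "integrable lborel (\<lambda>t. indicator ?G t *\<^sub>R (h t - g t))"
    using Bochner_Integration.integrable_diff[OF ih ig'] by (simp add: scaleR_diff_right)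
  have "(g has_integral ray_contour_integral \<gamma> f) {0..}"
    using has_integral_good[OF ig countable_bad] ray_contour_integral_eq[of f] ig by (simp add: g_def)
  moreover have "(h has_integral contour_integral (cpath b te) f) {0..}"
    using has_integral_good[OF ih countable_bad_at] contour_integral_unique[OF cpath_has_contour_integral[OF f(2) te]]
    by (simp add: h_def)
  ultimately have "((\<lambda>t. h t - g t) has_integral contour_integral (cpath b te) f - ray_contour_integral \<gamma> f) {0..}"
    by (intro has_integral_diff)
  with has_integral_good[OF iD countable_bad_at]
  have "contour_integral (cpath b te) f - ray_contour_integral \<gamma> f = (LINT t|lborel. indicator ?G t *\<^sub>R (h t - g t))"
    by (rule has_integral_unique[rotated])
  then have "ennreal (cmod (contour_integral (cpath b te) f - ray_contour_integral \<gamma> f))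
      \<le> (\<integral>\<^sup>+t. ennreal (norm (indicator ?G t *\<^sub>R (h t - g t))) \<partial>lborel)"
    using integral_norm_bound_ennreal[OF iD] by simp
  also have "\<dots> \<le> (\<integral>\<^sup>+t. ennreal (cmod (f (\<gamma> t)) * speed t) * indicator {t \<in> {0..} - bad. Re (\<gamma> t) \<le> b} t
      + ennreal (V * (1 + T / 4)) * majorant (b - 1) t \<partial>lborel)"
  proof (rule nn_integral_mono)
    fix t
    show "ennreal (norm (indicator ?G t *\<^sub>R (h t - g t)))
        \<le> ennreal (cmod (f (\<gamma> t)) * speed t) * indicator {t \<in> {0..} - bad. Re (\<gamma> t) \<le> b} t
        + ennreal (V * (1 + T / 4)) * majorant (b - 1) t"
    proof (cases "t \<in> ?G")
      case True
      then have good: "t \<in> {0..} - bad" "0 \<le> t" "t \<notin> ends (b - 1)" by (auto simp: bad_at_def)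
      have ng: "cmod (g t) = cmod (f (\<gamma> t)) * speed t" by (simp add: g_def norm_mult speed_def)
      from norm_clamped_deriv_cases[OF True] show ?thesis
      proof (elim disjE)
        assume "Re (\<gamma> t) < b - 1 \<and> clamped_deriv b t = 0"
        then show ?thesis using True good ng by (simp add: h_def)
      next
        assume *: "b - 1 \<le> Re (\<gamma> t) \<and> Re (\<gamma> t) \<le> b \<and> t \<in> strip (b - 1) \<and>
            cmod (clamped_deriv b t) \<le> (1 + T / 4) * speed t"
        define y where "y = Im (clamped b t)"
        have "clamped b t = Complex b y"
          using * by (simp add: y_def clamped_def complex_eq_iff)
        moreover have "0 \<le> y" "y \<le> T / 4"
          using Im_clamp_left_bounds[of "\<gamma> t" b] gamma_region[OF good(2)] by (auto simp: y_def clamped_def)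
        ultimately have "cmod (f (clamped b t)) \<le> V" using V by simp
        then have "cmod (f (clamped b t)) * cmod (clamped_deriv b t) \<le> V * ((1 + T / 4) * speed t)"
          using * V0 by (intro mult_mono) auto
        then have "cmod (h t) \<le> V * (1 + T / 4) * speed t" by (simp add: h_def norm_mult mult.assoc)
        then have hm: "ennreal (cmod (h t)) \<le> ennreal (V * (1 + T / 4)) * majorant (b - 1) t"
          using * good V0 T_pos by (intro le_majorant) auto
        have "ennreal (norm (h t - g t)) \<le> ennreal (cmod (g t) + cmod (h t))"
          by (intro ennreal_leI) (metis norm_triangle_ineq4 norm_minus_commute)
        also have "\<dots> = ennreal (cmod (g t)) + ennreal (cmod (h t))" by simp
        also have "\<dots> \<le> ennreal (cmod (g t)) + ennreal (V * (1 + T / 4)) * majorant (b - 1) t"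
          using hm by (intro add_left_mono)
        finally show ?thesis using True good * by (simp add: ng)
      next
        assume "b < Re (\<gamma> t) \<and> clamped_deriv b t = vector_derivative \<gamma> (at t) \<and> clamped b t = \<gamma> t"
        then have "h t - g t = 0" by (simp add: h_def g_def)
        then show ?thesis by simp
      qed
    qed simp
  qed
  also have "\<dots> = (\<integral>\<^sup>+t. ennreal (cmod (f (\<gamma> t)) * speed t) * indicator {t \<in> {0..} - bad. Re (\<gamma> t) \<le> b} t \<partial>lborel)
      + ennreal (V * (1 + T / 4)) * (\<integral>\<^sup>+t. majorant (b - 1) t \<partial>lborel)"
  proof -
    have "(\<lambda>t. ennreal (norm (indicator ({0..} - bad) t *\<^sub>R g t)) * indicator {t. 0 \<le> t \<and> Re (\<gamma> t) \<le> b} t)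
        \<in> borel_measurable lborel"
    proof -
      have m: "(\<lambda>t. indicator ({0..} - bad) t *\<^sub>R g t) \<in> borel_measurable lborel" using ig by auto
      have "{t. 0 \<le> t \<and> Re (\<gamma> t) \<le> b} \<in> sets lborel" using Re_le_closed by (auto intro: borel_closed)
      moreover have "(\<lambda>t. ennreal (norm (indicator ({0..} - bad) t *\<^sub>R g t))) \<in> borel_measurable lborel"
        using m by measurable
      ultimately show ?thesis by (intro borel_measurable_times_ennreal borel_measurable_indicator)
    qed
    also have "(\<lambda>t. ennreal (norm (indicator ({0..} - bad) t *\<^sub>R g t)) * indicator {t. 0 \<le> t \<and> Re (\<gamma> t) \<le> b} t)
        = (\<lambda>t. ennreal (cmod (f (\<gamma> t)) * speed t) * indicator {t \<in> {0..} - bad. Re (\<gamma> t) \<le> b} t)"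
      by (auto simp: fun_eq_iff indicator_def g_def norm_mult speed_def)
    finally have m1: "(\<lambda>t. ennreal (cmod (f (\<gamma> t)) * speed t) * indicator {t \<in> {0..} - bad. Re (\<gamma> t) \<le> b} t)
        \<in> borel_measurable lborel" .
    have "majorant (b - 1) \<in> borel_measurable borel" using majorant_measurable[of "b - 1"] by simp
    then show ?thesis using m1
      by (subst nn_integral_add) (auto intro!: borel_measurable_times arg_cong2[where f = "(+)"] nn_integral_cmult)
  qed
  also have "\<dots> \<le> ennreal (B * strip_length * exp (c * (b + 1)) / (1 - exp (- c)))
      + ennreal (V * (1 + T / 4)) * ennreal strip_length"
    by (intro add_mono weighted_tail[OF c bound b] mult_left_mono majorant_integral) auto
  also have "\<dots> = ennreal (B * strip_length * exp (c * (b + 1)) / (1 - exp (- c)) + V * (1 + T / 4) * strip_length)"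
  proof -
    have eq: "ennreal p + ennreal q * ennreal l = ennreal (p + q * l)" if "0 \<le> p" "0 \<le> q" "0 \<le> l" for p q l
      using that by (simp add: ennreal_mult)
    show ?thesis by (rule eq) (use c V0 T_pos strip_length_nonneg in auto)
  qed
  finally show ?thesis
    using c V0 T_pos strip_length_nonneg by (subst (asm) ennreal_le_iff) auto
qed

end

section \<open>Winding numbers of the clamped contour\<close>

context descending_contour
begin

text \<open>As Re \<gamma> tends to -\<infinity>, the part of the contour right of any vertical line
  is the image of a compact set of parameters; a convergent sequence on the contour eventually stays
  in such a part.\<close>

lemma closed_contour: "closed (\<gamma> ` {0..})"
  unfolding closed_sequential_limits
proof (intro allI impI, elim conjE)
  fix s z assume s: "\<forall>n. s n \<in> \<gamma> ` {0..}" and lim: "s \<longlonglongrightarrow> z"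
  define K where "K = \<gamma> ` {t. 0 \<le> t \<and> Re z - 1 \<le> Re (\<gamma> t)}"
  have "compact K"
    unfolding K_def by (intro compact_continuous_image compact_Re_ge continuous_on_subset[OF gamma_cont]) auto
  moreover have "\<forall>\<^sub>F n in sequentially. Re (s n) > Re z - 1"
    using order_tendstoD(1)[OF tendsto_Re[OF lim]] by simp
  then have "\<forall>\<^sub>F n in sequentially. s n \<in> K"
  proof eventually_elim
    case (elim n)
    obtain t where "0 \<le> t" "s n = \<gamma> t" using s by (metis atLeast_iff imageE)
    then show ?case using elim by (auto simp: K_def)
  qed
  ultimately have "z \<in> K"
    by (intro Lim_in_closed_set[OF compact_imp_closed _ _ lim]) auto
  then show "z \<in> \<gamma> ` {0..}" by (auto simp: K_def)
qed

lemma closed_completed: "closed (completed (\<gamma> ` {0..}))"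
proof -
  have "{s. Im s = 0 \<and> 1 \<le> Re s} = {s. Im s = 0} \<inter> {s. 1 \<le> Re s}" by auto
  moreover have "closed {s. Im s = 0}" "closed {s. 1 \<le> Re s}"
    by (intro closed_Collect_eq closed_Collect_le continuous_intros)+
  ultimately have "closed {s. Im s = 0 \<and> 1 \<le> Re s}" by auto
  then show ?thesis unfolding completed_def using closed_contour by auto
qed

lemma cpath_ends:
  assumes "0 < te" "\<And>t. te \<le> t \<Longrightarrow> Re (\<gamma> t) < b - 1" "b \<le> 1"
  shows "pathstart (cpath b te) = 1" "pathfinish (cpath b te) = of_real b"
  using assms clamped_eventually_const(1)[OF assms(1,2), of te]
  by (simp_all add: pathstart_def pathfinish_def cpath_def clamped_def start clamp_left_right)

lemma path_image_cpath: "0 < te \<Longrightarrow> path_image (cpath b te) \<subseteq> clamped b ` {0..}"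
  by (auto simp: path_image_def cpath_def)

lemma clamped_cases:
  assumes "0 \<le> t"
  shows "b \<le> Re (\<gamma> t) \<and> clamped b t = \<gamma> t \<or> Re (\<gamma> t) < b \<and> Re (clamped b t) = b"
  by (cases "b \<le> Re (\<gamma> t)") (auto simp: clamped_def clamp_left_right)

lemma clamped_box:
  assumes "0 \<le> t" "b \<le> 1"
  shows "b \<le> Re (clamped b t)" "Re (clamped b t) \<le> 1" "0 \<le> Im (clamped b t)" "Im (clamped b t) \<le> T / 4"
  using gamma_region[OF assms(1)] Im_clamp_left_bounds[of "\<gamma> t" b] assms(2)
  by (auto simp: clamped_def)

text \<open>This is the plane slit along the vertical ray from z, downwards for e = 1 and upwards
  for e = -1. It is star-shaped about the point at distance 1 from z on the opposite side, because a
  segment from there can meet the line Re s = Re z again only on that side.\<close>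

lemma starlike_slit:
  assumes "e = 1 \<or> e = (-1::real)"
  shows "starlike {s. Re s \<noteq> Re z \<or> 0 < e * (Im s - Im z)}"
  unfolding starlike_def
proof (intro bexI ballI subsetI)
  let ?S = "{s. Re s \<noteq> Re z \<or> 0 < e * (Im s - Im z)}" and ?a = "Complex (Re z) (Im z + e)"
  show a: "?a \<in> ?S" using assms by auto
  fix x p assume x: "x \<in> ?S" and "p \<in> closed_segment ?a x"
  then obtain u where u: "0 \<le> u" "u \<le> 1" "p = (1 - u) *\<^sub>R ?a + u *\<^sub>R x"
    by (auto simp: closed_segment_def)
  then have Re: "Re p - Re z = u * (Re x - Re z)" and Im: "e * (Im p - Im z) = (1 - u) * (e * e) + u * (e * (Im x - Im z))"
    unfolding u(3) by (simp_all add: algebra_simps)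
  have ee: "e * e = 1" using assms by auto
  show "p \<in> ?S"
  proof (cases "u = 0")
    case True
    then have "p = ?a" using u(3) by simp
    then show ?thesis using a by simp
  next
    case False
    show ?thesis
    proof (cases "Re x = Re z")
      case True
      then have "0 < u * (e * (Im x - Im z))" using x u False by auto
      moreover have "0 \<le> (1 - u) * (e * e)" using u ee by simp
      ultimately have "0 < e * (Im p - Im z)" unfolding Im by linarith
      then show ?thesis by simp
    next
      case False
      then show ?thesis using Re \<open>u \<noteq> 0\<close> by auto
    qed
  qed
qed

lemma winding_number_cpath_indep:
  assumes "z \<notin> clamped b ` {0..}"
    and te: "0 < te" "\<And>t. te \<le> t \<Longrightarrow> Re (\<gamma> t) < b - 1"
    and te': "0 < te'" "\<And>t. te' \<le> t \<Longrightarrow> Re (\<gamma> t) < b - 1"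
  shows "winding_number (cpath b te) z = winding_number (cpath b te') z"
proof -
  have c: "continuous_on (clamped b ` {0..}) (\<lambda>w. 1 / (w - z))"
    using assms(1) by (intro continuous_intros) auto
  have z: "z \<notin> path_image (cpath b te)" "z \<notin> path_image (cpath b te')"
    using path_image_cpath te(1) te'(1) assms(1) by blast+
  show ?thesis
    using winding_number_valid_path[OF valid_path_cpath[OF te(1)] z(1)]
      winding_number_valid_path[OF valid_path_cpath[OF te'(1)] z(2)]
      contour_integral_unique[OF cpath_has_contour_integral[OF c te]]
      contour_integral_unique[OF cpath_has_contour_integral[OF c te']] by simp
qed

text \<open>Moving the truncation line alters the path only inside Re s <= b, a convex set that
  misses z. The real segment from b' to b makes the endpoints agree.\<close>

lemma winding_number_clamp_shift:
  assumes b: "b' < b" "b \<le> 1" "b < Re z" and z: "z \<notin> \<gamma> ` {0..}"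
    and te: "0 < te" "\<And>t. te \<le> t \<Longrightarrow> Re (\<gamma> t) < b' - 1"
  shows "winding_number (cpath b te) z
    = winding_number (cpath b' te) z + winding_number (linepath (of_real b') (of_real b)) z"
proof -
  have te2: "Re (\<gamma> t) < b - 1" if "te \<le> t" for t using te(2)[OF that] b by simp
  note e1 = cpath_ends[OF te] and e2 = cpath_ends[OF te(1) te2 b(2)]
  have b'1: "b' \<le> 1" using b by simp
  have zc: "z \<notin> clamped c ` {0..}" if "c \<le> b" for c
  proof
    assume "z \<in> clamped c ` {0..}"
    then obtain t where t: "0 \<le> t" "z = clamped c t" by auto
    with clamped_cases[OF t(1), of c] z b that show False by auto
  qed
  have zp: "z \<notin> path_image (cpath b te)" "z \<notin> path_image (cpath b' te)"
    using path_image_cpath[OF te(1)] zc[of b] zc[of b'] b by auto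
  have zl: "z \<notin> closed_segment (of_real b') (of_real b)"
    using b by (auto simp: closed_segment_same_Im closed_segment_eq_real_ivl)
  let ?l = "linepath (of_real b') (of_real b) :: real \<Rightarrow> complex" and ?c = "linepath (of_real b) (of_real b) :: real \<Rightarrow> complex"
  \<comment> \<open>The constant path at b is appended so that both joins reach the clamped point r
    at the same parameter and the straight-line homotopy compares corresponding points.\<close>
  have "homotopic_paths (- {z}) (cpath b' te +++ ?l) (cpath b te +++ ?c)"
  proof (rule homotopic_paths_linear)
    show "path (cpath b' te +++ ?l)" "path (cpath b te +++ ?c)"
      using e1 e2 b'1 te by (auto intro!: path_join_imp path_cpath)
    show "pathstart (cpath b te +++ ?c) = pathstart (cpath b' te +++ ?l)"
      using e1 e2 b'1 by simp
    show "pathfinish (cpath b te +++ ?c) = pathfinish (cpath b' te +++ ?l)" by simp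
    fix t :: real assume t: "t \<in> {0..1}"
    define p q where "p = (cpath b' te +++ ?l) t" and "q = (cpath b te +++ ?c) t"
    have "p = q \<and> p \<noteq> z \<or> Re p \<le> b \<and> Re q \<le> b"
    proof (cases "t \<le> 1/2")
      case True
      define r where "r = te * (2 * t)"
      have r: "0 \<le> r" using t te by (simp add: r_def)
      have pq: "p = clamped b' r" "q = clamped b r"
        using True by (simp_all add: p_def q_def joinpaths_def cpath_def r_def)
      show ?thesis
      proof -
        have "clamped b r \<noteq> z" using zc[of b] r by auto
        then show ?thesis
          using clamped_cases[OF r, of b] clamped_cases[OF r, of b'] b unfolding pq by auto
      qed
    next
      case False
      have "Re (linepath (of_real b') (of_real b) (2 * t - 1) :: complex) \<le> b"
      proof -
        have "linepath (of_real b') (of_real b) (2 * t - 1) \<in> closed_segment (of_real b') (of_real b :: complex)"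
          using t False by (intro linepath_in_path) auto
        then show ?thesis using b by (auto simp: closed_segment_same_Im closed_segment_eq_real_ivl)
      qed
      then show ?thesis using False by (simp add: p_def q_def joinpaths_def linepath_refl)
    qed
    then show "closed_segment p q \<subseteq> - {z}"
    proof (elim disjE)
      assume "Re p \<le> b \<and> Re q \<le> b"
      then have "closed_segment p q \<subseteq> {s. Re s \<le> b}"
        by (intro closed_segment_subset) (auto simp: convex_halfspace_Re_le)
      then show ?thesis using b by auto
    qed auto
  qed
  then have "winding_number (cpath b' te +++ ?l) z = winding_number (cpath b te +++ ?c) z"
    by (rule winding_number_homotopic_paths)
  moreover have "winding_number (cpath b' te +++ ?l) z = winding_number (cpath b' te) z + winding_number ?l z"
    using e1 b'1 zp zl te by (intro winding_number_join path_cpath) auto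
  moreover have "winding_number (cpath b te +++ ?c) z = winding_number (cpath b te) z + winding_number ?c z"
    using e2 zp b te by (intro winding_number_join path_cpath) auto
  moreover have "winding_number ?c z = 0" using b by (intro winding_number_trivial) auto
  ultimately show ?thesis by simp
qed

definition clamped_loop :: "real \<Rightarrow> real \<Rightarrow> real \<Rightarrow> real \<Rightarrow> real \<Rightarrow> complex" where
  "clamped_loop b te \<kappa> \<eta> = cpath b te +++ linepath (Complex b 0) (Complex b \<eta>) +++
     linepath (Complex b \<eta>) (Complex \<kappa> \<eta>) +++ linepath (Complex \<kappa> \<eta>) (Complex \<kappa> 0) +++ linepath (Complex \<kappa> 0) (Complex 1 0)"

text \<open>If \<open>z\<close> is connected to far away points on the side \<open>e\<close> of the contour (\<open>1\<close>: below,
  \<open>-1\<close>: above), compare the loop with one that is closed by a large rectangle on the other side; the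
  latter has winding number \<open>0\<close> around these far away points, hence around \<open>z\<close>, and the two loops
  differ by a closed polygon in the plane slit along a vertical ray from \<open>z\<close>.\<close>

lemma winding_number_clamped_loop:
  assumes e: "e = 1 \<or> e = (-1::real)" and b: "b < 1" "1 < \<kappa>"
    and z: "b < Re z" "Re z < \<kappa>" "0 < e * (\<eta> - Im z)"
    and conn: "\<And>w. e * Im w < h \<Longrightarrow> connected_component (- completed (\<gamma> ` {0..})) z w"
    and te: "0 < te" "\<And>t. te \<le> t \<Longrightarrow> Re (\<gamma> t) < b - 1"
  shows "winding_number (clamped_loop b te \<kappa> \<eta>) z = 0"
proof -
  let ?C = "\<gamma> ` {0..}"
  \<comment> \<open>A far point on the side \<open>e\<close>: beyond the height required by
    \<open>conn\<close> and outside the half-plane that will contain the comparison loop.\<close>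
  define w where "w = Complex 0 (- e * (\<bar>h\<bar> + T + 1))"
  have ee: "e * e = 1" using e by auto
  have "e * Im w = - (\<bar>h\<bar> + T + 1)" using ee by (simp add: w_def algebra_simps)
  then have "e * Im w < h" using T_pos by linarith
  then have "connected_component (- completed ?C) z w" by (rule conn)
  then have zw: "z \<in> connected_component_set (- completed ?C) z" "w \<in> connected_component_set (- completed ?C) z"
    using connected_component_in[of "- completed ?C" z w] by (auto intro: connected_component_refl)
  have "path_connected (connected_component_set (- completed ?C) z)"
    using closed_completed
    by (intro connected_open_path_connected open_connected_component open_Compl connected_connected_component)
  then obtain g where g: "path g" "path_image g \<subseteq> - completed ?C" "pathstart g = z" "pathfinish g = w"
    using zw connected_component_subset[of "- completed ?C" z] unfolding path_connected_def by (meson subset_trans)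
  obtain R0 where R0: "\<And>p. p \<in> path_image g \<Longrightarrow> cmod p \<le> R0"
    using bounded_path_image[OF g(1)] unfolding bounded_iff by blast
  \<comment> \<open>The curve \<open>g\<close> from z to w lies well inside the disc of radius R,
    hence away from the rectangle sides and from everything clamped to Re s = -R; the rest of the
    comparison loop lies on the completed contour, which \<open>g\<close> avoids.\<close>
  define R where "R = \<bar>R0\<bar> + \<bar>b\<bar> + \<bar>\<kappa>\<bar> + cmod z + T + \<bar>\<eta>\<bar> + 1"
  have zR: "\<bar>Im z\<bar> < R" using abs_Im_le_cmod[of z] T_pos unfolding R_def by linarith
  have R: "R0 < R" "\<kappa> < R" "- R < b" "T < R" "0 < R" "1 < R" 
    using T_pos b norm_ge_zero[of z] unfolding R_def by linarith+
  have zK: "z \<in> path_image g" "w \<in> path_image g" using g by (metis pathstart_in_path_image pathfinish_in_path_image)+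
  have zC: "z \<notin> ?C" using zK(1) g(2) by (auto simp: completed_def)
  have zray: "\<not> (Im z = 0 \<and> 1 \<le> Re z)" using zK(1) g(2) by (auto simp: completed_def)
  obtain te' where te': "0 < te'" "\<And>t. te' \<le> t \<Longrightarrow> Re (\<gamma> t) < - R - 1"
    using Re_ge_bounded[of "- R - 1"] by blast
  have te'b: "Re (\<gamma> t) < b - 1" if "te' \<le> t" for t using te'(2)[OF that] R by simp
  have mR: "- R \<le> 1" using R by simp
  let ?q = "cpath (- R) te'"
  note qe = cpath_ends[OF te' mR]
  define u where "u = e * R"
  define rest where "rest = linepath (Complex (-R) 0) (Complex (-R) u) +++
    linepath (Complex (-R) u) (Complex R u) +++ linepath (Complex R u) (Complex R 0)"
  \<comment> \<open>The comparison loop: along the real ray to 1, along the contour clamped at -R,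
    and back on three sides of a large rectangle, on the side away from w.\<close>
  define \<Theta> where "\<Theta> = linepath (Complex R 0) (Complex 1 0) +++ ?q +++ rest"
  have c1: "(1::complex) = Complex 1 0" and cr: "complex_of_real r = Complex r 0" for r
    by (simp_all add: complex_eq_iff)
  have u: "\<bar>u\<bar> = R" using e R by (auto simp: u_def)
  have pim_rest: "path_image rest \<subseteq> {p. (\<bar>Re p\<bar> = R \<or> \<bar>Im p\<bar> = R) \<and> (Im p \<in> closed_segment 0 u)}"
    unfolding rest_def using R u
    by (auto simp: path_image_join closed_segment_same_Re closed_segment_same_Im closed_segment_commute)
  have pim_q: "path_image ?q \<subseteq> clamped (- R) ` {0..}" by (rule path_image_cpath[OF te'(1)])
  have path_rest: "path rest" "pathstart rest = Complex (-R) 0" "pathfinish rest = Complex R 0"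
    by (simp_all add: rest_def)
  have path_q: "path ?q" using te' by (intro path_cpath) auto
  have path_T: "path \<Theta>" "pathstart \<Theta> = Complex R 0" "pathfinish \<Theta> = Complex R 0"
    unfolding \<Theta>_def using path_rest path_q qe by (auto simp: c1 cr)
  have pim_T: "path_image \<Theta> = closed_segment (Complex R 0) (Complex 1 0) \<union> (path_image ?q \<union> path_image rest)"
    unfolding \<Theta>_def using path_rest path_q qe by (simp add: path_image_join c1 cr)
  have disj: "path_image g \<inter> path_image \<Theta> = {}"
  proof -
    have "p \<notin> path_image \<Theta>" if p: "p \<in> path_image g" for p
    proof
      assume "p \<in> path_image \<Theta>"
      then consider "p \<in> closed_segment (Complex R 0) (Complex 1 0)" | "p \<in> path_image ?q" | "p \<in> path_image rest"
        unfolding pim_T by blast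
      then show False
      proof cases
        case 1
        then have "p \<in> completed ?C"
          using R by (auto simp: completed_def closed_segment_same_Im closed_segment_eq_real_ivl split: if_splits)
        then show False using g(2) p by auto
      next
        case 2
        then obtain t where t: "0 \<le> t" "p = clamped (- R) t" using pim_q by auto
        from clamped_cases[OF t(1), of "- R"] show False
        proof (elim disjE conjE)
          assume "clamped (- R) t = \<gamma> t"
          then have "p \<in> completed ?C" using t by (auto simp: completed_def)
          then show False using g(2) p by auto
        next
          assume "Re (clamped (- R) t) = - R"
          then have "R \<le> cmod p" using abs_Re_le_cmod[of p] R t by simp
          then show False using R0[OF p] R by simp
        qed
      next
        case 3
        then have "R \<le> cmod p" using pim_rest abs_Re_le_cmod[of p] abs_Im_le_cmod[of p] by auto
        then show False using R0[OF p] R by simp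
      qed
    qed
    then show ?thesis by blast
  qed
  have "winding_number \<Theta> z = winding_number \<Theta> w"
    using path_T zK disj by (intro winding_number_eq[where S = "path_image g"] connected_path_image g(1)) auto
  also have "winding_number \<Theta> w = 0"
  proof -
    have sub: "0 \<le> Im p \<and> e = 1 \<or> Im p \<le> T / 4 \<and> e = -1" if pT: "p \<in> path_image \<Theta>" for p
    proof -
      consider "p \<in> closed_segment (Complex R 0) (Complex 1 0)" | "p \<in> path_image ?q" | "p \<in> path_image rest"
        using pT unfolding pim_T by blast
      then show ?thesis
      proof cases
        case 1 then show ?thesis using e T_pos by (auto simp: closed_segment_same_Im)
      next
        case 2
        then obtain t where t: "0 \<le> t" "p = clamped (- R) t" using pim_q by auto
        show ?thesis using e clamped_box(3,4)[OF t(1) mR] unfolding t(2) by auto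
      next
        case 3
        then have "Im p \<in> closed_segment 0 u" using pim_rest by auto
        then show ?thesis using e R T_pos by (auto simp: u_def closed_segment_eq_real_ivl split: if_splits)
      qed
    qed
    show ?thesis
    proof (cases "e = 1")
      case True
      show ?thesis
      proof (rule winding_number_zero_outside[of _ "{s. 0 \<le> Im s}"])
        show "convex {s. 0 \<le> Im s}" by (rule convex_halfspace_Im_ge)
        show "w \<notin> {s. 0 \<le> Im s}" using True T_pos by (simp add: w_def)
      qed (use path_T sub True in auto)
    next
      case False
      then have "e = -1" using e by simp
      show ?thesis
      proof (rule winding_number_zero_outside[of _ "{s. Im s \<le> T / 4}"])
        show "convex {s. Im s \<le> T / 4}" by (rule convex_halfspace_Im_le)
        show "w \<notin> {s. Im s \<le> T / 4}" using \<open>e = -1\<close> T_pos by (simp add: w_def)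
      qed (use path_T sub \<open>e = -1\<close> in auto)
    qed
  qed
  finally have T0: "winding_number \<Theta> z = 0" .
  define n where "n = (\<lambda>p q. winding_number (linepath p q) z)"
  have zT: "z \<notin> path_image \<Theta>" using zK disj by blast
  have zq: "z \<notin> path_image ?q" "z \<notin> closed_segment (Complex R 0) (Complex 1 0)" "z \<notin> path_image rest"
    using zT unfolding pim_T by auto
  define S where "S = {s. Re s \<noteq> Re z \<or> 0 < e * (Im s - Im z)}"
  have eu: "0 < e * (u - Im z)"
    using zR ee e unfolding u_def by (auto simp: algebra_simps)
  have vS: "closed_segment (Complex c x) (Complex c y) \<subseteq> S" if "c \<noteq> Re z" for c x y
    using that by (auto simp: S_def closed_segment_same_Re)
  have hS: "closed_segment (Complex x v) (Complex y v) \<subseteq> S" if "0 < e * (v - Im z)" for v x y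
    using that by (auto simp: S_def closed_segment_same_Im)
  have lS: "closed_segment (Complex x 0) (Complex y 0) \<subseteq> S" if "x < Re z \<and> y < Re z \<or> Re z < x \<and> Re z < y" for x y
    using that by (auto simp: S_def closed_segment_same_Im closed_segment_eq_real_ivl split: if_splits)
  have zS: "z \<notin> S" by (simp add: S_def)
  \<comment> \<open>The closed polygon by which the clamped loop differs from
    \<open>\<Theta>\<close>. None of its sides meets the vertical ray that starts at z on the side
    \<open>e\<close>, so it lies in a simply connected set without z.\<close>
  define \<Xi> where "\<Xi> = linepath (Complex \<kappa> 0) (Complex R 0) +++ linepath (Complex R 0) (Complex R u) +++
    linepath (Complex R u) (Complex (-R) u) +++ linepath (Complex (-R) u) (Complex (-R) 0) +++
    linepath (Complex (-R) 0) (Complex b 0) +++ linepath (Complex b 0) (Complex b \<eta>) +++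
    linepath (Complex b \<eta>) (Complex \<kappa> \<eta>) +++ linepath (Complex \<kappa> \<eta>) (Complex \<kappa> 0)"
  have segS: "closed_segment (Complex \<kappa> 0) (Complex R 0) \<subseteq> S" "closed_segment (Complex R 0) (Complex R u) \<subseteq> S"
    "closed_segment (Complex R u) (Complex (-R) u) \<subseteq> S" "closed_segment (Complex (-R) u) (Complex (-R) 0) \<subseteq> S"
    "closed_segment (Complex (-R) 0) (Complex b 0) \<subseteq> S" "closed_segment (Complex b 0) (Complex b \<eta>) \<subseteq> S"
    "closed_segment (Complex b \<eta>) (Complex \<kappa> \<eta>) \<subseteq> S" "closed_segment (Complex \<kappa> \<eta>) (Complex \<kappa> 0) \<subseteq> S"
    using z R b eu by (intro vS hS lS; simp)+
  note zseg = segS[THEN subsetD, of z]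
  have X0: "winding_number \<Xi> z = 0"
  proof (rule simply_connected_imp_winding_number_zero)
    show "simply_connected S" unfolding S_def by (intro starlike_imp_simply_connected starlike_slit e)
    show "path_image \<Xi> \<subseteq> S" using segS by (simp add: \<Xi>_def path_image_join)
  qed (use zS in \<open>auto simp: \<Xi>_def\<close>)
  have Xsum: "winding_number \<Xi> z = n (Complex \<kappa> 0) (Complex R 0) + (n (Complex R 0) (Complex R u) +
      (n (Complex R u) (Complex (-R) u) + (n (Complex (-R) u) (Complex (-R) 0) + (n (Complex (-R) 0) (Complex b 0)
      + (n (Complex b 0) (Complex b \<eta>) + (n (Complex b \<eta>) (Complex \<kappa> \<eta>) + n (Complex \<kappa> \<eta>) (Complex \<kappa> 0)))))))"
    unfolding \<Xi>_def n_def using zseg zS by (subst winding_number_join; auto simp: path_image_join)+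
  have Rsum: "winding_number rest z = n (Complex (-R) 0) (Complex (-R) u) + (n (Complex (-R) u) (Complex R u) + n (Complex R u) (Complex R 0))"
    unfolding rest_def n_def using zseg zS
    by (subst winding_number_join; auto simp: path_image_join closed_segment_commute)+
  have Tsum: "winding_number \<Theta> z = n (Complex R 0) (Complex 1 0) + (winding_number ?q z + winding_number rest z)"
    unfolding \<Theta>_def n_def using zq path_q path_rest qe
    by (subst winding_number_join; auto simp: path_image_join c1 cr)+
  have rev: "n q p = - n p q" if "z \<notin> closed_segment p q" for p q
    using winding_number_reversepath[of "linepath p q" z] that by (simp add: n_def)
  have split: "n (Complex R 0) (Complex 1 0) = n (Complex R 0) (Complex \<kappa> 0) + n (Complex \<kappa> 0) (Complex 1 0)"
    unfolding n_def using zq(2) R b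
    by (intro winding_number_split_linepath) (auto simp: closed_segment_same_Im closed_segment_eq_real_ivl)
  have zb: "z \<notin> clamped b ` {0..}"
  proof
    assume "z \<in> clamped b ` {0..}"
    then obtain t where t: "0 \<le> t" "z = clamped b t" by auto
    with clamped_cases[OF t(1), of b] zC z show False by auto
  qed
  have qb: "winding_number (cpath b te) z = winding_number ?q z + n (Complex (-R) 0) (Complex b 0)"
    using winding_number_cpath_indep[OF zb te te'(1) te'b]
      winding_number_clamp_shift[of "- R" b z te'] R b z zC te' by (simp add: n_def cr)
  have be: "pathstart (cpath b te) = Complex 1 0" "pathfinish (cpath b te) = Complex b 0"
    using cpath_ends[OF te] b by (simp_all add: c1 cr)
  have zpb: "z \<notin> path_image (cpath b te)" using zb path_image_cpath[OF te(1)] by blast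
  have z1: "z \<notin> closed_segment (Complex \<kappa> 0) (Complex 1 0)"
    using zray b by (auto simp: closed_segment_same_Im closed_segment_eq_real_ivl)
  have Lsum: "winding_number (clamped_loop b te \<kappa> \<eta>) z = winding_number (cpath b te) z + (n (Complex b 0) (Complex b \<eta>)
      + (n (Complex b \<eta>) (Complex \<kappa> \<eta>) + (n (Complex \<kappa> \<eta>) (Complex \<kappa> 0) + n (Complex \<kappa> 0) (Complex 1 0))))"
    unfolding clamped_loop_def n_def using zseg zS zpb be z1 te
    by (subst winding_number_join; auto simp: path_image_join path_cpath)+
  have r1: "n (Complex R 0) (Complex \<kappa> 0) = - n (Complex \<kappa> 0) (Complex R 0)"
    and r2: "n (Complex R u) (Complex R 0) = - n (Complex R 0) (Complex R u)"
    and r3: "n (Complex (-R) u) (Complex R u) = - n (Complex R u) (Complex (-R) u)"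
    and r4: "n (Complex (-R) 0) (Complex (-R) u) = - n (Complex (-R) u) (Complex (-R) 0)"
    using zseg zS by (intro rev; auto)+
  \<comment> \<open>The segments run through in both directions cancel, and the real segment from -R
    to b accounts for the different truncation lines.\<close>
  have "winding_number (clamped_loop b te \<kappa> \<eta>) z = winding_number \<Theta> z + winding_number \<Xi> z"
    unfolding Lsum qb Tsum Rsum split Xsum r1 r2 r3 r4 by (simp only: add_ac) simp
  then show ?thesis unfolding T0 X0 by simp
qed

text \<open>This is the homology form of Cauchy's theorem. The loop follows the contour and returns
  along the line at height \<eta>, so a singularity that lies below both or above both is not
  encircled.\<close>

lemma clamped_loop_Cauchy:
  assumes S: "open S" "f holomorphic_on S" and b: "b < 1" "1 < \<kappa>" and eta: "0 < \<eta>" "\<eta> \<le> T / 4"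
    and te: "0 < te" "\<And>t. te \<le> t \<Longrightarrow> Re (\<gamma> t) < b - 1"
    and sub: "clamped b ` {0..} \<subseteq> S" "closed_segment (Complex b 0) (Complex b \<eta>) \<subseteq> S"
      "closed_segment (Complex b \<eta>) (Complex \<kappa> \<eta>) \<subseteq> S" "closed_segment (Complex \<kappa> \<eta>) (Complex \<kappa> 0) \<subseteq> S"
      "closed_segment (Complex \<kappa> 0) (Complex 1 0) \<subseteq> S"
    and out: "\<And>w. w \<notin> S \<Longrightarrow> b \<le> Re w \<Longrightarrow> Re w \<le> \<kappa> \<Longrightarrow> 0 \<le> Im w \<Longrightarrow> Im w \<le> T / 4 \<Longrightarrow>
      b < Re w \<and> Re w < \<kappa> \<and> (lies_below (\<gamma> ` {0..}) w \<and> Im w < \<eta> \<or> lies_above (\<gamma> ` {0..}) w \<and> \<eta> < Im w)"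
  shows "contour_integral (cpath b te) f + (seg f (Complex b 0) (Complex b \<eta>)
    + (seg f (Complex b \<eta>) (Complex \<kappa> \<eta>) + (seg f (Complex \<kappa> \<eta>) (Complex \<kappa> 0)
    + seg f (Complex \<kappa> 0) (Complex 1 0)))) = 0"
proof -
  let ?L = "clamped_loop b te \<kappa> \<eta>"
  have c1: "(1::complex) = Complex 1 0" and cr: "complex_of_real r = Complex r 0" for r
    by (simp_all add: complex_eq_iff)
  have be: "pathstart (cpath b te) = Complex 1 0" "pathfinish (cpath b te) = Complex b 0"
    using cpath_ends[OF te] b by (simp_all add: c1 cr)
  have vp: "valid_path (cpath b te)" by (rule valid_path_cpath[OF te(1)])
  have pim: "path_image ?L = path_image (cpath b te) \<union> (closed_segment (Complex b 0) (Complex b \<eta>) \<union>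
     (closed_segment (Complex b \<eta>) (Complex \<kappa> \<eta>) \<union> (closed_segment (Complex \<kappa> \<eta>) (Complex \<kappa> 0)
      \<union> closed_segment (Complex \<kappa> 0) (Complex 1 0))))"
    unfolding clamped_loop_def using be by (simp add: path_image_join)
  have sub1: "path_image (cpath b te) \<subseteq> S" using path_image_cpath[OF te(1)] sub(1) by blast
  have vL: "valid_path ?L" "pathfinish ?L = pathstart ?L"
    unfolding clamped_loop_def using be vp by (auto intro!: valid_path_join)
  have box: "b \<le> Re p \<and> Re p \<le> \<kappa> \<and> 0 \<le> Im p \<and> Im p \<le> T / 4" if "p \<in> path_image ?L" for p
  proof -
    consider "p \<in> path_image (cpath b te)" | "p \<in> closed_segment (Complex b 0) (Complex b \<eta>)"
      | "p \<in> closed_segment (Complex b \<eta>) (Complex \<kappa> \<eta>)" | "p \<in> closed_segment (Complex \<kappa> \<eta>) (Complex \<kappa> 0)"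
      | "p \<in> closed_segment (Complex \<kappa> 0) (Complex 1 0)"
      using \<open>p \<in> path_image ?L\<close> unfolding pim by blast
    then show ?thesis
    proof cases
      case 1
      then obtain t where t: "0 \<le> t" "p = clamped b t" using path_image_cpath[OF te(1)] by auto
      show ?thesis using clamped_box[OF t(1), of b] b unfolding t(2) by auto
    qed (use b eta T_pos in \<open>auto simp: closed_segment_same_Re closed_segment_same_Im closed_segment_eq_real_ivl split: if_splits\<close>)
  qed
  have "(f has_contour_integral 0) ?L"
  proof (rule Cauchy_theorem_global[OF S vL])
    show "path_image ?L \<subseteq> S" using sub sub1 unfolding pim by auto
    fix w assume w: "w \<notin> S"
    show "winding_number ?L w = 0"
    proof (cases "b \<le> Re w \<and> Re w \<le> \<kappa> \<and> 0 \<le> Im w \<and> Im w \<le> T / 4")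
      case False
      let ?B = "cbox (Complex b 0) (Complex \<kappa> (T / 4))"
      show ?thesis
        by (rule winding_number_zero_outside[of _ ?B])
          (use False box vL in \<open>auto simp: in_cbox_complex_iff intro: valid_path_imp_path\<close>)
    next
      case True
      then have "b < Re w" "Re w < \<kappa>" and
        ab: "lies_below (\<gamma> ` {0..}) w \<and> Im w < \<eta> \<or> lies_above (\<gamma> ` {0..}) w \<and> \<eta> < Im w"
        using out[OF w] by auto
      note wn = winding_number_clamped_loop[OF _ b this(1,2) _ _ te]
      from ab show ?thesis
      proof (elim disjE conjE)
        assume "lies_below (\<gamma> ` {0..}) w" "Im w < \<eta>"
        then obtain h where "\<forall>v. Im v < h \<longrightarrow> connected_component (- completed (\<gamma> ` {0..})) w v"
          unfolding lies_below_def by blast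
        then show ?thesis using \<open>Im w < \<eta>\<close> by (intro wn[of 1 _ h]) auto
      next
        assume "lies_above (\<gamma> ` {0..}) w" "\<eta> < Im w"
        then obtain h where "\<forall>v. Im v > h \<longrightarrow> connected_component (- completed (\<gamma> ` {0..})) w v"
          unfolding lies_above_def by blast
        then show ?thesis using \<open>\<eta> < Im w\<close> by (intro wn[of "-1" _ "- h"]) auto
      qed
    qed
  qed
  then have "contour_integral ?L f = 0" by (rule contour_integral_unique)
  moreover have "f contour_integrable_on cpath b te"
    by (rule contour_integrable_holomorphic_simple[OF S(2,1) vp sub1])
  moreover have "f contour_integrable_on linepath p q" if "closed_segment p q \<subseteq> S" for p q
    using that holomorphic_on_imp_continuous_on[OF S(2)]
    by (intro contour_integrable_continuous_linepath) (auto intro: continuous_on_subset)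
  note this[OF sub(2)] this[OF sub(3)] this[OF sub(4)] this[OF sub(5)]
  ultimately show ?thesis
    using vp be by (simp add: clamped_loop_def valid_path_join)
qed

end

section \<open>The weight\<close>

text \<open>With \<alpha> = 1 and \<delta> = \<plusminus>1 this is \<Phi>. The pairs (1, 0) and (0,
  1) isolate the parts that turn, after the shift by \<i>T, into multiples of
  \<open>omega_plus\<close> and \<open>theta T 1\<close>.\<close>

definition weight :: "real \<Rightarrow> real \<Rightarrow> real \<Rightarrow> real \<Rightarrow> complex \<Rightarrow> complex" where
  "weight T \<sigma> \<alpha> \<delta> s = of_real \<alpha> * (of_real (T / 2) *
      (hcoth ((s - of_real \<sigma>) / of_real T) - hcoth ((1 - of_real \<sigma>) / of_real T)))
    + of_real \<delta> * ((s - 1) / 2)"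

text \<open>sinh(\<pi>z) vanishes at the integer multiples of \<i>, of which 0 and -\<i> lie here,
  and at 0 the singularity of h is removable. Holomorphy is glued from the strip |Im z| < 1 and from
  -2 < Im z < 0, which the half period \<i> of sinh(\<pi>z), up to sign, carries to |Im z| <
  1.\<close>

lemma hcoth_holomorphic_lower: "hcoth holomorphic_on {z. - 2 < Im z \<and> Im z < 1} - {- \<i>}"
proof -
  let ?A = "{z. \<bar>Im z\<bar> < 1}" and ?B = "{z. - 2 < Im z} \<inter> {z. Im z < 0} - {- \<i>}"
  have "(\<lambda>z. z * (cosh (of_real pi * z) / sinh (of_real pi * z))) holomorphic_on ?B"
  proof -
    have nz: "sinh (of_real pi * z) \<noteq> 0" if "z \<in> ?B" for z
    proof -
      have "z + \<i> \<noteq> 0" using that by (auto simp: complex_eq_iff)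
      moreover have "\<bar>Im (of_real pi * (z + \<i>))\<bar> < pi" using that by (auto simp: abs_mult)
      ultimately have "sinh (of_real pi * (z + \<i>)) \<noteq> 0" by (intro sinh_nonzero_strip) auto
      then show ?thesis using sinh_cosh_add_I_pi(1)[of "of_real pi * z"] by (simp add: algebra_simps)
    qed
    then show ?thesis unfolding sinh_def cosh_def by (intro holomorphic_intros) (auto simp: sinh_def)
  qed
  then have "hcoth holomorphic_on ?B"
    by (rule holomorphic_transform) (auto simp: hcoth_def coth_def)
  moreover have "open ?A" "open ?B"
    by (auto intro!: open_Collect_less continuous_intros open_Diff open_Int)
  ultimately have "hcoth holomorphic_on ?A \<union> ?B"
    by (intro holomorphic_on_Un hcoth_holomorphic)
  then show ?thesis by (rule holomorphic_on_subset) auto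
qed

lemma weight_holomorphic:
  assumes "T > 0" shows "weight T \<sigma> \<alpha> \<delta> holomorphic_on {s. \<bar>Im s\<bar> < T}"
proof -
  have "(\<lambda>s. hcoth ((s - of_real \<sigma>) / of_real T)) holomorphic_on {s. \<bar>Im s\<bar> < T}"
    by (rule holomorphic_on_compose_gen[OF _ hcoth_holomorphic, unfolded o_def])
      (use assms in \<open>auto intro!: holomorphic_intros simp: abs_mult divide_simps\<close>)
  then show ?thesis unfolding weight_def by (intro holomorphic_intros) auto
qed

lemma weight_jump:
  assumes "T > 0" "\<bar>Im s\<bar> < T" "s \<noteq> of_real \<sigma>"
  shows "(weight T \<sigma> \<alpha> \<delta> s - weight T \<sigma> \<alpha> \<delta> (s - \<i> * of_real T)) / (\<i> * of_real T)
    = of_real (\<alpha> / 2) * coth (of_real pi * (s - of_real \<sigma>) / of_real T) + of_real (\<delta> / 2)"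
proof -
  define z where "z = (s - of_real \<sigma>) / of_real T"
  have z: "z \<noteq> 0" "\<bar>Im z\<bar> < 1" using assms by (auto simp: z_def)
  have e: "(s - \<i> * of_real T - of_real \<sigma>) / of_real T = z - \<i>"
    using assms(1) by (simp add: z_def field_simps)
  have hs: "hcoth (z - \<i>) = hcoth z - \<i> * coth (of_real pi * z)"
    using z by (intro hcoth_shift) auto
  have "weight T \<sigma> \<alpha> \<delta> s - weight T \<sigma> \<alpha> \<delta> (s - \<i> * of_real T)
     = \<i> * of_real T * (of_real (\<alpha> / 2) * coth (of_real pi * z) + of_real (\<delta> / 2))"
    unfolding weight_def e z_def[symmetric] hs
    by (simp add: algebra_simps add_divide_distrib diff_divide_distrib)
  then show ?thesis using assms(1) by (simp add: z_def)
qed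

lemma weight_1 [simp]: "weight T \<sigma> \<alpha> \<delta> 1 = 0"
  by (simp add: weight_def)

lemma weight_cnj: "weight T \<sigma> \<alpha> \<delta> (cnj s) = cnj (weight T \<sigma> \<alpha> \<delta> s)"
proof -
  have "hcoth ((cnj s - of_real \<sigma>) / of_real T) = cnj (hcoth ((s - of_real \<sigma>) / of_real T))"
    by (simp flip: hcoth_cnj)
  moreover have "cnj (hcoth ((1 - of_real \<sigma>) / of_real T)) = hcoth ((1 - of_real \<sigma>) / of_real T)"
    by (simp flip: hcoth_cnj)
  ultimately show ?thesis by (simp add: weight_def)
qed

lemma coth_cnj: "coth (cnj z) = cnj (coth z)"
  by (simp add: coth_def sinh_def cosh_def exp_cnj)

lemma shift_weight_weight:
  assumes "T > 0" shows "shift_weight T \<sigma> (weight T \<sigma> \<alpha> \<delta>)"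
proof
  show "0 < T" by fact
  show "weight T \<sigma> \<alpha> \<delta> holomorphic_on {s. \<bar>Im s\<bar> < T}" by (rule weight_holomorphic[OF assms])
  show "weight T \<sigma> \<alpha> \<delta> 1 = 0" by simp
  show "weight T \<sigma> \<alpha> \<delta> (cnj s) = cnj (weight T \<sigma> \<alpha> \<delta> s)" for s by (rule weight_cnj)
  show "(\<lambda>s. weight T \<sigma> \<alpha> \<delta> (s - \<i> * of_real T)) holomorphic_on {s. - T < Im s \<and> Im s < 2 * T} - {of_real \<sigma>}"
  proof -
    have "(\<lambda>s. hcoth ((s - \<i> * of_real T - of_real \<sigma>) / of_real T)) holomorphic_on
        {s. - T < Im s \<and> Im s < 2 * T} - {of_real \<sigma>}"
    proof (rule holomorphic_on_compose_gen[OF _ hcoth_holomorphic_lower, unfolded o_def])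
      have e: "(s - \<i> * of_real T - of_real \<sigma>) / of_real T = (s - of_real \<sigma>) / of_real T - \<i>" for s
        using assms by (simp add: field_simps)
      show "(\<lambda>x. (x - \<i> * of_real T - of_real \<sigma>) / of_real T) ` ({s. - T < Im s \<and> Im s < 2 * T} - {of_real \<sigma>})
        \<subseteq> {z. - 2 < Im z \<and> Im z < 1} - {- \<i>}"
        unfolding e using assms by (auto simp: field_simps)
    qed (use assms in \<open>auto intro!: holomorphic_intros\<close>)
    then show ?thesis unfolding weight_def by (intro holomorphic_intros) auto
  qed
  fix s assume s: "\<bar>Im s\<bar> < T" "s \<noteq> complex_of_real \<sigma>"
  then have s': "\<bar>Im (cnj s)\<bar> < T" "cnj s \<noteq> complex_of_real \<sigma>"
    by (auto simp: complex_eq_iff)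
  have "(of_real pi * (cnj s - of_real \<sigma>) / of_real T) = cnj (of_real pi * (s - of_real \<sigma>) / of_real T)" by simp
  then show "(weight T \<sigma> \<alpha> \<delta> (cnj s) - weight T \<sigma> \<alpha> \<delta> (cnj s - \<i> * of_real T)) / (\<i> * of_real T)
        = cnj ((weight T \<sigma> \<alpha> \<delta> s - weight T \<sigma> \<alpha> \<delta> (s - \<i> * of_real T)) / (\<i> * of_real T))"
    unfolding weight_jump[OF assms s] weight_jump[OF assms s'] by (simp only: coth_cnj) simp
qed

lemma weight_growth:
  assumes "T > 0"
  obtains K R where "K > 0" "R > 0"
    "\<And>s. R \<le> \<bar>Re s\<bar> \<Longrightarrow> \<bar>Im s\<bar> \<le> T \<Longrightarrow> cmod (weight T \<sigma> \<alpha> \<delta> s) \<le> K * (1 + \<bar>Re s\<bar>)"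
proof -
  define C where "C = cmod (hcoth ((1 - of_real \<sigma>) / of_real T))"
  define K where "K = \<bar>\<alpha>\<bar> * (1 + \<bar>\<sigma>\<bar> + T + T / 2 * C) + \<bar>\<delta>\<bar> * (1 + T) + 1"
  have C0: "C \<ge> 0" by (simp add: C_def)
  have "cmod (weight T \<sigma> \<alpha> \<delta> s) \<le> K * (1 + \<bar>Re s\<bar>)" if s: "\<bar>\<sigma>\<bar> + T \<le> \<bar>Re s\<bar>" "\<bar>Im s\<bar> \<le> T" for s
  proof -
    have cs: "cmod s \<le> \<bar>Re s\<bar> + T" using cmod_le[of s] s by linarith
    have "T * 1 \<le> \<bar>Re s - \<sigma>\<bar>" using s by linarith
    then have "1 \<le> \<bar>Re ((s - of_real \<sigma>) / of_real T)\<bar>" using assms by (simp add: divide_simps)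
    then have "cmod (hcoth ((s - of_real \<sigma>) / of_real T)) \<le> 2 * cmod ((s - of_real \<sigma>) / of_real T)"
      by (rule norm_hcoth_le)
    also have "\<dots> = 2 / T * cmod (s - of_real \<sigma>)" using assms by (simp add: norm_divide)
    also have "\<dots> \<le> 2 / T * (\<bar>Re s\<bar> + T + \<bar>\<sigma>\<bar>)"
      using norm_triangle_ineq4[of s "of_real \<sigma>"] cs assms by (intro mult_left_mono) auto
    finally have "cmod (hcoth ((s - of_real \<sigma>) / of_real T) - hcoth ((1 - of_real \<sigma>) / of_real T))
        \<le> 2 / T * (\<bar>Re s\<bar> + T + \<bar>\<sigma>\<bar>) + C"
      using norm_triangle_ineq4[of "hcoth ((s - of_real \<sigma>) / of_real T)" "hcoth ((1 - of_real \<sigma>) / of_real T)"]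
      by (simp add: C_def)
    then have "T / 2 * cmod (hcoth ((s - of_real \<sigma>) / of_real T) - hcoth ((1 - of_real \<sigma>) / of_real T))
        \<le> T / 2 * (2 / T * (\<bar>Re s\<bar> + T + \<bar>\<sigma>\<bar>) + C)" using assms by (intro mult_left_mono) auto
    also have "\<dots> = \<bar>Re s\<bar> + T + \<bar>\<sigma>\<bar> + T / 2 * C" using assms by (simp add: field_simps)
    also have "\<dots> \<le> (1 + \<bar>\<sigma>\<bar> + T + T / 2 * C) * (1 + \<bar>Re s\<bar>)"
    proof -
      have "0 \<le> (\<bar>\<sigma>\<bar> + T + T / 2 * C) * \<bar>Re s\<bar>" using assms C0 by (intro mult_nonneg_nonneg) auto
      moreover have "(1 + \<bar>\<sigma>\<bar> + T + T / 2 * C) * (1 + \<bar>Re s\<bar>) =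
          1 + \<bar>\<sigma>\<bar> + T + T / 2 * C + \<bar>Re s\<bar> + (\<bar>\<sigma>\<bar> + T + T / 2 * C) * \<bar>Re s\<bar>" by (simp add: algebra_simps)
      ultimately show ?thesis by linarith
    qed
    finally have 1: "\<bar>\<alpha>\<bar> * (T / 2 * cmod (hcoth ((s - of_real \<sigma>) / of_real T) - hcoth ((1 - of_real \<sigma>) / of_real T)))
       \<le> \<bar>\<alpha>\<bar> * ((1 + \<bar>\<sigma>\<bar> + T + T / 2 * C) * (1 + \<bar>Re s\<bar>))"
      by (intro mult_left_mono) auto
    have "cmod (s - 1) \<le> \<bar>Re s\<bar> + T + 1" using norm_triangle_ineq4[of s 1] cs by simp
    moreover have "0 \<le> T * \<bar>Re s\<bar>" using assms by simp
    moreover have "(1 + T) * (1 + \<bar>Re s\<bar>) = 1 + T + \<bar>Re s\<bar> + T * \<bar>Re s\<bar>" by (simp add: algebra_simps)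
    moreover have "cmod ((s - 1) / 2) = cmod (s - 1) / 2" by (simp add: norm_divide)
    ultimately have "cmod ((s - 1) / 2) \<le> (1 + T) * (1 + \<bar>Re s\<bar>)"
      using norm_ge_zero[of "s - 1"] by linarith
    then have 2: "\<bar>\<delta>\<bar> * cmod ((s - 1) / 2) \<le> \<bar>\<delta>\<bar> * ((1 + T) * (1 + \<bar>Re s\<bar>))"
      by (intro mult_left_mono) auto
    have "cmod (weight T \<sigma> \<alpha> \<delta> s) \<le> \<bar>\<alpha>\<bar> * (T / 2 * cmod (hcoth ((s - of_real \<sigma>) / of_real T) - hcoth ((1 - of_real \<sigma>) / of_real T)))
        + \<bar>\<delta>\<bar> * cmod ((s - 1) / 2)"
      unfolding weight_def using assms
      by (intro order_trans[OF norm_triangle_ineq]) (simp add: norm_mult)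
    also have "\<dots> \<le> K * (1 + \<bar>Re s\<bar>)"
    proof -
      have "K * (1 + \<bar>Re s\<bar>) = \<bar>\<alpha>\<bar> * ((1 + \<bar>\<sigma>\<bar> + T + T / 2 * C) * (1 + \<bar>Re s\<bar>))
          + \<bar>\<delta>\<bar> * ((1 + T) * (1 + \<bar>Re s\<bar>)) + (1 + \<bar>Re s\<bar>)"
        unfolding K_def by (simp only: distrib_right mult.assoc mult_1_left)
      then show ?thesis using 1 2 by linarith
    qed
    finally show ?thesis .
  qed
  moreover have "K > 0" unfolding K_def using assms C0
    by (intro add_nonneg_pos add_nonneg_nonneg mult_nonneg_nonneg) auto
  moreover have "\<bar>\<sigma>\<bar> + T > 0" using assms by simp
  ultimately show ?thesis using that by blast
qed

lemma weight_derivative: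
  assumes "T > 0" "\<bar>Im s\<bar> < T"
  shows "(weight T \<sigma> \<alpha> \<delta> has_field_derivative
     of_real (\<alpha> / 2) * deriv hcoth ((s - of_real \<sigma>) / of_real T) + of_real (\<delta> / 2)) (at s)"
proof -
  have "\<bar>Im ((s - of_real \<sigma>) / of_real T)\<bar> < 1" using assms by simp
  then have h: "(hcoth has_field_derivative deriv hcoth ((s - of_real \<sigma>) / of_real T)) (at ((s - of_real \<sigma>) / of_real T))"
    by (intro holomorphic_derivI[OF hcoth_holomorphic]) (auto intro!: open_Collect_less continuous_intros)
  have "((\<lambda>s. (s - of_real \<sigma>) / of_real T) has_field_derivative 1 / of_real T) (at s)"
    using assms by (auto intro!: derivative_eq_intros)
  from DERIV_chain2[OF h this]
  have h': "((\<lambda>s. hcoth ((s - of_real \<sigma>) / of_real T)) has_field_derivative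
      deriv hcoth ((s - of_real \<sigma>) / of_real T) * (1 / of_real T)) (at s)" .
  have "((\<lambda>s. (s - 1) / 2) has_field_derivative 1 / 2) (at s)"
    by (auto intro!: derivative_eq_intros)
  from DERIV_add[OF DERIV_cmult[OF DERIV_cmult[OF DERIV_diff[OF h' DERIV_const]]] DERIV_cmult[OF this]]
  have "(weight T \<sigma> \<alpha> \<delta> has_field_derivative
     of_real \<alpha> * (of_real (T / 2) * (deriv hcoth ((s - of_real \<sigma>) / of_real T) * (1 / of_real T) - 0))
     + of_real \<delta> * (1 / 2)) (at s)"
    unfolding weight_def[abs_def] .
  then show ?thesis using assms by simp
qed

text \<open>Each of the two terms has slope at most 1/2: the first since |h'| <= 1 on the quarter
  strip, the second since |\<delta>| <= 1.\<close>

lemma norm_deriv_weight_le: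
  assumes "T > 0" "\<bar>Im s\<bar> \<le> T / 4" "\<bar>\<delta>\<bar> \<le> 1"
  shows "cmod (deriv (weight T \<sigma> 1 \<delta>) s) \<le> 1"
proof -
  have i: "\<bar>Im s\<bar> < T" "\<bar>Im ((s - of_real \<sigma>) / of_real T)\<bar> \<le> 1 / 4"
    using assms by (auto simp: divide_simps)
  have "deriv (weight T \<sigma> 1 \<delta>) s = of_real (1 / 2) * deriv hcoth ((s - of_real \<sigma>) / of_real T) + of_real (\<delta> / 2)"
    using weight_derivative[OF assms(1) i(1), of \<sigma> 1 \<delta>] by (intro DERIV_imp_deriv) simp
  also have "cmod \<dots> \<le> cmod (of_real (1 / 2) * deriv hcoth ((s - of_real \<sigma>) / of_real T)) + cmod (of_real (\<delta> / 2))"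
    by (rule norm_triangle_ineq)
  also have "\<dots> = cmod (deriv hcoth ((s - of_real \<sigma>) / of_real T)) / 2 + \<bar>\<delta>\<bar> / 2"
    by (simp add: norm_mult)
  also have "\<dots> \<le> 1"
    using norm_deriv_hcoth_le[OF i(2)] assms(3) by linarith
  finally show ?thesis .
qed

lemma weight_real: "weight T \<sigma> \<alpha> \<delta> (of_real r) = of_real (Re (weight T \<sigma> \<alpha> \<delta> (of_real r)))"
  using weight_cnj[of T \<sigma> \<alpha> \<delta> "of_real r"] by (simp add: complex_eq_iff)

text \<open>The mean value inequality, starting from the zero at 1. It is the origin of the factor t
  in the first integral of \<open>I_plus\<close>.\<close>

lemma norm_weight_le:
  assumes "T > 0" "\<bar>\<delta>\<bar> \<le> 1"
  shows "cmod (weight T \<sigma> 1 \<delta> (of_real r)) \<le> \<bar>r - 1\<bar>"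
proof -
  have "cmod (weight T \<sigma> 1 \<delta> (of_real r) - weight T \<sigma> 1 \<delta> 1) \<le> 1 * cmod (of_real r - 1)"
  proof (rule field_differentiable_bound[where S = "{s. Im s = 0}"])
    show "convex {s. Im s = 0}" by (simp add: convex_def)
    fix z assume z: "z \<in> {s. Im s = 0}"
    then show "(weight T \<sigma> 1 \<delta> has_field_derivative deriv (weight T \<sigma> 1 \<delta>) z) (at z within {s. Im s = 0})"
      using weight_derivative[OF assms(1), of z \<sigma> 1 \<delta>] assms
      by (auto intro!: has_field_derivative_at_within simp: DERIV_imp_deriv)
    show "cmod (deriv (weight T \<sigma> 1 \<delta>) z) \<le> 1"
      using z assms by (intro norm_deriv_weight_le) auto
  qed auto
  moreover have "cmod (of_real r - 1) = \<bar>r - 1\<bar>"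
    using norm_of_real[of "r - 1", where 'a = complex] by simp
  ultimately show ?thesis by simp
qed

text \<open>On the real line \<delta>\<Phi> has derivative (1 + \<delta>h')/2, positive by the
  strict bound on h', and it vanishes at 1.\<close>

lemma weight_sign:
  assumes "T > 0" "\<delta> = 1 \<or> \<delta> = -1"
  shows "r < 1 \<Longrightarrow> \<delta> * Re (weight T \<sigma> 1 \<delta> (of_real r)) < 0"
    and "1 < r \<Longrightarrow> 0 < \<delta> * Re (weight T \<sigma> 1 \<delta> (of_real r))"
proof -
  define f where "f = (\<lambda>r. \<delta> * Re (weight T \<sigma> 1 \<delta> (of_real r)))"
  have dd: "\<delta> * \<delta> = 1" using assms by auto
  have d: "\<exists>y. (f has_real_derivative y) (at u) \<and> 0 < y" for u
  proof -
    define z where "z = (u - \<sigma>) / T"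
    have zz: "(of_real u - of_real \<sigma>) / of_real T = (of_real z :: complex)" by (simp add: z_def)
    have "(weight T \<sigma> 1 \<delta> has_field_derivative
        of_real (1 / 2) * deriv hcoth (of_real z) + of_real (\<delta> / 2)) (at (of_real u))"
      using weight_derivative[OF assms(1), of "of_real u" \<sigma> 1 \<delta>] assms(1) unfolding zz by simp
    then have "((\<lambda>u. weight T \<sigma> 1 \<delta> (of_real u)) has_vector_derivative
        of_real (1 / 2) * deriv hcoth (of_real z) + of_real (\<delta> / 2)) (at u)"
      by (rule has_vector_derivative_real_field)
    from bounded_linear.has_vector_derivative[OF bounded_linear_Re this]
    have "((\<lambda>u. Re (weight T \<sigma> 1 \<delta> (of_real u))) has_real_derivative
        (Re (deriv hcoth (of_real z)) / 2 + \<delta> / 2)) (at u)"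
      by (simp add: has_real_derivative_iff_has_vector_derivative)
    then have "(f has_real_derivative \<delta> * (Re (deriv hcoth (of_real z)) / 2 + \<delta> / 2)) (at u)"
      unfolding f_def by (rule DERIV_cmult)
    moreover have "0 < \<delta> * (Re (deriv hcoth (of_real z)) / 2 + \<delta> / 2)"
      using deriv_hcoth_real(2)[of z] assms(2) by auto
    ultimately show ?thesis by blast
  qed
  have f1: "f 1 = 0" by (simp add: f_def)
  show "\<delta> * Re (weight T \<sigma> 1 \<delta> (of_real r)) < 0" if "r < 1"
    using DERIV_pos_imp_increasing[of r 1 f] d that f1 by (simp add: f_def)
  show "0 < \<delta> * Re (weight T \<sigma> 1 \<delta> (of_real r))" if "1 < r"
    using DERIV_pos_imp_increasing[of 1 r f] d that f1 by (simp add: f_def)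
qed

lemma contour_weight_weight:
  assumes "T > 0" "\<delta> = 1 \<or> \<delta> = -1"
  shows "contour_weight T (weight T \<sigma> 1 \<delta>)"
  unfolding contour_weight_def
proof (intro conjI exI ballI allI impI)
  show "weight T \<sigma> 1 \<delta> holomorphic_on {s. \<bar>Im s\<bar> < T}" by (rule weight_holomorphic[OF assms(1)])
  show "open {s. \<bar>Im s\<bar> < T}" by (intro open_Collect_less continuous_intros)
  show "R_quarter T \<subseteq> {s. \<bar>Im s\<bar> < T}" using assms by (auto simp: R_quarter_def)
  show "cmod (deriv (weight T \<sigma> 1 \<delta>) s) \<le> 1" if "s \<in> R_quarter T" for s
    using that assms by (intro norm_deriv_weight_le) (auto simp: R_quarter_def)
  show "weight T \<sigma> 1 \<delta> (of_real r) \<in> \<real>" for r by (subst weight_real) simp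
  show "(\<forall>r<1. 0 < Re (weight T \<sigma> 1 \<delta> (of_real r))) \<or> (\<forall>r<1. Re (weight T \<sigma> 1 \<delta> (of_real r)) < 0)"
    using weight_sign(1)[OF assms] assms(2) by auto
qed simp

section \<open>Segment integrals and the monomial y^(s-1)\<close>

lemma seg_integral: "seg f p q = integral {0..1} (\<lambda>u. f (linepath p q u) * (q - p))"
  by (simp add: contour_integral_integral)

lemma seg_horizontal:
  assumes "a < c"
  shows "seg f (Complex a v) (Complex c v) = integral {a..c} (\<lambda>u. f (Complex u v))"
proof -
  have l: "linepath (Complex a v) (Complex c v) u = linepath (Complex a 0) (Complex c 0) u + Complex 0 v" for u
    by (simp add: linepath_def complex_eq_iff algebra_simps)
  have "seg f (Complex a v) (Complex c v) = seg (\<lambda>s. f (s + Complex 0 v)) (Complex a 0) (Complex c 0)"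
    unfolding seg_integral l by (simp add: complex_diff)
  also have "\<dots> = integral {a..c} (\<lambda>u. f (of_real u + Complex 0 v))"
    using assms by (subst contour_integral_linepath_Reals_eq) (auto simp: complex_is_Real_iff)
  also have "(\<lambda>u. f (of_real u + Complex 0 v)) = (\<lambda>u. f (Complex u v))"
    by (intro ext arg_cong[of _ _ f]) (simp add: complex_eq_iff)
  finally show ?thesis .
qed

lemma continuous_on_seg_param:
  fixes F :: "'a::topological_space \<Rightarrow> complex \<Rightarrow> complex"
  assumes "continuous_on (U \<times> closed_segment p q) (\<lambda>(y, s). F y s)"
  shows "continuous_on U (\<lambda>y. seg (F y) p q)"
proof -
  have "continuous_on (U \<times> cbox 0 1) (\<lambda>(y, u). F y (linepath p q u) * (q - p))"
  proof -
    have "continuous_on (U \<times> cbox 0 1) (\<lambda>z. (\<lambda>(y, s). F y s) (fst z, linepath p q (snd z)) * (q - p))"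
    proof (intro continuous_on_mult_right continuous_on_compose2[OF assms])
      show "continuous_on (U \<times> cbox 0 1) (\<lambda>z. (fst z, linepath p q (snd z)))"
        unfolding linepath_def by (intro continuous_intros)
    qed (auto intro!: linepath_in_path)
    then show ?thesis by (simp add: case_prod_unfold)
  qed
  from integral_continuous_on_param[OF this] show ?thesis by (simp add: seg_integral)
qed

lemma seg_norm_le:
  assumes "continuous_on (closed_segment p q) f" "\<And>s. s \<in> closed_segment p q \<Longrightarrow> cmod (f s) \<le> M"
  shows "cmod (seg f p q) \<le> M * cmod (q - p)"
proof (rule contour_integral_bound_linepath)
  show "0 \<le> M" using order_trans[OF norm_ge_zero assms(2)[of p]] by simp
qed (use assms in \<open>auto intro: contour_integrable_continuous_linepath\<close>)

definition tmon :: "real \<Rightarrow> complex \<Rightarrow> complex" where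
  "tmon y s = of_real y powr (s - 1)"

lemma tmon_holomorphic: "y > 0 \<Longrightarrow> tmon y holomorphic_on S"
  unfolding tmon_def by (intro holomorphic_intros) auto

lemma tmon_cont: "y > 0 \<Longrightarrow> continuous_on S (tmon y)"
  by (rule holomorphic_on_imp_continuous_on[OF tmon_holomorphic])

lemma tmon_cnj: "y > 0 \<Longrightarrow> tmon y (cnj s) = cnj (tmon y s)"
  by (simp add: tmon_def powr_def exp_cnj cnj_Ln)

lemma norm_tmon: "y > 0 \<Longrightarrow> cmod (tmon y s) = y powr (Re s - 1)"
  by (simp add: tmon_def norm_powr_real_powr)

lemma tmon_Complex:
  assumes "y > 0"
  shows "tmon y (Complex u v) = of_real (y powr (u - 1)) * cis (v * ln y)"
proof -
  have "tmon y (Complex u v) = exp (of_real ((u - 1) * ln y) + \<i> * of_real (v * ln y))"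
    using assms by (simp add: tmon_def powr_def Ln_of_real complex_eq_iff exp_eq_polar algebra_simps)
  then show ?thesis
    using assms by (simp add: exp_add powr_def cis_conv_exp exp_of_real flip: of_real_mult)
qed

section \<open>The kernel\<close>

definition kernel :: "real \<Rightarrow> real \<Rightarrow> real \<Rightarrow> real \<Rightarrow> real \<Rightarrow> real" where
  "kernel T \<sigma> \<delta> \<kappa> y =
     Re (seg (\<lambda>s. weight T \<sigma> 1 \<delta> (s - \<i> * of_real T) * tmon y s) (Complex \<kappa> 0) (Complex \<kappa> T)
       + seg (\<lambda>s. weight T \<sigma> 1 \<delta> (s - \<i> * of_real T) * tmon y s) (Complex \<kappa> T) (Complex 1 T)
       + seg (\<lambda>s. weight T \<sigma> 1 \<delta> s * tmon y s) (Complex 1 0) (Complex \<kappa> 0))"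

text \<open>Multiplication by s - \<sigma> turns the coth term into \<alpha>T/2 h((s - \<sigma>)/T),
  and h(0) = 1/\<pi>. For \<alpha> = 1 the factor \<pi>T of \<open>shift_identity\<close> makes this
  T^2/2 y^(\<sigma>-1), the main term of the kernel.\<close>

lemma weight_jump_residue:
  assumes T: "T > 0" and y: "y > 0"
  shows "residue (\<lambda>s. (weight T \<sigma> \<alpha> \<delta> s - weight T \<sigma> \<alpha> \<delta> (s - \<i> * of_real T)) / (\<i> * of_real T) * tmon y s) (of_real \<sigma>)
    = of_real (\<alpha> * T / (2 * pi) * y powr (\<sigma> - 1))"
proof -
  interpret sw: shift_weight T \<sigma> "weight T \<sigma> \<alpha> \<delta>" by (rule shift_weight_weight[OF T])
  have "residue (\<lambda>s. sw.jump s * tmon y s) (of_real \<sigma>) = of_real (\<alpha> * T / (2 * pi) * y powr (\<sigma> - 1))"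
  proof (rule residue_simple'[OF sw.open_strips(1)])
    show "complex_of_real \<sigma> \<in> {s. \<bar>Im s\<bar> < T}" using T by simp
    show "(\<lambda>s. sw.jump s * tmon y s) holomorphic_on {s. \<bar>Im s\<bar> < T} - {complex_of_real \<sigma>}"
      by (intro holomorphic_on_mult sw.jump_hol tmon_holomorphic y)
    have ih: "isCont hcoth 0"
      using holomorphic_on_imp_continuous_on[OF hcoth_holomorphic]
      by (subst (asm) continuous_on_eq_continuous_at) (auto intro!: open_Collect_less continuous_intros)
    have "((\<lambda>s::complex. (s - of_real \<sigma>) / of_real T) \<longlongrightarrow> (of_real \<sigma> - of_real \<sigma>) / of_real T) (at (of_real \<sigma>))"
      by (intro tendsto_intros) (use T in auto)
    then have "((\<lambda>s. hcoth ((s - of_real \<sigma>) / of_real T)) \<longlongrightarrow> hcoth 0) (at (of_real \<sigma>))"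
      by (intro isCont_tendsto_compose[OF ih]) simp
    moreover have "(tmon y \<longlongrightarrow> tmon y (of_real \<sigma>)) (at (of_real \<sigma>))"
      using tmon_cont[OF y, of UNIV] by (simp add: continuous_on_eq_continuous_at isCont_def)
    ultimately have "((\<lambda>s. (of_real (\<alpha> / 2) * of_real T * hcoth ((s - of_real \<sigma>) / of_real T)
        + of_real (\<delta> / 2) * (s - of_real \<sigma>)) * tmon y s)
        \<longlongrightarrow> (of_real (\<alpha> / 2) * of_real T * hcoth 0 + of_real (\<delta> / 2) * (of_real \<sigma> - of_real \<sigma>)) * tmon y (of_real \<sigma>))
        (at (of_real \<sigma>))"
      by (intro tendsto_intros)
    also have "(of_real (\<alpha> / 2) * of_real T * hcoth 0 + of_real (\<delta> / 2) * (of_real \<sigma> - of_real \<sigma>)) * tmon y (of_real \<sigma>)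
       = (of_real (\<alpha> * T / (2 * pi) * y powr (\<sigma> - 1)) :: complex)"
    proof -
      have "tmon y (of_real \<sigma>) = of_real (y powr (\<sigma> - 1))"
        using tmon_Complex[OF y, of \<sigma> 0] by (simp add: complex_of_real_def)
      then show ?thesis by (simp add: hcoth_def)
    qed
    finally show "((\<lambda>s. sw.jump s * tmon y s * (s - of_real \<sigma>)) \<longlongrightarrow> of_real (\<alpha> * T / (2 * pi) * y powr (\<sigma> - 1))) (at (of_real \<sigma>))"
    proof (rule Lim_transform_eventually)
      have "\<forall>\<^sub>F s in at (of_real \<sigma>). s \<in> {s. \<bar>Im s\<bar> < T}"
        using sw.open_strips(1) T by (intro eventually_at_in_open') auto
      then show "\<forall>\<^sub>F s in at (of_real \<sigma>). (of_real (\<alpha> / 2) * of_real T * hcoth ((s - of_real \<sigma>) / of_real T)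
        + of_real (\<delta> / 2) * (s - of_real \<sigma>)) * tmon y s = sw.jump s * tmon y s * (s - of_real \<sigma>)"
        using eventually_neq_at_within[of "of_real \<sigma>" "of_real \<sigma>" UNIV]
      proof eventually_elim
        case (elim s)
        then have j: "sw.jump s = of_real (\<alpha> / 2) * coth (of_real pi * (s - of_real \<sigma>) / of_real T) + of_real (\<delta> / 2)"
          unfolding sw.jump_def sw.shifted_def by (intro weight_jump[OF T]) auto
        have hz: "hcoth ((s - of_real \<sigma>) / of_real T) = (s - of_real \<sigma>) / of_real T * coth (of_real pi * (s - of_real \<sigma>) / of_real T)"
          using elim T by (simp add: hcoth_def)
        show ?case unfolding j hz using T by (simp add: field_simps)
      qed
    qed
  qed
  then show ?thesis by (simp add: sw.jump_def sw.shifted_def)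
qed

text \<open>The unshifted weight on Im s = 0 and the shifted one on Im s = T are the same real
  number; only the phase of y^(s-1) differs, and the difference leaves the nonnegative factor 1 -
  cos(T ln y).\<close>

lemma weight_real_integrand:
  assumes "T > 0" "y > 0"
  shows "Re (weight T \<sigma> \<alpha> \<delta> (Complex u 0) * tmon y (Complex u 0)
           - weight T \<sigma> \<alpha> \<delta> (Complex u T - \<i> * of_real T) * tmon y (Complex u T))
    = Re (weight T \<sigma> \<alpha> \<delta> (of_real u)) * y powr (u - 1) * (1 - cos (T * ln y))"
proof -
  have "Complex u 0 = of_real u" "Complex u T - \<i> * of_real T = of_real u"
    by (simp_all add: complex_eq_iff)
  moreover have "Im (weight T \<sigma> \<alpha> \<delta> (of_real u)) = 0" by (subst weight_real) simp
  ultimately show ?thesis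
    using tmon_Complex[OF assms(2), of u 0] tmon_Complex[OF assms(2), of u T]
    by (simp add: complex_of_real_def[symmetric] algebra_simps)
qed

lemma eventually_lt_at_bot_real: "\<forall>\<^sub>F b in at_bot. b < (c::real)"
  by (meson eventually_at_bot_dense)

lemma growth_tendsto_0:
  fixes y :: real
  assumes "y > 1"
  shows "((\<lambda>b. K * (1 + \<bar>b\<bar>) * y powr (b - 1) * T) \<longlongrightarrow> 0) at_bot"
proof -
  have "ln y > 0" using assms by simp
  then have "((\<lambda>b. K * (1 + \<bar>b\<bar>) * exp (ln y * (b - 1)) * T) \<longlongrightarrow> 0) at_bot"
    by real_asymp
  then show ?thesis using assms by (simp add: powr_def mult.commute)
qed

lemma growth_tendsto_0':
  fixes y :: real
  assumes "0 < y" "y < 1"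
  shows "((\<lambda>b. K * (1 + \<bar>b\<bar>) * y powr (b - 1) * T) \<longlongrightarrow> 0) at_top"
proof -
  have "- ln y > 0" using assms by simp
  then have "((\<lambda>b. K * (1 + \<bar>b\<bar>) * exp (- ((- ln y) * (b - 1))) * T) \<longlongrightarrow> 0) at_top"
    by real_asymp
  then show ?thesis using assms by (simp add: powr_def mult.commute)
qed

lemma kernel_bounds:
  assumes T: "T > 0" and k: "1 < \<kappa>" "\<sigma> < \<kappa>" and d: "\<delta> = 1 \<or> \<delta> = -1"
  shows "1 < y \<Longrightarrow> 0 \<le> \<delta> * (kernel T \<sigma> \<delta> \<kappa> y - T\<^sup>2 / 2 * y powr (\<sigma> - 1))"
    and "0 < y \<Longrightarrow> y < 1 \<Longrightarrow> 0 \<le> \<delta> * kernel T \<sigma> \<delta> \<kappa> y"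
proof -
  interpret sw: shift_weight T \<sigma> "weight T \<sigma> 1 \<delta>" by (rule shift_weight_weight[OF T])
  let ?\<Phi> = "weight T \<sigma> 1 \<delta>"
  let ?U = "{s. - T < Im s \<and> Im s < 2 * T}" and ?V = "{s. \<bar>Im s\<bar> < T}"
  define g where "g = (\<lambda>y s. sw.shifted s * tmon y s)"
  define f where "f = (\<lambda>y s. ?\<Phi> s * tmon y s)"
  have kern: "kernel T \<sigma> \<delta> \<kappa> y = Re (seg (g y) (Complex \<kappa> 0) (Complex \<kappa> T) + seg (g y) (Complex \<kappa> T) (Complex 1 T)
     + seg (f y) (Complex 1 0) (Complex \<kappa> 0))" for y
    by (simp add: kernel_def g_def f_def sw.shifted_def)
  obtain K R where KR: "K > 0" "R > 0"
    "\<And>s. R \<le> \<bar>Re s\<bar> \<Longrightarrow> \<bar>Im s\<bar> \<le> T \<Longrightarrow> cmod (?\<Phi> s) \<le> K * (1 + \<bar>Re s\<bar>)"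
    using weight_growth[OF T] by metis
  have gh: "g y holomorphic_on ?U - {of_real \<sigma>}" if "y > 0" for y
    unfolding g_def by (intro holomorphic_on_mult sw.shifted_hol tmon_holomorphic that)
  have fh: "f y holomorphic_on ?V" if "y > 0" for y
    unfolding f_def by (intro holomorphic_on_mult sw.Phi_hol tmon_holomorphic that)
  have cg: "continuous_on X (g y)" if "y > 0" "X \<subseteq> ?U - {of_real \<sigma>}" for X y
    using holomorphic_on_imp_continuous_on[OF gh] continuous_on_subset that by blast
  have cf: "continuous_on X (f y)" if "y > 0" "X \<subseteq> ?V" for X y
    using holomorphic_on_imp_continuous_on[OF fh] continuous_on_subset that by blast
  have vert: "cmod (seg (g y) (Complex c 0) (Complex c T)) \<le> K * (1 + \<bar>c\<bar>) * y powr (c - 1) * T"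
    if "y > 0" "R \<le> \<bar>c\<bar>" "c \<noteq> \<sigma>" for y c
  proof -
    have "cmod (seg (g y) (Complex c 0) (Complex c T)) \<le> K * (1 + \<bar>c\<bar>) * y powr (c - 1) * cmod (Complex c T - Complex c 0)"
    proof (rule seg_norm_le)
      show "continuous_on (closed_segment (Complex c 0) (Complex c T)) (g y)"
        using that T by (intro cg) (auto simp: closed_segment_same_Re closed_segment_eq_real_ivl)
      fix s assume "s \<in> closed_segment (Complex c 0) (Complex c T)"
      then have s: "Re s = c" "0 \<le> Im s" "Im s \<le> T"
        using T by (auto simp: closed_segment_same_Re closed_segment_eq_real_ivl)
      have "cmod (sw.shifted s) \<le> K * (1 + \<bar>c\<bar>)"
        unfolding sw.shifted_def using KR(3)[of "s - \<i> * of_real T"] s that by simp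
      then show "cmod (g y s) \<le> K * (1 + \<bar>c\<bar>) * y powr (c - 1)"
        using that s by (simp add: g_def norm_mult norm_tmon mult_right_mono)
    qed
    then show ?thesis using T by (simp add: complex_diff cmod_def)
  qed
  have horiz: "seg (f y) (Complex a 0) (Complex c 0) - seg (g y) (Complex a T) (Complex c T) =
      integral {a..c} (\<lambda>u. f y (Complex u 0) - g y (Complex u T))
    \<and> (\<lambda>u. f y (Complex u 0) - g y (Complex u T)) integrable_on {a..c}" if "y > 0" "a < c" for a c y
  proof -
    have 1: "continuous_on {a..c} (\<lambda>u. f y (Complex u 0))"
      by (rule continuous_on_compose2[OF cf[OF that(1) order_refl]])
        (use T in \<open>auto intro!: continuous_intros simp: Complex_eq\<close>)
    have 2: "continuous_on {a..c} (\<lambda>u. g y (Complex u T))"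
      by (rule continuous_on_compose2[OF cg[OF that(1) order_refl]])
        (use T in \<open>auto intro!: continuous_intros simp: Complex_eq complex_eq_iff\<close>)
    show ?thesis
      unfolding seg_horizontal[OF that(2)]
      using 1 2 by (auto intro!: integral_diff[symmetric] integrable_continuous_real continuous_on_diff)
  qed
  have Rehoriz: "Re (seg (f y) (Complex a 0) (Complex c 0) - seg (g y) (Complex a T) (Complex c T)) =
      integral {a..c} (\<lambda>u. Re (?\<Phi> (of_real u)) * y powr (u - 1) * (1 - cos (T * ln y)))
     \<and> (\<lambda>u. Re (?\<Phi> (of_real u)) * y powr (u - 1) * (1 - cos (T * ln y))) integrable_on {a..c}"
    if "y > 0" "a < c" for a c y
  proof -
    have e: "Re (f y (Complex u 0) - g y (Complex u T)) = Re (?\<Phi> (of_real u)) * y powr (u - 1) * (1 - cos (T * ln y))" for u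
      unfolding f_def g_def sw.shifted_def by (rule weight_real_integrand[OF T that(1)])
    from horiz[OF that] have "((\<lambda>u. f y (Complex u 0) - g y (Complex u T)) has_integral
      (seg (f y) (Complex a 0) (Complex c 0) - seg (g y) (Complex a T) (Complex c T))) {a..c}"
      using integrable_integral by fastforce
    from has_integral_linear[OF this bounded_linear_Re]
    have "((\<lambda>u. Re (?\<Phi> (of_real u)) * y powr (u - 1) * (1 - cos (T * ln y))) has_integral
      Re (seg (f y) (Complex a 0) (Complex c 0) - seg (g y) (Complex a T) (Complex c T))) {a..c}"
      by (simp only: o_def e)
    then show ?thesis by (simp add: has_integral_iff)
  qed
  have cn: "0 \<le> 1 - cos z" for z :: real by simp
  show "0 \<le> \<delta> * (kernel T \<sigma> \<delta> \<kappa> y - T\<^sup>2 / 2 * y powr (\<sigma> - 1))" if y: "1 < y"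
  proof -
    have y0: "0 < y" using y by simp
    have lower: "- (K * (1 + \<bar>b\<bar>) * y powr (b - 1) * T) \<le> \<delta> * (kernel T \<sigma> \<delta> \<kappa> y - T\<^sup>2 / 2 * y powr (\<sigma> - 1))"
      if b: "b < 1" "b < \<sigma>" "b < - R" for b
    proof -
      \<comment> \<open>The monomial has no poles, so the only residue is that of the jump at
        \<sigma>. The height T/2 serves as \<eta>.\<close>
      have "Re (seg (g y) (Complex \<kappa> 0) (Complex \<kappa> T) + seg (g y) (Complex \<kappa> T) (Complex 1 T)) =
        Re (2 * of_real pi * \<i> * (\<Sum>p | p \<in> {} \<and> b < Re p \<and> 0 < Im p \<and> Im p < T. residue (g y) p)) +
        pi * T * Re (\<Sum>p | p \<in> {of_real \<sigma>} \<and> b < Re p \<and> Im p = 0. residue (\<lambda>s. sw.jump s * tmon y s) p)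
        + Re (seg (f y) (Complex \<kappa> 0) (Complex \<kappa> (T/2)) + seg (f y) (Complex \<kappa> (T/2)) (Complex b (T/2))
            + seg (f y) (Complex b (T/2)) (Complex b 0))
        + Re (seg (g y) (Complex b 0) (Complex b T) + seg (g y) (Complex b T) (Complex 1 T))"
        unfolding g_def f_def
        by (rule sw.shift_identity(2)[where P = "{}" and B = "tmon y"])
          (use b k T in \<open>auto intro!: tmon_holomorphic tmon_cnj y0\<close>)
      also have "{p. p \<in> {of_real \<sigma>} \<and> b < Re p \<and> Im p = 0} = {complex_of_real \<sigma>}" using b by auto
      also have "(\<Sum>p\<in>{complex_of_real \<sigma>}. residue (\<lambda>s. sw.jump s * tmon y s) p) = of_real (T / (2 * pi) * y powr (\<sigma> - 1))"
        using weight_jump_residue[OF T y0, of \<sigma> 1 \<delta>] by (simp add: sw.jump_def sw.shifted_def)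
      finally have 1: "Re (seg (g y) (Complex \<kappa> 0) (Complex \<kappa> T) + seg (g y) (Complex \<kappa> T) (Complex 1 T)) =
        T\<^sup>2 / 2 * y powr (\<sigma> - 1)
        + Re (seg (f y) (Complex \<kappa> 0) (Complex \<kappa> (T/2)) + seg (f y) (Complex \<kappa> (T/2)) (Complex b (T/2))
            + seg (f y) (Complex b (T/2)) (Complex b 0))
        + Re (seg (g y) (Complex b 0) (Complex b T) + seg (g y) (Complex b T) (Complex 1 T))"
        by (simp add: power2_eq_square)
      have "seg (f y) (Complex b 0) (Complex \<kappa> 0) + seg (f y) (Complex \<kappa> 0) (Complex \<kappa> (T/2))
         + seg (f y) (Complex \<kappa> (T/2)) (Complex b (T/2)) + seg (f y) (Complex b (T/2)) (Complex b 0)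
         = 2 * of_real pi * \<i> * (\<Sum>p\<in>{} \<inter> box (Complex b 0) (Complex \<kappa> (T/2)). residue (f y) p)"
        by (rule rect_residues[OF sw.open_strips(1,3)])
          (use fh[OF y0] b k T in \<open>auto simp: in_cbox_complex_iff\<close>)
      moreover have "seg (f y) (Complex b 0) (Complex \<kappa> 0) = seg (f y) (Complex b 0) (Complex 1 0) + seg (f y) (Complex 1 0) (Complex \<kappa> 0)"
        by (intro seg_split_Re cf y0) (use b k T in \<open>auto simp: closed_segment_same_Im closed_segment_eq_real_ivl\<close>)
      ultimately have "seg (f y) (Complex \<kappa> 0) (Complex \<kappa> (T/2))
         + seg (f y) (Complex \<kappa> (T/2)) (Complex b (T/2)) + seg (f y) (Complex b (T/2)) (Complex b 0)
         = - seg (f y) (Complex b 0) (Complex 1 0) - seg (f y) (Complex 1 0) (Complex \<kappa> 0)"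
        by (simp add: algebra_simps eq_neg_iff_add_eq_0)
      then have "kernel T \<sigma> \<delta> \<kappa> y - T\<^sup>2 / 2 * y powr (\<sigma> - 1) = Re (seg (g y) (Complex b 0) (Complex b T))
         - Re (seg (f y) (Complex b 0) (Complex 1 0) - seg (g y) (Complex b T) (Complex 1 T))"
        using 1 by (simp add: kern)
      also have "\<dots> = Re (seg (g y) (Complex b 0) (Complex b T))
         - integral {b..1} (\<lambda>u. Re (?\<Phi> (of_real u)) * y powr (u - 1) * (1 - cos (T * ln y)))"
        using Rehoriz[OF y0 b(1)] by simp
      finally have 3: "kernel T \<sigma> \<delta> \<kappa> y - T\<^sup>2 / 2 * y powr (\<sigma> - 1) = Re (seg (g y) (Complex b 0) (Complex b T))
         - integral {b..1} (\<lambda>u. Re (?\<Phi> (of_real u)) * y powr (u - 1) * (1 - cos (T * ln y)))" .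
      have 2: "\<delta> * (kernel T \<sigma> \<delta> \<kappa> y - T\<^sup>2 / 2 * y powr (\<sigma> - 1)) = \<delta> * Re (seg (g y) (Complex b 0) (Complex b T))
        + integral {b..1} (\<lambda>u. - \<delta> * (Re (?\<Phi> (of_real u)) * y powr (u - 1) * (1 - cos (T * ln y))))"
        unfolding 3 Henstock_Kurzweil_Integration.integral_mult_right by (simp only: right_diff_distrib mult_minus_left)
      have "0 \<le> integral {b..1} (\<lambda>u. - \<delta> * (Re (?\<Phi> (of_real u)) * y powr (u - 1) * (1 - cos (T * ln y))))"
      proof (rule Henstock_Kurzweil_Integration.integral_nonneg)
        show "(\<lambda>u. - \<delta> * (Re (?\<Phi> (of_real u)) * y powr (u - 1) * (1 - cos (T * ln y)))) integrable_on {b..1}"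
          using Rehoriz[OF y0 b(1)] by (intro integrable_on_mult_right) auto
        fix u assume "u \<in> {b..1}"
        then have "\<delta> * Re (?\<Phi> (of_real u)) \<le> 0"
          using weight_sign(1)[OF T d, of u] by (cases "u = 1") (auto intro: less_imp_le)
        then have "0 \<le> - (\<delta> * Re (?\<Phi> (of_real u))) * (y powr (u - 1) * (1 - cos (T * ln y)))"
          by (intro mult_nonneg_nonneg) auto
        then show "0 \<le> - \<delta> * (Re (?\<Phi> (of_real u)) * y powr (u - 1) * (1 - cos (T * ln y)))"
          by (simp only: mult.assoc mult_minus_left)
      qed
      moreover have "\<bar>\<delta> * Re (seg (g y) (Complex b 0) (Complex b T))\<bar> \<le> K * (1 + \<bar>b\<bar>) * y powr (b - 1) * T"
        using vert[OF y0, of b] b KR abs_Re_le_cmod[of "seg (g y) (Complex b 0) (Complex b T)"] d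
        by (auto simp: abs_mult)
      ultimately show ?thesis unfolding 2 by linarith
    qed
    have "\<forall>\<^sub>F b in at_bot. - (K * (1 + \<bar>b\<bar>) * y powr (b - 1) * T) \<le> \<delta> * (kernel T \<sigma> \<delta> \<kappa> y - T\<^sup>2 / 2 * y powr (\<sigma> - 1))"
      using eventually_lt_at_bot_real[of 1] eventually_lt_at_bot_real[of \<sigma>] eventually_lt_at_bot_real[of "- R"]
      by eventually_elim (rule lower)
    moreover have "((\<lambda>b. - (K * (1 + \<bar>b\<bar>) * y powr (b - 1) * T)) \<longlongrightarrow> - 0) at_bot"
      by (intro tendsto_minus growth_tendsto_0 y)
    ultimately show ?thesis
      using tendsto_upperbound[of "\<lambda>b. - (K * (1 + \<bar>b\<bar>) * y powr (b - 1) * T)" 0 at_bot] by simp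
  qed
  show "0 \<le> \<delta> * kernel T \<sigma> \<delta> \<kappa> y" if y: "0 < y" "y < 1"
  proof -
    have lower: "- (K * (1 + \<bar>c\<bar>) * y powr (c - 1) * T) \<le> \<delta> * kernel T \<sigma> \<delta> \<kappa> y" if c: "\<kappa> < c" "R < c" for c
    proof -
      have k1: "1 < c" using c k by simp
      have sU: "?U \<inter> {s. \<sigma> < Re s} \<subseteq> ?U - {of_real \<sigma>}" by auto
      have "seg (g y) (Complex \<kappa> 0) (Complex c 0) + seg (g y) (Complex c 0) (Complex c T)
         + seg (g y) (Complex c T) (Complex \<kappa> T) + seg (g y) (Complex \<kappa> T) (Complex \<kappa> 0)
         = 2 * of_real pi * \<i> * (\<Sum>p\<in>{} \<inter> box (Complex \<kappa> 0) (Complex c T). residue (g y) p)"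
      proof (rule rect_residues[of "?U \<inter> {s. \<sigma> < Re s}"])
        show "open (?U \<inter> {s. \<sigma> < Re s})" by (intro open_Int sw.open_strips(2) open_halfspace_Re_gt)
        show "convex (?U \<inter> {s. \<sigma> < Re s})" by (intro convex_Int sw.open_strips(4) convex_halfspace_Re_gt)
        show "g y holomorphic_on ?U \<inter> {s. \<sigma> < Re s} - {}" using gh[OF y(1)] sU by (auto intro: holomorphic_on_subset)
      qed (use c k T in \<open>auto simp: in_cbox_complex_iff\<close>)
      then have "seg (g y) (Complex \<kappa> 0) (Complex c 0) + seg (g y) (Complex c 0) (Complex c T)
         + seg (g y) (Complex c T) (Complex \<kappa> T) = seg (g y) (Complex \<kappa> 0) (Complex \<kappa> T)"
        using seg_reverse[of "Complex \<kappa> T" "Complex \<kappa> 0" "g y"] by (simp add: algebra_simps)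
      moreover have "seg (g y) (Complex c T) (Complex 1 T) = seg (g y) (Complex c T) (Complex \<kappa> T) + seg (g y) (Complex \<kappa> T) (Complex 1 T)"
        by (intro seg_split_Re cg y) (use c k T in \<open>auto simp: closed_segment_same_Im closed_segment_eq_real_ivl complex_eq_iff split: if_splits\<close>)
      \<comment> \<open>Right of \<sigma> on the real axis the jump is real, so \<i>T times it
        affects only the imaginary part; in the real part the shifted weight may be replaced by
        \<Phi>.\<close>
      moreover have "Re (seg (g y) (Complex \<kappa> 0) (Complex c 0)) = Re (seg (f y) (Complex \<kappa> 0) (Complex c 0))"
      proof -
        have e: "Re (g y (Complex u 0)) = Re (f y (Complex u 0))" if "u \<in> {\<kappa>..c}" for u
        proof -
          have cu: "Complex u 0 = of_real u" by (simp add: complex_eq_iff)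
          have ne: "Complex u 0 \<noteq> of_real \<sigma>" using that k by (auto simp: complex_eq_iff)
          have "Im (sw.jump (of_real u) * tmon y (of_real u)) = 0"
            using sw.jump_cnj[of "of_real u"] ne T tmon_cnj[OF y(1), of "of_real u"]
            unfolding cu by (simp add: complex_eq_iff)
          then show ?thesis unfolding g_def f_def cu sw.shifted_eq
            by (simp add: algebra_simps)
        qed
        have 1: "(\<lambda>u. g y (Complex u 0)) integrable_on {\<kappa>..c}" "(\<lambda>u. f y (Complex u 0)) integrable_on {\<kappa>..c}"
        proof -
          have "continuous_on {\<kappa>..c} (\<lambda>u. g y (Complex u 0))"
            by (rule continuous_on_compose2[OF cg[OF y(1) order_refl]])
              (use T k in \<open>auto intro!: continuous_intros simp: Complex_eq complex_eq_iff\<close>)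
          then show "(\<lambda>u. g y (Complex u 0)) integrable_on {\<kappa>..c}" by (rule integrable_continuous_real)
          have "continuous_on {\<kappa>..c} (\<lambda>u. f y (Complex u 0))"
            by (rule continuous_on_compose2[OF cf[OF y(1) order_refl]])
              (use T in \<open>auto intro!: continuous_intros simp: Complex_eq\<close>)
          then show "(\<lambda>u. f y (Complex u 0)) integrable_on {\<kappa>..c}" by (rule integrable_continuous_real)
        qed
        have "Re (integral {\<kappa>..c} (\<lambda>u. g y (Complex u 0))) = integral {\<kappa>..c} (\<lambda>u. Re (g y (Complex u 0)))"
          using has_integral_linear[OF integrable_integral[OF 1(1)] bounded_linear_Re] by (simp add: o_def has_integral_iff)
        also have "\<dots> = integral {\<kappa>..c} (\<lambda>u. Re (f y (Complex u 0)))"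
          by (rule integral_cong) (rule e)
        also have "\<dots> = Re (integral {\<kappa>..c} (\<lambda>u. f y (Complex u 0)))"
          using has_integral_linear[OF integrable_integral[OF 1(2)] bounded_linear_Re] by (simp add: o_def has_integral_iff)
        finally show ?thesis using c by (simp add: seg_horizontal)
      qed
      moreover have "seg (f y) (Complex 1 0) (Complex c 0) = seg (f y) (Complex 1 0) (Complex \<kappa> 0) + seg (f y) (Complex \<kappa> 0) (Complex c 0)"
        by (intro seg_split_Re cf y) (use c k T in \<open>auto simp: closed_segment_same_Im closed_segment_eq_real_ivl split: if_splits\<close>)
      moreover have "seg (g y) (Complex c T) (Complex 1 T) = - seg (g y) (Complex 1 T) (Complex c T)"
        by (rule seg_reverse)
      ultimately have "kernel T \<sigma> \<delta> \<kappa> y = Re (seg (g y) (Complex c 0) (Complex c T))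
         + Re (seg (f y) (Complex 1 0) (Complex c 0) - seg (g y) (Complex 1 T) (Complex c T))"
        unfolding kern by (simp add: algebra_simps complex_eq_iff)
      also have "\<dots> = Re (seg (g y) (Complex c 0) (Complex c T))
         + integral {1..c} (\<lambda>u. Re (?\<Phi> (of_real u)) * y powr (u - 1) * (1 - cos (T * ln y)))"
        using Rehoriz[OF y(1) k1] by simp
      finally have 3: "kernel T \<sigma> \<delta> \<kappa> y = Re (seg (g y) (Complex c 0) (Complex c T))
         + integral {1..c} (\<lambda>u. Re (?\<Phi> (of_real u)) * y powr (u - 1) * (1 - cos (T * ln y)))" .
      have 2: "\<delta> * kernel T \<sigma> \<delta> \<kappa> y = \<delta> * Re (seg (g y) (Complex c 0) (Complex c T))
        + integral {1..c} (\<lambda>u. \<delta> * (Re (?\<Phi> (of_real u)) * y powr (u - 1) * (1 - cos (T * ln y))))"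
        unfolding 3 Henstock_Kurzweil_Integration.integral_mult_right by (simp only: distrib_left)
      have "0 \<le> integral {1..c} (\<lambda>u. \<delta> * (Re (?\<Phi> (of_real u)) * y powr (u - 1) * (1 - cos (T * ln y))))"
      proof (rule Henstock_Kurzweil_Integration.integral_nonneg)
        show "(\<lambda>u. \<delta> * (Re (?\<Phi> (of_real u)) * y powr (u - 1) * (1 - cos (T * ln y)))) integrable_on {1..c}"
          using Rehoriz[OF y(1) k1] by (intro integrable_on_mult_right) auto
        fix u assume "u \<in> {1..c}"
        then have "0 \<le> \<delta> * Re (?\<Phi> (of_real u))"
          using weight_sign(2)[OF T d, of u] by (cases "u = 1") (auto intro: less_imp_le)
        then have "0 \<le> (\<delta> * Re (?\<Phi> (of_real u))) * (y powr (u - 1) * (1 - cos (T * ln y)))"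
          by (rule mult_nonneg_nonneg) auto
        then show "0 \<le> \<delta> * (Re (?\<Phi> (of_real u)) * y powr (u - 1) * (1 - cos (T * ln y)))"
          by (simp only: mult.assoc)
      qed
      moreover have "\<bar>\<delta> * Re (seg (g y) (Complex c 0) (Complex c T))\<bar> \<le> K * (1 + \<bar>c\<bar>) * y powr (c - 1) * T"
        using vert[OF y(1), of c] c k KR abs_Re_le_cmod[of "seg (g y) (Complex c 0) (Complex c T)"] d
        by (auto simp: abs_mult)
      ultimately show ?thesis unfolding 2 by linarith
    qed
    have "\<forall>\<^sub>F c in at_top. - (K * (1 + \<bar>c\<bar>) * y powr (c - 1) * T) \<le> \<delta> * kernel T \<sigma> \<delta> \<kappa> y"
      using eventually_gt_at_top[of \<kappa>] eventually_gt_at_top[of R] by eventually_elim (rule lower)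
    moreover have "((\<lambda>c. - (K * (1 + \<bar>c\<bar>) * y powr (c - 1) * T)) \<longlongrightarrow> - 0) at_top"
      by (intro tendsto_minus growth_tendsto_0' y)
    ultimately show ?thesis
      using tendsto_upperbound[of "\<lambda>c. - (K * (1 + \<bar>c\<bar>) * y powr (c - 1) * T)" 0 at_top] by simp
  qed
qed

lemma tmon_exp: "y > 0 \<Longrightarrow> tmon y s = exp ((s - 1) * of_real (ln y))"
  by (simp add: tmon_def powr_def Ln_of_real)

lemma continuous_on_seg_tmon:
  assumes "continuous_on (closed_segment p q) W"
  shows "continuous_on {0<..} (\<lambda>y. seg (\<lambda>s. W s * tmon y s) p q)"
proof (rule continuous_on_seg_param)
  have "continuous_on ({0<..} \<times> closed_segment p q) (\<lambda>z. W (snd z) * exp ((snd z - 1) * of_real (ln (fst z))))"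
    by (intro continuous_intros continuous_on_compose2[OF assms]) auto
  then show "continuous_on ({0<..} \<times> closed_segment p q) (\<lambda>(y, s). W s * tmon y s)"
    by (rule continuous_on_eq) (auto simp: tmon_exp)
qed

lemma weight_shift_cont:
  assumes "T > 0" "X \<subseteq> {s. - T < Im s \<and> Im s < 2 * T} - {of_real \<sigma>}"
  shows "continuous_on X (\<lambda>s. weight T \<sigma> \<alpha> \<delta> (s - \<i> * of_real T))"
  using shift_weight.shift_hol[OF shift_weight_weight[OF assms(1)]] assms(2)
  by (meson holomorphic_on_imp_continuous_on continuous_on_subset)

lemma weight_cont:
  assumes "T > 0" "X \<subseteq> {s. \<bar>Im s\<bar> < T}" shows "continuous_on X (weight T \<sigma> \<alpha> \<delta>)"
  using weight_holomorphic[OF assms(1)] assms(2)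
  by (meson holomorphic_on_imp_continuous_on continuous_on_subset)

lemma kernel_segments:
  assumes "T > 0" "1 < \<kappa>" "\<sigma> < \<kappa>"
  shows "closed_segment (Complex \<kappa> 0) (Complex \<kappa> T) \<subseteq> {s. - T < Im s \<and> Im s < 2 * T} - {of_real \<sigma>}"
    "closed_segment (Complex \<kappa> T) (Complex 1 T) \<subseteq> {s. - T < Im s \<and> Im s < 2 * T} - {of_real \<sigma>}"
    "closed_segment (Complex 1 0) (Complex \<kappa> 0) \<subseteq> {s. \<bar>Im s\<bar> < T}"
  using assms by (auto simp: closed_segment_same_Re closed_segment_same_Im closed_segment_eq_real_ivl)

lemma kernel_continuous:
  assumes "T > 0" "1 < \<kappa>" "\<sigma> < \<kappa>"
  shows "continuous_on {0<..} (kernel T \<sigma> \<delta> \<kappa>)"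
  unfolding kernel_def
  by (intro continuous_intros continuous_on_seg_tmon weight_shift_cont weight_cont
      kernel_segments[OF assms] assms)

text \<open>\<open>kernel_bounds\<close> leaves out y = 1, that is the term n = x. Continuity from
  the right gives it the bound of the branch y >= 1, in agreement with counting n = x in the partial
  sum.\<close>

lemma kernel_majorant:
  assumes T: "T > 0" and k: "1 < \<kappa>" "\<sigma> < \<kappa>" and d: "\<delta> = 1 \<or> \<delta> = -1" and y: "0 < y"
  shows "0 \<le> \<delta> * (kernel T \<sigma> \<delta> \<kappa> y - (if 1 \<le> y then T\<^sup>2 / 2 * y powr (\<sigma> - 1) else 0))"
proof -
  consider "y < 1" | "y = 1" | "1 < y" by linarith
  then show ?thesis
  proof cases
    case 2
    have "isCont (kernel T \<sigma> \<delta> \<kappa>) 1"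
      using kernel_continuous[OF T k] by (simp add: continuous_on_eq_continuous_at)
    then have "(kernel T \<sigma> \<delta> \<kappa> \<longlongrightarrow> kernel T \<sigma> \<delta> \<kappa> 1) (at_right 1)"
      by (simp add: isCont_def filterlim_at_split)
    then have "((\<lambda>y. \<delta> * (kernel T \<sigma> \<delta> \<kappa> y - T\<^sup>2 / 2 * y powr (\<sigma> - 1))) \<longlongrightarrow>
        \<delta> * (kernel T \<sigma> \<delta> \<kappa> 1 - T\<^sup>2 / 2 * 1 powr (\<sigma> - 1))) (at_right 1)"
      by (intro tendsto_intros) auto
    moreover have "\<forall>\<^sub>F y in at_right 1. 0 \<le> \<delta> * (kernel T \<sigma> \<delta> \<kappa> y - T\<^sup>2 / 2 * y powr (\<sigma> - 1))"
      using eventually_at_right_less[of "1::real"] by eventually_elim (rule kernel_bounds(1)[OF T k d])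
    ultimately have "0 \<le> \<delta> * (kernel T \<sigma> \<delta> \<kappa> 1 - T\<^sup>2 / 2 * 1 powr (\<sigma> - 1))"
      by (rule tendsto_lowerbound) simp
    then show ?thesis using 2 by simp
  qed (use kernel_bounds[OF T k d] y in auto)
qed

lemma seg_sums:
  assumes cont: "\<And>n. continuous_on (closed_segment p q) (F n)"
    and bound: "\<And>n s. s \<in> closed_segment p q \<Longrightarrow> cmod (F n s) \<le> M n" and M: "summable M"
    and sums: "\<And>s. s \<in> closed_segment p q \<Longrightarrow> (\<lambda>n. F n s) sums G s"
  shows "(\<lambda>n. seg (F n) p q) sums seg G p q"
proof -
  have "uniform_limit (closed_segment p q) (\<lambda>n s. \<Sum>i<n. F i s) (\<lambda>s. suminf (\<lambda>n. F n s)) sequentially"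
    by (rule Weierstrass_m_test[OF bound M])
  then have ul: "uniform_limit (closed_segment p q) (\<lambda>n s. \<Sum>i<n. F i s) G sequentially"
    by (rule uniform_limit_cong'[THEN iffD1, rotated -1]) (use sums in \<open>auto simp: sums_iff\<close>)
  have int: "F n contour_integrable_on linepath p q" for n
    by (rule contour_integrable_continuous_linepath[OF cont])
  have "((\<lambda>n. contour_integral (linepath p q) (\<lambda>s. \<Sum>i<n. F i s)) \<longlongrightarrow> seg G p q) sequentially"
  proof (rule contour_integral_uniform_limit(2))
    show "\<forall>\<^sub>F n in sequentially. (\<lambda>s. \<Sum>i<n. F i s) contour_integrable_on linepath p q"
      using int by (intro always_eventually allI contour_integrable_sum) auto
    show "uniform_limit (path_image (linepath p q)) (\<lambda>n s. \<Sum>i<n. F i s) G sequentially" using ul by simp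
    show "cmod (vector_derivative (linepath p q) (at t)) \<le> cmod (q - p)" for t by simp
  qed auto
  moreover have "contour_integral (linepath p q) (\<lambda>s. \<Sum>i<n. F i s) = (\<Sum>i<n. seg (F i) p q)" for n
    using int by (intro contour_integral_sum) auto
  ultimately show ?thesis by (simp add: sums_def)
qed

section \<open>Dirichlet series with nonnegative coefficients\<close>

locale dirichlet_series =
  fixes a :: "nat \<Rightarrow> real" and A :: "complex \<Rightarrow> complex"
  assumes a_nonneg: "\<And>n. n \<ge> 1 \<Longrightarrow> a n \<ge> 0"
    and abs_conv: "\<And>s. Re s > 1 \<Longrightarrow>
          summable (\<lambda>n. cmod (of_real (a (Suc n)) * of_nat (Suc n) powr (- s)))"
    and A_series: "\<And>s. Re s > 1 \<Longrightarrow>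
          (\<lambda>n. of_real (a (Suc n)) * of_nat (Suc n) powr (- s)) sums A s"
begin

text \<open>The shift by \<open>\<epsilon> > 0\<close> gives absolute convergence up to the line \<open>Re s = 1\<close>.\<close>

definition coeff :: "real \<Rightarrow> real \<Rightarrow> nat \<Rightarrow> real" where
  "coeff x \<epsilon> n = a (Suc n) / real (Suc n) * (x / real (Suc n)) powr \<epsilon>"

definition smoothed :: "real \<Rightarrow> real \<Rightarrow> complex \<Rightarrow> complex" where
  "smoothed x \<epsilon> s = A (s + of_real \<epsilon>) * of_real x powr (s + of_real \<epsilon> - 1)"

lemma term_eq:
  assumes "x > 0"
  shows "of_real (coeff x \<epsilon> n) * tmon (x / real (Suc n)) s
    = of_real (a (Suc n)) * of_nat (Suc n) powr (- (s + of_real \<epsilon>)) * of_real x powr (s + of_real \<epsilon> - 1)"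
proof -
  define m where "m = real (Suc n)"
  have m: "m > 0" by (simp add: m_def)
  have "(of_nat (Suc n) :: complex) = of_real m" by (simp add: m_def)
  then have 1: "(of_nat (Suc n) :: complex) powr (- (s + of_real \<epsilon>)) = exp (- (s + of_real \<epsilon>) * of_real (ln m))"
    using m by (simp add: powr_def Ln_of_real)
  have 2: "of_real x powr (s + of_real \<epsilon> - 1) = exp ((s + of_real \<epsilon> - 1) * of_real (ln x))"
    using assms by (simp add: powr_def Ln_of_real)
  have 3: "tmon (x / m) s = exp ((s - 1) * of_real (ln x - ln m))"
    using assms m by (simp add: tmon_exp ln_div)
  have 4: "coeff x \<epsilon> n = a (Suc n) * exp (- ln m + \<epsilon> * (ln x - ln m))"
  proof -
    have "(x / m) powr \<epsilon> = exp (\<epsilon> * (ln x - ln m))" using assms m by (simp add: powr_def ln_div)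
    moreover have "a (Suc n) / m = a (Suc n) * exp (- ln m)" using m by (simp add: exp_minus divide_inverse)
    ultimately show ?thesis unfolding coeff_def m_def[symmetric] by (simp only: exp_add mult.assoc)
  qed
  have e: "exp (of_real (- ln m + \<epsilon> * (ln x - ln m))) * exp ((s - 1) * of_real (ln x - ln m))
     = exp (- (s + of_real \<epsilon>) * of_real (ln m)) * exp ((s + of_real \<epsilon> - 1) * of_real (ln x))"
    unfolding exp_add[symmetric] by (rule arg_cong[of _ _ exp]) (simp add: algebra_simps)
  have "(of_real (a (Suc n) * exp (- ln m + \<epsilon> * (ln x - ln m))) :: complex)
      = of_real (a (Suc n)) * exp (of_real (- ln m + \<epsilon> * (ln x - ln m)))"
    by (simp only: of_real_mult exp_of_real)
  then show ?thesis
    unfolding 1 2 4 m_def[symmetric] 3 by (simp only: mult.assoc e)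
qed

lemma term_sums:
  assumes "x > 0" "\<epsilon> > 0" "1 \<le> Re s"
  shows "(\<lambda>n. of_real (coeff x \<epsilon> n) * tmon (x / real (Suc n)) s) sums smoothed x \<epsilon> s"
  unfolding term_eq[OF assms(1)] smoothed_def
  by (intro sums_mult2 A_series) (use assms in simp)

text \<open>Domination by the absolutely convergent series at 1 + \<epsilon>, uniformly in 1 <= Re s
  <= \<kappa>. The factor 1 + x^(\<kappa>-1) covers x <= 1 and x > 1 at once.\<close>

lemma term_bound:
  assumes "x > 0" "\<epsilon> > 0" "1 \<le> Re s" "Re s \<le> \<kappa>"
  shows "cmod (of_real (coeff x \<epsilon> n) * tmon (x / real (Suc n)) s)
    \<le> (1 + x powr (\<kappa> - 1)) * x powr \<epsilon> * cmod (of_real (a (Suc n)) * of_nat (Suc n) powr (- (1 + of_real \<epsilon>)))"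
proof -
  define m where "m = real (Suc n)"
  have m: "m \<ge> 1" by (simp add: m_def)
  have nm: "cmod (of_nat (Suc n) powr z) = m powr Re z" for z
  proof -
    have "(of_nat (Suc n) :: complex) = of_real m" by (simp add: m_def)
    then show ?thesis using m norm_powr_real_powr[of "of_real m" z] by simp
  qed
  have aa: "a (Suc n) \<ge> 0" using a_nonneg by simp
  have "cmod (of_real (coeff x \<epsilon> n) * tmon (x / real (Suc n)) s)
     = a (Suc n) * m powr (- (Re s + \<epsilon>)) * x powr (Re s + \<epsilon> - 1)"
    unfolding term_eq[OF assms(1)] using assms(1) aa by (simp only: norm_mult nm) (simp add: norm_powr_real_powr)
  also have "\<dots> \<le> a (Suc n) * m powr (- (1 + \<epsilon>)) * ((1 + x powr (\<kappa> - 1)) * x powr \<epsilon>)"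
  proof (intro mult_mono mult_left_mono)
    show "m powr (- (Re s + \<epsilon>)) \<le> m powr (- (1 + \<epsilon>))" using m assms by (intro powr_mono) auto
    have "x powr (Re s - 1) \<le> 1 + x powr (\<kappa> - 1)"
    proof (cases "x \<le> 1")
      case True
      then have "x powr (Re s - 1) \<le> 1" using assms by (simp add: powr_le1)
      then show ?thesis by (meson add_increasing2 powr_ge_zero)
    next
      case False
      then have "x powr (Re s - 1) \<le> x powr (\<kappa> - 1)" using assms by (intro powr_mono) auto
      then show ?thesis by simp
    qed
    then have "x powr (Re s - 1) * x powr \<epsilon> \<le> (1 + x powr (\<kappa> - 1)) * x powr \<epsilon>"
      by (intro mult_right_mono) auto
    moreover have "Re s + \<epsilon> - 1 = (Re s - 1) + \<epsilon>" by simp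
    ultimately show "x powr (Re s + \<epsilon> - 1) \<le> (1 + x powr (\<kappa> - 1)) * x powr \<epsilon>"
      by (simp only: powr_add)
  qed (use aa in auto)
  also have "\<dots> = (1 + x powr (\<kappa> - 1)) * x powr \<epsilon> * cmod (of_real (a (Suc n)) * of_nat (Suc n) powr (- (1 + of_real \<epsilon>)))"
    using aa by (simp only: norm_mult nm) simp
  finally show ?thesis .
qed

lemma seg_term_sums:
  assumes x: "x > 0" "\<epsilon> > 0" and sub: "closed_segment p q \<subseteq> {s. 1 \<le> Re s \<and> Re s \<le> \<kappa>}"
    and W: "continuous_on (closed_segment p q) W"
  shows "(\<lambda>n. of_real (coeff x \<epsilon> n) * seg (\<lambda>s. W s * tmon (x / real (Suc n)) s) p q)
     sums seg (\<lambda>s. W s * smoothed x \<epsilon> s) p q"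
proof -
  have "compact (W ` closed_segment p q)" by (intro compact_continuous_image W) auto
  from compact_imp_bounded[OF this] obtain C where C: "C > 0" "\<forall>z\<in>W ` closed_segment p q. cmod z \<le> C"
    unfolding bounded_pos by blast
  let ?t = "\<lambda>n s. of_real (coeff x \<epsilon> n) * tmon (x / real (Suc n)) s"
  have cn: "continuous_on (closed_segment p q) (\<lambda>s. W s * tmon (x / real (Suc n)) s)" for n
    using x by (intro continuous_intros W tmon_cont) auto
  have "(\<lambda>n. seg (\<lambda>s. W s * ?t n s) p q) sums seg (\<lambda>s. W s * smoothed x \<epsilon> s) p q"
  proof (rule seg_sums)
    show "continuous_on (closed_segment p q) (\<lambda>s. W s * ?t n s)" for n
      using x by (intro continuous_intros W tmon_cont) auto
    show "summable (\<lambda>n. C * ((1 + x powr (\<kappa> - 1)) * x powr \<epsilon> *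
        cmod (of_real (a (Suc n)) * of_nat (Suc n) powr (- (1 + of_real \<epsilon>)))))"
      using x by (intro summable_mult abs_conv) simp
    fix s assume s: "s \<in> closed_segment p q"
    show "cmod (W s * ?t n s) \<le> C * ((1 + x powr (\<kappa> - 1)) * x powr \<epsilon> *
        cmod (of_real (a (Suc n)) * of_nat (Suc n) powr (- (1 + of_real \<epsilon>))))" for n
      unfolding norm_mult[of "W s"] using C s sub x by (intro mult_mono term_bound) auto
    show "(\<lambda>n. W s * ?t n s) sums (W s * smoothed x \<epsilon> s)"
      using s sub x by (intro sums_mult term_sums) auto
  qed
  moreover have "seg (\<lambda>s. W s * ?t n s) p q = of_real (coeff x \<epsilon> n) * seg (\<lambda>s. W s * tmon (x / real (Suc n)) s) p q" for n
  proof -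
    have "seg (\<lambda>s. W s * ?t n s) p q = seg (\<lambda>s. of_real (coeff x \<epsilon> n) * (W s * tmon (x / real (Suc n)) s)) p q"
      by (simp add: mult_ac)
    also have "\<dots> = of_real (coeff x \<epsilon> n) * seg (\<lambda>s. W s * tmon (x / real (Suc n)) s) p q"
      by (intro contour_integral_lmul contour_integrable_continuous_linepath cn)
    finally show ?thesis .
  qed
  ultimately show ?thesis by simp
qed

definition smoothed_kernel :: "real \<Rightarrow> real \<Rightarrow> real \<Rightarrow> real \<Rightarrow> real \<Rightarrow> real \<Rightarrow> complex" where
  "smoothed_kernel T \<sigma> \<delta> \<kappa> x \<epsilon> =
     seg (\<lambda>s. weight T \<sigma> 1 \<delta> (s - \<i> * of_real T) * smoothed x \<epsilon> s) (Complex \<kappa> 0) (Complex \<kappa> T)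
       + seg (\<lambda>s. weight T \<sigma> 1 \<delta> (s - \<i> * of_real T) * smoothed x \<epsilon> s) (Complex \<kappa> T) (Complex 1 T)
       + seg (\<lambda>s. weight T \<sigma> 1 \<delta> s * smoothed x \<epsilon> s) (Complex 1 0) (Complex \<kappa> 0)"

lemma smoothed_kernel_sums:
  assumes T: "T > 0" and k: "1 < \<kappa>" "\<sigma> < \<kappa>" and x: "x > 0" "\<epsilon> > 0"
  shows "(\<lambda>n. coeff x \<epsilon> n * kernel T \<sigma> \<delta> \<kappa> (x / real (Suc n))) sums Re (smoothed_kernel T \<sigma> \<delta> \<kappa> x \<epsilon>)"
proof -
  note seg = kernel_segments[OF T k]
  have in1: "closed_segment (Complex \<kappa> 0) (Complex \<kappa> T) \<subseteq> {s. 1 \<le> Re s \<and> Re s \<le> \<kappa>}"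
    "closed_segment (Complex \<kappa> T) (Complex 1 T) \<subseteq> {s. 1 \<le> Re s \<and> Re s \<le> \<kappa>}"
    "closed_segment (Complex 1 0) (Complex \<kappa> 0) \<subseteq> {s. 1 \<le> Re s \<and> Re s \<le> \<kappa>}"
    using k by (auto simp: closed_segment_same_Re closed_segment_same_Im closed_segment_eq_real_ivl)
  have "(\<lambda>n. Re (of_real (coeff x \<epsilon> n) * seg (\<lambda>s. weight T \<sigma> 1 \<delta> (s - \<i> * of_real T) * tmon (x / real (Suc n)) s) (Complex \<kappa> 0) (Complex \<kappa> T)
      + of_real (coeff x \<epsilon> n) * seg (\<lambda>s. weight T \<sigma> 1 \<delta> (s - \<i> * of_real T) * tmon (x / real (Suc n)) s) (Complex \<kappa> T) (Complex 1 T)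
      + of_real (coeff x \<epsilon> n) * seg (\<lambda>s. weight T \<sigma> 1 \<delta> s * tmon (x / real (Suc n)) s) (Complex 1 0) (Complex \<kappa> 0)))
     sums Re (smoothed_kernel T \<sigma> \<delta> \<kappa> x \<epsilon>)"
    unfolding smoothed_kernel_def
    by (intro sums_Re sums_add seg_term_sums[OF x in1(1)] seg_term_sums[OF x in1(2)]
        seg_term_sums[OF x in1(3)] weight_shift_cont weight_cont T seg)
  then show ?thesis by (simp add: kernel_def distrib_left)
qed

lemma partial_sum_bound:
  assumes T: "T > 0" and k: "1 < \<kappa>" "\<sigma> < \<kappa>" and d: "\<delta> = 1 \<or> \<delta> = -1" and x: "x > 0" "\<epsilon> > 0"
  shows "0 \<le> \<delta> * (Re (smoothed_kernel T \<sigma> \<delta> \<kappa> x \<epsilon>)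
    - (\<Sum>n | real (Suc n) \<le> x. coeff x \<epsilon> n * (T\<^sup>2 / 2 * (x / real (Suc n)) powr (\<sigma> - 1))))"
proof -
  let ?c = "\<lambda>n. coeff x \<epsilon> n * (if 1 \<le> x / real (Suc n) then T\<^sup>2 / 2 * (x / real (Suc n)) powr (\<sigma> - 1) else 0)"
  have fin: "finite {n. real (Suc n) \<le> x}"
    by (rule finite_subset[of _ "{..nat \<lfloor>x\<rfloor>}"]) (auto simp: le_nat_floor)
  have "(\<lambda>n. if real (Suc n) \<le> x then coeff x \<epsilon> n * (T\<^sup>2 / 2 * (x / real (Suc n)) powr (\<sigma> - 1)) else 0)
      sums (\<Sum>n | real (Suc n) \<le> x. coeff x \<epsilon> n * (T\<^sup>2 / 2 * (x / real (Suc n)) powr (\<sigma> - 1)))"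
    by (rule sums_If_finite[OF fin])
  also have "(\<lambda>n. if real (Suc n) \<le> x then coeff x \<epsilon> n * (T\<^sup>2 / 2 * (x / real (Suc n)) powr (\<sigma> - 1)) else 0) = ?c"
    by (auto simp: fun_eq_iff divide_simps)
  finally have 1: "(\<lambda>n. \<delta> * (coeff x \<epsilon> n * kernel T \<sigma> \<delta> \<kappa> (x / real (Suc n)) - ?c n)) sums
     (\<delta> * (Re (smoothed_kernel T \<sigma> \<delta> \<kappa> x \<epsilon>)
    - (\<Sum>n | real (Suc n) \<le> x. coeff x \<epsilon> n * (T\<^sup>2 / 2 * (x / real (Suc n)) powr (\<sigma> - 1)))))"
    by (intro sums_mult sums_diff smoothed_kernel_sums[OF T k x])
  have "0 \<le> \<delta> * (coeff x \<epsilon> n * kernel T \<sigma> \<delta> \<kappa> (x / real (Suc n)) - ?c n)" for n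
  proof -
    have "0 \<le> coeff x \<epsilon> n * (\<delta> * (kernel T \<sigma> \<delta> \<kappa> (x / real (Suc n))
        - (if 1 \<le> x / real (Suc n) then T\<^sup>2 / 2 * (x / real (Suc n)) powr (\<sigma> - 1) else 0)))"
      using x a_nonneg by (intro mult_nonneg_nonneg kernel_majorant[OF T k d]) (auto simp: coeff_def)
    then show ?thesis by (simp only: right_diff_distrib mult.left_commute)
  qed
  from sums_le[OF this sums_zero 1] show ?thesis .
qed

end

section \<open>Poles of the continued series and its conjugation symmetry\<close>

lemma simple_pole_tendsto:
  assumes iso: "isolated_singularity_at f z" and pole: "is_pole f z" "zorder f z = -1"
  shows "((\<lambda>w. (w - z) * f w) \<longlongrightarrow> residue f z) (at z)" "residue f z \<noteq> 0"
proof -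
  obtain e where "e > 0" "f analytic_on ball z e - {z}"
    using iso by (auto simp: isolated_singularity_at_def)
  then have h: "f holomorphic_on ball z e - {z}" using analytic_imp_holomorphic by blast
  have z: "z \<in> ball z e" using \<open>e > 0\<close> by simp
  from zorder_exist_pole[OF h open_ball z pole(1)] obtain r where
    ne: "zor_poly f z z \<noteq> 0" and r: "r > 0" "zor_poly f z holomorphic_on cball z r" by blast
  have res: "residue f z = zor_poly f z z" by (rule residue_simple_pole[OF assms])
  then show "residue f z \<noteq> 0" using ne by simp
  have "zor_poly f z holomorphic_on ball z r"
    using r(2) ball_subset_cball by (rule holomorphic_on_subset)
  then have "isCont (zor_poly f z) z"
    using r(1) continuous_on_eq_continuous_at[OF open_ball, of z r "zor_poly f z"]
    by (auto dest: holomorphic_on_imp_continuous_on)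
  then have "(zor_poly f z \<longlongrightarrow> residue f z) (at z)" by (simp add: isCont_def res)
  moreover have "\<forall>\<^sub>F w in at z. zor_poly f z w = (w - z) * f w"
    using zor_poly_pole_eq[OF iso pole(1)] unfolding pole(2)
    by (rule eventually_mono) (simp add: mult.commute)
  ultimately show "((\<lambda>w. (w - z) * f w) \<longlongrightarrow> residue f z) (at z)"
    by (rule Lim_transform_eventually)
qed

lemma discrete_set_countable:
  assumes "discrete_set P" shows "countable P"
proof -
  have "P \<subseteq> (\<Union>n::nat. P \<inter> cball 0 (real n))"
    using real_arch_simple by auto
  moreover have "countable (P \<inter> cball 0 (real n))" for n
    using assms by (intro countable_finite) (simp add: discrete_set_def)
  then have "countable (\<Union>n::nat. P \<inter> cball 0 (real n))" by (rule countable_UN[OF countableI_type])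
  ultimately show ?thesis by (rule countable_subset)
qed

lemma discrete_set_Un: "discrete_set P \<Longrightarrow> discrete_set Q \<Longrightarrow> discrete_set (P \<union> Q)"
  by (simp add: discrete_set_def Int_Un_distrib2)

lemma discrete_set_cnj: assumes "discrete_set P" shows "discrete_set (cnj ` P)"
  unfolding discrete_set_def
proof (intro allI impI)
  fix K :: "complex set" assume "compact K"
  then have "compact (cnj ` K)" by (intro compact_continuous_image continuous_intros)
  then have "finite (P \<inter> cnj ` K)" using assms by (simp add: discrete_set_def)
  then have "finite (cnj ` (P \<inter> cnj ` K))" by simp
  then show "finite (cnj ` P \<inter> K)" by (rule finite_subset[rotated]) (auto simp: image_iff, metis complex_cnj_cnj)
qed

lemma eventually_not_in_discrete: "discrete_set P \<Longrightarrow> \<forall>\<^sub>F w in at z. w \<notin> P"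
proof -
  assume "discrete_set P"
  then have "closed (P - {z})" using discrete_set_closed discrete_set_subset[of P "P - {z}"] by blast
  then have "\<forall>\<^sub>F w in nhds z. w \<in> - (P - {z})" by (intro eventually_nhds_in_open open_Compl) auto
  then show ?thesis unfolding eventually_at_filter by (rule eventually_mono) auto
qed

locale meromorphic_dirichlet = dirichlet_series +
  assumes A_mero: "A nicely_meromorphic_on UNIV"
    and pole_1: "is_pole A 1" "zorder A 1 = -1"
begin

definition poles :: "complex set" where "poles = {s. is_pole A s}"

lemma iso: "isolated_singularity_at A z"
  using A_mero unfolding nicely_meromorphic_on_def
  by (meson UNIV_I meromorphic_on_isolated_singularity meromorphic_on_meromorphic_at meromorphic_on_subset subset_UNIV)

lemma discrete_poles: "discrete_set poles"
  unfolding discrete_set_def poles_def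
  using finite_not_islimpt_in_compact[of _ "{s. is_pole A s}"] not_islimpt_poles[OF iso]
  by (metis Int_commute)

lemma closed_poles: "closed poles" by (rule discrete_set_closed[OF discrete_poles])

lemma A_holomorphic: "A holomorphic_on - poles"
proof -
  have "A analytic_on - poles"
    unfolding analytic_on_analytic_at[of _ "- poles"]
    using nicely_meromorphic_on_imp_analytic_at[OF A_mero] by (auto simp: poles_def)
  then show ?thesis by (rule analytic_imp_holomorphic)
qed

lemma A_pole_0: "s \<in> poles \<Longrightarrow> A s = 0"
  using is_pole_zero_at_nicely_mero[OF A_mero] by (auto simp: poles_def)

lemma A_norm_le:
  assumes "1 < u" "u \<le> Re s"
  shows "cmod (A s) \<le> (\<Sum>n. cmod (of_real (a (Suc n)) * of_nat (Suc n) powr (- of_real u)))"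
proof -
  have s: "Re s > 1" using assms by simp
  have nm: "cmod (of_real (a (Suc n)) * of_nat (Suc n) powr z) = a (Suc n) * real (Suc n) powr Re z" for n z
  proof -
    have "cmod (of_nat (Suc n) powr z) = real (Suc n) powr Re z"
      using norm_powr_real_powr[of "of_real (real (Suc n))" z] by simp
    then show ?thesis using a_nonneg[of "Suc n"] by (simp only: norm_mult) simp
  qed
  have "cmod (A s) = cmod (\<Sum>n. of_real (a (Suc n)) * of_nat (Suc n) powr (- s))"
    using A_series[OF s] by (simp add: sums_iff)
  also have "\<dots> \<le> (\<Sum>n. cmod (of_real (a (Suc n)) * of_nat (Suc n) powr (- s)))"
    by (rule summable_norm[OF abs_conv[OF s]])
  also have "\<dots> \<le> (\<Sum>n. cmod (of_real (a (Suc n)) * of_nat (Suc n) powr (- of_real u)))"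
  proof (rule suminf_le)
    show "cmod (of_real (a (Suc n)) * of_nat (Suc n) powr (- s)) \<le> cmod (of_real (a (Suc n)) * of_nat (Suc n) powr (- of_real u))" for n
      unfolding nm using assms a_nonneg[of "Suc n"] by (intro mult_left_mono powr_mono) auto
    show "summable (\<lambda>n. cmod (of_real (a (Suc n)) * of_nat (Suc n) powr (- of_real u)))"
      using assms by (intro abs_conv) simp
  qed (rule abs_conv[OF s])
  finally show ?thesis .
qed

text \<open>The series bounds A on every half-plane Re s >= u with u > 1, so A cannot tend to
  infinity at a point with Re s > 1.\<close>

lemma poles_Re_le: assumes "s \<in> poles" shows "Re s \<le> 1"
proof (rule ccontr)
  assume "\<not> Re s \<le> 1"
  then obtain u where u: "1 < u" "u < Re s" using dense[of 1 "Re s"] by auto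
  have "open {z. u < Re z}" by (rule open_halfspace_Re_gt)
  then have "\<forall>\<^sub>F w in at s. w \<in> {z. u < Re z}" using u by (intro eventually_at_in_open') auto
  then have "\<forall>\<^sub>F w in at s. cmod (A w) \<le> (\<Sum>n. cmod (of_real (a (Suc n)) * of_nat (Suc n) powr (- of_real u)))"
    by (rule eventually_mono) (rule A_norm_le[OF u(1)], simp)
  moreover have "filterlim A at_infinity (at s)" using assms by (simp add: poles_def is_pole_def)
  then have "\<forall>\<^sub>F w in at s. cmod (A w) > (\<Sum>n. cmod (of_real (a (Suc n)) * of_nat (Suc n) powr (- of_real u)))"
    by (simp add: filterlim_at_infinity_conv_norm_at_top filterlim_at_top_dense)
  ultimately have "\<forall>\<^sub>F w in at s. False" by eventually_elim simp
  then show False by simp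
qed

lemma A_cnj_series: assumes "Re s > 1" shows "A (cnj s) = cnj (A s)"
proof -
  have e: "of_real (a (Suc n)) * of_nat (Suc n) powr (- cnj s) = cnj (of_real (a (Suc n)) * of_nat (Suc n) powr (- s))" for n
  proof -
    have "of_nat (Suc n) powr (- cnj s) = cnj (of_nat (Suc n) powr (- s))"
    proof -
      have l: "Ln (of_nat (Suc n)) = (of_real (ln (real (Suc n))) :: complex)"
        using Ln_of_real[of "real (Suc n)"] by simp
      show ?thesis by (simp only: powr_def l) (simp add: exp_cnj)
    qed
    then show ?thesis by (simp only: complex_cnj_mult complex_cnj_complex_of_real)
  qed
  have "(\<lambda>n. of_real (a (Suc n)) * of_nat (Suc n) powr (- cnj s)) sums A (cnj s)"
    by (rule A_series) (use assms in simp)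
  then have "(\<lambda>n. cnj (of_real (a (Suc n)) * of_nat (Suc n) powr (- s))) sums A (cnj s)"
    unfolding e .
  moreover have "(\<lambda>n. cnj (of_real (a (Suc n)) * of_nat (Suc n) powr (- s))) sums cnj (A s)"
    using A_series[OF assms] by (simp only: sums_cnj)
  ultimately show ?thesis by (rule sums_unique2)
qed

text \<open>The coefficients are real, so A and its reflection agree for Re s > 1, and by the
  identity theorem off the poles and their conjugates. At the poles both sides are 0, the value that
  a nicely meromorphic function takes there.\<close>

lemma A_cnj: "A (cnj s) = cnj (A s)"
proof -
  define Q where "Q = poles \<union> cnj ` poles"
  have Q: "discrete_set Q" unfolding Q_def by (intro discrete_set_Un discrete_set_cnj discrete_poles)
  have cQ: "cnj z \<in> Q \<longleftrightarrow> z \<in> Q" for z by (auto simp: Q_def image_iff) (metis complex_cnj_cnj)+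
  have op: "open (- Q)" using discrete_set_closed[OF Q] by auto
  have "connected (UNIV - Q)"
    by (intro connected_open_diff_countable discrete_set_countable Q) auto
  then have con: "connected (- Q)" by (simp add: Compl_eq_Diff_UNIV)
  have h1: "A holomorphic_on - Q" by (rule holomorphic_on_subset[OF A_holomorphic]) (auto simp: Q_def)
  have "cnj ` (- Q) \<subseteq> - Q" using cQ by auto
  then have "A holomorphic_on cnj ` (- Q)" by (rule holomorphic_on_subset[OF h1])
  then have h2: "(cnj \<circ> A \<circ> cnj) holomorphic_on - Q" by (intro holomorphic_on_compose_cnj_cnj op)
  have eqQ: "A z = cnj (A (cnj z))" if "z \<notin> Q" for z
  proof -
    have e: "A w = (cnj \<circ> A \<circ> cnj) w" if "w \<in> {z. 1 < Re z}" for w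
      using A_cnj_series[of w] that by simp
    have ne: "{z::complex. 1 < Re z} \<noteq> {}" by (auto intro: exI[of _ 2])
    have sub: "{z. 1 < Re z} \<subseteq> - Q"
    proof
      fix w assume w: "w \<in> {z. 1 < Re z}"
      then have "\<not> Re w \<le> 1" by simp
      moreover have "Re w \<le> 1" if "w \<in> cnj ` poles" using that poles_Re_le by auto
      ultimately show "w \<in> - Q" using poles_Re_le[of w] by (auto simp: Q_def)
    qed
    have "A z = (cnj \<circ> A \<circ> cnj) z"
      by (rule analytic_continuation_open[OF open_halfspace_Re_gt op ne con sub h1 h2 e])
        (use that in auto)
    then show ?thesis by simp
  qed
  \<comment> \<open>Until the pole set is known to be symmetric, a pole z does not force the value
    at \<open>cnj z\<close> to be 0.\<close>
  have pc: "cnj z \<in> poles" if "z \<in> poles" for z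
  proof -
    have "\<forall>\<^sub>F w in at (cnj z). A w = cnj (A (cnj w))"
      using eventually_not_in_discrete[OF Q] by eventually_elim (rule eqQ)
    moreover have "filterlim A at_infinity (at z)" using that by (simp add: poles_def is_pole_def)
    have fl: "filterlim cnj (at z) (at (cnj z))"
    proof (rule filterlim_atI)
      show "(cnj \<longlongrightarrow> z) (at (cnj z))" using tendsto_cnj[OF tendsto_ident_at, of "cnj z" UNIV] by simp
      show "\<forall>\<^sub>F w in at (cnj z). cnj w \<noteq> z"
        unfolding eventually_at_filter by (rule always_eventually) auto
    qed
    have "filterlim (\<lambda>w. A (cnj w)) at_infinity (at (cnj z))"
      by (rule filterlim_compose[OF \<open>filterlim A at_infinity (at z)\<close> fl])
    then have "filterlim (\<lambda>w. cnj (A (cnj w))) at_infinity (at (cnj z))"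
      by (simp add: filterlim_at_infinity_conv_norm_at_top)
    ultimately have "filterlim A at_infinity (at (cnj z))"
      by (subst filterlim_cong[OF refl refl]) auto
    then show ?thesis by (simp add: poles_def is_pole_def)
  qed
  show ?thesis
  proof (cases "s \<in> Q")
    case True
    then consider "s \<in> poles" | "cnj s \<in> poles" by (auto simp: Q_def)
    then have "s \<in> poles \<and> cnj s \<in> poles"
      by cases (use pc[of s] pc[of "cnj s"] in simp_all)
    then show ?thesis by (simp add: A_pole_0)
  next
    case False
    then show ?thesis using eqQ[of "cnj s"] cQ by simp
  qed
qed

abbreviation "res1 \<equiv> residue A 1"

lemma res1_tendsto: "((\<lambda>w. (w - 1) * A w) \<longlongrightarrow> res1) (at 1)" and res1_nonzero: "res1 \<noteq> 0"
  using simple_pole_tendsto[OF iso pole_1] by auto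

text \<open>For real u > 1 the number (u - 1) A(u) is real and nonnegative, and the residue is its
  limit from the right; it is nonzero because the pole is simple. The sign enters in
  \<open>remainder_pointwise\<close>.\<close>

lemma res1_pos: "res1 \<in> \<real>" "0 < Re res1"
proof -
  have fl: "filterlim (\<lambda>u::real. of_real u :: complex) (at 1) (at_right 1)"
    by (rule filterlim_atI) (auto intro!: tendsto_eq_intros simp: eventually_at_filter)
  have lim: "((\<lambda>u::real. (of_real u - 1) * A (of_real u)) \<longlongrightarrow> res1) (at_right 1)"
    by (rule filterlim_compose[OF res1_tendsto fl])
  have A_real: "A (of_real u) = of_real (Re (A (of_real u)))" for u
    using A_cnj[of "of_real u"] by (simp add: complex_eq_iff)
  have A_nonneg: "0 \<le> Re (A (of_real u))" if "1 < u" for u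
  proof -
    have su: "(\<lambda>n. Re (of_real (a (Suc n)) * of_nat (Suc n) powr (- of_real u))) sums Re (A (of_real u))"
      using A_series[of "of_real u"] that by (intro sums_Re) auto
    have "Re (of_real (a (Suc n)) * of_nat (Suc n) powr (- of_real u)) \<ge> 0" for n
    proof -
      have "(of_nat (Suc n) :: complex) powr (- of_real u) = of_real (real (Suc n) powr (- u))"
        using powr_of_real[of "real (Suc n)" "- u"] by simp
      then show ?thesis using a_nonneg[of "Suc n"] by (simp del: of_nat_Suc)
    qed
    then show ?thesis by (rule sums_le[OF _ sums_zero su])
  qed
  have e: "(of_real u - 1) * A (of_real u) = of_real ((u - 1) * Re (A (of_real u)))" for u
    by (subst A_real) simp
  have Im0: "Im res1 = 0"
    by (rule tendsto_unique[OF _ tendsto_Im[OF lim]]) (simp_all add: e)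
  then show "res1 \<in> \<real>" by (simp add: complex_is_Real_iff)
  have "0 \<le> Re res1"
  proof (rule tendsto_lowerbound[OF tendsto_Re[OF lim]])
    show "\<forall>\<^sub>F u in at_right 1. 0 \<le> Re ((of_real u - 1) * A (of_real u))"
      using eventually_at_right_less[of "1::real"] by eventually_elim (unfold e, use A_nonneg in auto)
  qed simp
  moreover have "Re res1 \<noteq> 0" using res1_nonzero Im0 by (auto simp: complex_eq_iff)
  ultimately show "0 < Re res1" by simp
qed

lemma one_pole: "1 \<in> poles" using pole_1 by (simp add: poles_def)

text \<open>\<open>F_reg A\<close> has a removable singularity at 1 but not necessarily the right
  value there. The contour starts at 1, so the holomorphic extension is needed.\<close>

definition regular :: "complex \<Rightarrow> complex" where
  "regular = (SOME F. F holomorphic_on - (poles - {1}) \<and> (\<forall>z\<in>- poles. F z = F_reg A z))"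

lemma regular: "regular holomorphic_on - (poles - {1})" "z \<notin> poles \<Longrightarrow> regular z = A z - res1 / (z - 1)"
proof -
  have S: "- (poles - {1}) - {1} = - poles" using one_pole by auto
  have "open (- (poles - {1}))"
    using discrete_set_closed[OF discrete_set_subset[OF discrete_poles]] by (intro open_Compl) auto
  then have i: "1 \<in> interior (- (poles - {1}))" by (simp add: interior_open)
  have h: "F_reg A holomorphic_on - (poles - {1}) - {1}"
    unfolding S F_reg_def using one_pole by (intro holomorphic_intros A_holomorphic) auto
  have "((\<lambda>z. (z - 1) * A z - res1) \<longlongrightarrow> res1 - res1) (at 1)"
    by (intro tendsto_intros res1_tendsto)
  then have "((\<lambda>z. (z - 1) * F_reg A z) \<longlongrightarrow> 0) (at 1)"
    unfolding diff_self by (rule Lim_transform_eventually)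
      (auto simp: eventually_at_filter F_reg_def right_diff_distrib)
  then have "\<exists>F. F holomorphic_on - (poles - {1}) \<and> (\<forall>z\<in>- poles. F z = F_reg A z)"
    using holomorphic_on_extend_lim[OF h i] unfolding S by blast
  then have "regular holomorphic_on - (poles - {1}) \<and> (\<forall>z\<in>- poles. regular z = F_reg A z)"
    unfolding regular_def by (rule someI_ex)
  then show "regular holomorphic_on - (poles - {1})" "z \<notin> poles \<Longrightarrow> regular z = A z - res1 / (z - 1)"
    by (auto simp: F_reg_def)
qed

lemma open_off_poles: "open (- (poles - {1}))" "open (- poles)"
  by (rule open_Compl, rule discrete_set_closed, rule discrete_set_subset[OF discrete_poles], rule Diff_subset)
    (rule open_Compl[OF closed_poles])

end

section \<open>Cancelling the pole at 1, and the limit \<epsilon> to 0\<close>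

definition slope1 :: "(complex \<Rightarrow> complex) \<Rightarrow> complex \<Rightarrow> complex" where
  "slope1 W s = (if s = 1 then deriv W 1 else W s / (s - 1))"

lemma slope1_holomorphic:
  assumes "W holomorphic_on S" "open S" "1 \<in> S" "W 1 = 0"
  shows "slope1 W holomorphic_on S"
proof -
  have "1 \<in> interior S" using assms by (simp add: interior_open)
  then have "(\<lambda>z. if z = 1 then deriv W 1 else (W z - W 1) / (z - 1)) holomorphic_on S"
    by (rule pole_lemma[OF assms(1)])
  then show ?thesis unfolding slope1_def assms(4) diff_zero .
qed

lemma slope1_mult: "W 1 = 0 \<Longrightarrow> (s - 1) * slope1 W s = W s"
  by (simp add: slope1_def)

context meromorphic_dirichlet
begin

text \<open>For \<open>W(1) = 0\<close> this is \<open>W(s) A(s) x\<^sup>s\<^sup>-\<^sup>1\<close> with its removable singularity at \<open>1\<close> filled in.\<close>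

definition filled :: "(complex \<Rightarrow> complex) \<Rightarrow> real \<Rightarrow> complex \<Rightarrow> complex" where
  "filled W x s = (W s * regular s + res1 * slope1 W s) * tmon x s"

lemma filled_eq:
  assumes "W 1 = 0" "s \<notin> poles"
  shows "filled W x s = W s * A s * tmon x s"
proof -
  have "s \<noteq> 1" using assms one_pole by auto
  then show ?thesis using regular(2)[OF assms(2)] by (simp add: filled_def slope1_def right_diff_distrib)
qed

lemma filled_holomorphic:
  assumes "W holomorphic_on S" "open S" "1 \<in> S" "W 1 = 0" "x > 0"
  shows "filled W x holomorphic_on S - (poles - {1})"
  unfolding filled_def
  by (intro holomorphic_intros tmon_holomorphic assms(5) holomorphic_on_subset[OF assms(1)]
      holomorphic_on_subset[OF regular(1)] holomorphic_on_subset[OF slope1_holomorphic[OF assms(1-4)]]) auto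

text \<open>Translating the segment to the right meets no pole, so the integrand is jointly
  continuous in \<epsilon> and s, including \<epsilon> = 0.\<close>

lemma seg_smoothed_tendsto:
  assumes x: "x > 0" and W: "continuous_on (closed_segment p q) W"
    and seg: "\<And>s. s \<in> closed_segment p q \<Longrightarrow> 1 \<le> Re s \<and> s \<notin> poles"
  shows "(\<lambda>m. seg (\<lambda>s. W s * smoothed x (1 / real (Suc m)) s) p q) \<longlonglongrightarrow> seg (\<lambda>s. W s * A s * tmon x s) p q"
proof -
  have "continuous_on {0..} (\<lambda>\<epsilon>. seg (\<lambda>s. W s * smoothed x \<epsilon> s) p q)"
  proof (rule continuous_on_seg_param)
    have np: "s + of_real \<epsilon> \<notin> poles" if "s \<in> closed_segment p q" "0 \<le> \<epsilon>" for s \<epsilon>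
      using seg[OF that(1)] that(2) poles_Re_le[of "s + of_real \<epsilon>"] by (cases "\<epsilon> = 0") force+
    have cA: "continuous_on (- poles) (\<lambda>s. A s * tmon x s)"
      by (intro continuous_intros holomorphic_on_imp_continuous_on A_holomorphic tmon_cont x)
    have "continuous_on ({0..} \<times> closed_segment p q) (\<lambda>z. A (snd z + of_real (fst z)) * tmon x (snd z + of_real (fst z)))"
      by (rule continuous_on_compose2[OF cA]) (use np in \<open>auto intro!: continuous_intros simp: add.commute\<close>)
    moreover have "continuous_on ({0..} \<times> closed_segment p q) (\<lambda>z. W (snd z))"
      by (rule continuous_on_compose2[OF W]) (auto intro!: continuous_intros)
    ultimately have "continuous_on ({0..} \<times> closed_segment p q)
       (\<lambda>z. W (snd z) * (A (snd z + of_real (fst z)) * tmon x (snd z + of_real (fst z))))"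
      by (rule continuous_on_mult[rotated])
    then show "continuous_on ({0..} \<times> closed_segment p q) (\<lambda>(\<epsilon>, s). W s * smoothed x \<epsilon> s)"
      by (rule continuous_on_eq) (simp add: smoothed_def tmon_def case_prod_unfold)
  qed
  then have "((\<lambda>\<epsilon>. seg (\<lambda>s. W s * smoothed x \<epsilon> s) p q) \<longlongrightarrow> seg (\<lambda>s. W s * smoothed x 0 s) p q) (at 0 within {0..})"
    by (simp add: continuous_on_def)
  moreover have "filterlim (\<lambda>m. 1 / real (Suc m)) (at 0 within {0..}) sequentially"
    unfolding filterlim_at using LIMSEQ_Suc[OF lim_1_over_n] by auto
  ultimately have "(\<lambda>m. seg (\<lambda>s. W s * smoothed x (1 / real (Suc m)) s) p q) \<longlonglongrightarrow> seg (\<lambda>s. W s * smoothed x 0 s) p q"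
    by (rule filterlim_compose)
  then show ?thesis by (simp add: smoothed_def tmon_def mult.assoc)
qed

text \<open>This segment starts at the pole, which the smoothing moves to 1 - \<epsilon>, so joint
  continuity fails. Dominated convergence takes over: the zero of W contributes u - 1 and the pole
  1/(u - 1 + \<epsilon>), a quotient between 0 and 1.\<close>

lemma seg_smoothed_real_tendsto:
  assumes x: "x > 0" and k: "1 < \<kappa>" and W: "continuous_on {1..\<kappa>} (\<lambda>u. W (Complex u 0))" 
   and W1: "continuous_on {1..\<kappa>} (\<lambda>u. slope1 W (Complex u 0))" "W 1 = 0"
  shows "(\<lambda>m. seg (\<lambda>s. W s * smoothed x (1 / real (Suc m)) s) (Complex 1 0) (Complex \<kappa> 0))
    \<longlonglongrightarrow> seg (filled W x) (Complex 1 0) (Complex \<kappa> 0)"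
proof -
  define e where "e = (\<lambda>m. 1 / real (Suc m))"
  have e: "e m > 0" "e m \<le> 1" for m by (auto simp: e_def)
  have e0: "e \<longlonglongrightarrow> 0" unfolding e_def by (rule LIMSEQ_Suc[OF lim_1_over_n])
  \<comment> \<open>This is (s - 1) A(s) x^(s-1) on the real axis, continued across s = 1 by means
    of the residue and therefore continuous on [1, \<infinity>).\<close>
  define k where "k = (\<lambda>u. ((Complex u 0 - 1) * regular (Complex u 0) + res1) * tmon x (Complex u 0))"
  have np: "Complex u 0 \<in> - (poles - {1})" if "1 \<le> u" for u
    using poles_Re_le[of "Complex u 0"] that by (auto simp: complex_eq_iff)
  have Cc: "continuous_on X (\<lambda>u. Complex u 0)" for X
    unfolding Complex_eq by (intro continuous_intros)
  have kc: "continuous_on {1..} k"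
    unfolding k_def
    by (intro continuous_intros Cc continuous_on_compose2[OF tmon_cont[OF x, of UNIV] Cc]
        continuous_on_compose2[OF holomorphic_on_imp_continuous_on[OF regular(1)] Cc]) (use np in auto)
  have "compact (k ` {1..\<kappa>+1})"
    by (intro compact_continuous_image continuous_on_subset[OF kc]) auto
  from compact_imp_bounded[OF this] obtain D where D: "\<And>u. u \<in> {1..\<kappa>+1} \<Longrightarrow> cmod (k u) \<le> D"
    unfolding bounded_iff by blast
  have "compact ((\<lambda>u. slope1 W (Complex u 0)) ` {1..\<kappa>})"
    by (intro compact_continuous_image W1) auto
  from compact_imp_bounded[OF this] obtain E where E: "\<And>u. u \<in> {1..\<kappa>} \<Longrightarrow> cmod (slope1 W (Complex u 0)) \<le> E"
    unfolding bounded_iff by blast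
  have D0: "0 \<le> D" using order_trans[OF norm_ge_zero D[of 1]] k by simp
  have E0: "0 \<le> E" using order_trans[OF norm_ge_zero E[of 1]] k by simp
  define f where "f = (\<lambda>m u. W (Complex u 0) * smoothed x (e m) (Complex u 0))"
  have f: "f m u = slope1 W (Complex u 0) * k (u + e m) * of_real ((u - 1) / (u - 1 + e m))" if "1 \<le> u" for m u
  proof -
    define v where "v = u + e m"
    have v: "v > 1" using that e[of m] by (simp add: v_def)
    have cv: "Complex u 0 + of_real (e m) = Complex v 0" by (simp add: complex_eq_iff v_def)
    have np: "Complex v 0 \<notin> poles" "Complex v 0 \<noteq> 1" using poles_Re_le[of "Complex v 0"] v by (auto simp: complex_eq_iff)
    have "k v = (Complex v 0 - 1) * A (Complex v 0) * tmon x (Complex v 0)"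
      using np by (simp add: k_def regular(2) right_diff_distrib)
    moreover have "Complex v 0 - 1 = of_real (v - 1)" by (simp add: complex_eq_iff)
    ultimately have kv: "k v = of_real (v - 1) * A (Complex v 0) * tmon x (Complex v 0)" by (simp only:)
    have "Complex u 0 - 1 = of_real (u - 1)" by (simp add: complex_eq_iff)
    then have Wu: "W (Complex u 0) = of_real (u - 1) * slope1 W (Complex u 0)"
      using slope1_mult[of W, OF W1(2), of "Complex u 0"] by (simp only:)
    have "f m u = W (Complex u 0) * (A (Complex v 0) * tmon x (Complex v 0))"
      by (simp only: f_def smoothed_def cv tmon_def)
    also have "\<dots> = slope1 W (Complex u 0) * (of_real (v - 1) * A (Complex v 0) * tmon x (Complex v 0)) * of_real ((u - 1) / (v - 1))"
    proof -
      have "of_real (u - 1) = (of_real (v - 1) * of_real ((u - 1) / (v - 1)) :: complex)"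
        unfolding of_real_mult[symmetric] using v by (intro arg_cong[of _ _ of_real]) simp
      then show ?thesis unfolding Wu by (simp only: mult_ac)
    qed
    also have "\<dots> = slope1 W (Complex u 0) * k (u + e m) * of_real ((u - 1) / (u - 1 + e m))"
      unfolding kv[symmetric] by (simp add: v_def add_diff_eq algebra_simps)
    finally show ?thesis .
  qed
  \<comment> \<open>At u = 1 every \<open>f m\<close> vanishes while \<open>filled\<close> need not;
    the pointwise limit differs from it at this single point.\<close>
  define g where "g = (\<lambda>u. if u = 1 then 0 else slope1 W (Complex u 0) * k u)"
  have fc: "continuous_on {1..\<kappa>} (f m)" for m
  proof -
    have "continuous_on {1..\<kappa>} (\<lambda>u. slope1 W (Complex u 0) * k (u + e m) * of_real ((u - 1) / (u - 1 + e m)))"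
      using e[of m] by (intro continuous_intros W1 continuous_on_compose2[OF kc]) auto
    then show ?thesis by (rule continuous_on_eq) (simp add: f)
  qed
  have "(\<lambda>m. integral {1..\<kappa>} (f m)) \<longlonglongrightarrow> integral {1..\<kappa>} g"
  proof (rule dominated_convergence(2))
    show "f m integrable_on {1..\<kappa>}" for m by (rule integrable_continuous_real[OF fc])
    show "(\<lambda>u. E * D) integrable_on {1..\<kappa>}" by (rule integrable_const_ivl)
    show "norm (f m u) \<le> E * D" if "u \<in> {1..\<kappa>}" for m u
    proof -
      have "norm (f m u) = cmod (slope1 W (Complex u 0)) * cmod (k (u + e m)) * \<bar>(u - 1) / (u - 1 + e m)\<bar>"
        using that by (simp add: f norm_mult del: of_real_divide)
      also have "\<dots> \<le> E * D * 1"
      proof (intro mult_mono)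
        show "\<bar>(u - 1) / (u - 1 + e m)\<bar> \<le> 1" using e[of m] that by auto
      qed (use that E[of u] e[of m] D0 E0 in \<open>auto intro!: D\<close>)
      finally show ?thesis by simp
    qed
    show "(\<lambda>m. f m u) \<longlonglongrightarrow> g u" if "u \<in> {1..\<kappa>}" for u
    proof (cases "u = 1")
      case True
      then show ?thesis by (simp add: f g_def)
    next
      case False
      then have u: "u > 1" using that by auto
      have "isCont k u" using kc u by (intro continuous_on_interior[OF kc]) (auto simp: interior_real_atLeast)
      moreover have "(\<lambda>m. u + e m) \<longlonglongrightarrow> u + 0" by (intro tendsto_intros e0)
      ultimately have k': "(\<lambda>m. k (u + e m)) \<longlonglongrightarrow> k u" by (auto intro: isCont_tendsto_compose)
      have "(\<lambda>m. slope1 W (Complex u 0) * k (u + e m) * of_real ((u - 1) / (u - 1 + e m)))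
         \<longlonglongrightarrow> slope1 W (Complex u 0) * k u * of_real ((u - 1) / (u - 1 + 0))"
        using u by (intro tendsto_intros k' e0) auto
      then show ?thesis using u by (simp add: f g_def)
    qed
  qed
  moreover have "integral {1..\<kappa>} g = integral {1..\<kappa>} (\<lambda>u. filled W x (Complex u 0))"
  proof (rule integral_spike[of "{1}"])
    show "filled W x (Complex u 0) = g u" if "u \<in> {1..\<kappa>} - {1}" for u
    proof -
      have Wu: "W (Complex u 0) = (Complex u 0 - 1) * slope1 W (Complex u 0)"
        by (simp add: slope1_mult W1)
      show ?thesis unfolding filled_def g_def k_def Wu using that by (simp add: algebra_simps)
    qed
  qed simp
  ultimately show ?thesis unfolding seg_horizontal[OF \<open>1 < \<kappa>\<close>] f_def e_def by simp
qed

text \<open>The bound for positive \<epsilon> passes to the limit along \<epsilon> = 1/(m + 1). The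
  partial sum is finite and converges term by term.\<close>

lemma partial_sum_le:
  assumes T: "T > 0" and k: "1 < \<kappa>" "\<sigma> < \<kappa>" and d: "\<delta> = 1 \<or> \<delta> = -1" and x: "x > 0"
    and line: "\<And>s. Re s = 1 \<Longrightarrow> \<bar>Im s\<bar> \<le> T \<Longrightarrow> s \<noteq> 1 \<Longrightarrow> s \<notin> poles"
  shows "0 \<le> \<delta> * (Re (seg (\<lambda>s. weight T \<sigma> 1 \<delta> (s - \<i> * of_real T) * A s * tmon x s) (Complex \<kappa> 0) (Complex \<kappa> T)
      + seg (\<lambda>s. weight T \<sigma> 1 \<delta> (s - \<i> * of_real T) * A s * tmon x s) (Complex \<kappa> T) (Complex 1 T)
      + seg (filled (weight T \<sigma> 1 \<delta>) x) (Complex 1 0) (Complex \<kappa> 0))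
    - T\<^sup>2 / 2 * ((\<Sum>n | 1 \<le> n \<and> real n \<le> x. a n * real n powr (- \<sigma>)) / x powr (1 - \<sigma>)))"
proof -
  note seg = kernel_segments[OF T k]
  have re: "1 \<le> Re s \<and> s \<notin> poles" if "s \<in> closed_segment (Complex \<kappa> 0) (Complex \<kappa> T) \<union> closed_segment (Complex \<kappa> T) (Complex 1 T)" for s
    using that k T poles_Re_le[of s] line[of s]
    by (auto simp: closed_segment_same_Re closed_segment_same_Im closed_segment_eq_real_ivl complex_eq_iff)
  have C0: "Complex u 0 = of_real u" for u by (simp add: complex_eq_iff)
  have st: "{s. \<bar>Im s\<bar> < T} = {s. - T < Im s} \<inter> {s. Im s < T}" by auto
  have op: "open {s. \<bar>Im s\<bar> < T}" unfolding st by (intro open_Int open_halfspace_Im_gt open_halfspace_Im_lt)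
  have W: "continuous_on {1..\<kappa>} (\<lambda>u. h (Complex u 0))" if "h holomorphic_on {s. \<bar>Im s\<bar> < T}" for h
    unfolding C0 using T by (intro continuous_on_compose2[OF holomorphic_on_imp_continuous_on[OF that]] continuous_intros) auto
  have lim: "(\<lambda>m. smoothed_kernel T \<sigma> \<delta> \<kappa> x (1 / real (Suc m))) \<longlonglongrightarrow>
      seg (\<lambda>s. weight T \<sigma> 1 \<delta> (s - \<i> * of_real T) * A s * tmon x s) (Complex \<kappa> 0) (Complex \<kappa> T)
      + seg (\<lambda>s. weight T \<sigma> 1 \<delta> (s - \<i> * of_real T) * A s * tmon x s) (Complex \<kappa> T) (Complex 1 T)
      + seg (filled (weight T \<sigma> 1 \<delta>) x) (Complex 1 0) (Complex \<kappa> 0)"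
    unfolding smoothed_kernel_def
    using re by (intro tendsto_add seg_smoothed_tendsto seg_smoothed_real_tendsto x k weight_shift_cont[OF T] seg W
        weight_holomorphic[OF T] slope1_holomorphic[OF weight_holomorphic[OF T] op] weight_1) (auto simp: T)
  have e0: "(\<lambda>m. 1 / real (Suc m)) \<longlonglongrightarrow> 0" by (rule LIMSEQ_Suc[OF lim_1_over_n])
  have "(\<lambda>m. coeff x (1 / real (Suc m)) n * (T\<^sup>2 / 2 * (x / real (Suc n)) powr (\<sigma> - 1)))
     \<longlonglongrightarrow> T\<^sup>2 / 2 * (a (Suc n) * real (Suc n) powr (- \<sigma>) / x powr (1 - \<sigma>))" for n
  proof -
    define m where "m = real (Suc n)"
    have m: "m > 0" by (simp add: m_def)
    have "(\<lambda>j. a (Suc n) / m * (x / m) powr (1 / real (Suc j)) * (T\<^sup>2 / 2 * (x / m) powr (\<sigma> - 1)))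
      \<longlonglongrightarrow> a (Suc n) / m * (x / m) powr 0 * (T\<^sup>2 / 2 * (x / m) powr (\<sigma> - 1))"
      using x m by (intro tendsto_intros e0) auto
    moreover have "a (Suc n) / m * (x / m) powr 0 * (T\<^sup>2 / 2 * (x / m) powr (\<sigma> - 1))
       = T\<^sup>2 / 2 * (a (Suc n) * m powr (- \<sigma>) / x powr (1 - \<sigma>))"
      using x m by (simp add: powr_divide powr_diff powr_minus field_simps)
    ultimately show ?thesis unfolding coeff_def m_def by simp
  qed
  then have sl: "(\<lambda>m. \<Sum>n | real (Suc n) \<le> x. coeff x (1 / real (Suc m)) n * (T\<^sup>2 / 2 * (x / real (Suc n)) powr (\<sigma> - 1)))
     \<longlonglongrightarrow> (\<Sum>n | real (Suc n) \<le> x. T\<^sup>2 / 2 * (a (Suc n) * real (Suc n) powr (- \<sigma>) / x powr (1 - \<sigma>)))"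
    by (intro tendsto_sum)
  have se: "(\<Sum>n | real (Suc n) \<le> x. T\<^sup>2 / 2 * (a (Suc n) * real (Suc n) powr (- \<sigma>) / x powr (1 - \<sigma>)))
    = T\<^sup>2 / 2 * ((\<Sum>n | 1 \<le> n \<and> real n \<le> x. a n * real n powr (- \<sigma>)) / x powr (1 - \<sigma>))"
    unfolding sum_divide_distrib sum_distrib_left
    by (rule sum.reindex_bij_witness[of _ "\<lambda>n. n - 1" Suc]) auto
  show ?thesis
  proof (rule tendsto_lowerbound)
    show "(\<lambda>m. \<delta> * (Re (smoothed_kernel T \<sigma> \<delta> \<kappa> x (1 / real (Suc m)))
       - (\<Sum>n | real (Suc n) \<le> x. coeff x (1 / real (Suc m)) n * (T\<^sup>2 / 2 * (x / real (Suc n)) powr (\<sigma> - 1))))) \<longlonglongrightarrow>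
      \<delta> * (Re (seg (\<lambda>s. weight T \<sigma> 1 \<delta> (s - \<i> * of_real T) * A s * tmon x s) (Complex \<kappa> 0) (Complex \<kappa> T)
      + seg (\<lambda>s. weight T \<sigma> 1 \<delta> (s - \<i> * of_real T) * A s * tmon x s) (Complex \<kappa> T) (Complex 1 T)
      + seg (filled (weight T \<sigma> 1 \<delta>) x) (Complex 1 0) (Complex \<kappa> 0))
    - T\<^sup>2 / 2 * ((\<Sum>n | 1 \<le> n \<and> real n \<le> x. a n * real n powr (- \<sigma>)) / x powr (1 - \<sigma>)))"
      unfolding se[symmetric] by (intro tendsto_intros tendsto_Re lim sl)
    show "\<forall>\<^sub>F m in sequentially. 0 \<le> \<delta> * (Re (smoothed_kernel T \<sigma> \<delta> \<kappa> x (1 / real (Suc m)))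
       - (\<Sum>n | real (Suc n) \<le> x. coeff x (1 / real (Suc m)) n * (T\<^sup>2 / 2 * (x / real (Suc n)) powr (\<sigma> - 1))))"
      by (intro always_eventually allI partial_sum_bound T k d x) simp
  qed simp
qed

end

section \<open>Shifting the contour\<close>

locale ladder_contour = meromorphic_dirichlet a A + descending_contour \<gamma> T
  for a A \<gamma> T +
  fixes \<sigma>n :: "nat \<Rightarrow> real" and x :: real
  assumes line: "\<And>s. Re s = 1 \<Longrightarrow> \<bar>Im s\<bar> \<le> T \<Longrightarrow> s \<noteq> 1 \<Longrightarrow> s \<notin> poles"
    and rungs: "filterlim \<sigma>n at_bot sequentially"
    and ladder_bounded: "bounded_away_from_1 A T (ladder T \<sigma>n)"
    and contour_bounded: "bounded_away_from_1 A T (\<gamma> ` {0..})"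
    and real_poles_below: "\<And>\<rho>. \<rho> \<in> poles \<Longrightarrow> Im \<rho> = 0 \<Longrightarrow> \<rho> \<noteq> 1 \<Longrightarrow> lies_below (\<gamma> ` {0..}) \<rho>"
    and upper_poles_above: "\<And>\<rho>. \<rho> \<in> poles \<Longrightarrow> 0 < Im \<rho> \<Longrightarrow> lies_above (\<gamma> ` {0..}) \<rho>"
    and x_gt: "T < x"
begin

text \<open>The places where the growth of A is controlled. Only the upper half of the ladder is
  kept, because the lower half enters through conjugation.\<close>

abbreviation frame :: "complex set" where "frame \<equiv> {s \<in> ladder T \<sigma>n. 0 \<le> Im s} \<union> \<gamma> ` {0..}"

lemma x_pos: "0 < x" using x_gt T_pos by simp

lemma frame_no_pole: "s \<in> frame \<Longrightarrow> s \<noteq> 1 \<Longrightarrow> s \<notin> poles"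
  using ladder_bounded contour_bounded by (auto simp: bounded_away_from_1_def poles_def)

lemma rung_in_frame: "0 \<le> v \<Longrightarrow> v \<le> T \<Longrightarrow> Complex (\<sigma>n n) v \<in> frame"
  by (auto simp: ladder_def)

lemma top_in_frame: "u \<le> 1 \<Longrightarrow> Complex u T \<in> frame"
  using T_pos by (auto simp: ladder_def)

lemma frame_Im: "s \<in> frame \<Longrightarrow> 0 \<le> Im s \<and> Im s \<le> T"
  using gamma_region T_pos by (force simp: ladder_def)

lemma poles_rung: assumes "p \<in> poles" "\<bar>Im p\<bar> \<le> T" "\<sigma>n n < 1" shows "Re p \<noteq> \<sigma>n n"
proof
  assume r: "Re p = \<sigma>n n"
  then have "p \<in> ladder T \<sigma>n - {1}" using assms(2,3) by (auto simp: ladder_def)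
  then show False using ladder_bounded assms(1) unfolding bounded_away_from_1_def poles_def by blast
qed

lemma poles_Im: assumes "p \<in> poles" shows "Im p \<noteq> T"
proof
  assume i: "Im p = T"
  then have "p \<in> frame" using top_in_frame[of "Re p"] poles_Re_le[OF assms] by (metis complex_surj)
  moreover have "p \<noteq> 1" using i T_pos by auto
  ultimately show False using frame_no_pole[of p] assms by blast
qed

text \<open>For Re s <= 1/2 the point lies outside the ball of radius 1/4 about 1, so both
  boundedness hypotheses apply; dividing by |T^s| gives the factor T^(-Re s).\<close>

lemma A_growth: obtains M where "M \<ge> 0" "\<And>s. s \<in> frame \<Longrightarrow> Re s \<le> 1 / 2 \<Longrightarrow> cmod (A s) \<le> M * T powr (- Re s)"
proof -
  have bd: "\<exists>M. \<forall>s\<in>S - ball 1 (1/4). cmod (A s * of_real T powr s) \<le> M" if "bounded_away_from_1 A T S" for S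
  proof -
    have "bounded ((\<lambda>s. A s * of_real T powr s) ` (S - ball 1 (1/4)))"
      using that unfolding bounded_away_from_1_def by (metis zero_less_divide_1_iff zero_less_numeral)
    then show ?thesis unfolding bounded_iff by blast
  qed
  obtain M1 where M1: "\<forall>s\<in>ladder T \<sigma>n - ball 1 (1/4). cmod (A s * of_real T powr s) \<le> M1" using bd[OF ladder_bounded] ..
  obtain M2 where M2: "\<forall>s\<in>\<gamma> ` {0..} - ball 1 (1/4). cmod (A s * of_real T powr s) \<le> M2" using bd[OF contour_bounded] ..
  show ?thesis
  proof (rule that[of "max 0 (max M1 M2)"])
    fix s assume s: "s \<in> frame" "Re s \<le> 1 / 2"
    have "\<bar>Re (1 - s)\<bar> \<le> cmod (1 - s)" by (rule abs_Re_le_cmod)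
    then have "s \<notin> ball 1 (1/4)" using s by (simp add: dist_norm)
    then have "cmod (A s * of_real T powr s) \<le> max 0 (max M1 M2)" using s M1 M2 by (force simp: le_max_iff_disj)
    then have "cmod (A s) * T powr Re s * T powr (- Re s) \<le> max 0 (max M1 M2) * T powr (- Re s)"
      using T_pos by (intro mult_right_mono) (auto simp: norm_mult norm_powr_real_powr)
    moreover have "T powr Re s * T powr (- Re s) = 1" using T_pos by (simp flip: powr_add)
    ultimately show "cmod (A s) \<le> max 0 (max M1 M2) * T powr (- Re s)" by (simp add: mult.assoc)
  qed simp
qed

text \<open>Decay at some exponential rate along the frame, constants left open: enough to make the
  integrals over the rungs vanish and those over the contour and the top line converge.\<close>

definition decaying :: "(complex \<Rightarrow> complex) \<Rightarrow> bool" where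
  "decaying f \<longleftrightarrow> (\<exists>D\<ge>0. \<exists>c>0. \<exists>\<beta>. \<forall>s\<in>frame. Re s \<le> \<beta> \<longrightarrow> cmod (f s) \<le> D * exp (c * Re s))"

lemma decaying_cong:
  assumes "decaying f" "\<And>s. s \<in> frame \<Longrightarrow> Re s \<le> \<beta>' \<Longrightarrow> cmod (g s) \<le> K * cmod (f s)" "0 \<le> K"
  shows "decaying g"
proof -
  from assms(1) obtain D c \<beta> where f: "0 \<le> D" "0 < c" "\<And>s. s \<in> frame \<Longrightarrow> Re s \<le> \<beta> \<Longrightarrow> cmod (f s) \<le> D * exp (c * Re s)"
    unfolding decaying_def by blast
  have "cmod (g s) \<le> K * D * exp (c * Re s)" if "s \<in> frame" "Re s \<le> min \<beta> \<beta>'" for s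
    using order_trans[OF assms(2)[of s] mult_left_mono[OF f(3)[of s] assms(3)]] that by (simp add: mult.assoc)
  then show ?thesis unfolding decaying_def using f(1,2) assms(3) by (meson mult_nonneg_nonneg)
qed

text \<open>As \<open>x > T\<close>, the bound on \<open>A(s) T\<^sup>s\<close> beats weights of linear growth.\<close>

lemma decaying_weighted:
  assumes W: "\<And>s. s \<in> frame \<Longrightarrow> Re s \<le> - R \<Longrightarrow> cmod (W s) \<le> K * (1 + \<bar>Re s\<bar>)" "0 \<le> K"
    and B: "\<And>s. s \<in> frame \<Longrightarrow> Re s \<le> \<beta> \<Longrightarrow> cmod (B s) \<le> M * y powr (- Re s)" "0 \<le> M" "0 < y" "y < x"
  shows "decaying (\<lambda>s. W s * B s * tmon x s)"
proof -
  \<comment> \<open>The product of the bound on B and x^(s-1) decays at the rate ln(x/y) = 2c. One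
    half of it absorbs the linear growth of W, the other half is the rate that remains.\<close>
  define c where "c = ln (x / y) / 2"
  have c: "c > 0" using B x_pos by (simp add: c_def)
  have "cmod (W s * B s * tmon x s) \<le> K * (1 + 1 / c) * (M / x) * exp (c * Re s)"
    if s: "s \<in> frame" "Re s \<le> min (min (- R) \<beta>) 0" for s
  proof -
    define u where "u = Re s"
    have u: "u \<le> 0" using s by (simp add: u_def)
    have "c * (- u) \<le> exp (c * (- u))" using exp_ge_add_one_self[of "c * (- u)"] by linarith
    then have "\<bar>u\<bar> \<le> exp (- c * u) / c" using c u by (simp add: pos_le_divide_eq mult.commute)
    moreover have "1 \<le> exp (- c * u)" using c u by (simp add: mult_nonneg_nonpos)
    ultimately have "1 + \<bar>u\<bar> \<le> exp (- c * u) + exp (- c * u) / c" by linarith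
    then have w: "1 + \<bar>u\<bar> \<le> (1 + 1 / c) * exp (- c * u)" by (simp add: distrib_right)
    have "cmod (W s * B s * tmon x s) \<le> (K * (1 + \<bar>u\<bar>)) * (M * y powr (- u)) * x powr (u - 1)"
    proof -
      have "cmod (W s) \<le> K * (1 + \<bar>Re s\<bar>)" "cmod (B s) \<le> M * y powr (- Re s)"
        by (rule W(1), use s in simp, use s in simp) (rule B(1), use s in simp, use s in simp)
      then show ?thesis
        unfolding norm_mult norm_tmon[OF x_pos] u_def using W(2) B(2) by (intro mult_mono) auto
    qed
    also have "\<dots> \<le> (K * ((1 + 1 / c) * exp (- c * u))) * (M * y powr (- u)) * x powr (u - 1)"
      using w W(2) B(2) by (intro mult_right_mono mult_left_mono) auto
    also have "y powr (- u) = exp (- u * ln y)" using B by (simp add: powr_def)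
    also have "x powr (u - 1) = exp (u * ln x) / x" using x_pos by (simp add: powr_def algebra_simps exp_diff exp_minus divide_inverse)
    also have "(K * ((1 + 1 / c) * exp (- c * u))) * (M * exp (- u * ln y)) * (exp (u * ln x) / x)
       = K * (1 + 1 / c) * (M / x) * (exp (- c * u) * exp (- u * ln y) * exp (u * ln x))" by (simp add: mult_ac)
    also have "exp (- c * u) * exp (- u * ln y) * exp (u * ln x) = exp (c * u)"
    proof -
      have l: "ln x = ln y + 2 * c" using B(3) x_pos by (simp add: c_def ln_div field_simps)
      have "- c * u + - u * ln y + u * ln x = c * u" unfolding l by (simp add: algebra_simps)
      then show ?thesis by (simp only: exp_add[symmetric])
    qed
    finally show ?thesis by (simp only: u_def)
  qed
  moreover have "0 \<le> K * (1 + 1 / c) * (M / x)" using W(2) B(2) c x_pos by simp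
  ultimately show ?thesis unfolding decaying_def using c by blast
qed

lemma rungs_lt: "\<forall>\<^sub>F n in sequentially. \<sigma>n n < r"
  using rungs by (auto simp: filterlim_at_bot_dense)

lemma exp_rungs_tendsto_0: "0 < c \<Longrightarrow> (\<lambda>n. K * exp (c * \<sigma>n n)) \<longlonglongrightarrow> 0"
proof -
  assume c: "0 < c"
  have "filterlim (\<lambda>n. c * \<sigma>n n) at_bot sequentially"
    using rungs c by (subst filterlim_tendsto_pos_mult_at_bot[OF tendsto_const c]) auto
  then have "(\<lambda>n. exp (c * \<sigma>n n)) \<longlonglongrightarrow> 0" by (rule filterlim_compose[OF exp_at_bot])
  then show ?thesis using tendsto_mult[OF tendsto_const[of K]] by force
qed

lemma rung_seg_tendsto_0:
  assumes f: "decaying f" and cont: "\<forall>\<^sub>F n in sequentially. continuous_on (closed_segment (Complex (\<sigma>n n) 0) (Complex (\<sigma>n n) T)) f"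
  shows "(\<lambda>n. seg f (Complex (\<sigma>n n) 0) (Complex (\<sigma>n n) T)) \<longlonglongrightarrow> 0"
proof -
  from f obtain D c \<beta> where f: "0 \<le> D" "0 < c" "\<And>s. s \<in> frame \<Longrightarrow> Re s \<le> \<beta> \<Longrightarrow> cmod (f s) \<le> D * exp (c * Re s)"
    unfolding decaying_def by blast
  show ?thesis
  proof (rule Lim_null_comparison)
    show "\<forall>\<^sub>F n in sequentially. norm (seg f (Complex (\<sigma>n n) 0) (Complex (\<sigma>n n) T)) \<le> (D * T) * exp (c * \<sigma>n n)"
      using cont rungs_lt[of \<beta>]
    proof eventually_elim
      case (elim n)
      have "cmod (seg f (Complex (\<sigma>n n) 0) (Complex (\<sigma>n n) T)) \<le> D * exp (c * \<sigma>n n) * cmod (Complex (\<sigma>n n) T - Complex (\<sigma>n n) 0)"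
      proof (rule seg_norm_le[OF elim(1)])
        fix s assume "s \<in> closed_segment (Complex (\<sigma>n n) 0) (Complex (\<sigma>n n) T)"
        then have "Re s = \<sigma>n n" "0 \<le> Im s" "Im s \<le> T" using T_pos by (auto simp: closed_segment_same_Re closed_segment_eq_real_ivl)
        then show "cmod (f s) \<le> D * exp (c * \<sigma>n n)"
          using f(3)[of s] rung_in_frame[of "Im s" n] elim(2) by (metis complex_surj less_imp_le)
      qed
      also have "cmod (Complex (\<sigma>n n) T - Complex (\<sigma>n n) 0) = T" using T_pos by (simp add: complex_diff cmod_def)
      finally show ?case by (simp add: mult_ac)
    qed
  qed (rule exp_rungs_tendsto_0[OF f(2)])
qed

text \<open>Two of these integrals differ by one between two rungs, which is exponentially small.
  The rungs are not assumed monotone, hence the maximum of two of them in the estimate.\<close>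

lemma top_seg_convergent:
  assumes f: "decaying f" and cont: "continuous_on {s. Im s = T \<and> Re s \<le> \<kappa>} f"
  shows "convergent (\<lambda>n. seg f (Complex (\<sigma>n n) T) (Complex \<kappa> T))"
proof -
  from f obtain D c \<beta> where f: "0 \<le> D" "0 < c" "\<And>s. s \<in> frame \<Longrightarrow> Re s \<le> \<beta> \<Longrightarrow> cmod (f s) \<le> D * exp (c * Re s)"
    unfolding decaying_def by blast
  define r where "r = min (min \<beta> 1) (\<kappa> - 1)"
  define h where "h = (\<lambda>u. f (Complex u T))"
  have hc: "continuous_on {..\<kappa>} h"
    unfolding h_def Complex_eq by (intro continuous_on_compose2[OF cont] continuous_intros) auto
  have int: "h integrable_on {u..v}" if "v \<le> \<kappa>" for u v
    using that by (intro integrable_continuous_real continuous_on_subset[OF hc]) auto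
  have hb: "cmod (h u) \<le> D * exp (c * u)" if "u \<le> r" for u
    using f(3)[of "Complex u T"] top_in_frame[of u] that by (simp add: h_def r_def)
  have tail: "cmod (integral {u..v} h) \<le> D / c * exp (c * v)" if "u \<le> v" "v \<le> r" for u v
  proof -
    have hi: "((\<lambda>t. D * exp (c * t)) has_integral (D / c * exp (c * v) - D / c * exp (c * u))) {u..v}"
      using f(2) that by (intro fundamental_theorem_of_calculus)
        (auto intro!: derivative_eq_intros simp flip: has_real_derivative_iff_has_vector_derivative)
    have "cmod (integral {u..v} h) \<le> integral {u..v} (\<lambda>t. D * exp (c * t))"
      using that hb by (intro integral_norm_bound_integral int has_integral_integrable[OF hi]) (auto simp: r_def)
    also have "\<dots> \<le> D / c * exp (c * v)" using integral_unique[OF hi] f(1,2) by simp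
    finally show ?thesis .
  qed
  define X where "X = (\<lambda>n. integral {\<sigma>n n..\<kappa>} h)"
  have X: "cmod (X m - X n) \<le> D / c * exp (c * max (\<sigma>n m) (\<sigma>n n))" if "\<sigma>n m \<le> r" "\<sigma>n n \<le> r" for m n
  proof -
    have le: "cmod (integral {u..\<kappa>} h - integral {v..\<kappa>} h) \<le> D / c * exp (c * v)" if "u \<le> v" "v \<le> r" for u v
    proof -
      have "integral {u..v} h + integral {v..\<kappa>} h = integral {u..\<kappa>} h"
        using that by (intro Henstock_Kurzweil_Integration.integral_combine int) (auto simp: r_def)
      then have "integral {u..\<kappa>} h - integral {v..\<kappa>} h = integral {u..v} h" by (metis add_diff_cancel_right')
      then show ?thesis using tail[OF that] by simp
    qed
    show ?thesis
    proof (cases "\<sigma>n m \<le> \<sigma>n n")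
      case True
      then show ?thesis using le[of "\<sigma>n m" "\<sigma>n n"] that by (simp add: X_def max_def)
    next
      case False
      then show ?thesis using le[of "\<sigma>n n" "\<sigma>n m"] that by (simp add: X_def max_def norm_minus_commute)
    qed
  qed
  have "Cauchy X"
  proof (rule CauchyI)
    fix e :: real assume e: "0 < e"
    have "\<forall>\<^sub>F n in sequentially. D / c * exp (c * \<sigma>n n) < e"
      using order_tendstoD(2)[OF exp_rungs_tendsto_0[OF f(2)] e] by blast
    then have "\<forall>\<^sub>F n in sequentially. \<sigma>n n \<le> r \<and> D / c * exp (c * \<sigma>n n) < e"
      using rungs_lt[of r] by eventually_elim auto
    then obtain N where N: "\<And>n. N \<le> n \<Longrightarrow> \<sigma>n n \<le> r \<and> D / c * exp (c * \<sigma>n n) < e"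
      by (auto simp: eventually_sequentially)
    have "norm (X m - X n) < e" if "N \<le> m" "N \<le> n" for m n
      using X[of m n] N[OF that(1)] N[OF that(2)] by (auto simp: max_def split: if_splits)
    then show "\<exists>M. \<forall>m\<ge>M. \<forall>n\<ge>M. norm (X m - X n) < e" by blast
  qed
  then have "convergent X" by (rule Cauchy_convergent)
  moreover have "\<forall>\<^sub>F n in sequentially. X n = seg f (Complex (\<sigma>n n) T) (Complex \<kappa> T)"
    using rungs_lt[of \<kappa>] by eventually_elim (simp add: X_def seg_horizontal h_def)
  ultimately show ?thesis by (simp add: convergent_cong)
qed

definition exit_time :: "real \<Rightarrow> real" where
  "exit_time b = (SOME t. 0 < t \<and> (\<forall>u\<ge>t. Re (\<gamma> u) < b - 1))"

lemma exit_time: "0 < exit_time b" "exit_time b \<le> u \<Longrightarrow> Re (\<gamma> u) < b - 1"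
proof -
  have "\<exists>t. 0 < t \<and> (\<forall>u\<ge>t. Re (\<gamma> u) < b - 1)" using Re_ge_bounded[of "b - 1"] by blast
  then have "0 < exit_time b \<and> (\<forall>u\<ge>exit_time b. Re (\<gamma> u) < b - 1)" unfolding exit_time_def by (rule someI_ex)
  then show "0 < exit_time b" "exit_time b \<le> u \<Longrightarrow> Re (\<gamma> u) < b - 1" by auto
qed

abbreviation "clamped_path n \<equiv> cpath (\<sigma>n n) (exit_time (\<sigma>n n))"

text \<open>The point 1 is kept: the contour starts there, and the \<open>filled\<close> integrands
  are regular there.\<close>

definition slit :: "complex set" where "slit = {s. \<bar>Im s\<bar> < T} - (poles - {1})"

lemma open_slit: "open slit"
proof -
  have "slit = ({s. - T < Im s} \<inter> {s. Im s < T}) \<inter> - (poles - {1})" by (auto simp: slit_def)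
  then show ?thesis
    using open_Int[OF open_Int[OF open_halfspace_Im_gt open_halfspace_Im_lt] open_off_poles(1)] by simp
qed

lemma contour_in_slit: "\<gamma> ` {0..} \<subseteq> slit"
proof (rule image_subsetI)
  fix t :: real assume t: "t \<in> {0..}"
  then have "\<gamma> t \<notin> poles - {1}" using frame_no_pole[of "\<gamma> t"] by auto
  moreover have "\<bar>Im (\<gamma> t)\<bar> < T" using gamma_region[of t] t T_pos by simp
  ultimately show "\<gamma> t \<in> slit" by (simp add: slit_def)
qed

lemma clamped_in_slit: assumes "\<sigma>n n < 1" shows "clamped (\<sigma>n n) ` {0..} \<subseteq> slit"
proof (rule image_subsetI)
  fix t :: real assume t: "t \<in> {0..}"
  let ?z = "clamped (\<sigma>n n) t"
  have im: "0 \<le> Im ?z" "Im ?z \<le> T / 4" using clamped_box[of t "\<sigma>n n"] t assms by auto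
  from clamped_cases[of t "\<sigma>n n"] t consider "?z = \<gamma> t" | "Re ?z = \<sigma>n n" by auto
  then show "?z \<in> slit"
  proof cases
    case 1
    then show ?thesis using contour_in_slit t by auto
  next
    case 2
    then have "?z \<notin> poles" using poles_rung[of ?z n] im assms T_pos by auto
    then show ?thesis using im T_pos by (auto simp: slit_def)
  qed
qed

text \<open>In \<open>cpath_close_to_ray\<close> with b = \<sigma>n n both the tail and the bound V
  on the rung are of order exp(c \<sigma>n n).\<close>

lemma clamped_integral_tendsto:
  assumes cont: "continuous_on slit f" and f: "decaying f"
  shows "(\<lambda>n. contour_integral (clamped_path n) f) \<longlonglongrightarrow> ray_contour_integral \<gamma> f"
proof -
  from f obtain D c \<beta> where f: "0 \<le> D" "0 < c" "\<And>s. s \<in> frame \<Longrightarrow> Re s \<le> \<beta> \<Longrightarrow> cmod (f s) \<le> D * exp (c * Re s)"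
    unfolding decaying_def by blast
  define K where "K = D * strip_length * exp c / (1 - exp (- c)) + D * (1 + T / 4) * strip_length"
  have "(\<lambda>n. contour_integral (clamped_path n) f - ray_contour_integral \<gamma> f) \<longlonglongrightarrow> 0"
  proof (rule Lim_null_comparison)
    show "\<forall>\<^sub>F n in sequentially. norm (contour_integral (clamped_path n) f - ray_contour_integral \<gamma> f) \<le> K * exp (c * \<sigma>n n)"
      using rungs_lt[of \<beta>] rungs_lt[of 1]
    proof eventually_elim
      case (elim n)
      have "cmod (contour_integral (clamped_path n) f - ray_contour_integral \<gamma> f)
        \<le> D * strip_length * exp (c * (\<sigma>n n + 1)) / (1 - exp (- c)) + (D * exp (c * \<sigma>n n)) * (1 + T / 4) * strip_length"
      proof (rule cpath_close_to_ray)
        show "continuous_on (\<gamma> ` {0..}) f" "continuous_on (clamped (\<sigma>n n) ` {0..}) f"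
          using contour_in_slit clamped_in_slit[OF elim(2)] by (auto intro: continuous_on_subset[OF cont])
        show "cmod (f (\<gamma> t)) \<le> D * exp (c * Re (\<gamma> t))" if "0 \<le> t" "Re (\<gamma> t) \<le> \<beta>" for t
          using that by (intro f) auto
        show "cmod (f (Complex (\<sigma>n n) y)) \<le> D * exp (c * \<sigma>n n)" if "0 \<le> y" "y \<le> T / 4" for y
          using f(3)[of "Complex (\<sigma>n n) y"] rung_in_frame[of y n] that elim T_pos by simp
      qed (use f elim exit_time in auto)
      also have "exp (c * (\<sigma>n n + 1)) = exp c * exp (c * \<sigma>n n)" by (simp add: distrib_left exp_add)
      finally show ?case by (simp add: K_def algebra_simps add_divide_distrib)
    qed
  qed (rule exp_rungs_tendsto_0[OF f(2)])
  then show ?thesis by (simp add: LIM_zero_iff)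
qed

text \<open>Right of b and with bounded height there are finitely many poles, so half of the least
  nonzero |Im p| works. The cap T/8 keeps the line at height \<eta> within the heights of
  \<open>R_quarter\<close>.\<close>

lemma pole_gap:
  obtains \<eta> where "0 < \<eta>" "\<eta> \<le> T / 8" "\<And>p. p \<in> poles \<Longrightarrow> b \<le> Re p \<Longrightarrow> \<bar>Im p\<bar> \<le> \<eta> \<Longrightarrow> Im p = 0"
proof -
  define Q where "Q = poles \<inter> cbox (Complex b (- T)) (Complex 1 T)"
  have "finite Q" using discrete_poles unfolding Q_def discrete_set_def by (simp add: compact_cbox)
  define \<eta> where "\<eta> = Min (insert (T / 8) ((\<lambda>p. \<bar>Im p\<bar> / 2) ` {p \<in> Q. Im p \<noteq> 0}))"
  have fin: "finite (insert (T / 8) ((\<lambda>p. \<bar>Im p\<bar> / 2) ` {p \<in> Q. Im p \<noteq> 0}))" using \<open>finite Q\<close> by simp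
  show ?thesis
  proof (rule that[of \<eta>])
    show "0 < \<eta>" unfolding \<eta>_def using fin T_pos by (subst Min_gr_iff) auto
    show le: "\<eta> \<le> T / 8" unfolding \<eta>_def using fin by (intro Min_le) auto
    fix p assume p: "p \<in> poles" "b \<le> Re p" "\<bar>Im p\<bar> \<le> \<eta>"
    then have "p \<in> Q" using poles_Re_le[OF p(1)] le T_pos by (auto simp: Q_def in_cbox_complex_iff)
    show "Im p = 0"
    proof (rule ccontr)
      assume "Im p \<noteq> 0"
      then have "\<eta> \<le> \<bar>Im p\<bar> / 2" unfolding \<eta>_def using fin \<open>p \<in> Q\<close> by (intro Min_le) auto
      then show False using p(3) \<open>Im p \<noteq> 0\<close> by linarith
    qed
  qed
qed

text \<open>The left-hand side is the polygon that \<open>shift_identity\<close> leaves above the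
  real poles. Real poles other than 1 lie below both the contour and the line at height \<eta>,
  upper poles above both, so \<open>clamped_loop_Cauchy\<close> trades the polygon for the way from
  \<kappa> back to 1 followed by the contour.\<close>

lemma loop_identity:
  assumes f: "f holomorphic_on slit" and b: "\<sigma>n n < 1" "1 < \<kappa>"
    and eta: "0 < \<eta>" "\<eta> \<le> T / 8" "\<And>p. p \<in> poles \<Longrightarrow> \<sigma>n n \<le> Re p \<Longrightarrow> \<bar>Im p\<bar> \<le> \<eta> \<Longrightarrow> Im p = 0"
  shows "seg f (Complex \<kappa> 0) (Complex \<kappa> \<eta>) + seg f (Complex \<kappa> \<eta>) (Complex (\<sigma>n n) \<eta>)
      + seg f (Complex (\<sigma>n n) \<eta>) (Complex (\<sigma>n n) 0)
    = contour_integral (clamped_path n) f - seg f (Complex 1 0) (Complex \<kappa> 0)"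
proof -
  let ?b = "\<sigma>n n"
  have "contour_integral (clamped_path n) f + (seg f (Complex ?b 0) (Complex ?b \<eta>)
    + (seg f (Complex ?b \<eta>) (Complex \<kappa> \<eta>) + (seg f (Complex \<kappa> \<eta>) (Complex \<kappa> 0)
    + seg f (Complex \<kappa> 0) (Complex 1 0)))) = 0"
  proof (rule clamped_loop_Cauchy[OF open_slit f b eta(1) _ exit_time clamped_in_slit[OF b(1)]])
    show "\<eta> \<le> T / 4" using eta T_pos by linarith
    have seg_slit: "closed_segment p q \<subseteq> slit"
      if "\<And>s. s \<in> closed_segment p q \<Longrightarrow> \<bar>Im s\<bar> < T \<and> (s \<in> poles \<longrightarrow> s = 1)" for p q
      using that by (auto simp: slit_def)
    show "closed_segment (Complex ?b 0) (Complex ?b \<eta>) \<subseteq> slit"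
    proof (rule seg_slit)
      fix s assume "s \<in> closed_segment (Complex ?b 0) (Complex ?b \<eta>)"
      then have "Re s = ?b" "0 \<le> Im s" "Im s \<le> \<eta>"
        using eta(1) by (auto simp: closed_segment_same_Re closed_segment_eq_real_ivl)
      then show "\<bar>Im s\<bar> < T \<and> (s \<in> poles \<longrightarrow> s = 1)" using poles_rung[of s n] b(1) eta(2) T_pos by auto
    qed
    show "closed_segment (Complex ?b \<eta>) (Complex \<kappa> \<eta>) \<subseteq> slit"
    proof (rule seg_slit)
      fix s assume "s \<in> closed_segment (Complex ?b \<eta>) (Complex \<kappa> \<eta>)"
      then have "?b \<le> Re s" "Im s = \<eta>"
        using b by (auto simp: closed_segment_same_Im closed_segment_eq_real_ivl)
      then show "\<bar>Im s\<bar> < T \<and> (s \<in> poles \<longrightarrow> s = 1)" using eta(3)[of s] eta(1,2) T_pos by auto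
    qed
    show "closed_segment (Complex \<kappa> \<eta>) (Complex \<kappa> 0) \<subseteq> slit"
    proof (rule seg_slit)
      fix s assume "s \<in> closed_segment (Complex \<kappa> \<eta>) (Complex \<kappa> 0)"
      then have "Re s = \<kappa>" "0 \<le> Im s" "Im s \<le> \<eta>"
        using eta(1) by (auto simp: closed_segment_same_Re closed_segment_eq_real_ivl)
      then show "\<bar>Im s\<bar> < T \<and> (s \<in> poles \<longrightarrow> s = 1)" using poles_Re_le[of s] b(2) eta(2) T_pos by auto
    qed
    show "closed_segment (Complex \<kappa> 0) (Complex 1 0) \<subseteq> slit"
    proof (rule seg_slit)
      fix s assume "s \<in> closed_segment (Complex \<kappa> 0) (Complex 1 0)"
      then have "1 \<le> Re s" "Im s = 0"
        using b(2) by (auto simp: closed_segment_same_Im closed_segment_eq_real_ivl)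
      then show "\<bar>Im s\<bar> < T \<and> (s \<in> poles \<longrightarrow> s = 1)" using poles_Re_le[of s] T_pos by (auto simp: complex_eq_iff)
    qed
    fix w assume w: "w \<notin> slit" "?b \<le> Re w" "Re w \<le> \<kappa>" "0 \<le> Im w" "Im w \<le> T / 4"
    then have p: "w \<in> poles" "w \<noteq> 1" using T_pos by (auto simp: slit_def)
    have "?b < Re w" using poles_rung[OF p(1), of n] w b T_pos by (cases "Re w = ?b") auto
    moreover have "Re w < \<kappa>" using poles_Re_le[OF p(1)] b by simp
    moreover have "lies_below (\<gamma> ` {0..}) w \<and> Im w < \<eta> \<or> lies_above (\<gamma> ` {0..}) w \<and> \<eta> < Im w"
    proof (cases "Im w = 0")
      case True
      then show ?thesis using real_poles_below[OF p(1)] p(2) eta by simp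
    next
      case False
      then show ?thesis using upper_poles_above[OF p(1)] eta(3)[OF p(1)] w by force
    qed
    ultimately show "?b < Re w \<and> Re w < \<kappa> \<and> (lies_below (\<gamma> ` {0..}) w \<and> Im w < \<eta> \<or> lies_above (\<gamma> ` {0..}) w \<and> \<eta> < Im w)"
      by blast
  qed
  then show ?thesis
    using seg_reverse[of "Complex ?b 0" "Complex ?b \<eta>" f] seg_reverse[of "Complex ?b \<eta>" "Complex \<kappa> \<eta>" f]
      seg_reverse[of "Complex \<kappa> \<eta>" "Complex \<kappa> 0" f] seg_reverse[of "Complex \<kappa> 0" "Complex 1 0" f]
    by (simp add: algebra_simps)
qed

end

text \<open>The shifted weight is \<Phi> - \<i>T jump, and coth makes the jump at worst a simple
  pole. The limit L stays abstract because it is going to be multiplied by a factor that tends to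
  0.\<close>

lemma weight_shift_pole:
  assumes T: "T > 0"
  obtains L where "((\<lambda>s. (s - of_real \<sigma>) * weight T \<sigma> \<alpha> \<delta> (s - \<i> * of_real T)) \<longlongrightarrow> L) (at (of_real \<sigma>))"
proof -
  interpret sw: shift_weight T \<sigma> "weight T \<sigma> \<alpha> \<delta>" by (rule shift_weight_weight[OF T])
  have ih: "isCont hcoth 0"
    using holomorphic_on_imp_continuous_on[OF hcoth_holomorphic]
    by (subst (asm) continuous_on_eq_continuous_at) (auto intro!: open_Collect_less continuous_intros)
  have iw: "isCont (weight T \<sigma> \<alpha> \<delta>) (of_real \<sigma>)"
    using holomorphic_on_imp_continuous_on[OF sw.Phi_hol] sw.open_strips(1) T
    by (subst (asm) continuous_on_eq_continuous_at) auto
  have "((\<lambda>s::complex. (s - of_real \<sigma>) / of_real T) \<longlongrightarrow> (of_real \<sigma> - of_real \<sigma>) / of_real T) (at (of_real \<sigma>))"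
    by (intro tendsto_intros) (use T in auto)
  then have "((\<lambda>s. hcoth ((s - of_real \<sigma>) / of_real T)) \<longlongrightarrow> hcoth 0) (at (of_real \<sigma>))"
    by (intro isCont_tendsto_compose[OF ih]) simp
  then have lim: "((\<lambda>s. (s - of_real \<sigma>) * weight T \<sigma> \<alpha> \<delta> s - \<i> * of_real T * (of_real (\<alpha> / 2) * (of_real T * hcoth ((s - of_real \<sigma>) / of_real T))
      + of_real (\<delta> / 2) * (s - of_real \<sigma>)))
     \<longlongrightarrow> (of_real \<sigma> - of_real \<sigma>) * weight T \<sigma> \<alpha> \<delta> (of_real \<sigma>) - \<i> * of_real T * (of_real (\<alpha> / 2) * (of_real T * hcoth 0)
      + of_real (\<delta> / 2) * (of_real \<sigma> - of_real \<sigma>))) (at (of_real \<sigma>))"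
    using iw unfolding isCont_def by (intro tendsto_intros)
  show ?thesis
  proof (rule that, rule Lim_transform_eventually[OF lim])
    have "\<forall>\<^sub>F s in at (of_real \<sigma>). s \<in> {s. \<bar>Im s\<bar> < T}"
      using sw.open_strips(1) T by (intro eventually_at_in_open') auto
    then show "\<forall>\<^sub>F s in at (of_real \<sigma>). (s - of_real \<sigma>) * weight T \<sigma> \<alpha> \<delta> s - \<i> * of_real T * (of_real (\<alpha> / 2) * (of_real T * hcoth ((s - of_real \<sigma>) / of_real T))
      + of_real (\<delta> / 2) * (s - of_real \<sigma>)) = (s - of_real \<sigma>) * weight T \<sigma> \<alpha> \<delta> (s - \<i> * of_real T)"
      using eventually_neq_at_within[of "of_real \<sigma>" "of_real \<sigma>" UNIV]
    proof eventually_elim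
      case (elim s)
      define k where "k = coth (of_real pi * (s - of_real \<sigma>) / of_real T)"
      have "(weight T \<sigma> \<alpha> \<delta> s - weight T \<sigma> \<alpha> \<delta> (s - \<i> * of_real T)) / (\<i> * of_real T)
          = of_real (\<alpha> / 2) * k + of_real (\<delta> / 2)"
        unfolding k_def using elim by (intro weight_jump[OF T]) auto
      then have "weight T \<sigma> \<alpha> \<delta> s - weight T \<sigma> \<alpha> \<delta> (s - \<i> * of_real T) = \<i> * of_real T * (of_real (\<alpha> / 2) * k + of_real (\<delta> / 2))"
        using T by (simp add: divide_eq_eq mult_ac)
      then have w: "weight T \<sigma> \<alpha> \<delta> (s - \<i> * of_real T) = weight T \<sigma> \<alpha> \<delta> s - \<i> * of_real T * (of_real (\<alpha> / 2) * k + of_real (\<delta> / 2))"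
        by (simp add: algebra_simps)
      have hz: "of_real T * hcoth ((s - of_real \<sigma>) / of_real T) = (s - of_real \<sigma>) * k"
        using elim T by (simp add: hcoth_def k_def)
      show ?case unfolding w hz by (simp add: algebra_simps del: of_real_divide)
    qed
  qed
qed

section \<open>Convergence of the residue sums over the upper poles\<close>

context ladder_contour
begin

text \<open>Unlike \<open>slit\<close>, this contains the top line Im s = T, on which the shifted
  weight is integrated.\<close>

definition wide :: "complex set" where "wide = {s. - T < Im s \<and> Im s < 2 * T} - (poles - {1})"

lemma slit_wide: "slit \<subseteq> wide" using T_pos by (auto simp: slit_def wide_def)

lemma open_wide: "open wide"
proof -
  have "wide = ({s. - T < Im s} \<inter> {s. Im s < 2 * T}) \<inter> - (poles - {1})" by (auto simp: wide_def)
  then show ?thesis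
    using open_Int[OF open_Int[OF open_halfspace_Im_gt open_halfspace_Im_lt] open_off_poles(1)] by simp
qed

lemma wide_frame: "s \<in> frame \<Longrightarrow> s \<in> wide"
  using frame_no_pole[of s] frame_Im[of s] T_pos by (auto simp: wide_def)

lemma wide_rung: assumes "\<sigma>n n < 1" shows "closed_segment (Complex (\<sigma>n n) 0) (Complex (\<sigma>n n) T) \<subseteq> wide - poles"
proof
  fix s assume "s \<in> closed_segment (Complex (\<sigma>n n) 0) (Complex (\<sigma>n n) T)"
  then have s: "Re s = \<sigma>n n" "0 \<le> Im s" "Im s \<le> T" using T_pos by (auto simp: closed_segment_same_Re closed_segment_eq_real_ivl)
  then have "s \<in> frame" using rung_in_frame[of "Im s" n] by (metis complex_surj)
  moreover have "s \<noteq> 1" using s assms by auto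
  ultimately show "s \<in> wide - poles" using wide_frame frame_no_pole by blast
qed

lemma wide_top: "{s. Im s = T} \<subseteq> wide - poles"
  using poles_Im T_pos by (auto simp: wide_def)

lemma wide_right: "1 < \<kappa> \<Longrightarrow> closed_segment (Complex \<kappa> 0) (Complex \<kappa> T) \<subseteq> wide - poles"
  using T_pos poles_Re_le by (fastforce simp: wide_def closed_segment_same_Re closed_segment_eq_real_ivl)

text \<open>For each rung, 2\<pi>\<i> times the sum is a combination of integrals over fixed
  segments, the rung, the top line and the clamped contour, all of which converge by decay. The
  right side of the rectangle stands at abscissa 2, beyond all poles.\<close>

lemma residue_sum_convergent:
  assumes f: "f holomorphic_on wide" and dec: "decaying f"
  shows "convergent (\<lambda>n. \<Sum>p | p \<in> poles \<and> \<sigma>n n < Re p \<and> 0 < Im p \<and> Im p < T. residue f p)"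
proof -
  define X where "X = (\<lambda>n. seg f (Complex 1 0) (Complex 2 0) + seg f (Complex 2 0) (Complex 2 T)
     - seg f (Complex (\<sigma>n n) T) (Complex 2 T) - seg f (Complex (\<sigma>n n) 0) (Complex (\<sigma>n n) T)
     - contour_integral (clamped_path n) f)"
  have fc: "continuous_on S f" if "S \<subseteq> wide" for S
    using that f holomorphic_on_imp_continuous_on holomorphic_on_subset by blast
  have "\<forall>\<^sub>F n in sequentially. continuous_on (closed_segment (Complex (\<sigma>n n) 0) (Complex (\<sigma>n n) T)) f"
    using rungs_lt[of 1] by eventually_elim (use wide_rung in \<open>auto intro!: fc\<close>)
  then have l1: "convergent (\<lambda>n. seg f (Complex (\<sigma>n n) 0) (Complex (\<sigma>n n) T))"
    using rung_seg_tendsto_0[OF dec] by (auto simp: convergent_def)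
  have l2: "convergent (\<lambda>n. contour_integral (clamped_path n) f)"
    using clamped_integral_tendsto[OF fc[OF slit_wide] dec] by (auto simp: convergent_def)
  have l3: "convergent (\<lambda>n. seg f (Complex (\<sigma>n n) T) (Complex 2 T))"
    using wide_top by (intro top_seg_convergent dec fc) auto
  have "convergent X" unfolding X_def by (intro convergent_diff convergent_const l1 l2 l3)
  then have "convergent (\<lambda>n. 1 / (2 * of_real pi * \<i>) * X n)" by (intro convergent_mult convergent_const)
  moreover have "\<forall>\<^sub>F n in sequentially. 1 / (2 * of_real pi * \<i>) * X n
     = (\<Sum>p | p \<in> poles \<and> \<sigma>n n < Re p \<and> 0 < Im p \<and> Im p < T. residue f p)"
    using rungs_lt[of 1]
  proof eventually_elim
    case (elim n)
    let ?b = "\<sigma>n n"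
    obtain \<eta> where eta: "0 < \<eta>" "\<eta> \<le> T / 8" "\<And>p. p \<in> poles \<Longrightarrow> ?b \<le> Re p \<Longrightarrow> \<bar>Im p\<bar> \<le> \<eta> \<Longrightarrow> Im p = 0"
      using pole_gap[of ?b] by blast
    have etaT: "\<eta> < T" using eta T_pos by linarith
    have loop: "seg f (Complex 2 0) (Complex 2 \<eta>) + seg f (Complex 2 \<eta>) (Complex ?b \<eta>)
      + seg f (Complex ?b \<eta>) (Complex ?b 0)
      = contour_integral (clamped_path n) f - seg f (Complex 1 0) (Complex 2 0)"
      by (rule loop_identity[OF holomorphic_on_subset[OF f slit_wide] elim _ eta]) simp
    have rect: "seg f (Complex ?b \<eta>) (Complex 2 \<eta>) + seg f (Complex 2 \<eta>) (Complex 2 T)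
     + seg f (Complex 2 T) (Complex ?b T) + seg f (Complex ?b T) (Complex ?b \<eta>)
     = 2 * of_real pi * \<i> * (\<Sum>p\<in>(poles - {1}) \<inter> box (Complex ?b \<eta>) (Complex 2 T). residue f p)"
    proof (rule rect_residues)
      have U: "{s. - T < Im s \<and> Im s < 2 * T} = {s. - T < Im s} \<inter> {s. Im s < 2 * T}" by auto
      show "open {s. - T < Im s \<and> Im s < 2 * T}" unfolding U
        by (intro open_Int open_halfspace_Im_gt open_halfspace_Im_lt)
      show "convex {s. - T < Im s \<and> Im s < 2 * T}" unfolding U
        by (intro convex_Int convex_halfspace_Im_gt convex_halfspace_Im_lt)
      show "f holomorphic_on {s. - T < Im s \<and> Im s < 2 * T} - (poles - {1})" using f by (simp add: wide_def)
      show "discrete_set (poles - {1})" by (rule discrete_set_subset[OF discrete_poles]) auto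
      show "cbox (Complex ?b \<eta>) (Complex 2 T) \<subseteq> {s. - T < Im s \<and> Im s < 2 * T}"
        using eta T_pos by (auto simp: in_cbox_complex_iff)
      fix p assume p: "p \<in> poles - {1}" "p \<in> cbox (Complex ?b \<eta>) (Complex 2 T)"
      then have "Re p \<noteq> ?b" "Re p \<le> 1" "Im p \<noteq> T" "Im p \<noteq> \<eta>"
        using poles_rung[of p n] poles_Re_le[of p] poles_Im[of p] eta(1,2) eta(3)[of p] elim by (auto simp: in_cbox_complex_iff)
      then show "p \<in> box (Complex ?b \<eta>) (Complex 2 T)"
        using p by (auto simp: in_cbox_complex_iff in_box_complex_iff)
    qed (use elim etaT in auto)
    have set: "(poles - {1}) \<inter> box (Complex ?b \<eta>) (Complex 2 T) = {p \<in> poles. ?b < Re p \<and> 0 < Im p \<and> Im p < T}"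
    proof (intro set_eqI iffI)
      fix p assume "p \<in> (poles - {1}) \<inter> box (Complex ?b \<eta>) (Complex 2 T)"
      then show "p \<in> {p \<in> poles. ?b < Re p \<and> 0 < Im p \<and> Im p < T}" using eta by (auto simp: in_box_complex_iff)
    next
      fix p assume p: "p \<in> {p \<in> poles. ?b < Re p \<and> 0 < Im p \<and> Im p < T}"
      then have "\<eta> < Im p" using eta(3)[of p] by force
      then show "p \<in> (poles - {1}) \<inter> box (Complex ?b \<eta>) (Complex 2 T)"
        using p poles_Re_le[of p] by (auto simp: in_box_complex_iff)
    qed
    have sp1: "seg f (Complex 2 0) (Complex 2 T) = seg f (Complex 2 0) (Complex 2 \<eta>) + seg f (Complex 2 \<eta>) (Complex 2 T)"
      using wide_right[of 2] eta etaT by (intro seg_split_Im fc) (auto simp: closed_segment_eq_real_ivl)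
    have sp2: "seg f (Complex ?b 0) (Complex ?b T) = seg f (Complex ?b 0) (Complex ?b \<eta>) + seg f (Complex ?b \<eta>) (Complex ?b T)"
      using wide_rung[OF elim] eta etaT by (intro seg_split_Im fc) (auto simp: closed_segment_eq_real_ivl)
    have C: "contour_integral (clamped_path n) f = seg f (Complex 2 0) (Complex 2 \<eta>) + seg f (Complex 2 \<eta>) (Complex ?b \<eta>)
      + seg f (Complex ?b \<eta>) (Complex ?b 0) + seg f (Complex 1 0) (Complex 2 0)"
      using loop by (simp add: eq_diff_eq)
    have rev: "seg f (Complex ?b \<eta>) (Complex 2 \<eta>) = - seg f (Complex 2 \<eta>) (Complex ?b \<eta>)"
      "seg f (Complex ?b T) (Complex 2 T) = - seg f (Complex 2 T) (Complex ?b T)"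
      "seg f (Complex ?b \<eta>) (Complex ?b T) = - seg f (Complex ?b T) (Complex ?b \<eta>)"
      "seg f (Complex ?b 0) (Complex ?b \<eta>) = - seg f (Complex ?b \<eta>) (Complex ?b 0)"
      by (rule seg_reverse)+
    have "X n = 2 * of_real pi * \<i> * (\<Sum>p | p \<in> poles \<and> \<sigma>n n < Re p \<and> 0 < Im p \<and> Im p < T. residue f p)"
      unfolding X_def sp1 sp2 C rect[unfolded set, symmetric] rev by simp
    then show ?case by simp
  qed
  ultimately show ?thesis by (simp only: convergent_cong)
qed

text \<open>\<open>A\<close> is replaced by \<open>A - q\<close>, where \<open>q\<close> has the same order of growth, cancels the pole at \<open>1\<close>
  (so that the contour may start there), and makes the difference vanish at \<open>\<sigma>\<close> unless \<open>\<sigma>\<close> is a pole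
  off the contour; this removes the pole of the shifted weight.\<close>

definition tame :: "complex \<Rightarrow> complex" where
  "tame s = regular s - res1 * slope1 (\<lambda>s. of_real T powr (1 - s) - 1) s"

lemma tame_holomorphic: "tame holomorphic_on - (poles - {1})"
proof -
  have "slope1 (\<lambda>s. of_real T powr (1 - s) - 1) holomorphic_on UNIV"
    using T_pos by (intro slope1_holomorphic holomorphic_intros) auto
  then have "slope1 (\<lambda>s. of_real T powr (1 - s) - 1) holomorphic_on - (poles - {1})"
    by (rule holomorphic_on_subset) auto
  then show ?thesis unfolding tame_def by (intro holomorphic_intros regular)
qed

lemma tame_eq: assumes "s \<notin> poles" shows "tame s = A s - res1 * of_real T powr (1 - s) / (s - 1)"
proof -
  have "s \<noteq> 1" using assms one_pole by auto
  then show ?thesis using regular(2)[OF assms] by (simp add: tame_def slope1_def diff_divide_distrib right_diff_distrib)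
qed

definition balanced :: "real \<Rightarrow> complex \<Rightarrow> complex" where
  "balanced \<sigma> s = tame s - (if of_real \<sigma> \<in> wide then tame (of_real \<sigma>) * of_real T powr of_real \<sigma> else 0) * of_real T powr (- s)"

lemma balanced_holomorphic: "balanced \<sigma> holomorphic_on - (poles - {1})"
  unfolding balanced_def using T_pos by (intro holomorphic_intros tame_holomorphic) auto

lemma balanced_root: "of_real \<sigma> \<in> wide \<Longrightarrow> balanced \<sigma> (of_real \<sigma>) = 0"
  using T_pos by (simp add: balanced_def powr_minus)

text \<open>For Re s <= 0 the denominator s - 1 has modulus at least 1, so both corrections are of
  order T^(-Re s), like A itself.\<close>

lemma balanced_growth:
  obtains M where "M \<ge> 0" "\<And>s. s \<in> frame \<Longrightarrow> Re s \<le> 0 \<Longrightarrow> cmod (balanced \<sigma> s) \<le> M * T powr (- Re s)"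
proof -
  obtain M where M: "M \<ge> 0" "\<And>s. s \<in> frame \<Longrightarrow> Re s \<le> 1 / 2 \<Longrightarrow> cmod (A s) \<le> M * T powr (- Re s)"
    using A_growth by blast
  define c where "c = (if of_real \<sigma> \<in> wide then tame (of_real \<sigma>) * of_real T powr of_real \<sigma> else 0)"
  show ?thesis
  proof (rule that[of "M + cmod res1 * T + cmod c"])
    show "0 \<le> M + cmod res1 * T + cmod c" using M(1) T_pos by simp
    fix s assume s: "s \<in> frame" "Re s \<le> 0"
    then have "s \<noteq> 1" by auto
    then have np: "s \<notin> poles" using frame_no_pole s by blast
    have "\<bar>Re (s - 1)\<bar> \<le> cmod (s - 1)" by (rule abs_Re_le_cmod)
    then have d: "1 \<le> cmod (s - 1)" using s by simp
    have n: "cmod (of_real T powr z) = T powr Re z" for z using T_pos by (simp add: norm_powr_real_powr)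
    have "cmod (balanced \<sigma> s) \<le> cmod (A s) + cmod (res1 * of_real T powr (1 - s) / (s - 1)) + cmod (c * of_real T powr (- s))"
      unfolding balanced_def c_def[symmetric] tame_eq[OF np] by (intro norm_triangle_le_diff add_mono order_refl norm_triangle_ineq4)
    also have "cmod (res1 * of_real T powr (1 - s) / (s - 1)) \<le> cmod (res1 * of_real T powr (1 - s)) / 1"
      unfolding norm_divide using d by (intro divide_left_mono) auto
    also have "cmod (res1 * of_real T powr (1 - s)) / 1 = cmod res1 * T * T powr (- Re s)"
    proof -
      have "T powr (1 - Re s) = T * T powr (- Re s)" using T_pos by (simp add: powr_diff powr_minus divide_inverse)
      then show ?thesis by (simp add: norm_mult n)
    qed
    also have "cmod (c * of_real T powr (- s)) = cmod c * T powr (- Re s)" by (simp add: norm_mult n)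
    also have "cmod (A s) \<le> M * T powr (- Re s)" using s by (intro M) auto
    finally show "cmod (balanced \<sigma> s) \<le> (M + cmod res1 * T + cmod c) * T powr (- Re s)"
      by (simp add: algebra_simps)
  qed
qed

lemma weight_growth_frame:
  "\<exists>K R. 0 < K \<and> (\<forall>s\<in>frame. Re s \<le> - R \<longrightarrow> cmod (weight T \<sigma> \<alpha> \<delta> s) \<le> K * (1 + \<bar>Re s\<bar>) \<and>
     cmod (weight T \<sigma> \<alpha> \<delta> (s - \<i> * of_real T)) \<le> K * (1 + \<bar>Re s\<bar>))"
proof -
  obtain K R where KR: "K > 0" "R > 0"
    "\<And>s. R \<le> \<bar>Re s\<bar> \<Longrightarrow> \<bar>Im s\<bar> \<le> T \<Longrightarrow> cmod (weight T \<sigma> \<alpha> \<delta> s) \<le> K * (1 + \<bar>Re s\<bar>)"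
    using weight_growth[OF T_pos, of \<sigma> \<alpha> \<delta>] by blast
  show ?thesis
  proof (intro exI conjI ballI impI)
    fix s assume s: "s \<in> frame" "Re s \<le> - R"
    show "cmod (weight T \<sigma> \<alpha> \<delta> s) \<le> K * (1 + \<bar>Re s\<bar>)"
      using KR(3)[of s] frame_Im[OF s(1)] s(2) KR(2) by linarith
    have "cmod (weight T \<sigma> \<alpha> \<delta> (s - \<i> * of_real T)) \<le> K * (1 + \<bar>Re (s - \<i> * of_real T)\<bar>)"
      using frame_Im[OF s(1)] s(2) KR(2) by (intro KR(3)) auto
    then show "cmod (weight T \<sigma> \<alpha> \<delta> (s - \<i> * of_real T)) \<le> K * (1 + \<bar>Re s\<bar>)" by simp
  qed (rule KR(1))
qed

lemma decaying_weights:
  assumes B: "\<And>s. s \<in> frame \<Longrightarrow> Re s \<le> \<beta> \<Longrightarrow> cmod (B s) \<le> M * y powr (- Re s)" "0 \<le> M" "0 < y" "y < x"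
  shows "decaying (\<lambda>s. weight T \<sigma> \<alpha> \<delta> s * B s * tmon x s)"
    and "decaying (\<lambda>s. weight T \<sigma> \<alpha> \<delta> (s - \<i> * of_real T) * B s * tmon x s)"
proof -
  obtain K R where KR: "0 < K" "\<forall>s\<in>frame. Re s \<le> - R \<longrightarrow> cmod (weight T \<sigma> \<alpha> \<delta> s) \<le> K * (1 + \<bar>Re s\<bar>) \<and>
     cmod (weight T \<sigma> \<alpha> \<delta> (s - \<i> * of_real T)) \<le> K * (1 + \<bar>Re s\<bar>)"
    using weight_growth_frame[of \<sigma> \<alpha> \<delta>] by (elim exE conjE)
  show "decaying (\<lambda>s. weight T \<sigma> \<alpha> \<delta> s * B s * tmon x s)"
    by (rule decaying_weighted[where R = R and K = K, OF _ _ B]) (use KR in \<open>simp_all del: Un_iff\<close>)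
  show "decaying (\<lambda>s. weight T \<sigma> \<alpha> \<delta> (s - \<i> * of_real T) * B s * tmon x s)"
    by (rule decaying_weighted[where R = R and K = K, OF _ _ B]) (use KR in \<open>simp_all del: Un_iff\<close>)
qed

lemma shifted_hol_wide: "(\<lambda>s. weight T \<sigma> \<alpha> \<delta> (s - \<i> * of_real T)) holomorphic_on wide - {of_real \<sigma>}"
  by (rule holomorphic_on_subset[OF shift_weight.shift_hol[OF shift_weight_weight[OF T_pos]]]) (auto simp: wide_def)

text \<open>\<open>shift_identity\<close> ties only one real component of this sum to the real
  residue sum, so the complex sum has to converge on its own. With \<open>balanced\<close> in place
  of A the integrand extends holomorphically to all of \<open>wide\<close>, as
  \<open>residue_sum_convergent\<close> requires; the subtracted terms are holomorphic at the upper
  poles and leave the residues unchanged.\<close>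

lemma upper_residues_convergent:
  "convergent (\<lambda>n. \<Sum>p | p \<in> poles \<and> \<sigma>n n < Re p \<and> 0 < Im p \<and> Im p < T.
     residue (\<lambda>s. weight T \<sigma> \<alpha> \<delta> (s - \<i> * of_real T) * (A s * tmon x s)) p)"
proof -
  let ?W = "\<lambda>s. weight T \<sigma> \<alpha> \<delta> (s - \<i> * of_real T)"
  define f where "f = (\<lambda>s. ?W s * balanced \<sigma> s * tmon x s)"
  have fh: "f holomorphic_on wide - {of_real \<sigma>}"
    unfolding f_def by (intro holomorphic_intros shifted_hol_wide tmon_holomorphic x_pos
        holomorphic_on_subset[OF balanced_holomorphic]) (auto simp: wide_def)
  have "\<exists>g. g holomorphic_on wide \<and> (\<forall>z\<in>wide - {of_real \<sigma>}. g z = f z)"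
  proof (cases "of_real \<sigma> \<in> wide")
    case True
    then have i: "of_real \<sigma> \<in> interior wide" by (simp add: interior_open open_wide)
    obtain L where L: "((\<lambda>s. (s - of_real \<sigma>) * ?W s) \<longlongrightarrow> L) (at (of_real \<sigma>))" by (rule weight_shift_pole[OF T_pos])
    have "continuous_on wide (balanced \<sigma>)"
      by (rule holomorphic_on_imp_continuous_on, rule holomorphic_on_subset[OF balanced_holomorphic]) (auto simp: wide_def)
    then have "isCont (balanced \<sigma>) (of_real \<sigma>)"
      using continuous_on_eq_continuous_at[OF open_wide] True by blast
    then have b: "(balanced \<sigma> \<longlongrightarrow> 0) (at (of_real \<sigma>))" using balanced_root[OF True] by (simp add: isCont_def)
    have t: "(tmon x \<longlongrightarrow> tmon x (of_real \<sigma>)) (at (of_real \<sigma>))"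
      using tmon_cont[OF x_pos, of UNIV] by (simp add: continuous_on_eq_continuous_at isCont_def)
    have "((\<lambda>s. (s - of_real \<sigma>) * ?W s * balanced \<sigma> s * tmon x s) \<longlongrightarrow> L * 0 * tmon x (of_real \<sigma>)) (at (of_real \<sigma>))"
      by (intro tendsto_mult L b t)
    then have "((\<lambda>s. (s - of_real \<sigma>) * f s) \<longlongrightarrow> 0) (at (of_real \<sigma>))" by (simp add: f_def mult.assoc)
    from holomorphic_on_extend_lim[OF fh i] this show ?thesis by blast
  next
    case False
    then show ?thesis using fh by auto
  qed
  then obtain g where g: "g holomorphic_on wide" and gf: "\<forall>z\<in>wide - {of_real \<sigma>}. g z = f z" by (elim exE conjE)
  obtain M where M: "M \<ge> 0" "\<And>s. s \<in> frame \<Longrightarrow> Re s \<le> 0 \<Longrightarrow> cmod (balanced \<sigma> s) \<le> M * T powr (- Re s)"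
    using balanced_growth[of \<sigma>] by blast
  have "decaying f"
    unfolding f_def by (rule decaying_weights(2)[OF M(2,1) T_pos x_gt])
  \<comment> \<open>\<open>g\<close> and \<open>f\<close> may differ at \<sigma> itself, so they are
    compared only for Re s <= \<sigma> - 1.\<close>
  then have "decaying g"
  proof (rule decaying_cong)
    show "cmod (g s) \<le> 1 * cmod (f s)" if "s \<in> frame" "Re s \<le> \<sigma> - 1" for s
    proof -
      have "s \<noteq> of_real \<sigma>" using that(2) by (intro notI) simp
      then show ?thesis using gf wide_frame[OF that(1)] by simp
    qed
  qed simp
  from residue_sum_convergent[OF g(1) this]
  have "convergent (\<lambda>n. \<Sum>p | p \<in> poles \<and> \<sigma>n n < Re p \<and> 0 < Im p \<and> Im p < T. residue g p)" .
  also have "(\<lambda>n. \<Sum>p | p \<in> poles \<and> \<sigma>n n < Re p \<and> 0 < Im p \<and> Im p < T. residue g p)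
    = (\<lambda>n. \<Sum>p | p \<in> poles \<and> \<sigma>n n < Re p \<and> 0 < Im p \<and> Im p < T. residue (\<lambda>s. ?W s * (A s * tmon x s)) p)"
  proof (intro ext sum.cong refl)
    fix n p assume "p \<in> {p. p \<in> poles \<and> \<sigma>n n < Re p \<and> 0 < Im p \<and> Im p < T}"
    then have p: "p \<in> poles" "0 < Im p" "Im p < T" by auto
    define V where "V = ({s. 0 < Im s} \<inter> {s. Im s < T}) \<inter> - (poles - {p})"
    have "open V"
      unfolding V_def using discrete_set_closed[OF discrete_set_subset[OF discrete_poles, of "poles - {p}"]]
      by (intro open_Int open_halfspace_Im_gt open_halfspace_Im_lt open_Compl) auto
    have pV: "p \<in> V" using p by (simp add: V_def)
    define q where "q = (\<lambda>s. res1 * of_real T powr (1 - s) / (s - 1) + (if of_real \<sigma> \<in> wide then tame (of_real \<sigma>) * of_real T powr of_real \<sigma> else 0) * of_real T powr (- s))"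
    have V1: "s \<noteq> 1" "s \<noteq> of_real \<sigma>" if "s \<in> V" for s using that by (auto simp: V_def)
    have Wh: "?W holomorphic_on V"
      by (rule holomorphic_on_subset[OF shift_weight.shift_hol[OF shift_weight_weight[OF T_pos]]]) (use T_pos in \<open>auto simp: V_def\<close>)
    have h1: "(\<lambda>s. ?W s * (A s * tmon x s)) holomorphic_on V - {p}"
      by (intro holomorphic_intros tmon_holomorphic x_pos holomorphic_on_subset[OF Wh] holomorphic_on_subset[OF A_holomorphic])
        (auto simp: V_def)
    have h2: "(\<lambda>s. ?W s * q s * tmon x s) holomorphic_on V"
      unfolding q_def using V1 T_pos by (intro holomorphic_intros tmon_holomorphic x_pos Wh) auto
    have "\<forall>\<^sub>F s in at p. s \<in> V - {p}" using \<open>open V\<close> pV by (rule eventually_at_in_open)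
    then have "\<forall>\<^sub>F s in at p. g s = ?W s * (A s * tmon x s) - ?W s * q s * tmon x s"
    proof eventually_elim
      case (elim s)
      then have s: "s \<in> wide" "s \<notin> poles" using T_pos by (auto simp: V_def wide_def)
      have "balanced \<sigma> s = A s - q s" by (simp add: balanced_def tame_eq[OF s(2)] q_def)
      then have "g s = f s" using gf s(1) V1[of s] elim by simp
      then show ?case using \<open>balanced \<sigma> s = A s - q s\<close> by (simp add: f_def algebra_simps)
    qed
    then have "residue g p = residue (\<lambda>s. ?W s * (A s * tmon x s) - ?W s * q s * tmon x s) p" by (rule residue_cong) simp
    also have "\<dots> = residue (\<lambda>s. ?W s * (A s * tmon x s)) p - residue (\<lambda>s. ?W s * q s * tmon x s) p"
      by (rule residue_diff[OF \<open>open V\<close> pV h1 holomorphic_on_subset[OF h2]]) auto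
    also have "residue (\<lambda>s. ?W s * q s * tmon x s) p = 0" by (rule residue_holo[OF \<open>open V\<close> pV h2])
    finally show "residue g p = residue (\<lambda>s. ?W s * (A s * tmon x s)) p" by simp
  qed
  finally show ?thesis .
qed

end

section \<open>The contour identity in the limit over the rungs\<close>

context ladder_contour
begin

definition upper_sum :: "real \<Rightarrow> real \<Rightarrow> real \<Rightarrow> nat \<Rightarrow> complex" where
  "upper_sum \<sigma> \<alpha> \<delta> n = (\<Sum>p | p \<in> poles \<and> \<sigma>n n < Re p \<and> 0 < Im p \<and> Im p < T.
     residue (\<lambda>s. weight T \<sigma> \<alpha> \<delta> (s - \<i> * of_real T) * (A s * tmon x s)) p)"

definition real_sum :: "real \<Rightarrow> real \<Rightarrow> real \<Rightarrow> nat \<Rightarrow> complex" where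
  "real_sum \<sigma> \<alpha> \<delta> n = (\<Sum>p | p \<in> insert (of_real \<sigma>) poles \<and> \<sigma>n n < Re p \<and> Im p = 0.
     residue (\<lambda>s. (weight T \<sigma> \<alpha> \<delta> s - weight T \<sigma> \<alpha> \<delta> (s - \<i> * of_real T)) / (\<i> * of_real T) * (A s * tmon x s)) p)"

definition shifted_integrand :: "real \<Rightarrow> real \<Rightarrow> real \<Rightarrow> complex \<Rightarrow> complex" where
  "shifted_integrand \<sigma> \<alpha> \<delta> s = weight T \<sigma> \<alpha> \<delta> (s - \<i> * of_real T) * (A s * tmon x s)"

lemma shifted_integrand_holomorphic: "shifted_integrand \<sigma> \<alpha> \<delta> holomorphic_on wide - poles - {of_real \<sigma>}"
  unfolding shifted_integrand_def
  by (intro holomorphic_intros tmon_holomorphic x_pos holomorphic_on_subset[OF shifted_hol_wide]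
      holomorphic_on_subset[OF A_holomorphic]) auto

lemma filled_weight_holomorphic: "filled (weight T \<sigma> \<alpha> \<delta>) x holomorphic_on slit"
  unfolding slit_def
proof (rule filled_holomorphic[OF weight_holomorphic[OF T_pos] _ _ weight_1 x_pos])
  have "{s. \<bar>Im s\<bar> < T} = {s. - T < Im s} \<inter> {s. Im s < T}" by auto
  then show "open {s. \<bar>Im s\<bar> < T}" using open_Int[OF open_halfspace_Im_gt open_halfspace_Im_lt] by simp
qed (use T_pos in auto)

text \<open>This is \<open>shift_identity\<close> for B(s) = A(s) x^(s-1), followed by
  \<open>loop_identity\<close>, which exchanges the polygon near the real axis for the clamped
  contour. The polygon meets no pole, so on it \<open>filled\<close> agrees with the plain
  product.\<close>

lemma real_sum_real_and_identity:
  assumes k: "1 < \<kappa>" "\<sigma> < \<kappa>" and b: "\<sigma>n n < 1" "\<sigma>n n < \<sigma>"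
  shows "real_sum \<sigma> \<alpha> \<delta> n \<in> \<real>"
    and "Re (seg (shifted_integrand \<sigma> \<alpha> \<delta>) (Complex \<kappa> 0) (Complex \<kappa> T) + seg (shifted_integrand \<sigma> \<alpha> \<delta>) (Complex \<kappa> T) (Complex 1 T)
        + seg (filled (weight T \<sigma> \<alpha> \<delta>) x) (Complex 1 0) (Complex \<kappa> 0))
      = Re (2 * of_real pi * \<i> * upper_sum \<sigma> \<alpha> \<delta> n) + pi * T * Re (real_sum \<sigma> \<alpha> \<delta> n)
      + Re (contour_integral (clamped_path n) (filled (weight T \<sigma> \<alpha> \<delta>) x))
      + Re (seg (shifted_integrand \<sigma> \<alpha> \<delta>) (Complex (\<sigma>n n) 0) (Complex (\<sigma>n n) T)
          + seg (shifted_integrand \<sigma> \<alpha> \<delta>) (Complex (\<sigma>n n) T) (Complex 1 T))"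
proof -
  interpret sw: shift_weight T \<sigma> "weight T \<sigma> \<alpha> \<delta>" by (rule shift_weight_weight[OF T_pos])
  let ?b = "\<sigma>n n" and ?\<Phi> = "weight T \<sigma> \<alpha> \<delta>"
  obtain \<eta> where eta: "0 < \<eta>" "\<eta> \<le> T / 8" "\<And>p. p \<in> poles \<Longrightarrow> ?b \<le> Re p \<Longrightarrow> \<bar>Im p\<bar> \<le> \<eta> \<Longrightarrow> Im p = 0"
    using pole_gap[of ?b] by blast
  have etaT: "\<eta> < T" using eta(2) T_pos by linarith
  have B: "(\<lambda>s. A s * tmon x s) holomorphic_on - poles"
    by (intro holomorphic_intros A_holomorphic tmon_holomorphic x_pos)
  have Bcnj: "A (cnj s) * tmon x (cnj s) = cnj (A s * tmon x s)" for s
    by (simp add: A_cnj tmon_cnj x_pos)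
  have P1: "p \<in> poles \<Longrightarrow> \<bar>Im p\<bar> \<le> T \<Longrightarrow> Re p < \<kappa>" for p using poles_Re_le[of p] k by simp
  have Pb: "p \<in> poles \<Longrightarrow> \<bar>Im p\<bar> \<le> T \<Longrightarrow> Re p \<noteq> ?b" for p using poles_rung[of p n] b by simp
  note id = sw.shift_identity[OF B discrete_poles Bcnj k b P1 Pb poles_Im eta(1) etaT eta(3)]
  show "real_sum \<sigma> \<alpha> \<delta> n \<in> \<real>"
    using id(1) unfolding real_sum_def sw.jump_def sw.shifted_def .
  have fe: "seg (\<lambda>s. ?\<Phi> s * (A s * tmon x s)) p q = seg (filled ?\<Phi> x) p q"
    if "\<And>s. s \<in> closed_segment p q \<Longrightarrow> s \<notin> poles" for p q
    by (rule contour_integral_eq) (use that in \<open>simp add: filled_eq mult.assoc\<close>)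
  have e1: "s \<notin> poles" if "s \<in> closed_segment (Complex \<kappa> 0) (Complex \<kappa> \<eta>)" for s
    using that poles_Re_le[of s] k by (auto simp: closed_segment_same_Re)
  have e2: "s \<notin> poles" if "s \<in> closed_segment (Complex \<kappa> \<eta>) (Complex ?b \<eta>)" for s
    using that eta(3)[of s] eta(1) k b by (auto simp: closed_segment_same_Im closed_segment_eq_real_ivl)
  have e3: "s \<notin> poles" if "s \<in> closed_segment (Complex ?b \<eta>) (Complex ?b 0)" for s
    using that Pb[of s] eta(1) etaT by (auto simp: closed_segment_same_Re closed_segment_eq_real_ivl)
  have fe3:
    "seg (\<lambda>s. ?\<Phi> s * (A s * tmon x s)) (Complex \<kappa> 0) (Complex \<kappa> \<eta>) = seg (filled ?\<Phi> x) (Complex \<kappa> 0) (Complex \<kappa> \<eta>)"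
    "seg (\<lambda>s. ?\<Phi> s * (A s * tmon x s)) (Complex \<kappa> \<eta>) (Complex ?b \<eta>) = seg (filled ?\<Phi> x) (Complex \<kappa> \<eta>) (Complex ?b \<eta>)"
    "seg (\<lambda>s. ?\<Phi> s * (A s * tmon x s)) (Complex ?b \<eta>) (Complex ?b 0) = seg (filled ?\<Phi> x) (Complex ?b \<eta>) (Complex ?b 0)"
    by (rule fe, erule e1) (rule fe, erule e2, rule fe, erule e3)
  have loop: "seg (filled ?\<Phi> x) (Complex \<kappa> 0) (Complex \<kappa> \<eta>) + seg (filled ?\<Phi> x) (Complex \<kappa> \<eta>) (Complex ?b \<eta>)
      + seg (filled ?\<Phi> x) (Complex ?b \<eta>) (Complex ?b 0)
    = contour_integral (clamped_path n) (filled ?\<Phi> x) - seg (filled ?\<Phi> x) (Complex 1 0) (Complex \<kappa> 0)"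
    by (rule loop_identity[OF filled_weight_holomorphic b(1) k(1) eta])
  show "Re (seg (shifted_integrand \<sigma> \<alpha> \<delta>) (Complex \<kappa> 0) (Complex \<kappa> T) + seg (shifted_integrand \<sigma> \<alpha> \<delta>) (Complex \<kappa> T) (Complex 1 T)
        + seg (filled (weight T \<sigma> \<alpha> \<delta>) x) (Complex 1 0) (Complex \<kappa> 0))
      = Re (2 * of_real pi * \<i> * upper_sum \<sigma> \<alpha> \<delta> n) + pi * T * Re (real_sum \<sigma> \<alpha> \<delta> n)
      + Re (contour_integral (clamped_path n) (filled (weight T \<sigma> \<alpha> \<delta>) x))
      + Re (seg (shifted_integrand \<sigma> \<alpha> \<delta>) (Complex (\<sigma>n n) 0) (Complex (\<sigma>n n) T)
          + seg (shifted_integrand \<sigma> \<alpha> \<delta>) (Complex (\<sigma>n n) T) (Complex 1 T))"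
  proof -
    define S1 where "S1 = upper_sum \<sigma> \<alpha> \<delta> n"
    define S2 where "S2 = real_sum \<sigma> \<alpha> \<delta> n"
    have S1: "(\<Sum>p | p \<in> poles \<and> ?b < Re p \<and> 0 < Im p \<and> Im p < T. residue (\<lambda>s. sw.shifted s * (A s * tmon x s)) p) = S1"
      by (simp add: S1_def upper_sum_def sw.shifted_def)
    have S2: "(\<Sum>p | p \<in> insert (of_real \<sigma>) poles \<and> ?b < Re p \<and> Im p = 0. residue (\<lambda>s. sw.jump s * (A s * tmon x s)) p) = S2"
      unfolding S2_def real_sum_def sw.jump_def sw.shifted_def ..
    have g: "(\<lambda>s. sw.shifted s * (A s * tmon x s)) = shifted_integrand \<sigma> \<alpha> \<delta>"
      by (simp add: shifted_integrand_def[abs_def] sw.shifted_def)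
    show ?thesis
      using id(2)[unfolded S1 S2, unfolded g, unfolded fe3, unfolded loop]
      unfolding S1_def[symmetric] S2_def[symmetric] by simp
  qed
qed

lemma decaying_shifted_integrand: "decaying (shifted_integrand \<sigma> \<alpha> \<delta>)"
  and decaying_filled: "decaying (filled (weight T \<sigma> \<alpha> \<delta>) x)"
proof -
  obtain M where M: "M \<ge> 0" "\<And>s. s \<in> frame \<Longrightarrow> Re s \<le> 1 / 2 \<Longrightarrow> cmod (A s) \<le> M * T powr (- Re s)"
    using A_growth by blast
  show "decaying (shifted_integrand \<sigma> \<alpha> \<delta>)"
  proof -
    have "decaying (\<lambda>s. weight T \<sigma> \<alpha> \<delta> (s - \<i> * of_real T) * A s * tmon x s)"
      by (rule decaying_weights(2)[OF M(2,1) T_pos x_gt])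
    then show ?thesis by (simp only: shifted_integrand_def[abs_def] mult.assoc)
  qed
  have dec: "decaying (\<lambda>s. weight T \<sigma> \<alpha> \<delta> s * A s * tmon x s)"
    by (rule decaying_weights(1)[OF M(2,1) T_pos x_gt])
  show "decaying (filled (weight T \<sigma> \<alpha> \<delta>) x)"
  proof (rule decaying_cong[OF dec, where \<beta>' = 0 and K = 1])
    fix s assume s: "s \<in> frame" "Re s \<le> 0"
    have "s \<noteq> 1" using s(2) by (intro notI) simp
    then have "s \<notin> poles" using frame_no_pole[OF s(1)] by blast
    then show "cmod (filled (weight T \<sigma> \<alpha> \<delta>) x s) \<le> 1 * cmod (weight T \<sigma> \<alpha> \<delta> s * A s * tmon x s)"
      by (simp add: filled_eq)
  qed simp
qed

lemma rung_integrand_tendsto_0: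
  "(\<lambda>n. seg (shifted_integrand \<sigma> \<alpha> \<delta>) (Complex (\<sigma>n n) 0) (Complex (\<sigma>n n) T)) \<longlonglongrightarrow> 0"
proof (rule rung_seg_tendsto_0[OF decaying_shifted_integrand])
  show "\<forall>\<^sub>F n in sequentially. continuous_on (closed_segment (Complex (\<sigma>n n) 0) (Complex (\<sigma>n n) T)) (shifted_integrand \<sigma> \<alpha> \<delta>)"
    using rungs_lt[of 1] rungs_lt[of \<sigma>]
  proof eventually_elim
    case (elim n)
    have "of_real \<sigma> \<notin> closed_segment (Complex (\<sigma>n n) 0) (Complex (\<sigma>n n) T)"
      using elim(2) by (auto simp: closed_segment_same_Re)
    then have "closed_segment (Complex (\<sigma>n n) 0) (Complex (\<sigma>n n) T) \<subseteq> wide - poles - {of_real \<sigma>}"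
      using wide_rung[OF elim(1)] by auto
    then show ?case
      by (rule continuous_on_subset[OF holomorphic_on_imp_continuous_on[OF shifted_integrand_holomorphic]])
  qed
qed

text \<open>In the identity for a single rung every term except the real residue sum is already
  known to converge; solving for that sum gives its limit, and as it is real the identity between
  real parts determines it.\<close>

lemma residue_sums_tendsto:
  assumes k: "1 < \<kappa>" "\<sigma> < \<kappa>"
  obtains U V where "upper_sum \<sigma> \<alpha> \<delta> \<longlonglongrightarrow> U" "real_sum \<sigma> \<alpha> \<delta> \<longlonglongrightarrow> of_real V"
    "(\<lambda>n. Re (contour_integral (clamped_path n) (filled (weight T \<sigma> \<alpha> \<delta>) x))
      + Re (seg (shifted_integrand \<sigma> \<alpha> \<delta>) (Complex (\<sigma>n n) T) (Complex 1 T)))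
     \<longlonglongrightarrow> Re (seg (shifted_integrand \<sigma> \<alpha> \<delta>) (Complex \<kappa> 0) (Complex \<kappa> T) + seg (shifted_integrand \<sigma> \<alpha> \<delta>) (Complex \<kappa> T) (Complex 1 T)
        + seg (filled (weight T \<sigma> \<alpha> \<delta>) x) (Complex 1 0) (Complex \<kappa> 0))
      - Re (2 * of_real pi * \<i> * U) - pi * T * V"
proof -
  let ?g = "shifted_integrand \<sigma> \<alpha> \<delta>" and ?f = "filled (weight T \<sigma> \<alpha> \<delta>) x"
  define Z where "Z = Re (seg ?g (Complex \<kappa> 0) (Complex \<kappa> T) + seg ?g (Complex \<kappa> T) (Complex 1 T)
        + seg ?f (Complex 1 0) (Complex \<kappa> 0))"
  have "convergent (upper_sum \<sigma> \<alpha> \<delta>)"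
    using upper_residues_convergent[of \<sigma> \<alpha> \<delta>] by (simp add: upper_sum_def[abs_def])
  then obtain U where U: "upper_sum \<sigma> \<alpha> \<delta> \<longlonglongrightarrow> U" by (auto simp: convergent_def)
  have ci: "(\<lambda>n. contour_integral (clamped_path n) ?f) \<longlonglongrightarrow> ray_contour_integral \<gamma> ?f"
    by (intro clamped_integral_tendsto decaying_filled holomorphic_on_imp_continuous_on filled_weight_holomorphic)
  have "{s. Im s = T \<and> Re s \<le> 1} \<subseteq> wide - poles - {of_real \<sigma>}" using wide_top T_pos by auto
  then have "continuous_on {s. Im s = T \<and> Re s \<le> 1} ?g"
    by (rule continuous_on_subset[OF holomorphic_on_imp_continuous_on[OF shifted_integrand_holomorphic]])
  from top_seg_convergent[OF decaying_shifted_integrand this]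
  obtain t where t: "(\<lambda>n. seg ?g (Complex (\<sigma>n n) T) (Complex 1 T)) \<longlonglongrightarrow> t" by (auto simp: convergent_def)
  note r = rung_integrand_tendsto_0[of \<sigma> \<alpha> \<delta>]
  define V where "V = (Z - Re (2 * of_real pi * \<i> * U) - Re (ray_contour_integral \<gamma> ?f) - Re (0 + t)) / (pi * T)"
  have lim: "(\<lambda>n. (Z - Re (2 * of_real pi * \<i> * upper_sum \<sigma> \<alpha> \<delta> n) - Re (contour_integral (clamped_path n) ?f)
     - Re (seg ?g (Complex (\<sigma>n n) 0) (Complex (\<sigma>n n) T) + seg ?g (Complex (\<sigma>n n) T) (Complex 1 T))) / (pi * T)) \<longlonglongrightarrow> V"
    unfolding V_def using T_pos by (intro tendsto_intros U ci t r tendsto_Re) auto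
  have "(\<lambda>n. of_real ((Z - Re (2 * of_real pi * \<i> * upper_sum \<sigma> \<alpha> \<delta> n) - Re (contour_integral (clamped_path n) ?f)
     - Re (seg ?g (Complex (\<sigma>n n) 0) (Complex (\<sigma>n n) T) + seg ?g (Complex (\<sigma>n n) T) (Complex 1 T))) / (pi * T)) :: complex) \<longlonglongrightarrow> of_real V"
    by (intro tendsto_of_real lim)
  then have V: "real_sum \<sigma> \<alpha> \<delta> \<longlonglongrightarrow> of_real V"
  proof (rule Lim_transform_eventually)
    show "\<forall>\<^sub>F n in sequentially. of_real ((Z - Re (2 * of_real pi * \<i> * upper_sum \<sigma> \<alpha> \<delta> n) - Re (contour_integral (clamped_path n) ?f)
     - Re (seg ?g (Complex (\<sigma>n n) 0) (Complex (\<sigma>n n) T) + seg ?g (Complex (\<sigma>n n) T) (Complex 1 T))) / (pi * T)) = real_sum \<sigma> \<alpha> \<delta> n"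
      using rungs_lt[of 1] rungs_lt[of \<sigma>]
    proof eventually_elim
      case (elim n)
      have "(Z - Re (2 * of_real pi * \<i> * upper_sum \<sigma> \<alpha> \<delta> n) - Re (contour_integral (clamped_path n) ?f)
     - Re (seg ?g (Complex (\<sigma>n n) 0) (Complex (\<sigma>n n) T) + seg ?g (Complex (\<sigma>n n) T) (Complex 1 T))) / (pi * T) = Re (real_sum \<sigma> \<alpha> \<delta> n)"
        unfolding Z_def real_sum_real_and_identity(2)[OF k elim] using T_pos by (simp add: field_simps)
      then show ?case using real_sum_real_and_identity(1)[OF k elim, of \<alpha> \<delta>]
        by (simp only: of_real_Re)
    qed
  qed
  have "(\<lambda>n. Re (contour_integral (clamped_path n) ?f) + Re (seg ?g (Complex (\<sigma>n n) T) (Complex 1 T)))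
     \<longlonglongrightarrow> Re (ray_contour_integral \<gamma> ?f) + Re t" by (intro tendsto_intros ci t tendsto_Re)
  also have "Re (ray_contour_integral \<gamma> ?f) + Re t = Z - Re (2 * of_real pi * \<i> * U) - pi * T * V"
    using T_pos by (simp add: V_def)
  finally show ?thesis using that[OF U V] unfolding Z_def by blast
qed

end

section \<open>Bounds for the integrals that remain\<close>

lemma has_integral_one_minus:
  fixes h :: "real \<Rightarrow> real"
  assumes "(h has_integral I) {b..1}"
  shows "((\<lambda>t. h (1 - t)) has_integral I) {0..1 - b}"
proof -
  have "((\<lambda>t. h (- t)) has_integral I) (cbox (- 1) (- b))"
    using assms by simp
  from has_integral_affinity'[OF this, of 1 "- 1"] show ?thesis by (simp add: add.commute)
qed

lemma convex_contour_integral_eq_seg: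
  assumes "convex S" "open S" "f holomorphic_on S" "valid_path p" "path_image p \<subseteq> S"
  shows "contour_integral p f = seg f (pathstart p) (pathfinish p)"
proof -
  obtain g where g: "\<And>s. s \<in> S \<Longrightarrow> (g has_field_derivative f s) (at s within S)"
    using holomorphic_convex_primitive'[OF assms(1-3)] by blast
  have "pathstart p \<in> S" "pathfinish p \<in> S" using assms(5) by auto
  then have "closed_segment (pathstart p) (pathfinish p) \<subseteq> S" using assms(1) by (simp add: closed_segment_subset)
  then have "(f has_contour_integral (g (pathfinish (linepath (pathstart p) (pathfinish p)))
      - g (pathstart (linepath (pathstart p) (pathfinish p))))) (linepath (pathstart p) (pathfinish p))"
    by (intro contour_integral_primitive[OF g]) auto
  then have "seg f (pathstart p) (pathfinish p) = g (pathfinish p) - g (pathstart p)"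
    by (simp add: contour_integral_unique)
  then show ?thesis
    using contour_integral_primitive[OF g assms(4,5)] by (simp add: contour_integral_unique)
qed

context ladder_contour
begin

text \<open>The polar part is only bounded by a constant on the left, which T^(-Re s) fails to
  dominate if T < 1. This explains \<open>max T 1\<close> here and the condition 1 < x in
  \<open>regular_part_tendsto\<close>.\<close>

lemma regular_growth:
  obtains M where "0 \<le> M" "\<And>s. s \<in> frame \<Longrightarrow> Re s \<le> 0 \<Longrightarrow> cmod (regular s) \<le> M * max T 1 powr (- Re s)"
proof -
  obtain M where M: "M \<ge> 0" "\<And>s. s \<in> frame \<Longrightarrow> Re s \<le> 1 / 2 \<Longrightarrow> cmod (A s) \<le> M * T powr (- Re s)"
    using A_growth by blast
  show ?thesis
  proof (rule that[of "M + cmod res1"])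
    show "0 \<le> M + cmod res1" using M(1) by simp
    fix s assume s: "s \<in> frame" "Re s \<le> 0"
    have "s \<noteq> 1" using s(2) by (intro notI) simp
    then have np: "s \<notin> poles" using frame_no_pole[OF s(1)] by blast
    have "\<bar>Re (s - 1)\<bar> \<le> cmod (s - 1)" by (rule abs_Re_le_cmod)
    then have d: "1 \<le> cmod (s - 1)" using s by simp
    have "cmod (regular s) \<le> cmod (A s) + cmod (res1 / (s - 1))"
      unfolding regular(2)[OF np] by (rule norm_triangle_ineq4)
    also have "cmod (res1 / (s - 1)) \<le> cmod res1 / 1"
      unfolding norm_divide using d by (intro divide_left_mono) auto
    also have "cmod (A s) \<le> M * T powr (- Re s)" by (rule M(2)[OF s(1)]) (use s(2) in simp)
    also have "T powr (- Re s) \<le> max T 1 powr (- Re s)" using s(2) T_pos by (intro powr_mono2) auto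
    finally have "cmod (regular s) \<le> M * max T 1 powr (- Re s) + cmod res1 * 1" using M(1) by (simp add: mult_left_mono)
    moreover have "1 \<le> max T 1 powr (- Re s)" using s(2) by (intro ge_one_powr_ge_zero) auto
    then have "cmod res1 * 1 \<le> cmod res1 * max T 1 powr (- Re s)" by (intro mult_left_mono) auto
    ultimately show "cmod (regular s) \<le> (M + cmod res1) * max T 1 powr (- Re s)" by (simp add: distrib_right)
  qed
qed

lemma regular_part_holomorphic: "(\<lambda>s. weight T \<sigma> \<alpha> \<delta> s * regular s * tmon x s) holomorphic_on slit"
  by (intro holomorphic_intros tmon_holomorphic x_pos holomorphic_on_subset[OF weight_holomorphic[OF T_pos]]
      holomorphic_on_subset[OF regular(1)]) (auto simp: slit_def)

lemma regular_part_tendsto: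
  assumes "1 < x"
  shows "(\<lambda>n. contour_integral (clamped_path n) (\<lambda>s. weight T \<sigma> \<alpha> \<delta> s * regular s * tmon x s))
    \<longlonglongrightarrow> ray_contour_integral \<gamma> (\<lambda>s. weight T \<sigma> \<alpha> \<delta> s * F_reg A s * of_real x powr (s - 1))"
proof -
  obtain M where M: "0 \<le> M" "\<And>s. s \<in> frame \<Longrightarrow> Re s \<le> 0 \<Longrightarrow> cmod (regular s) \<le> M * max T 1 powr (- Re s)"
    using regular_growth by blast
  have "decaying (\<lambda>s. weight T \<sigma> \<alpha> \<delta> s * regular s * tmon x s)"
    by (rule decaying_weights(1)[OF M(2,1)]) (use assms x_gt T_pos in auto)
  then have "(\<lambda>n. contour_integral (clamped_path n) (\<lambda>s. weight T \<sigma> \<alpha> \<delta> s * regular s * tmon x s))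
    \<longlonglongrightarrow> ray_contour_integral \<gamma> (\<lambda>s. weight T \<sigma> \<alpha> \<delta> s * regular s * tmon x s)"
    by (intro clamped_integral_tendsto holomorphic_on_imp_continuous_on regular_part_holomorphic)
  also have "ray_contour_integral \<gamma> (\<lambda>s. weight T \<sigma> \<alpha> \<delta> s * regular s * tmon x s)
    = ray_contour_integral \<gamma> (\<lambda>s. weight T \<sigma> \<alpha> \<delta> s * F_reg A s * of_real x powr (s - 1))"
    unfolding ray_contour_integral_def
  proof (rule integral_cong)
    fix t :: real assume t: "t \<in> {0..}"
    show "weight T \<sigma> \<alpha> \<delta> (\<gamma> t) * regular (\<gamma> t) * tmon x (\<gamma> t) * vector_derivative \<gamma> (at t)
       = weight T \<sigma> \<alpha> \<delta> (\<gamma> t) * F_reg A (\<gamma> t) * of_real x powr (\<gamma> t - 1) * vector_derivative \<gamma> (at t)"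
    proof (cases "\<gamma> t = 1")
      \<comment> \<open>At s = 1 both integrands vanish through the weight, although
        \<open>regular\<close> and \<open>F_reg A\<close> may differ there.\<close>
      case True
      then show ?thesis by simp
    next
      case False
      then have "\<gamma> t \<notin> poles" using frame_no_pole[of "\<gamma> t"] t by blast
      then show ?thesis by (simp add: regular(2) F_reg_def tmon_def)
    qed
  qed
  finally show ?thesis .
qed

text \<open>Multiplied by the weight, the polar part is holomorphic in the whole strip |Im s| < T.
  Its integral over the contour may therefore be taken along the real axis, where its sign can be
  read off.\<close>

lemma clamped_filled_split:
  assumes b: "\<sigma>n n < 1"
  shows "contour_integral (clamped_path n) (filled (weight T \<sigma> \<alpha> \<delta>) x)
    = contour_integral (clamped_path n) (\<lambda>s. weight T \<sigma> \<alpha> \<delta> s * regular s * tmon x s)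
      - res1 * seg (\<lambda>s. slope1 (weight T \<sigma> \<alpha> \<delta>) s * tmon x s) (Complex (\<sigma>n n) 0) (Complex 1 0)"
proof -
  let ?W = "weight T \<sigma> \<alpha> \<delta>" and ?V = "{s. \<bar>Im s\<bar> < T}"
  let ?p = "clamped_path n" and ?k = "\<lambda>s. slope1 (weight T \<sigma> \<alpha> \<delta>) s * tmon x s"
  have V: "?V = {s. - T < Im s} \<inter> {s. Im s < T}" by auto
  have op: "open ?V" unfolding V by (intro open_Int open_halfspace_Im_gt open_halfspace_Im_lt)
  have cv: "convex ?V" unfolding V by (intro convex_Int convex_halfspace_Im_gt convex_halfspace_Im_lt)
  have vp: "valid_path ?p" by (rule valid_path_cpath[OF exit_time(1)])
  have im: "path_image ?p \<subseteq> slit" using path_image_cpath[OF exit_time(1)] clamped_in_slit[OF b] by blast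
  then have imV: "path_image ?p \<subseteq> ?V" by (auto simp: slit_def)
  have kh: "?k holomorphic_on ?V"
    using T_pos by (intro holomorphic_intros tmon_holomorphic x_pos slope1_holomorphic[OF weight_holomorphic[OF T_pos] op] weight_1) auto
  have "(\<lambda>s. ?W s * regular s * tmon x s) contour_integrable_on ?p"
    by (rule contour_integrable_holomorphic_simple[OF regular_part_holomorphic open_slit vp im])
  moreover have ki: "?k contour_integrable_on ?p"
    by (rule contour_integrable_holomorphic_simple[OF kh op vp imV])
  ultimately have "contour_integral ?p (\<lambda>s. ?W s * regular s * tmon x s + res1 * ?k s)
     = contour_integral ?p (\<lambda>s. ?W s * regular s * tmon x s) + res1 * contour_integral ?p ?k"
    by (simp add: contour_integral_add contour_integral_lmul contour_integrable_lmul)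
  moreover have "(\<lambda>s. ?W s * regular s * tmon x s + res1 * ?k s) = filled ?W x"
    by (simp add: filled_def[abs_def] algebra_simps)
  moreover have "contour_integral ?p ?k = - seg ?k (Complex (\<sigma>n n) 0) (Complex 1 0)"
  proof -
    have e: "pathstart ?p = Complex 1 0" "pathfinish ?p = Complex (\<sigma>n n) 0"
      using cpath_ends[OF exit_time, of "\<sigma>n n"] b by (auto simp: complex_eq_iff)
    show ?thesis unfolding convex_contour_integral_eq_seg[OF cv op kh vp imV] e by (rule seg_reverse)
  qed
  ultimately show ?thesis by simp
qed

lemma remainder_pointwise:
  assumes d: "\<delta> = 1 \<or> \<delta> = -1" and u: "u < 1"
  shows "\<delta> * Re (shifted_integrand \<sigma> 1 \<delta> (Complex u T) - res1 * (slope1 (weight T \<sigma> 1 \<delta>) (Complex u 0) * tmon x (Complex u 0)))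
    \<le> (1 - u) * cmod (F_reg A (Complex u T)) * x powr (u - 1)"
proof -
  define w where "w = Re (weight T \<sigma> 1 \<delta> (of_real u))"
  have w: "weight T \<sigma> 1 \<delta> (of_real u) = of_real w" unfolding w_def by (rule weight_real)
  have sh: "Complex u T - \<i> * of_real T = of_real u" "Complex u 0 = of_real u" by (simp_all add: complex_eq_iff)
  have r: "res1 = of_real (Re res1)" using res1_pos(1) by simp
  define r where "r = Re res1"
  have r0: "0 < r" using res1_pos(2) by (simp add: r_def)
  have rr: "res1 = of_real r" using r by (simp add: r_def)
  define F where "F = F_reg A (Complex u T)"
  have A: "A (Complex u T) = F + of_real r / (Complex u T - 1)" by (simp add: F_def F_reg_def rr)
  have sl: "slope1 (weight T \<sigma> 1 \<delta>) (of_real u) = of_real (w / (u - 1))"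
    using u w by (simp add: slope1_def)
  have t0: "tmon x (of_real u) = of_real (x powr (u - 1))" using tmon_Complex[OF x_pos, of u 0] by (simp add: sh(2))
  define E where "E = tmon x (Complex u T)"
  have nE: "cmod E = x powr (u - 1)" by (simp add: E_def norm_tmon x_pos)
  have wn: "\<bar>w\<bar> \<le> 1 - u" using norm_weight_le[OF T_pos, of \<delta> \<sigma> u] d u unfolding w by auto
  have ws: "\<delta> * w < 0" using weight_sign(1)[OF T_pos d u] by (simp add: w_def)
  have "shifted_integrand \<sigma> 1 \<delta> (Complex u T) - res1 * (slope1 (weight T \<sigma> 1 \<delta>) (Complex u 0) * tmon x (Complex u 0))
    = of_real w * (F * E) + of_real (w * r) * (E / (Complex u T - 1) - of_real (x powr (u - 1) / (u - 1)))"
    unfolding shifted_integrand_def sh w A sl t0 rr E_def[symmetric] by (simp add: algebra_simps)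
  then have "\<delta> * Re (shifted_integrand \<sigma> 1 \<delta> (Complex u T) - res1 * (slope1 (weight T \<sigma> 1 \<delta>) (Complex u 0) * tmon x (Complex u 0)))
    = \<delta> * w * Re (F * E) + \<delta> * w * (r * (Re (E / (Complex u T - 1)) - x powr (u - 1) / (u - 1)))"
    by (simp only: plus_complex.sel minus_complex.sel Re_complex_of_real times_complex.sel Im_complex_of_real mult_zero_left diff_zero)
      (simp add: algebra_simps)
  also have "\<delta> * w * (r * (Re (E / (Complex u T - 1)) - x powr (u - 1) / (u - 1))) \<le> 0"
  proof -
    have "\<bar>Re (Complex u T - 1)\<bar> \<le> cmod (Complex u T - 1)" by (rule abs_Re_le_cmod)
    then have "1 - u \<le> cmod (Complex u T - 1)" using u by simp
    then have "cmod (E / (Complex u T - 1)) \<le> x powr (u - 1) / (1 - u)"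
      unfolding norm_divide nE using u by (intro divide_left_mono) (auto intro!: mult_pos_pos)
    then have "\<bar>Re (E / (Complex u T - 1))\<bar> \<le> x powr (u - 1) / (1 - u)"
      using abs_Re_le_cmod order_trans by blast
    moreover have "x powr (u - 1) / (u - 1) = - (x powr (u - 1) / (1 - u))" unfolding minus_divide_right by simp
    ultimately have "0 \<le> Re (E / (Complex u T - 1)) - x powr (u - 1) / (u - 1)" by linarith
    then have "0 \<le> r * (Re (E / (Complex u T - 1)) - x powr (u - 1) / (u - 1))" using r0 by simp
    then show ?thesis by (rule mult_nonpos_nonneg[OF less_imp_le[OF ws]])
  qed
  also have "\<delta> * w * Re (F * E) \<le> (1 - u) * cmod F * x powr (u - 1)"
  proof -
    have "\<delta> * w * Re (F * E) \<le> \<bar>\<delta> * w\<bar> * \<bar>Re (F * E)\<bar>" by (metis abs_ge_self abs_mult)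
    also have "\<dots> \<le> (1 - u) * cmod (F * E)"
      using wn d abs_Re_le_cmod[of "F * E"] by (intro mult_mono) (auto simp: abs_mult)
    finally show ?thesis by (simp add: norm_mult nE mult.assoc)
  qed
  finally show ?thesis by (simp add: F_def)
qed

definition top_integral :: ennreal where
  "top_integral = (\<integral>\<^sup>+t\<in>{0..}. ennreal (t * cmod (F_reg A (1 - of_real t + \<i> * of_real T)) * x powr (- t)) \<partial>lborel)"

lemma top_not_pole: "Complex u T \<notin> poles"
  using poles_Im[of "Complex u T"] by auto

text \<open>The substitution t = 1 - u makes the left-hand side a truncation of
  \<open>top_integral\<close>.\<close>

lemma top_part_le:
  assumes b: "b < 1"
  shows "ennreal (integral {b..1} (\<lambda>u. (1 - u) * cmod (F_reg A (Complex u T)) * x powr (u - 1))) \<le> top_integral"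
proof -
  let ?h = "\<lambda>u. (1 - u) * cmod (F_reg A (Complex u T)) * x powr (u - 1)"
  have "continuous_on UNIV (\<lambda>u. F_reg A (Complex u T))"
  proof -
    have "F_reg A holomorphic_on - poles"
      unfolding F_reg_def using one_pole by (intro holomorphic_intros A_holomorphic) auto
    then have "continuous_on (- poles) (F_reg A)" by (rule holomorphic_on_imp_continuous_on)
    then show ?thesis
      by (rule continuous_on_compose2) (use top_not_pole in \<open>auto simp: Complex_eq intro!: continuous_intros\<close>)
  qed
  then have "continuous_on {b..1} (\<lambda>u. F_reg A (Complex u T))" by (rule continuous_on_subset) simp
  then have "continuous_on {b..1} ?h" using x_pos by (intro continuous_intros) auto
  then have "(?h has_integral integral {b..1} ?h) {b..1}" by (intro integrable_integral integrable_continuous_real)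
  from has_integral_one_minus[OF this]
  have "((\<lambda>t. t * cmod (F_reg A (Complex (1 - t) T)) * x powr (- t)) has_integral integral {b..1} ?h) {0..1 - b}" by simp
  then have "(\<integral>\<^sup>+t. ennreal (t * cmod (F_reg A (Complex (1 - t) T)) * x powr (- t)) * indicator {0..1 - b} t \<partial>lborel) = ennreal (integral {b..1} ?h)"
    by (intro nn_integral_has_integral_lebesgue') auto
  moreover have "(\<integral>\<^sup>+t. ennreal (t * cmod (F_reg A (Complex (1 - t) T)) * x powr (- t)) * indicator {0..1 - b} t \<partial>lborel) \<le> top_integral"
    unfolding top_integral_def
  proof (rule nn_integral_mono)
    fix t :: real
    have "1 - of_real t + \<i> * of_real T = Complex (1 - t) T" by (simp add: complex_eq_iff)
    then show "ennreal (t * cmod (F_reg A (Complex (1 - t) T)) * x powr (- t)) * indicator {0..1 - b} t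
      \<le> ennreal (t * cmod (F_reg A (1 - of_real t + \<i> * of_real T)) * x powr (- t)) * indicator {0..} t"
      by (auto simp: indicator_def)
  qed
  ultimately show ?thesis by simp
qed

lemma remainder_le:
  assumes d: "\<delta> = 1 \<or> \<delta> = -1" and b: "\<sigma>n n < 1" and fin: "top_integral \<noteq> \<infinity>"
  shows "\<delta> * (Re (contour_integral (clamped_path n) (filled (weight T \<sigma> 1 \<delta>) x))
      + Re (seg (shifted_integrand \<sigma> 1 \<delta>) (Complex (\<sigma>n n) T) (Complex 1 T)))
    \<le> cmod (contour_integral (clamped_path n) (\<lambda>s. weight T \<sigma> 1 \<delta> s * regular s * tmon x s)) + enn2real top_integral"
proof -
  let ?b = "\<sigma>n n" and ?J = "contour_integral (clamped_path n) (\<lambda>s. weight T \<sigma> 1 \<delta> s * regular s * tmon x s)"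
  let ?k = "\<lambda>s. slope1 (weight T \<sigma> 1 \<delta>) s * tmon x s" and ?g = "shifted_integrand \<sigma> 1 \<delta>"
  let ?h = "\<lambda>u. (1 - u) * cmod (F_reg A (Complex u T)) * x powr (u - 1)"
  have Cc: "continuous_on X (\<lambda>u. Complex u v)" for X v unfolding Complex_eq by (intro continuous_intros)
  have V: "{s. \<bar>Im s\<bar> < T} = {s. - T < Im s} \<inter> {s. Im s < T}" by auto
  have op: "open {s. \<bar>Im s\<bar> < T}" unfolding V by (intro open_Int open_halfspace_Im_gt open_halfspace_Im_lt)
  have kh: "?k holomorphic_on {s. \<bar>Im s\<bar> < T}"
    using T_pos by (intro holomorphic_intros tmon_holomorphic x_pos slope1_holomorphic[OF weight_holomorphic[OF T_pos] op] weight_1) auto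
  have kc: "continuous_on {?b..1} (\<lambda>u. ?k (Complex u 0))"
    by (rule continuous_on_compose2[OF holomorphic_on_imp_continuous_on[OF kh] Cc]) (use T_pos in auto)
  have gt: "Complex u T \<in> wide - poles - {of_real \<sigma>}" for u
  proof -
    have "Complex u T \<in> wide - poles" using wide_top by (rule subsetD) simp
    moreover have "Complex u T \<noteq> of_real \<sigma>" using T_pos by (simp add: complex_eq_iff)
    ultimately show ?thesis by simp
  qed
  have gc: "continuous_on {?b..1} (\<lambda>u. ?g (Complex u T))"
    by (rule continuous_on_compose2[OF holomorphic_on_imp_continuous_on[OF shifted_integrand_holomorphic] Cc])
      (use gt in auto)
  have hc: "continuous_on {?b..1} ?h"
  proof -
    have "F_reg A holomorphic_on - poles"
      unfolding F_reg_def using one_pole by (intro holomorphic_intros A_holomorphic) auto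
    then have "continuous_on {?b..1} (\<lambda>u. F_reg A (Complex u T))"
      by (intro continuous_on_compose2[OF holomorphic_on_imp_continuous_on Cc]) (use top_not_pole in auto)
    then show ?thesis using x_pos by (intro continuous_intros) auto
  qed
  define q where "q = (\<lambda>u. \<delta> * Re (?g (Complex u T) - res1 * ?k (Complex u 0)))"
  have qc: "continuous_on {?b..1} q" unfolding q_def by (intro continuous_intros gc kc)
  \<comment> \<open>\<open>remainder_pointwise\<close> divides by u - 1 and holds only for u < 1;
    removing the endpoint does not change the integrals.\<close>
  have half_open: "(f has_integral i) {?b..<1} \<longleftrightarrow> (f has_integral i) {?b..1}" for f :: "real \<Rightarrow> real" and i
    by (rule has_integral_spike_set_eq; rule negligible_subset[of "{1}"]) auto
  have "integral {?b..1} q \<le> integral {?b..1} ?h"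
  proof (rule has_integral_le)
    show "(q has_integral integral {?b..1} q) {?b..<1}"
      using integrable_integral[OF integrable_continuous_real[OF qc]] half_open by simp
    show "(?h has_integral integral {?b..1} ?h) {?b..<1}"
      using integrable_integral[OF integrable_continuous_real[OF hc]] half_open by simp
    show "q u \<le> ?h u" if "u \<in> {?b..<1}" for u
      unfolding q_def using that by (intro remainder_pointwise[OF d]) auto
  qed
  moreover have "integral {?b..1} ?h \<le> enn2real top_integral"
  proof -
    have "ennreal (integral {?b..1} ?h) \<le> ennreal (enn2real top_integral)"
      using top_part_le[OF b] fin by (simp add: top.not_eq_extremum)
    then show ?thesis by (simp add: ennreal_le_iff)
  qed
  moreover have "integral {?b..1} q = \<delta> * (Re (seg ?g (Complex ?b T) (Complex 1 T)) - Re (res1 * seg ?k (Complex ?b 0) (Complex 1 0)))"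
  proof -
    have gi: "((\<lambda>u. ?g (Complex u T)) has_integral seg ?g (Complex ?b T) (Complex 1 T)) {?b..1}"
      unfolding seg_horizontal[OF b] by (intro integrable_integral integrable_continuous_real gc)
    have ki: "((\<lambda>u. ?k (Complex u 0)) has_integral seg ?k (Complex ?b 0) (Complex 1 0)) {?b..1}"
      unfolding seg_horizontal[OF b] by (intro integrable_integral integrable_continuous_real kc)
    have "(q has_integral \<delta> * Re (seg ?g (Complex ?b T) (Complex 1 T) - res1 * seg ?k (Complex ?b 0) (Complex 1 0))) {?b..1}"
      unfolding q_def
      by (intro has_integral_mult_right has_integral_Re has_integral_diff gi ki)
    then show ?thesis by (simp add: integral_unique)
  qed
  moreover have "\<delta> * Re ?J \<le> cmod ?J"
    using d abs_Re_le_cmod[of ?J] by auto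
  ultimately show ?thesis
    unfolding clamped_filled_split[OF b] by (simp only: minus_complex.sel) (simp add: algebra_simps)
qed

text \<open>Here T < x <= 1, so A decays exponentially along the top line while the polar part is of
  size |r|/t, r being the residue at 1. Eventually t |F| exceeds |r|/2, and x^(-t) >= 1.\<close>

lemma top_integral_infinite:
  assumes "x \<le> 1" shows "top_integral = \<infinity>"
proof -
  obtain M where M: "M \<ge> 0" "\<And>s. s \<in> frame \<Longrightarrow> Re s \<le> 1 / 2 \<Longrightarrow> cmod (A s) \<le> M * T powr (- Re s)"
    using A_growth by blast
  define r where "r = cmod res1"
  have r: "r > 0" using res1_nonzero by (simp add: r_def)
  have T1: "T < 1" using x_gt assms by simp
  then have "- ln T > 0" using T_pos by simp
  then have "((\<lambda>t. t * (r / (t + T) - M / T * exp (- ((- ln T) * t)))) \<longlongrightarrow> r) at_top" by real_asymp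
  then have "\<forall>\<^sub>F t in at_top. t * (r / (t + T) - M / T * exp (- ((- ln T) * t))) > r / 2"
    using r by (intro order_tendstoD(1)) auto
  then obtain N where N: "\<And>t. N \<le> t \<Longrightarrow> t * (r / (t + T) - M / T * exp (- ((- ln T) * t))) > r / 2"
    by (auto simp: eventually_at_top_linorder)
  define N' where "N' = max N 1"
  have "r / 2 \<le> t * cmod (F_reg A (1 - of_real t + \<i> * of_real T)) * x powr (- t)" if t: "N' \<le> t" for t
  proof -
    have t1: "1 \<le> t" "N \<le> t" using t by (auto simp: N'_def)
    have s: "1 - of_real t + \<i> * of_real T = Complex (1 - t) T" by (simp add: complex_eq_iff)
    have "cmod (A (Complex (1 - t) T)) \<le> M * T powr (- Re (Complex (1 - t) T))"
      by (rule M(2)[OF top_in_frame]) (use t1 in auto)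
    also have "T powr (- Re (Complex (1 - t) T)) = exp (- ((- ln T) * t)) / T"
      using T_pos by (simp add: powr_def algebra_simps exp_diff)
    finally have A: "cmod (A (Complex (1 - t) T)) \<le> M / T * exp (- ((- ln T) * t))" by simp
    have "cmod (Complex (1 - t) T - 1) \<le> \<bar>Re (Complex (1 - t) T - 1)\<bar> + \<bar>Im (Complex (1 - t) T - 1)\<bar>" by (rule cmod_le)
    then have c: "cmod (Complex (1 - t) T - 1) \<le> t + T" using t1 T_pos by simp
    have c0: "0 < cmod (Complex (1 - t) T - 1)" using T_pos by (simp add: complex_eq_iff)
    have "r / (t + T) \<le> r / cmod (Complex (1 - t) T - 1)" using c c0 r t1 T_pos by (intro divide_left_mono) (auto intro!: mult_pos_pos)
    also have "\<dots> = cmod (res1 / (Complex (1 - t) T - 1))" by (simp add: norm_divide r_def)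
    also have "\<dots> \<le> cmod (F_reg A (Complex (1 - t) T)) + cmod (A (Complex (1 - t) T))"
      using norm_triangle_ineq4[of "A (Complex (1 - t) T)" "F_reg A (Complex (1 - t) T)"] by (simp add: F_reg_def)
    finally have "r / (t + T) - M / T * exp (- ((- ln T) * t)) \<le> cmod (F_reg A (Complex (1 - t) T))" using A by linarith
    then have "t * (r / (t + T) - M / T * exp (- ((- ln T) * t))) \<le> t * cmod (F_reg A (Complex (1 - t) T))"
      using t1 by (intro mult_left_mono) auto
    then have "r / 2 \<le> t * cmod (F_reg A (Complex (1 - t) T))" using N[OF t1(2)] by linarith
    also have "\<dots> * 1 \<le> t * cmod (F_reg A (Complex (1 - t) T)) * x powr (- t)"
    proof (rule mult_left_mono)
      have "x powr t \<le> 1" using x_pos assms t1 by (intro powr_le1) auto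
      then show "1 \<le> x powr (- t)" using x_pos by (simp add: powr_minus one_le_inverse)
    qed (use t1 in auto)
    finally show ?thesis by (simp add: s)
  qed
  then have "(\<integral>\<^sup>+t. ennreal (r / 2) * indicator {N'..} t \<partial>lborel) \<le> top_integral"
    unfolding top_integral_def
    by (intro nn_integral_mono) (auto simp: indicator_def N'_def intro!: ennreal_leI)
  moreover have "(\<integral>\<^sup>+t. ennreal (r / 2) * indicator {N'..} t \<partial>lborel) = \<infinity>"
  proof -
    have "emeasure lborel {N'..} = \<infinity>"
    proof (rule ccontr)
      assume "emeasure lborel {N'..} \<noteq> \<infinity>"
      then obtain K :: nat where K: "emeasure lborel {N'..} < of_nat K"
        using ennreal_Ex_less_of_nat by (auto simp: top.not_eq_extremum)
      have "emeasure lborel {N'..N' + real K} \<le> emeasure lborel {N'..}" by (intro emeasure_mono) auto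
      then show False using K by (simp add: ennreal_of_nat_eq_real_of_nat)
    qed
    then show ?thesis using r by (simp add: nn_integral_cmult_indicator ennreal_mult_top)
  qed
  ultimately show ?thesis by (simp add: top_unique)
qed

text \<open>An infinite \<open>top_integral\<close> makes the claim trivial. Otherwise 1 < x by
  \<open>top_integral_infinite\<close>, which is what the convergence of the regular part along the
  contour needs.\<close>

lemma remainder_limit_le:
  assumes d: "\<delta> = 1 \<or> \<delta> = -1"
    and lim: "(\<lambda>n. Re (contour_integral (clamped_path n) (filled (weight T \<sigma> 1 \<delta>) x))
      + Re (seg (shifted_integrand \<sigma> 1 \<delta>) (Complex (\<sigma>n n) T) (Complex 1 T))) \<longlonglongrightarrow> L"
  shows "ennreal (\<delta> * L) \<le> I_plus A T \<gamma> (weight T \<sigma> 1 \<delta>) x"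
proof (cases "top_integral = \<infinity>")
  case True
  then show ?thesis by (simp add: I_plus_def top_integral_def[symmetric])
next
  case False
  then have x1: "1 < x" using top_integral_infinite by force
  let ?R = "ray_contour_integral \<gamma> (\<lambda>s. weight T \<sigma> 1 \<delta> s * F_reg A s * of_real x powr (s - 1))"
  have "\<delta> * L \<le> cmod ?R + enn2real top_integral"
  proof (rule tendsto_le)
    show "(\<lambda>n. \<delta> * (Re (contour_integral (clamped_path n) (filled (weight T \<sigma> 1 \<delta>) x))
      + Re (seg (shifted_integrand \<sigma> 1 \<delta>) (Complex (\<sigma>n n) T) (Complex 1 T)))) \<longlonglongrightarrow> \<delta> * L"
      by (intro tendsto_mult tendsto_const lim)
    show "(\<lambda>n. cmod (contour_integral (clamped_path n) (\<lambda>s. weight T \<sigma> 1 \<delta> s * regular s * tmon x s)) + enn2real top_integral)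
      \<longlonglongrightarrow> cmod ?R + enn2real top_integral"
      by (intro tendsto_add tendsto_const tendsto_norm regular_part_tendsto x1)
    show "\<forall>\<^sub>F n in sequentially. \<delta> * (Re (contour_integral (clamped_path n) (filled (weight T \<sigma> 1 \<delta>) x))
      + Re (seg (shifted_integrand \<sigma> 1 \<delta>) (Complex (\<sigma>n n) T) (Complex 1 T)))
      \<le> cmod (contour_integral (clamped_path n) (\<lambda>s. weight T \<sigma> 1 \<delta> s * regular s * tmon x s)) + enn2real top_integral"
      using rungs_lt[of 1] by eventually_elim (rule remainder_le[OF d _ False])
  qed simp
  then have "ennreal (\<delta> * L) \<le> ennreal (enn2real top_integral + cmod ?R)" by (intro ennreal_leI) simp
  also have "\<dots> = top_integral + ennreal (cmod ?R)"
    using False by (subst ennreal_plus) (auto simp: top.not_eq_extremum)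
  finally show ?thesis by (simp add: I_plus_def top_integral_def)
qed

end

section \<open>The explicit formula\<close>

lemma residue_lincomb:
  assumes "open V" "p \<in> V" "f holomorphic_on V - {p}" "g holomorphic_on V - {p}"
    and h: "\<And>s. s \<in> V \<Longrightarrow> s \<noteq> p \<Longrightarrow> h s = c * f s + d * g s"
  shows "residue h p = c * residue f p + d * residue g p"
proof -
  have "\<forall>\<^sub>F s in at p. s \<in> V - {p}" using assms(1,2) by (rule eventually_at_in_open)
  then have "\<forall>\<^sub>F s in at p. h s = c * f s + d * g s" by (rule eventually_mono) (use h in auto)
  then have "residue h p = residue (\<lambda>s. c * f s + d * g s) p" by (rule residue_cong) simp
  also have "\<dots> = residue (\<lambda>s. c * f s) p + residue (\<lambda>s. d * g s) p"
    by (intro residue_add[OF assms(1,2)] holomorphic_intros assms(3,4))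
  also have "\<dots> = c * residue f p + d * residue g p"
    by (simp add: residue_lmul[OF assms(1,2,3)] residue_lmul[OF assms(1,2,4)])
  finally show ?thesis .
qed

text \<open>-\<i> times \<open>theta T \<sigma> s\<close> is (s - \<i>T - \<sigma>)/T, so
  \<open>zcot\<close> becomes h at the shifted point, and \<open>c_const\<close> is the constant
  h((1 - \<sigma>)/T) that normalises \<Phi>(1) = 0.\<close>

lemma omega_plus_weight:
  assumes "T > 0"
  shows "omega_plus T \<sigma> s = - of_real (2 / T) * weight T \<sigma> 1 0 (s - \<i> * of_real T)"
proof -
  have 1: "- \<i> * theta T \<sigma> s = (s - \<i> * of_real T - of_real \<sigma>) / of_real T"
    using assms by (simp add: theta_def field_simps)
  have 2: "- \<i> * theta T \<sigma> (1 + \<i> * of_real T) = (1 - of_real \<sigma>) / of_real T"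
    using assms by (simp add: theta_def field_simps)
  show ?thesis
    using assms by (simp add: omega_plus_def c_const_def zcot_eq_hcoth 1[simplified] 2[simplified] weight_def field_simps)
qed

lemma theta_weight:
  assumes "T > 0"
  shows "theta T 1 s = \<i> * of_real (2 / T) * weight T \<sigma> 0 1 (s - \<i> * of_real T)"
  using assms by (simp add: theta_def weight_def field_simps)

context ladder_contour
begin

definition omega_sum :: "real \<Rightarrow> nat \<Rightarrow> complex" where
  "omega_sum \<sigma> n = (\<Sum>\<rho> | \<rho> \<in> upper_poles A T \<and> Re \<rho> > \<sigma>n n.
     residue (\<lambda>s. omega_plus T \<sigma> s * of_real x powr (s - 1) * A s) \<rho>)"

definition theta_sum :: "nat \<Rightarrow> complex" where
  "theta_sum n = (\<Sum>\<rho> | \<rho> \<in> upper_poles A T \<and> Re \<rho> > \<sigma>n n.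
     residue (\<lambda>s. theta T 1 s * of_real x powr (s - 1) * A s) \<rho>)"

definition coth_sum :: "real \<Rightarrow> nat \<Rightarrow> complex" where
  "coth_sum \<sigma> n = (\<Sum>\<rho> | \<rho> \<in> real_poles A \<union> {of_real \<sigma>} \<and> Re \<rho> > \<sigma>n n.
     residue (\<lambda>s. coth (of_real pi * (s - of_real \<sigma>) / of_real T) * A s * of_real x powr (s - 1)) \<rho>)"

definition plain_sum :: "nat \<Rightarrow> complex" where
  "plain_sum n = (\<Sum>\<rho> | \<rho> \<in> real_poles A \<and> Re \<rho> > \<sigma>n n. residue (\<lambda>s. A s * of_real x powr (s - 1)) \<rho>)"

lemma upper_neighbourhood:
  assumes "p \<in> poles" "0 < Im p" "Im p < T"
  obtains V where "open V" "p \<in> V" "V \<subseteq> {s. 0 < Im s \<and> Im s < T}" "V - {p} \<subseteq> - poles"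
proof
  define V where "V = ({s. 0 < Im s} \<inter> {s. Im s < T}) \<inter> - (poles - {p})"
  show "open V"
    unfolding V_def using discrete_set_closed[OF discrete_set_subset[OF discrete_poles, of "poles - {p}"]]
    by (intro open_Int open_halfspace_Im_gt open_halfspace_Im_lt open_Compl) auto
  show "p \<in> V" using assms by (simp add: V_def)
  show "V \<subseteq> {s. 0 < Im s \<and> Im s < T}" "V - {p} \<subseteq> - poles" by (auto simp: V_def)
qed

lemma shifted_weight_upper_holomorphic:
  "V \<subseteq> {s. 0 < Im s \<and> Im s < T} \<Longrightarrow> (\<lambda>s. weight T \<sigma> \<alpha> \<delta> (s - \<i> * of_real T)) holomorphic_on V"
  by (rule holomorphic_on_subset[OF shift_weight.shift_hol[OF shift_weight_weight[OF T_pos]]]) (use T_pos in auto)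

lemma upper_weights_holomorphic:
  assumes "V \<subseteq> {s. 0 < Im s \<and> Im s < T}"
  shows "omega_plus T \<sigma> holomorphic_on V" "theta T 1 holomorphic_on V"
proof -
  have "(\<lambda>s. - of_real (2 / T) * weight T \<sigma> 1 0 (s - \<i> * of_real T)) holomorphic_on V"
    by (intro holomorphic_intros shifted_weight_upper_holomorphic assms)
  then show "omega_plus T \<sigma> holomorphic_on V" by (simp only: omega_plus_weight[OF T_pos, symmetric])
  show "theta T 1 holomorphic_on V" unfolding theta_def using T_pos by (intro holomorphic_intros) auto
qed

text \<open>Linearity of the residue: the h part of the weight gives \<open>omega_plus\<close>, the
  linear part gives \<open>theta T 1\<close>, and only the latter changes sign with
  \<delta>.\<close>

lemma upper_sum_eq:
  "upper_sum \<sigma> 1 \<delta> n = - of_real (T / 2) * omega_sum \<sigma> n - of_real \<delta> * \<i> * of_real (T / 2) * theta_sum n"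
proof -
  have set: "{\<rho>. \<rho> \<in> upper_poles A T \<and> Re \<rho> > \<sigma>n n} = {p. p \<in> poles \<and> \<sigma>n n < Re p \<and> 0 < Im p \<and> Im p < T}"
    by (auto simp: upper_poles_def poles_def)
  have "residue (\<lambda>s. weight T \<sigma> 1 \<delta> (s - \<i> * of_real T) * (A s * tmon x s)) p
    = - of_real (T / 2) * residue (\<lambda>s. omega_plus T \<sigma> s * of_real x powr (s - 1) * A s) p
      + - (of_real \<delta> * \<i> * of_real (T / 2)) * residue (\<lambda>s. theta T 1 s * of_real x powr (s - 1) * A s) p"
    if p: "p \<in> poles" "0 < Im p" "Im p < T" for p
  proof -
    obtain V where V: "open V" "p \<in> V" "V \<subseteq> {s. 0 < Im s \<and> Im s < T}" "V - {p} \<subseteq> - poles"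
      using upper_neighbourhood[OF p] by blast
    have V': "V - {p} \<subseteq> {s. 0 < Im s \<and> Im s < T}" using V(3) by auto
    show ?thesis
    proof (rule residue_lincomb[OF V(1,2)])
      show "(\<lambda>s. omega_plus T \<sigma> s * of_real x powr (s - 1) * A s) holomorphic_on V - {p}"
        "(\<lambda>s. theta T 1 s * of_real x powr (s - 1) * A s) holomorphic_on V - {p}"
        using x_pos by (intro holomorphic_intros upper_weights_holomorphic V' holomorphic_on_subset[OF A_holomorphic V(4)]; simp)+
      fix s
      have w: "weight T \<sigma> 1 \<delta> (s - \<i> * of_real T) = - of_real (T / 2) * omega_plus T \<sigma> s + - (of_real \<delta> * \<i> * of_real (T / 2)) * theta T 1 s"
        unfolding omega_plus_weight[OF T_pos] theta_weight[OF T_pos, of s \<sigma>] using T_pos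
        by (simp add: weight_def field_simps)
      show "weight T \<sigma> 1 \<delta> (s - \<i> * of_real T) * (A s * tmon x s)
        = - of_real (T / 2) * (omega_plus T \<sigma> s * of_real x powr (s - 1) * A s)
          + - (of_real \<delta> * \<i> * of_real (T / 2)) * (theta T 1 s * of_real x powr (s - 1) * A s)"
        unfolding tmon_def w by (simp add: algebra_simps del: of_real_divide)
    qed
  qed
  then show ?thesis
    unfolding upper_sum_def omega_sum_def theta_sum_def set sum_distrib_left
    by (simp add: sum_subtractf[symmetric] sum_distrib_left sum_negf[symmetric] del: of_real_divide)
qed

lemma coth_holomorphic: "(\<lambda>s. coth (of_real pi * (s - of_real \<sigma>) / of_real T)) holomorphic_on {s. \<bar>Im s\<bar> < T} - {of_real \<sigma>}"
proof -
  interpret sw: shift_weight T \<sigma> "weight T \<sigma> 1 0" by (rule shift_weight_weight[OF T_pos])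
  have "(\<lambda>s. 2 * sw.jump s) holomorphic_on {s. \<bar>Im s\<bar> < T} - {of_real \<sigma>}"
    by (intro holomorphic_intros sw.jump_hol)
  then show ?thesis
  proof (rule holomorphic_transform)
    show "2 * sw.jump s = coth (of_real pi * (s - of_real \<sigma>) / of_real T)" if "s \<in> {s. \<bar>Im s\<bar> < T} - {of_real \<sigma>}" for s
    proof -
      have "sw.jump s = of_real (1 / 2) * coth (of_real pi * (s - of_real \<sigma>) / of_real T) + of_real (0 / 2)"
        unfolding sw.jump_def sw.shifted_def using that by (intro weight_jump[OF T_pos]) auto
      then show ?thesis by (simp add: mult.commute)
    qed
  qed
qed

lemma real_sum_eq: "real_sum \<sigma> 1 \<delta> n = of_real (1 / 2) * coth_sum \<sigma> n + of_real (\<delta> / 2) * plain_sum n"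
proof -
  let ?P = "{p. p \<in> insert (of_real \<sigma>) poles \<and> \<sigma>n n < Re p \<and> Im p = 0}"
  have set: "{\<rho>. \<rho> \<in> real_poles A \<union> {of_real \<sigma>} \<and> Re \<rho> > \<sigma>n n} = ?P"
    by (auto simp: real_poles_def poles_def)
  have dQ: "discrete_set (insert (of_real \<sigma>) poles)" using discrete_poles by (simp add: discrete_set_insert)
  have nb: "open ({s. \<bar>Im s\<bar> < T} - (insert (of_real \<sigma>) poles - {p}))" for p
  proof -
    have "closed (insert (of_real \<sigma>) poles - {p})" by (rule discrete_set_closed[OF discrete_set_subset[OF dQ]]) auto
    moreover have "{s. \<bar>Im s\<bar> < T} = {s. - T < Im s} \<inter> {s. Im s < T}" by auto
    ultimately show ?thesis using open_Int[OF open_halfspace_Im_gt open_halfspace_Im_lt] by (auto intro!: open_Diff)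
  qed
  have e: "residue (\<lambda>s. (weight T \<sigma> 1 \<delta> s - weight T \<sigma> 1 \<delta> (s - \<i> * of_real T)) / (\<i> * of_real T) * (A s * tmon x s)) p
    = of_real (1 / 2) * residue (\<lambda>s. coth (of_real pi * (s - of_real \<sigma>) / of_real T) * A s * of_real x powr (s - 1)) p
      + of_real (\<delta> / 2) * residue (\<lambda>s. A s * of_real x powr (s - 1)) p"
    if p: "Im p = 0" for p
  proof (rule residue_lincomb[OF nb[of p]])
    let ?V = "{s. \<bar>Im s\<bar> < T} - (insert (of_real \<sigma>) poles - {p})"
    show "p \<in> ?V" using p T_pos by simp
    have s1: "?V - {p} \<subseteq> - poles" "?V - {p} \<subseteq> {s. \<bar>Im s\<bar> < T} - {of_real \<sigma>}" by auto
    have Ax: "(\<lambda>s. A s * of_real x powr (s - 1)) holomorphic_on ?V - {p}"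
      using tmon_holomorphic[OF x_pos]
      by (intro holomorphic_on_mult holomorphic_on_subset[OF A_holomorphic s1(1)]) (simp add: tmon_def[abs_def])
    then show "(\<lambda>s. A s * of_real x powr (s - 1)) holomorphic_on ?V - {p}" .
    show "(\<lambda>s. coth (of_real pi * (s - of_real \<sigma>) / of_real T) * A s * of_real x powr (s - 1)) holomorphic_on ?V - {p}"
      using holomorphic_on_mult[OF holomorphic_on_subset[OF coth_holomorphic s1(2)] Ax] by (simp add: mult.assoc)
    fix s assume "s \<in> ?V" "s \<noteq> p"
    then have w: "(weight T \<sigma> 1 \<delta> s - weight T \<sigma> 1 \<delta> (s - \<i> * of_real T)) / (\<i> * of_real T)
      = of_real (1 / 2) * coth (of_real pi * (s - of_real \<sigma>) / of_real T) + of_real (\<delta> / 2)"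
      by (intro weight_jump[OF T_pos]) auto
    show "(weight T \<sigma> 1 \<delta> s - weight T \<sigma> 1 \<delta> (s - \<i> * of_real T)) / (\<i> * of_real T) * (A s * tmon x s)
      = of_real (1 / 2) * (coth (of_real pi * (s - of_real \<sigma>) / of_real T) * A s * of_real x powr (s - 1))
        + of_real (\<delta> / 2) * (A s * of_real x powr (s - 1))"
      unfolding tmon_def w by (simp add: algebra_simps del: of_real_divide)
  qed
  \<comment> \<open>If \<sigma> is not a pole of A, it belongs to the index set because of coth but
    contributes no residue here.\<close>
  have pl: "(\<Sum>p\<in>?P. residue (\<lambda>s. A s * of_real x powr (s - 1)) p) = plain_sum n"
    unfolding plain_sum_def
  proof (rule sum.mono_neutral_right)
    show "finite ?P"
    proof (rule finite_subset)
      show "?P \<subseteq> insert (of_real \<sigma>) (poles \<inter> cbox (Complex (\<sigma>n n) 0) (Complex 1 0))"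
        using poles_Re_le by (auto simp: in_cbox_complex_iff)
      show "finite (insert (of_real \<sigma>) (poles \<inter> cbox (Complex (\<sigma>n n) 0) (Complex 1 0)))"
        using discrete_poles unfolding discrete_set_def by (simp add: compact_cbox)
    qed
    show "{\<rho> \<in> real_poles A. Re \<rho> > \<sigma>n n} \<subseteq> ?P" by (auto simp: real_poles_def poles_def)
    show "\<forall>p\<in>?P - {\<rho> \<in> real_poles A. Re \<rho> > \<sigma>n n}. residue (\<lambda>s. A s * of_real x powr (s - 1)) p = 0"
    proof
      fix p assume "p \<in> ?P - {\<rho> \<in> real_poles A. Re \<rho> > \<sigma>n n}"
      then have "p \<in> - poles" by (auto simp: real_poles_def poles_def)
      then show "residue (\<lambda>s. A s * of_real x powr (s - 1)) p = 0"
        using x_pos by (intro residue_holo[OF open_off_poles(2)] holomorphic_on_mult A_holomorphic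
            tmon_holomorphic[unfolded tmon_def[abs_def]])
    qed
  qed
  have "real_sum \<sigma> 1 \<delta> n = (\<Sum>p\<in>?P. of_real (1 / 2) * residue (\<lambda>s. coth (of_real pi * (s - of_real \<sigma>) / of_real T) * A s * of_real x powr (s - 1)) p
      + of_real (\<delta> / 2) * residue (\<lambda>s. A s * of_real x powr (s - 1)) p)"
    unfolding real_sum_def by (intro sum.cong refl e) auto
  then show ?thesis
    unfolding coth_sum_def set sum.distrib sum_distrib_left[symmetric] pl .
qed

lemma simple_pole_residue:
  assumes p: "p \<in> upper_poles A T" "zorder A p = -1" and E: "\<And>V. V \<subseteq> {s. 0 < Im s \<and> Im s < T} \<Longrightarrow> E holomorphic_on V"
  shows "residue (\<lambda>s. E s * of_real x powr (s - 1) * A s) p = E p * of_real x powr (p - 1) * residue A p"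
proof -
  have p': "is_pole A p" "p \<in> poles" "0 < Im p" "Im p < T" using p(1) by (auto simp: upper_poles_def poles_def)
  obtain V where V: "open V" "p \<in> V" "V \<subseteq> {s. 0 < Im s \<and> Im s < T}" "V - {p} \<subseteq> - poles"
    using upper_neighbourhood[OF p'(2-4)] by blast
  have th: "(\<lambda>s. of_real x powr (s - 1)) holomorphic_on S" for S :: "complex set"
    using tmon_holomorphic[OF x_pos, of S] by (simp add: tmon_def[abs_def])
  show ?thesis
  proof (rule residue_simple'[OF V(1,2)])
    show "(\<lambda>s. E s * of_real x powr (s - 1) * A s) holomorphic_on V - {p}"
      using V(3) by (intro holomorphic_on_mult th E holomorphic_on_subset[OF A_holomorphic V(4)]) auto
    have "(\<lambda>s. E s * of_real x powr (s - 1)) holomorphic_on V" by (intro holomorphic_on_mult th E V(3))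
    then have "isCont (\<lambda>s. E s * of_real x powr (s - 1)) p"
      using continuous_on_eq_continuous_at[OF V(1)] V(2) holomorphic_on_imp_continuous_on by blast
    then have "((\<lambda>s. E s * of_real x powr (s - 1)) \<longlongrightarrow> E p * of_real x powr (p - 1)) (at p)" by (simp add: isCont_def)
    from tendsto_mult[OF this simple_pole_tendsto(1)[OF iso p'(1) p(2)]]
    show "((\<lambda>s. E s * of_real x powr (s - 1) * A s * (s - p)) \<longlongrightarrow> E p * of_real x powr (p - 1) * residue A p) (at p)"
      by (simp add: mult_ac)
  qed
qed

text \<open>Sums of the residue limits for \<delta> = 1 and \<delta> = -1 recover the coth and
  \<omega> sums, differences the plain and \<theta> sums. \<open>L \<delta>\<close> is the limit of
  the integrals over the contour and the top line.\<close>

lemma explicit_formula: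
  obtains M\<^sub>R E\<^sub>R :: real and M\<^sub>C E\<^sub>C :: complex and L :: "real \<Rightarrow> real"
  where "coth_sum \<sigma> \<longlonglongrightarrow> of_real M\<^sub>R" "plain_sum \<longlonglongrightarrow> of_real E\<^sub>R"
    "omega_sum \<sigma> \<longlonglongrightarrow> M\<^sub>C" "theta_sum \<longlonglongrightarrow> E\<^sub>C"
    "\<And>\<delta>. \<delta> = 1 \<or> \<delta> = -1 \<Longrightarrow> \<delta> * ((\<Sum>n | 1 \<le> n \<and> real n \<le> x. a n * real n powr (- \<sigma>)) / x powr (1 - \<sigma>)
          - (pi / T * M\<^sub>R + 2 * pi / T * Im M\<^sub>C))
       \<le> pi / T * E\<^sub>R + 2 * pi / T * Re E\<^sub>C + 2 / T\<^sup>2 * (\<delta> * L \<delta>)"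
    "\<And>\<delta>. \<delta> = 1 \<or> \<delta> = -1 \<Longrightarrow> ennreal (\<delta> * L \<delta>) \<le> I_plus A T \<gamma> (weight T \<sigma> 1 \<delta>) x"
proof -
  define \<kappa> where "\<kappa> = max 2 (\<sigma> + 1)"
  have k: "1 < \<kappa>" "\<sigma> < \<kappa>" by (auto simp: \<kappa>_def)
  define Z where "Z = (\<lambda>\<delta>. Re (seg (shifted_integrand \<sigma> 1 \<delta>) (Complex \<kappa> 0) (Complex \<kappa> T) + seg (shifted_integrand \<sigma> 1 \<delta>) (Complex \<kappa> T) (Complex 1 T)
        + seg (filled (weight T \<sigma> 1 \<delta>) x) (Complex 1 0) (Complex \<kappa> 0)))"
  define S where "S = (\<Sum>n | 1 \<le> n \<and> real n \<le> x. a n * real n powr (- \<sigma>)) / x powr (1 - \<sigma>)"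
  obtain U1 V1 where 1: "upper_sum \<sigma> 1 1 \<longlonglongrightarrow> U1" "real_sum \<sigma> 1 1 \<longlonglongrightarrow> of_real V1"
    "(\<lambda>n. Re (contour_integral (clamped_path n) (filled (weight T \<sigma> 1 1) x))
      + Re (seg (shifted_integrand \<sigma> 1 1) (Complex (\<sigma>n n) T) (Complex 1 T))) \<longlonglongrightarrow> Z 1 - Re (2 * of_real pi * \<i> * U1) - pi * T * V1"
    using residue_sums_tendsto[OF k, of 1 1] unfolding Z_def by blast
  obtain U2 V2 where 2: "upper_sum \<sigma> 1 (-1) \<longlonglongrightarrow> U2" "real_sum \<sigma> 1 (-1) \<longlonglongrightarrow> of_real V2"
    "(\<lambda>n. Re (contour_integral (clamped_path n) (filled (weight T \<sigma> 1 (-1)) x))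
      + Re (seg (shifted_integrand \<sigma> 1 (-1)) (Complex (\<sigma>n n) T) (Complex 1 T))) \<longlonglongrightarrow> Z (-1) - Re (2 * of_real pi * \<i> * U2) - pi * T * V2"
    using residue_sums_tendsto[OF k, of 1 "-1"] unfolding Z_def by blast
  define L where "L = (\<lambda>\<delta>::real. if \<delta> = 1 then Z 1 - Re (2 * of_real pi * \<i> * U1) - pi * T * V1
     else Z (-1) - Re (2 * of_real pi * \<i> * U2) - pi * T * V2)"
  have T0: "(of_real T :: complex) \<noteq> 0" using T_pos by simp
  show ?thesis
  proof (rule that[of "V1 + V2" "V1 - V2" "- (U1 + U2) / of_real T" "\<i> * (U1 - U2) / of_real T" L])
    have "coth_sum \<sigma> = (\<lambda>n. real_sum \<sigma> 1 1 n + real_sum \<sigma> 1 (-1) n)"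
      by (simp add: fun_eq_iff real_sum_eq field_simps)
    then show "coth_sum \<sigma> \<longlonglongrightarrow> of_real (V1 + V2)" using tendsto_add[OF 1(2) 2(2)] by simp
    have "plain_sum = (\<lambda>n. real_sum \<sigma> 1 1 n - real_sum \<sigma> 1 (-1) n)"
      by (simp add: fun_eq_iff real_sum_eq field_simps)
    then show "plain_sum \<longlonglongrightarrow> of_real (V1 - V2)" using tendsto_diff[OF 1(2) 2(2)] by simp
    have "omega_sum \<sigma> = (\<lambda>n. - (upper_sum \<sigma> 1 1 n + upper_sum \<sigma> 1 (-1) n) / of_real T)"
      using T0 by (simp add: fun_eq_iff upper_sum_eq field_simps)
    then show "omega_sum \<sigma> \<longlonglongrightarrow> - (U1 + U2) / of_real T"
      using tendsto_divide[OF tendsto_minus[OF tendsto_add[OF 1(1) 2(1)]] tendsto_const T0] by simp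
    have "theta_sum = (\<lambda>n. \<i> * (upper_sum \<sigma> 1 1 n - upper_sum \<sigma> 1 (-1) n) / of_real T)"
      using T0 by (simp add: fun_eq_iff upper_sum_eq field_simps)
    then show "theta_sum \<longlonglongrightarrow> \<i> * (U1 - U2) / of_real T"
      using tendsto_divide[OF tendsto_mult[OF tendsto_const[of \<i>] tendsto_diff[OF 1(1) 2(1)]] tendsto_const T0] by simp
    fix \<delta> :: real assume d: "\<delta> = 1 \<or> \<delta> = -1"
    show "ennreal (\<delta> * L \<delta>) \<le> I_plus A T \<gamma> (weight T \<sigma> 1 \<delta>) x"
      using d remainder_limit_le[OF _ 1(3)] remainder_limit_le[OF _ 2(3)] by (auto simp: L_def)
    have g: "(\<lambda>s. weight T \<sigma> 1 \<delta> (s - \<i> * of_real T) * A s * tmon x s) = shifted_integrand \<sigma> 1 \<delta>"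
      by (simp add: fun_eq_iff shifted_integrand_def mult.assoc)
    have "0 \<le> \<delta> * (Z \<delta> - T\<^sup>2 / 2 * S)"
      using partial_sum_le[OF T_pos k d x_pos line] unfolding g Z_def S_def by simp
    then have "0 \<le> 2 / T\<^sup>2 * (\<delta> * (Z \<delta> - T\<^sup>2 / 2 * S))" by (rule mult_nonneg_nonneg[rotated]) simp
    then have le: "\<delta> * S \<le> 2 / T\<^sup>2 * (\<delta> * Z \<delta>)" using T_pos by (simp add: algebra_simps)
    have i: "Im (- (U1 + U2) / of_real T) = - (Im U1 + Im U2) / T" "Re (\<i> * (U1 - U2) / of_real T) = - (Im U1 - Im U2) / T"
      by (simp_all add: Im_divide_of_real Re_divide_of_real)
    have "2 / T\<^sup>2 * (\<delta> * Z \<delta>) = \<delta> * (pi / T * (V1 + V2) + 2 * pi / T * (- (Im U1 + Im U2) / T))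
       + (pi / T * (V1 - V2) + 2 * pi / T * (- (Im U1 - Im U2) / T)) + 2 / T\<^sup>2 * (\<delta> * L \<delta>)"
      using d T_pos by (auto simp: L_def field_simps power2_eq_square)
    with le have "\<delta> * S \<le> \<delta> * (pi / T * (V1 + V2) + 2 * pi / T * (- (Im U1 + Im U2) / T))
       + (pi / T * (V1 - V2) + 2 * pi / T * (- (Im U1 - Im U2) / T)) + 2 / T\<^sup>2 * (\<delta> * L \<delta>)" by simp
    then show "\<delta> * ((\<Sum>n | 1 \<le> n \<and> real n \<le> x. a n * real n powr (- \<sigma>)) / x powr (1 - \<sigma>)
          - (pi / T * (V1 + V2) + 2 * pi / T * Im (- (U1 + U2) / of_real T)))
       \<le> pi / T * (V1 - V2) + 2 * pi / T * Re (\<i> * (U1 - U2) / of_real T) + 2 / T\<^sup>2 * (\<delta> * L \<delta>)"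
      unfolding i S_def[symmetric] right_diff_distrib[of \<delta>] by linarith
  qed
qed

end

theorem theorem1p1:
  fixes a :: "nat \<Rightarrow> real" and A :: "complex \<Rightarrow> complex" and T :: real
    and \<sigma>n :: "nat \<Rightarrow> real" and \<gamma> :: "real \<Rightarrow> complex" and \<sigma> x :: real
  assumes a_nonneg: "\<And>n. n \<ge> 1 \<Longrightarrow> a n \<ge> 0"
    and abs_conv: "\<And>s. Re s > 1 \<Longrightarrow>
          summable (\<lambda>n. cmod (of_real (a (Suc n)) * of_nat (Suc n) powr (- s)))"
    and A_series: "\<And>s. Re s > 1 \<Longrightarrow>
          (\<lambda>n. of_real (a (Suc n)) * of_nat (Suc n) powr (- s)) sums A s"
    and A_mero: "A nicely_meromorphic_on UNIV"
    and simple_pole_1: "is_pole A 1" "zorder A 1 = -1"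
    and T_pos: "T > 0"
    and no_other_poles: "\<And>s. Re s = 1 \<Longrightarrow> \<bar>Im s\<bar> \<le> T \<Longrightarrow> s \<noteq> 1 \<Longrightarrow> \<not> is_pole A s"
    and \<sigma>n_0: "\<sigma>n 0 = 1"
    and \<sigma>n_lim: "filterlim \<sigma>n at_bot sequentially"
    and bounded_ladder: "bounded_away_from_1 A T (ladder T \<sigma>n)"
    and C_admissible: "admissible_contour \<gamma>"
    and C_start: "\<gamma> 0 = 1"
    and C_end: "filterlim (\<lambda>t. Re (\<gamma> t)) at_bot at_top"
    and C_region: "\<gamma> ` {0..} \<subseteq> R_quarter T"
    and bounded_C: "bounded_away_from_1 A T (\<gamma> ` {0..})"
    and C_real_poles: "\<And>\<rho>. \<rho> \<in> real_poles A \<Longrightarrow> \<rho> \<noteq> 1 \<Longrightarrow> lies_below (\<gamma> ` {0..}) \<rho>"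
    and C_upper_poles: "\<And>\<rho>. is_pole A \<rho> \<Longrightarrow> Im \<rho> > 0 \<Longrightarrow> lies_above (\<gamma> ` {0..}) \<rho>"
    and x_gt: "x > T"
  shows "\<exists>\<Phi>. contour_weight T \<Phi> \<and>
    (\<exists>(M\<^sub>R :: real) (E\<^sub>R :: real) (M\<^sub>C :: complex) (E\<^sub>C :: complex).
       has_pole_sum \<sigma>n
         (\<lambda>\<rho>. residue (\<lambda>s. coth (of_real pi * (s - of_real \<sigma>) / of_real T)
                           * A s * of_real x powr (s - 1)) \<rho>)
         (real_poles A \<union> {of_real \<sigma>}) (of_real M\<^sub>R) \<and>
       has_pole_sum \<sigma>n
         (\<lambda>\<rho>. residue (\<lambda>s. A s * of_real x powr (s - 1)) \<rho>)
         (real_poles A) (of_real E\<^sub>R) \<and>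
       has_pole_sum \<sigma>n
         (\<lambda>\<rho>. residue (\<lambda>s. omega_plus T \<sigma> s * of_real x powr (s - 1) * A s) \<rho>)
         (upper_poles A T) M\<^sub>C \<and>
       has_pole_sum \<sigma>n
         (\<lambda>\<rho>. residue (\<lambda>s. theta T 1 s * of_real x powr (s - 1) * A s) \<rho>)
         (upper_poles A T) E\<^sub>C \<and>
       ((\<forall>\<rho>\<in>upper_poles A T. zorder A \<rho> = -1) \<longrightarrow>
          has_pole_sum \<sigma>n (\<lambda>\<rho>. omega_plus T \<sigma> \<rho> * of_real x powr (\<rho> - 1) * residue A \<rho>)
            (upper_poles A T) M\<^sub>C \<and>
          has_pole_sum \<sigma>n (\<lambda>\<rho>. theta T 1 \<rho> * of_real x powr (\<rho> - 1) * residue A \<rho>)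
            (upper_poles A T) E\<^sub>C) \<and>
       ereal \<bar>(\<Sum>n | 1 \<le> n \<and> real n \<le> x. a n * real n powr (- \<sigma>)) / x powr (1 - \<sigma>)
               - (pi / T * M\<^sub>R + 2 * pi / T * Im M\<^sub>C)\<bar>
         \<le> ereal (pi / T * E\<^sub>R + 2 * pi / T * Re E\<^sub>C)
            + ereal (2 / T\<^sup>2) * enn2ereal (I_plus A T \<gamma> \<Phi> x))"
proof -
  interpret D: meromorphic_dirichlet a A
    by unfold_locales (use a_nonneg abs_conv A_series A_mero simple_pole_1 in auto)
  interpret ladder_contour a A \<gamma> T \<sigma>n x
    by unfold_locales
      (use T_pos no_other_poles \<sigma>n_lim bounded_ladder C_admissible C_start C_end C_region bounded_C
        C_real_poles C_upper_poles x_gt in \<open>auto simp: D.poles_def real_poles_def\<close>)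
  obtain M\<^sub>R E\<^sub>R :: real and M\<^sub>C E\<^sub>C :: complex and L :: "real \<Rightarrow> real"
    where lim: "coth_sum \<sigma> \<longlonglongrightarrow> of_real M\<^sub>R" "plain_sum \<longlonglongrightarrow> of_real E\<^sub>R"
      "omega_sum \<sigma> \<longlonglongrightarrow> M\<^sub>C" "theta_sum \<longlonglongrightarrow> E\<^sub>C"
    and bound: "\<And>\<delta>. \<delta> = 1 \<or> \<delta> = -1 \<Longrightarrow>
        \<delta> * ((\<Sum>n | 1 \<le> n \<and> real n \<le> x. a n * real n powr (- \<sigma>)) / x powr (1 - \<sigma>)
          - (pi / T * M\<^sub>R + 2 * pi / T * Im M\<^sub>C))
        \<le> pi / T * E\<^sub>R + 2 * pi / T * Re E\<^sub>C + 2 / T\<^sup>2 * (\<delta> * L \<delta>)"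
    and I: "\<And>\<delta>. \<delta> = 1 \<or> \<delta> = -1 \<Longrightarrow> ennreal (\<delta> * L \<delta>) \<le> I_plus A T \<gamma> (weight T \<sigma> 1 \<delta>) x"
    by (rule explicit_formula[of \<sigma>]) (rule that)
  define d where "d = (\<Sum>n | 1 \<le> n \<and> real n \<le> x. a n * real n powr (- \<sigma>)) / x powr (1 - \<sigma>)
          - (pi / T * M\<^sub>R + 2 * pi / T * Im M\<^sub>C)"
  \<comment> \<open>The sign of the deviation decides which one-sided estimate is used, and with it
    the function \<Phi> of the theorem.\<close>
  define \<delta> where "\<delta> = (if 0 \<le> d then 1 else -1 :: real)"
  have \<delta>: "\<delta> = 1 \<or> \<delta> = -1" "\<bar>d\<bar> = \<delta> * d" by (auto simp: \<delta>_def)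
  \<comment> \<open>\<open>ennreal\<close> truncates negative numbers to 0, hence the passage
    through \<open>max 0\<close>.\<close>
  have "ereal (\<delta> * L \<delta>) \<le> ereal (max 0 (\<delta> * L \<delta>))" by simp
  also have "\<dots> = enn2ereal (ennreal (\<delta> * L \<delta>))" by (metis enn2ereal_ennreal ennreal_max_0 max.cobounded1)
  also have "\<dots> \<le> enn2ereal (I_plus A T \<gamma> (weight T \<sigma> 1 \<delta>) x)"
    using I[OF \<delta>(1)] by (simp add: less_eq_ennreal.rep_eq)
  finally have i: "ereal (2 / T\<^sup>2) * ereal (\<delta> * L \<delta>) \<le> ereal (2 / T\<^sup>2) * enn2ereal (I_plus A T \<gamma> (weight T \<sigma> 1 \<delta>) x)"
    by (rule ereal_mult_left_mono) simp
  have "\<bar>d\<bar> \<le> pi / T * E\<^sub>R + 2 * pi / T * Re E\<^sub>C + 2 / T\<^sup>2 * (\<delta> * L \<delta>)"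
    using bound[OF \<delta>(1)] unfolding d_def[symmetric] \<delta>(2) .
  then have "ereal \<bar>d\<bar> \<le> ereal (pi / T * E\<^sub>R + 2 * pi / T * Re E\<^sub>C) + ereal (2 / T\<^sup>2) * ereal (\<delta> * L \<delta>)" by simp
  also have "\<dots> \<le> ereal (pi / T * E\<^sub>R + 2 * pi / T * Re E\<^sub>C) + ereal (2 / T\<^sup>2) * enn2ereal (I_plus A T \<gamma> (weight T \<sigma> 1 \<delta>) x)"
    by (intro add_left_mono i)
  finally have main: "ereal \<bar>d\<bar> \<le> ereal (pi / T * E\<^sub>R + 2 * pi / T * Re E\<^sub>C) + ereal (2 / T\<^sup>2) * enn2ereal (I_plus A T \<gamma> (weight T \<sigma> 1 \<delta>) x)" .
  have sums: "has_pole_sum \<sigma>n (\<lambda>\<rho>. residue (\<lambda>s. coth (of_real pi * (s - of_real \<sigma>) / of_real T) * A s * of_real x powr (s - 1)) \<rho>)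
         (real_poles A \<union> {of_real \<sigma>}) (of_real M\<^sub>R)"
    "has_pole_sum \<sigma>n (\<lambda>\<rho>. residue (\<lambda>s. A s * of_real x powr (s - 1)) \<rho>) (real_poles A) (of_real E\<^sub>R)"
    "has_pole_sum \<sigma>n (\<lambda>\<rho>. residue (\<lambda>s. omega_plus T \<sigma> s * of_real x powr (s - 1) * A s) \<rho>) (upper_poles A T) M\<^sub>C"
    "has_pole_sum \<sigma>n (\<lambda>\<rho>. residue (\<lambda>s. theta T 1 s * of_real x powr (s - 1) * A s) \<rho>) (upper_poles A T) E\<^sub>C"
    using lim unfolding has_pole_sum_def coth_sum_def[abs_def] plain_sum_def[abs_def] omega_sum_def[abs_def] theta_sum_def[abs_def]
    by blast+
  have simple: "has_pole_sum \<sigma>n (\<lambda>\<rho>. E \<rho> * of_real x powr (\<rho> - 1) * residue A \<rho>) (upper_poles A T) K"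
    if z: "\<forall>\<rho>\<in>upper_poles A T. zorder A \<rho> = -1"
      and E: "\<And>V. V \<subseteq> {s. 0 < Im s \<and> Im s < T} \<Longrightarrow> E holomorphic_on V"
      and K: "has_pole_sum \<sigma>n (\<lambda>\<rho>. residue (\<lambda>s. E s * of_real x powr (s - 1) * A s) \<rho>) (upper_poles A T) K" for E K
  proof -
    have "(\<Sum>\<rho> | \<rho> \<in> upper_poles A T \<and> Re \<rho> > \<sigma>n n. residue (\<lambda>s. E s * of_real x powr (s - 1) * A s) \<rho>)
      = (\<Sum>\<rho> | \<rho> \<in> upper_poles A T \<and> Re \<rho> > \<sigma>n n. E \<rho> * of_real x powr (\<rho> - 1) * residue A \<rho>)" for n
      using z by (intro sum.cong refl simple_pole_residue E) auto
    then show ?thesis using K by (simp add: has_pole_sum_def)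
  qed
  show ?thesis
    using contour_weight_weight[OF T_pos \<delta>(1), of \<sigma>] sums main simple[OF _ upper_weights_holomorphic(1) sums(3)]
      simple[OF _ upper_weights_holomorphic(2) sums(4)]
    unfolding d_def by blast
qed

end
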